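(* Let $E=\mathbb{C}\rtimes\mathbb{T}$ be the Euclidean motion group. Let $\tilde{v}\in H^{2,1}(\mathbb{C})=H^{2,1}(\mathbb{R}^2)$ and let $v\in L^1(E)$ be given by $v(x,z)=\tilde{v}(x)$. Let $X\in\operatorname{span}\{X_1,X_2\}$. Then there is $S=S_{X,v}\in VN(E\times E)$ such that \[ S(u)=\int_E\partial_{(X,0)}u(g,g^{-1})\,v(g)\,dg \] for every $u\in\mathcal{D}(E\times E)$.
   Context: $E=\mathbb{C}\rtimes\mathbb{T}$ has multiplication $(x,z)(x',z')=(x+zx',zz')$ and inverse $(x,z)^{-1}=(-\bar{z}x,\bar{z})$. It is unimodular with Haar integral that of $\mathbb{C}\times\mathbb{T}$. In its Lie algebra, $X_1,X_2$ are the elements with $\exp(hX_1)=(h,1)$ and $\exp(hX_2)=(ih,1)$ for $h\in\mathbb{R}$. $H^{2,1}(\mathbb{R}^2)$ is the space of functions $v:\mathbb{R}^2\to\mathbb{C}$ with $v\in L^1(\mathbb{R}^2)$ and $\partial_x^2v\in L^1(\mathbb{R}^2)$ for all $x\in\mathbb{R}^2$, where $\partial_xv(y)=\frac{d}{dt}v(y+tx)|_{t=0}$ and second order derivatives may be taken in the distributional sense. For a locally compact group $G$, the Fourier algebra $A(G)$ (Eymard) is the Banach algebra of all functions $u(g)=\langle\lambda(g)\xi|\eta\rangle$ with $\xi,\eta\in L^2(G)$, where $\lambda$ is the left regular representation of $G$ on $L^2(G)$; its norm is $\|u\|_A=\inf\{\|\xi\|_2\|\eta\|_2: u=\langle\lambda(\cdot)\xi|\eta\rangle\}$.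 Its dual is the group von Neumann algebra $VN(G)=\lambda(G)''\subset\mathcal{B}(L^2(G))$ via $T(u)=\langle T\xi|\eta\rangle$ for $u=\langle\lambda(\cdot)\xi|\eta\rangle$. For a Lie group $G$, $\mathcal{D}(G)$ is the space of compactly supported smooth functions on $G$; it is contained in $A(G)$. For $X$ in the Lie algebra of $G$ and $u\in\mathcal{D}(G\times G)$, $\partial_{(X,0)}u(g,h)=\frac{d}{dt}u(g\exp(tX),h)|_{t=0}$. *)

theory Defs
  imports "HOL-Analysis.Analysis" "HOL-Probability.Probability_Measure" "HOL-Algebra.Group"
begin

section \<open>Smooth functions, test functions and the space $H^{2,1}$\<close>

text \<open>Being \<open>k\<close> times continuously differentiable on a finite-dimensional space: a differentiable
  map is of class $C^{k+1}$ iff all its directional derivatives are of class $C^k$.\<close>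

primrec C_class :: "nat \<Rightarrow> ('a::euclidean_space \<Rightarrow> 'b::real_normed_vector) \<Rightarrow> bool" where
  "C_class 0 f \<longleftrightarrow> continuous_on UNIV f"
| "C_class (Suc k) f \<longleftrightarrow>
     (\<forall>x. f differentiable (at x)) \<and> (\<forall>d. C_class k (\<lambda>x. frechet_derivative f (at x) d))"

definition smooth :: "('a::euclidean_space \<Rightarrow> 'b::real_normed_vector) \<Rightarrow> bool" where
  "smooth f \<longleftrightarrow> (\<forall>k. C_class k f)"

definition test_functions :: "('a::euclidean_space \<Rightarrow> complex) set" where
  "test_functions = {\<phi>. smooth \<phi> \<and> compact (closure {x. \<phi> x \<noteq> 0})}"

definition dir_deriv :: "'a::real_normed_vector \<Rightarrow> ('a \<Rightarrow> complex) \<Rightarrow> 'a \<Rightarrow> complex" where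
  "dir_deriv x f y = vector_derivative (\<lambda>t::real. f (y + t *\<^sub>R x)) (at 0)"

text \<open>\<open>w\<close> is the second derivative of \<open>f\<close> in direction \<open>x\<close> in the sense of distributions.\<close>

definition has_weak_second_deriv ::
    "('a::euclidean_space \<Rightarrow> complex) \<Rightarrow> 'a \<Rightarrow> ('a \<Rightarrow> complex) \<Rightarrow> bool" where
  "has_weak_second_deriv f x w \<longleftrightarrow>
     (\<forall>\<phi>\<in>test_functions.
        (LINT y|lborel. f y * dir_deriv x (dir_deriv x \<phi>) y) = (LINT y|lborel. w y * \<phi> y))"

text \<open>Elements of $L^1$ are represented by Borel functions. At type \<open>complex\<close>, Lebesgue measure and
  directions are those of the real plane.\<close>

definition H21 :: "('a::euclidean_space \<Rightarrow> complex) set" where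
  "H21 = {f. integrable lborel f \<and>
             (\<forall>x. \<exists>w. integrable lborel w \<and> has_weak_second_deriv f x w)}"


section \<open>The group von Neumann algebra and its action on the Fourier algebra\<close>

text \<open>Here a locally compact group is given by a group \<open>G\<close> and a left Haar measure \<open>M\<close>
  on \<open>carrier G\<close>. Elements of $L^2$ are represented by functions; equality in $L^2$ is equality
  almost everywhere.\<close>

definition L2 :: "'a measure \<Rightarrow> ('a \<Rightarrow> complex) set" where
  "L2 M = {f \<in> borel_measurable M. integrable M (\<lambda>x. (cmod (f x))\<^sup>2)}"

definition L2_inner :: "'a measure \<Rightarrow> ('a \<Rightarrow> complex) \<Rightarrow> ('a \<Rightarrow> complex) \<Rightarrow> complex" where
  "L2_inner M f g = (LINT x|M. f x * cnj (g x))"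

definition L2_norm :: "'a measure \<Rightarrow> ('a \<Rightarrow> complex) \<Rightarrow> real" where
  "L2_norm M f = sqrt (LINT x|M. (cmod (f x))\<^sup>2)"

text \<open>Bounded linear operators on $L^2$, as maps on representatives.\<close>

definition L2_bounded_ops :: "'a measure \<Rightarrow> (('a \<Rightarrow> complex) \<Rightarrow> ('a \<Rightarrow> complex)) set" where
  "L2_bounded_ops M = {T.
     (\<forall>f\<in>L2 M. T f \<in> L2 M) \<and>
     (\<forall>f\<in>L2 M. \<forall>g\<in>L2 M. (AE x in M. f x = g x) \<longrightarrow> (AE x in M. T f x = T g x)) \<and>
     (\<forall>f\<in>L2 M. \<forall>g\<in>L2 M. AE x in M. T (\<lambda>y. f y + g y) x = T f x + T g x) \<and>
     (\<forall>c. \<forall>f\<in>L2 M. AE x in M. T (\<lambda>y. c * f y) x = c * T f x) \<and>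
     (\<exists>C. \<forall>f\<in>L2 M. L2_norm M (T f) \<le> C * L2_norm M f)}"

definition commutant ::
    "'a measure \<Rightarrow> (('a \<Rightarrow> complex) \<Rightarrow> ('a \<Rightarrow> complex)) set \<Rightarrow> (('a \<Rightarrow> complex) \<Rightarrow> ('a \<Rightarrow> complex)) set" where
  "commutant M A = {T \<in> L2_bounded_ops M.
     \<forall>S\<in>A. \<forall>f\<in>L2 M. AE x in M. T (S f) x = S (T f) x}"

definition left_regular ::
    "('a, 'b) monoid_scheme \<Rightarrow> 'a \<Rightarrow> ('a \<Rightarrow> complex) \<Rightarrow> ('a \<Rightarrow> complex)" where
  "left_regular G g \<xi> = (\<lambda>h. \<xi> (inv\<^bsub>G\<^esub> g \<otimes>\<^bsub>G\<^esub> h))"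

definition VN ::
    "('a, 'b) monoid_scheme \<Rightarrow> 'a measure \<Rightarrow> (('a \<Rightarrow> complex) \<Rightarrow> ('a \<Rightarrow> complex)) set" where
  "VN G M = commutant M (commutant M (left_regular G ` carrier G))"

text \<open>\<open>u\<close> is the coefficient function of the left regular representation at \<open>\<xi>\<close>, \<open>\<eta>\<close>.\<close>

definition is_coefficient ::
    "('a, 'b) monoid_scheme \<Rightarrow> 'a measure \<Rightarrow> ('a \<Rightarrow> complex) \<Rightarrow> ('a \<Rightarrow> complex) \<Rightarrow> ('a \<Rightarrow> complex) \<Rightarrow> bool"
  where
  "is_coefficient G M u \<xi> \<eta> \<longleftrightarrow>
     \<xi> \<in> L2 M \<and> \<eta> \<in> L2 M \<and> (\<forall>g\<in>carrier G. u g = L2_inner M (left_regular G g \<xi>) \<eta>)"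

text \<open>The duality between the Fourier algebra and \<open>VN G M\<close>. The value is determined only if \<open>u\<close> is
  a coefficient function (that is, lies in the Fourier algebra) and if all its representations
  as a coefficient function give the same number.\<close>

definition VN_apply ::
    "('a, 'b) monoid_scheme \<Rightarrow> 'a measure \<Rightarrow> (('a \<Rightarrow> complex) \<Rightarrow> ('a \<Rightarrow> complex)) \<Rightarrow> ('a \<Rightarrow> complex) \<Rightarrow> complex"
  where
  "VN_apply G M T u = (THE c. \<exists>\<xi> \<eta>. is_coefficient G M u \<xi> \<eta> \<and> c = L2_inner M (T \<xi>) \<eta>)"


section \<open>The Euclidean motion group\<close>

definition motion_group :: "(complex \<times> complex) monoid" where
  "motion_group =
     \<lparr>carrier = UNIV \<times> sphere 0 1,
      mult = (\<lambda>(x, z) (x', z'). (x + z * x', z * z')),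
      one = (0, 1)\<rparr>"

lemma motion_group_simps [simp]:
  "carrier motion_group = UNIV \<times> sphere 0 1"
  "(x, z) \<otimes>\<^bsub>motion_group\<^esub> (x', z') = (x + z * x', z * z')"
  "\<one>\<^bsub>motion_group\<^esub> = (0, 1)"
  by (simp_all add: motion_group_def)

lemma cnj_mult_unit: "cmod z = 1 \<Longrightarrow> cnj z * z = 1"
  by (metis complex_norm_square mult.commute of_real_1 one_power2)

lemma group_motion_group: "group motion_group"
proof (rule groupI)
  fix g assume "g \<in> carrier motion_group"
  then obtain x z where g: "g = (x, z)" "cmod z = 1" by (cases g) auto
  have "(- cnj z * x, cnj z) \<otimes>\<^bsub>motion_group\<^esub> g = \<one>\<^bsub>motion_group\<^esub>"
    using g by (simp add: cnj_mult_unit)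
  then show "\<exists>h\<in>carrier motion_group. h \<otimes>\<^bsub>motion_group\<^esub> g = \<one>\<^bsub>motion_group\<^esub>"
    using g by (intro bexI[of _ "(- cnj z * x, cnj z)"]) auto
qed (auto simp: norm_mult algebra_simps)

lemma inv_motion_group:
  assumes "cmod z = 1"
  shows "inv\<^bsub>motion_group\<^esub> (x, z) = (- cnj z * x, cnj z)"
  using assms by (intro group.inv_equality[OF group_motion_group]) (auto simp: cnj_mult_unit)

text \<open>Normalised arc length on the unit circle.\<close>

definition circle_measure :: "complex measure" where
  "circle_measure = distr (uniform_measure lborel {0..2 * pi}) (restrict_space borel (sphere 0 1)) cis"

definition motion_haar :: "(complex \<times> complex) measure" where
  "motion_haar = lborel \<Otimes>\<^sub>M circle_measure"

lemma space_motion_haar: "space motion_haar = carrier motion_group"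
  by (simp add: motion_haar_def circle_measure_def space_pair_measure space_restrict_space)

lemma prob_space_circle_measure: "prob_space circle_measure"
proof -
  have "continuous_on UNIV cis"
    by (intro continuous_intros)
  then have "cis \<in> borel \<rightarrow>\<^sub>M restrict_space borel (sphere 0 1)"
    by (intro measurable_restrict_space2 borel_measurable_continuous_onI) auto
  then have "cis \<in> uniform_measure lborel {0..2 * pi} \<rightarrow>\<^sub>M restrict_space borel (sphere 0 1)"
    by simp
  moreover have "prob_space (uniform_measure lborel {0..2 * pi})"
    by (intro prob_space_uniform_measure) auto
  ultimately show ?thesis
    unfolding circle_measure_def by (intro prob_space.prob_space_distr)
qed


subsection \<open>Lie algebra and exponential map\<close>

text \<open>The Lie algebra is the tangent space \<open>\<complex> \<times> \<i>\<real>\<close> at the identity, inside the ambient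
  real vector space \<open>\<complex> \<times> \<complex>\<close>; the exponential of \<open>X\<close> is the value at \<open>1\<close> of the one-parameter
  subgroup with initial velocity \<open>X\<close>.\<close>

definition one_parameter_subgroup :: "(real \<Rightarrow> complex \<times> complex) \<Rightarrow> bool" where
  "one_parameter_subgroup \<gamma> \<longleftrightarrow>
     range \<gamma> \<subseteq> carrier motion_group \<and> (\<forall>s t. \<gamma> (s + t) = \<gamma> s \<otimes>\<^bsub>motion_group\<^esub> \<gamma> t)"

definition motion_exp :: "complex \<times> complex \<Rightarrow> complex \<times> complex" where
  "motion_exp X =
     (THE \<gamma>. one_parameter_subgroup \<gamma> \<and> (\<gamma> has_vector_derivative X) (at 0)) 1"

definition X\<^sub>1 :: "complex \<times> complex" where "X\<^sub>1 = (1, 0)"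
definition X\<^sub>2 :: "complex \<times> complex" where "X\<^sub>2 = (\<i>, 0)"

lemma motion_exp_translation: "motion_exp (c, 0) = (c, 1)"
proof -
  let ?P = "\<lambda>\<gamma>. one_parameter_subgroup \<gamma> \<and> (\<gamma> has_vector_derivative (c, 0)) (at 0)"
  let ?\<gamma> = "\<lambda>t::real. (t *\<^sub>R c, 1::complex)"
  have "(THE \<gamma>. ?P \<gamma>) = ?\<gamma>"
  proof (rule the_equality)
    show "?P ?\<gamma>"
      by (auto simp: one_parameter_subgroup_def algebra_simps intro!: derivative_eq_intros)
  next
    fix \<gamma> assume P: "?P \<gamma>"
    have hom: "\<gamma> (s + t) = \<gamma> s \<otimes>\<^bsub>motion_group\<^esub> \<gamma> t" for s t
      using P by (simp add: one_parameter_subgroup_def)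
    have homs: "snd (\<gamma> (s + t)) = snd (\<gamma> s) * snd (\<gamma> t)"
        "fst (\<gamma> (s + t)) = fst (\<gamma> s) + snd (\<gamma> s) * fst (\<gamma> t)" for s t
      by (cases "\<gamma> s"; cases "\<gamma> t"; simp add: hom)+
    have unit: "cmod (snd (\<gamma> t)) = 1" for t
      using P by (auto simp: one_parameter_subgroup_def dest!: subsetD[OF _ rangeI[of \<gamma> t]])
    have \<gamma>0: "\<gamma> 0 = (0, 1)"
    proof -
      have "snd (\<gamma> 0) = 1"
        using homs(1)[of 0 0] unit[of 0] by auto
      with homs(2)[of 0 0] show ?thesis by (auto simp: prod_eq_iff)
    qed
    have d0: "((\<lambda>t. fst (\<gamma> t)) has_vector_derivative c) (at 0)"
        "((\<lambda>t. snd (\<gamma> t)) has_vector_derivative 0) (at 0)"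
      using P
      by (auto simp: has_vector_derivative_def dest: has_derivative_fst has_derivative_snd)
    have shift: "(f has_vector_derivative D) (at t)"
      if "((\<lambda>h. f (t + h)) has_vector_derivative D) (at 0)" for f :: "real \<Rightarrow> complex" and D t
      using that unfolding has_vector_derivative_def has_derivative_at
      by (simp add: add.commute)
    have ds: "((\<lambda>t. snd (\<gamma> t)) has_vector_derivative 0) (at t)" for t
    proof (rule shift)
      show "((\<lambda>h. snd (\<gamma> (t + h))) has_vector_derivative 0) (at 0)"
        unfolding homs using has_vector_derivative_mult_right[OF d0(2), of "snd (\<gamma> t)"] by simp
    qed
    have s1: "snd (\<gamma> t) = 1" for t
      using has_vector_derivative_zero_constant[of UNIV "\<lambda>t. snd (\<gamma> t)"] ds \<gamma>0
      by (metis UNIV_I convex_UNIV snd_conv)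
    have df: "((\<lambda>t. fst (\<gamma> t) - t *\<^sub>R c) has_vector_derivative 0) (at t)" for t
    proof (rule shift)
      have "((\<lambda>h. fst (\<gamma> t) + fst (\<gamma> h) - (t + h) *\<^sub>R c) has_vector_derivative 0) (at 0)"
        by (auto intro!: derivative_eq_intros d0)
      then show "((\<lambda>h. fst (\<gamma> (t + h)) - (t + h) *\<^sub>R c) has_vector_derivative 0) (at 0)"
        by (simp add: homs s1)
    qed
    have "fst (\<gamma> t) = t *\<^sub>R c" for t
    proof -
      obtain k where "\<And>t. fst (\<gamma> t) - t *\<^sub>R c = k"
        using has_vector_derivative_zero_constant[of UNIV "\<lambda>t. fst (\<gamma> t) - t *\<^sub>R c"] df by auto
      from this[of 0] this[of t] show ?thesis by (simp add: \<gamma>0)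
    qed
    with s1 show "\<gamma> = ?\<gamma>" by (auto simp: prod_eq_iff)
  qed
  then show ?thesis by (simp add: motion_exp_def)
qed

lemma motion_exp_X\<^sub>1: "motion_exp (h *\<^sub>R X\<^sub>1) = (of_real h, 1)"
  and motion_exp_X\<^sub>2: "motion_exp (h *\<^sub>R X\<^sub>2) = (\<i> * of_real h, 1)"
  by (simp_all add: X\<^sub>1_def X\<^sub>2_def motion_exp_translation scaleR_conv_of_real mult.commute)


subsection \<open>The product of the motion group with itself\<close>

abbreviation motion_group2 :: "((complex \<times> complex) \<times> (complex \<times> complex)) monoid" where
  "motion_group2 \<equiv> motion_group \<times>\<times> motion_group"

abbreviation motion_haar2 :: "((complex \<times> complex) \<times> (complex \<times> complex)) measure" where
  "motion_haar2 \<equiv> motion_haar \<Otimes>\<^sub>M motion_haar"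

text \<open>Compactly supported smooth functions on the group. Smoothness on the manifold is tested
  along the local diffeomorphism \<open>(x, s) \<mapsto> (x, cis s)\<close> onto the motion group, in each factor. Only
  the values on the carrier matter; as the carrier is closed in the ambient space, the closure
  below is the support within the group.\<close>

definition D_motion2 :: "((complex \<times> complex) \<times> (complex \<times> complex) \<Rightarrow> complex) set" where
  "D_motion2 = {u.
     smooth (\<lambda>((x, s :: real), (y, t :: real)). u ((x, cis s), (y, cis t))) \<and>
     compact (closure {p \<in> carrier motion_group2. u p \<noteq> 0})}"

definition deriv_first ::
    "complex \<times> complex \<Rightarrow> ((complex \<times> complex) \<times> (complex \<times> complex) \<Rightarrow> complex) \<Rightarrow>
     (complex \<times> complex) \<times> (complex \<times> complex) \<Rightarrow> complex" where
  "deriv_first X u = (\<lambda>(g, h).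
     vector_derivative (\<lambda>t::real. u (g \<otimes>\<^bsub>motion_group\<^esub> motion_exp (t *\<^sub>R X), h)) (at 0))"

end

theory Submission
  imports Defs "HOL-Probability.Probability"
begin

text \<open>For \<open>X = (c, 0)\<close>, replace the right hand side by difference quotients with step \<open>h\<close>, smoothed by a
  Gaussian of width \<open>e\<close> in the translation variables. On a coefficient function of \<open>\<xi>\<close>, \<open>\<eta>\<close>, the
  Fourier transform in the translations turns such an approximation into an integral over
  \<open>(k, l) \<in> \<complex>\<^sup>2\<close> and over the rotations \<open>z\<close>, in which the partial Fourier transforms of \<open>\<xi>\<close> and \<open>\<eta>\<close>
  are paired by a multiplier of modulus at most \<open>|c| |k| |FT v' (k - z l)|\<close>. As \<open>v'\<close> lies in
  $H^{2,1}$, its Fourier transform is at most \<open>W / (1 + |\<kappa>|\<^sup>2)\<close>, and the average of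
  \<open>|k| / (1 + |k - z l|\<^sup>2)\<close> over the circle is bounded uniformly in \<open>k\<close> and \<open>l\<close>: this averaging over
  the rotations absorbs the derivative. By the Schur test and Plancherel's inequality, all
  approximations are at most a constant times the product of the norms of \<open>\<xi>\<close> and \<open>\<eta>\<close>. A generalised
  limit of them along \<open>e = h \<rightarrow> 0\<close> is a bounded form that depends on the coefficient function alone,
  hence is given by an operator in the bicommutant. On test functions, which are coefficient
  functions by the fundamental theorem of calculus along one-parameter subgroups, the limit exists
  by dominated convergence and is the required integral.\<close>

section \<open>Square integrable functions\<close>

text \<open>The decay of the transform of \<open>v'\<close> alone cannot compensate the factor |k|
  of the derivative: for k near z l the bound W / (1 + |k - z l|^2) is of order one, however large
  |k| is. But for given k and l this happens only for z in an arc of length about 1 / |k|, and the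
  square in the denominator makes the rest of the circle contribute no more than the arc. So the
  estimate has to be an integral over z instead of a pointwise bound of a multiplier. The
  combination k - z l stems from the translation part \<open>- cnj z * x\<close> of the inverse,
  which puts \<open>z\<close> onto the second frequency when the two translations are paired with
  (k, l). The Gaussian makes the Fourier integrals absolutely convergent for functions that are only
  integrable, and the final constant does not depend on its width. Convergence as e = h -> 0 is
  shown on test functions, while other coefficient functions only have the uniform bound; the
  generalised limit is linear and bounded on all bounded sequences and so yields a form on the whole
  of L2.\<close>

lemma borel_measurable_cnj [measurable (raw)]:
  "f \<in> borel_measurable M \<Longrightarrow> (\<lambda>x. cnj (f x)) \<in> borel_measurable M"
  by (rule borel_measurable_continuous_on[where f=cnj]) (intro continuous_intros)

lemma ennreal_power2_le_D:
  assumes "a\<^sup>2 \<le> ennreal (r\<^sup>2)" "0 \<le> r"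
  shows "a \<le> ennreal r"
proof (cases a)
  case (real b)
  then show ?thesis
    using assms power2_le_imp_le[of b r] by (simp add: ennreal_power)
next
  case top
  then show ?thesis
    using assms by (simp add: power2_eq_square top_unique ennreal_mult_eq_top_iff)
qed

lemma L2_measurable: "f \<in> L2 M \<Longrightarrow> f \<in> borel_measurable M"
  by (simp add: L2_def)

lemma L2_integrable: "f \<in> L2 M \<Longrightarrow> integrable M (\<lambda>x. (cmod (f x))\<^sup>2)"
  by (simp add: L2_def)

lemma L2_norm_nonneg: "0 \<le> L2_norm M f"
  by (simp add: L2_norm_def)

lemma L2_norm_sq: "(L2_norm M f)\<^sup>2 = (LINT x|M. (cmod (f x))\<^sup>2)"
  by (simp add: L2_norm_def)

lemma nn_integral_L2_norm:
  assumes "f \<in> L2 M"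
  shows "(\<integral>\<^sup>+x. ennreal ((cmod (f x))\<^sup>2) \<partial>M) = ennreal ((L2_norm M f)\<^sup>2)"
  unfolding L2_norm_sq using L2_integrable[OF assms] by (intro nn_integral_eq_integral) auto

lemma L2_cmult:
  assumes "f \<in> L2 M"
  shows "(\<lambda>x. c * f x) \<in> L2 M"
  using assms by (auto simp: L2_def norm_mult power_mult_distrib)

lemma cmod_add_sq_le: "(cmod (a + b))\<^sup>2 \<le> 2 * (cmod a)\<^sup>2 + 2 * (cmod b)\<^sup>2"
proof -
  have "(cmod (a + b))\<^sup>2 \<le> (cmod a + cmod b)\<^sup>2"
    by (intro power_mono norm_triangle_ineq) auto
  also have "\<dots> \<le> 2 * (cmod a)\<^sup>2 + 2 * (cmod b)\<^sup>2"
    using zero_le_power2[of "cmod a - cmod b"] by (simp add: power2_eq_square algebra_simps)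
  finally show ?thesis .
qed

lemma L2_add:
  assumes "f \<in> L2 M" "g \<in> L2 M"
  shows "(\<lambda>x. f x + g x) \<in> L2 M"
  unfolding L2_def
proof (intro CollectI conjI)
  have [measurable]: "f \<in> borel_measurable M" "g \<in> borel_measurable M"
    using assms by (auto simp: L2_measurable)
  show "(\<lambda>x. f x + g x) \<in> borel_measurable M"
    by measurable
  show "integrable M (\<lambda>x. (cmod (f x + g x))\<^sup>2)"
    by (rule Bochner_Integration.integrable_bound[of M "\<lambda>x. 2 * (cmod (f x))\<^sup>2 + 2 * (cmod (g x))\<^sup>2"])
       (auto intro!: L2_integrable assms cmod_add_sq_le)
qed

lemma L2_diff:
  assumes "f \<in> L2 M" "g \<in> L2 M"
  shows "(\<lambda>x. f x - g x) \<in> L2 M"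
  using L2_add[OF assms(1) L2_cmult[OF assms(2), of "-1"]] by simp

lemma nn_integral_cmod_mult_le:
  assumes "f \<in> L2 M" "g \<in> L2 M"
  shows "(\<integral>\<^sup>+x. ennreal (cmod (f x) * cmod (g x)) \<partial>M) \<le> ennreal (L2_norm M f * L2_norm M g)"
proof -
  have [measurable]: "f \<in> borel_measurable M" "g \<in> borel_measurable M"
    using assms by (auto simp: L2_measurable)
  have "(\<integral>\<^sup>+x. ennreal (cmod (f x) * cmod (g x)) \<partial>M)\<^sup>2
      = (\<integral>\<^sup>+x. ennreal (cmod (f x)) * ennreal (cmod (g x)) \<partial>M)\<^sup>2"
    by (simp add: ennreal_mult)
  also have "\<dots> \<le> (\<integral>\<^sup>+x. (ennreal (cmod (f x)))\<^sup>2 \<partial>M) * (\<integral>\<^sup>+x. (ennreal (cmod (g x)))\<^sup>2 \<partial>M)"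
    by (rule Cauchy_Schwarz_nn_integral) measurable
  also have "\<dots> = ennreal ((L2_norm M f * L2_norm M g)\<^sup>2)"
    using assms by (simp add: ennreal_power nn_integral_L2_norm power_mult_distrib ennreal_mult)
  finally show ?thesis
    by (rule ennreal_power2_le_D) (simp add: L2_norm_nonneg)
qed

lemma integrable_L2_mult:
  assumes "f \<in> L2 M" "g \<in> L2 M"
  shows "integrable M (\<lambda>x. f x * cnj (g x))"
proof (rule integrableI_bounded)
  have [measurable]: "f \<in> borel_measurable M" "g \<in> borel_measurable M"
    using assms by (auto simp: L2_measurable)
  show "(\<lambda>x. f x * cnj (g x)) \<in> borel_measurable M"
    by measurable
  have "(\<integral>\<^sup>+x. ennreal (cmod (f x * cnj (g x))) \<partial>M) \<le> ennreal (L2_norm M f * L2_norm M g)"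
    using nn_integral_cmod_mult_le[OF assms] by (simp add: norm_mult)
  also have "\<dots> < \<infinity>" by simp
  finally show "(\<integral>\<^sup>+x. ennreal (cmod (f x * cnj (g x))) \<partial>M) < \<infinity>" .
qed

lemma L2_Cauchy_Schwarz:
  assumes "f \<in> L2 M" "g \<in> L2 M"
  shows "cmod (L2_inner M f g) \<le> L2_norm M f * L2_norm M g"
proof -
  have "ennreal (cmod (L2_inner M f g)) \<le> (\<integral>\<^sup>+x. ennreal (cmod (f x * cnj (g x))) \<partial>M)"
    unfolding L2_inner_def by (intro integral_norm_bound_ennreal integrable_L2_mult assms)
  also have "\<dots> \<le> ennreal (L2_norm M f * L2_norm M g)"
    using nn_integral_cmod_mult_le[OF assms] by (simp add: norm_mult)
  finally show ?thesis
    by (simp add: L2_norm_nonneg)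
qed

lemma L2_inner_add_left:
  assumes "f \<in> L2 M" "g \<in> L2 M" "h \<in> L2 M"
  shows "L2_inner M (\<lambda>x. f x + g x) h = L2_inner M f h + L2_inner M g h"
  unfolding L2_inner_def using assms by (simp add: distrib_right integrable_L2_mult)

lemma L2_inner_cmult_left: "L2_inner M (\<lambda>x. c * f x) h = c * L2_inner M f h"
  unfolding L2_inner_def by (simp add: mult.assoc)

lemma L2_inner_commute: "L2_inner M g f = cnj (L2_inner M f g)"
  unfolding L2_inner_def by (subst Bochner_Integration.integral_cnj[of M "\<lambda>x. f x * cnj (g x)", symmetric]) (simp add: mult.commute)

lemma L2_inner_add_right:
  assumes "f \<in> L2 M" "g \<in> L2 M" "h \<in> L2 M"
  shows "L2_inner M h (\<lambda>x. f x + g x) = L2_inner M h f + L2_inner M h g"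
  unfolding L2_inner_def using assms by (simp add: distrib_left integrable_L2_mult)

lemma L2_inner_cmult_right: "L2_inner M h (\<lambda>x. c * f x) = cnj c * L2_inner M h f"
  unfolding L2_inner_def by (simp add: mult.left_commute)

lemma L2_inner_diff_left:
  assumes "f \<in> L2 M" "g \<in> L2 M" "h \<in> L2 M"
  shows "L2_inner M (\<lambda>x. f x - g x) h = L2_inner M f h - L2_inner M g h"
  unfolding L2_inner_def using assms by (simp add: left_diff_distrib integrable_L2_mult)

lemma L2_inner_self: "L2_inner M f f = of_real ((L2_norm M f)\<^sup>2)"
proof -
  have "L2_inner M f f = (LINT x|M. complex_of_real ((cmod (f x))\<^sup>2))"
    unfolding L2_inner_def by (intro Bochner_Integration.integral_cong refl) (simp only: complex_norm_square)
  then show ?thesis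
    unfolding L2_norm_sq by (simp only: integral_complex_of_real)
qed

lemma L2_inner_cong_AE:
  assumes "f \<in> L2 M" "f' \<in> L2 M" "g \<in> L2 M" "g' \<in> L2 M"
    "AE x in M. f x = f' x" "AE x in M. g x = g' x"
  shows "L2_inner M f g = L2_inner M f' g'"
  unfolding L2_inner_def
proof (rule integral_cong_AE)
  have [measurable]: "f \<in> borel_measurable M" "g \<in> borel_measurable M"
     "f' \<in> borel_measurable M" "g' \<in> borel_measurable M"
    using assms by (auto simp: L2_measurable)
  show "(\<lambda>x. f x * cnj (g x)) \<in> borel_measurable M" "(\<lambda>x. f' x * cnj (g' x)) \<in> borel_measurable M"
    by measurable
  show "AE x in M. f x * cnj (g x) = f' x * cnj (g' x)"
    using assms(5,6) by auto
qed

lemma L2_norm_cmult: "L2_norm M (\<lambda>x. c * f x) = cmod c * L2_norm M f"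
  by (simp add: L2_norm_def norm_mult power_mult_distrib real_sqrt_mult)

lemma L2_norm_eq_0_AE:
  assumes "f \<in> L2 M" "L2_norm M f = 0"
  shows "AE x in M. f x = 0"
proof -
  have "(LINT x|M. (cmod (f x))\<^sup>2) = 0"
    using assms(2) by (simp add: L2_norm_def)
  then have "AE x in M. (cmod (f x))\<^sup>2 = 0"
    by (subst (asm) integral_nonneg_eq_0_iff_AE) (auto intro: L2_integrable assms)
  then show ?thesis by simp
qed

lemma L2_eqI_inner:
  assumes "f \<in> L2 M" "g \<in> L2 M" "\<And>h. h \<in> L2 M \<Longrightarrow> L2_inner M f h = L2_inner M g h"
  shows "AE x in M. f x = g x"
proof -
  let ?d = "\<lambda>x. f x - g x"
  have d: "?d \<in> L2 M" by (intro L2_diff assms)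
  have "L2_inner M ?d ?d = 0"
    using assms d by (simp add: L2_inner_diff_left)
  then have "L2_norm M ?d = 0"
    by (simp add: L2_inner_self)
  then show ?thesis
    using L2_norm_eq_0_AE[OF d] by simp
qed

section \<open>Completeness of L2 and the Riesz representation theorem\<close>

lemma L2_norm_add_sq:
  assumes "f \<in> L2 M" "g \<in> L2 M"
  shows "(L2_norm M (\<lambda>x. f x + g x))\<^sup>2 = (L2_norm M f)\<^sup>2 + (L2_norm M g)\<^sup>2 + 2 * Re (L2_inner M f g)"
proof -
  have "complex_of_real ((L2_norm M (\<lambda>x. f x + g x))\<^sup>2) =
     of_real ((L2_norm M f)\<^sup>2) + of_real ((L2_norm M g)\<^sup>2) + (L2_inner M f g + cnj (L2_inner M f g))"
    unfolding L2_inner_self[symmetric]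
    using assms L2_inner_commute[of M g f] by (simp add: L2_inner_add_left L2_inner_add_right L2_add)
  also have "\<dots> = of_real ((L2_norm M f)\<^sup>2 + (L2_norm M g)\<^sup>2 + 2 * Re (L2_inner M f g))"
    by (simp add: complex_add_cnj)
  finally show ?thesis
    using of_real_eq_iff by blast
qed

text \<open>Squared increments of order 16^-n leave room to multiply the n-th one by 4^n and still
  sum them in L1. Where the sum \<open>G\<close> is finite, the increments are at most
  \<open>sqrt (R x) / 2 ^ n\<close>, so the sequence converges pointwise, and its tails have an
  integrable majorant. The rate is the one at which the minimising sequence in the Riesz theorem is
  chosen.\<close>

lemma L2_complete:
  fixes f :: "nat \<Rightarrow> 'a \<Rightarrow> complex"
  assumes f: "\<And>n. f n \<in> L2 M"
    and c: "\<And>n. (L2_norm M (\<lambda>x. f (Suc n) x - f n x))\<^sup>2 \<le> c * (1/16) ^ n"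
  obtains g where "g \<in> L2 M" "(\<lambda>n. L2_norm M (\<lambda>x. f n x - g x)) \<longlonglongrightarrow> 0"
proof -
  have [measurable]: "f n \<in> borel_measurable M" for n
    using f by (auto simp: L2_measurable)
  have c0: "c \<ge> 0"
    using order_trans[OF zero_le_power2 c[of 0]] by simp
  define d where "d n x = cmod (f (Suc n) x - f n x)" for n x
  have [measurable]: "d n \<in> borel_measurable M" for n
    unfolding d_def by measurable
  define G where "G x = (\<Sum>n. ennreal (4 ^ n * (d n x)\<^sup>2))" for x
  have [measurable]: "G \<in> borel_measurable M"
    unfolding G_def by measurable
  have "(\<integral>\<^sup>+x. G x \<partial>M) = (\<Sum>n. \<integral>\<^sup>+x. ennreal (4 ^ n * (d n x)\<^sup>2) \<partial>M)"
    unfolding G_def by (intro nn_integral_suminf) measurable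
  also have "\<dots> \<le> (\<Sum>n. ennreal (c * (1/4) ^ n))"
  proof (intro suminf_le allI)
    fix n
    have "(\<integral>\<^sup>+x. ennreal (4 ^ n * (d n x)\<^sup>2) \<partial>M) = ennreal (4 ^ n) * (\<integral>\<^sup>+x. ennreal ((d n x)\<^sup>2) \<partial>M)"
      by (subst nn_integral_cmult[symmetric]) (auto simp: ennreal_mult)
    also have "\<dots> = ennreal (4 ^ n) * ennreal ((L2_norm M (\<lambda>x. f (Suc n) x - f n x))\<^sup>2)"
      unfolding d_def by (subst nn_integral_L2_norm) (auto intro: L2_diff f)
    also have "\<dots> \<le> ennreal (4 ^ n) * ennreal (c * (1/16) ^ n)"
      using c by (intro mult_left_mono ennreal_leI) auto
    also have "\<dots> = ennreal (c * (1/4) ^ n)"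
    proof -
      have "(16::real) ^ n = 4 ^ n * 4 ^ n"
        by (simp flip: power_mult_distrib)
      then show ?thesis
        using c0 by (subst ennreal_mult[symmetric]) (auto simp: power_divide)
    qed
    finally show "(\<integral>\<^sup>+x. ennreal (4 ^ n * (d n x)\<^sup>2) \<partial>M) \<le> ennreal (c * (1/4) ^ n)" .
  qed auto
  also have "\<dots> = ennreal (\<Sum>n. c * (1/4) ^ n)"
    using c0 by (intro suminf_ennreal2 summable_mult summable_geometric) auto
  finally have "(\<integral>\<^sup>+x. G x \<partial>M) \<le> ennreal (\<Sum>n. c * (1/4) ^ n)" .
  then have Gint: "(\<integral>\<^sup>+x. G x \<partial>M) < \<infinity>"
    by (simp add: le_less_trans)
  then have Gfin: "AE x in M. G x \<noteq> \<infinity>"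
    by (intro nn_integral_PInf_AE) auto
  define R where "R x = enn2real (G x)" for x
  have [measurable]: "R \<in> borel_measurable M"
    unfolding R_def by measurable
  \<comment> \<open>Where the sequence diverges, \<open>lim\<close> has an arbitrary value; this
    concerns a null set only.\<close>
  define g where "g x = lim (\<lambda>n. f n x)" for x
  have [measurable]: "g \<in> borel_measurable M"
    unfolding g_def by measurable
  have AE_le: "AE x in M. \<forall>n. (cmod (f n x - g x))\<^sup>2 \<le> 4 * (1/4) ^ n * R x"
    using Gfin
  proof eventually_elim
    case (elim x)
    have dle: "d n x \<le> sqrt (R x) * (1/2) ^ n" for n
    proof -
      have "ennreal (4 ^ n * (d n x)\<^sup>2) \<le> G x"
        unfolding G_def
        by (rule order_trans[OF _ sum_le_suminf[of "\<lambda>n. ennreal (4 ^ n * (d n x)\<^sup>2)" "{n}"]])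
          (auto intro: summableI)
      also have "G x = ennreal (R x)"
        unfolding R_def using elim by (simp add: top.not_eq_extremum)
      finally have "4 ^ n * (d n x)\<^sup>2 \<le> R x"
        by (simp add: R_def)
      moreover have "(4::real) ^ n = (2 ^ n)\<^sup>2"
        by (simp add: power2_eq_square flip: power_mult_distrib)
      ultimately have "(2 ^ n * d n x)\<^sup>2 \<le> R x"
        by (simp only: power_mult_distrib)
      then have "2 ^ n * d n x \<le> sqrt (R x)"
        by (rule real_le_rsqrt)
      then show ?thesis
        by (simp add: field_simps)
    qed
    have sm: "summable (\<lambda>n. sqrt (R x) * (1/2) ^ n)"
      by (intro summable_mult summable_geometric) auto
    have s: "summable (\<lambda>n. norm (f (Suc n) x - f n x))"
      using dle by (intro summable_comparison_test'[OF sm, of 0]) (auto simp: d_def)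
    have "(\<lambda>n. f n x) \<longlonglongrightarrow> (\<Sum>n. f (Suc n) x - f n x) + f 0 x"
    proof -
      have t: "(\<lambda>n. \<Sum>k<n. f (Suc k) x - f k x) \<longlonglongrightarrow> (\<Sum>n. f (Suc n) x - f n x)"
        by (rule summable_LIMSEQ[OF summable_norm_cancel[OF s]])
      show ?thesis
        using tendsto_add[OF t tendsto_const[of "f 0 x"]]
        by (simp add: sum_lessThan_telescope[where f="\<lambda>n. f n x"])
    qed
    then have lim: "(\<lambda>n. f n x) \<longlonglongrightarrow> g x"
      unfolding g_def by (simp add: limI)
    have "cmod (f n x - g x) \<le> 2 * (1/2) ^ n * sqrt (R x)" for n
    proof -
      have "(\<lambda>m. f (m + n) x) \<longlonglongrightarrow> g x"
        using lim by (rule LIMSEQ_ignore_initial_segment)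
      then have l: "(\<lambda>m. cmod (f n x - f (m + n) x)) \<longlonglongrightarrow> cmod (f n x - g x)"
        by (intro tendsto_intros)
      \<comment> \<open>The finite geometric sum is kept with its negative end term, since the
        induction on \<open>m\<close> does not close for the plain bound that follows from
        it.\<close>
      have "cmod (f n x - f (m + n) x) \<le> 2 * (1/2) ^ n * sqrt (R x) - 2 * (1/2) ^ (m + n) * sqrt (R x)" for m
      proof (induction m)
        case (Suc m)
        have "cmod (f n x - f (Suc m + n) x) \<le> cmod (f n x - f (m + n) x) + d (m + n) x"
          unfolding d_def using norm_triangle_ineq4[of "f n x - f (m + n) x" "f (Suc (m + n)) x - f (m + n) x"] by simp
        also have "\<dots> \<le> 2 * (1/2) ^ n * sqrt (R x) - 2 * (1/2) ^ (m + n) * sqrt (R x) + sqrt (R x) * (1/2) ^ (m + n)"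
          by (intro add_mono Suc dle)
        finally show ?case by (simp add: field_simps)
      qed simp
      then have "cmod (f n x - f (m + n) x) \<le> 2 * (1/2) ^ n * sqrt (R x)" for m
        by (rule order_trans) (simp add: R_def)
      then show ?thesis
        by (intro Lim_bounded[OF l]) auto
    qed
    then have "(cmod (f n x - g x))\<^sup>2 \<le> (2 * (1/2) ^ n * sqrt (R x))\<^sup>2" for n
      by (intro power_mono) auto
    also have "(2 * (1/2) ^ n * sqrt (R x))\<^sup>2 = 4 * (1/4) ^ n * R x" for n
    proof -
      have "((1/2::real) ^ n)\<^sup>2 = (1/4) ^ n"
        by (simp add: power2_eq_square flip: power_mult_distrib)
      then show ?thesis
        by (simp only: power_mult_distrib) (simp add: R_def)
    qed
    finally show ?case by blast
  qed
  have Rint: "integrable M R"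
  proof (rule integrableI_bounded)
    have "(\<integral>\<^sup>+x. ennreal (norm (R x)) \<partial>M) \<le> (\<integral>\<^sup>+x. G x \<partial>M)"
      unfolding R_def by (intro nn_integral_mono) (simp add: ennreal_enn2real_if)
    then show "(\<integral>\<^sup>+x. ennreal (norm (R x)) \<partial>M) < \<infinity>"
      using Gint by simp
  qed measurable
  have fg: "(\<lambda>x. f n x - g x) \<in> L2 M" for n
    unfolding L2_def
  proof (intro CollectI conjI)
    show "integrable M (\<lambda>x. (cmod (f n x - g x))\<^sup>2)"
    proof (rule Bochner_Integration.integrable_bound)
      show "integrable M (\<lambda>x. 4 * (1/4) ^ n * R x)"
        using Rint by (rule integrable_mult_right)
      show "AE x in M. norm ((cmod (f n x - g x))\<^sup>2) \<le> norm (4 * (1/4) ^ n * R x)"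
        using AE_le
      proof eventually_elim
        case (elim x)
        have "norm ((cmod (f n x - g x))\<^sup>2) = (cmod (f n x - g x))\<^sup>2"
          by simp
        also have "\<dots> \<le> 4 * (1/4) ^ n * R x"
          using elim by (rule spec)
        finally show ?case
          unfolding real_norm_def by (rule order_trans[OF _ abs_ge_self])
      qed
    qed measurable
  qed measurable
  show ?thesis
  proof
    show "g \<in> L2 M"
      using L2_diff[OF f[of 0] fg[of 0]] by simp
    have le: "(L2_norm M (\<lambda>x. f n x - g x))\<^sup>2 \<le> (4 * (LINT x|M. R x)) * (1/4) ^ n" for n
    proof -
      have "(LINT x|M. (cmod (f n x - g x))\<^sup>2) \<le> (LINT x|M. 4 * (1/4) ^ n * R x)"
        using AE_le Rint L2_integrable[OF fg[of n]] by (intro integral_mono_AE) auto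
      then show ?thesis
        by (simp add: L2_norm_sq mult_ac)
    qed
    have "(\<lambda>n. (4 * (LINT x|M. R x)) * (1/4::real) ^ n) \<longlonglongrightarrow> (4 * (LINT x|M. R x)) * 0"
      by (intro tendsto_mult tendsto_const LIMSEQ_realpow_zero) auto
    then have "(\<lambda>n. (4 * (LINT x|M. R x)) * (1/4::real) ^ n) \<longlonglongrightarrow> 0"
      by simp
    then have "(\<lambda>n. (L2_norm M (\<lambda>x. f n x - g x))\<^sup>2) \<longlonglongrightarrow> 0"
      by (rule Lim_null_comparison[rotated]) (intro always_eventually allI, simp add: le)
    then have "(\<lambda>n. sqrt ((L2_norm M (\<lambda>x. f n x - g x))\<^sup>2)) \<longlonglongrightarrow> sqrt 0"
      by (intro tendsto_intros)
    then show "(\<lambda>n. L2_norm M (\<lambda>x. f n x - g x)) \<longlonglongrightarrow> 0"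
      by (simp add: L2_norm_nonneg)
  qed
qed

text \<open>If \<open>h\<close> represents \<open>\<phi>\<close>, then \<open>J f\<close> is the
  squared distance from \<open>f\<close> to \<open>h\<close> up to a constant. So \<open>h\<close>
  is found as the minimiser of \<open>J\<close>: completing the square bounds \<open>J\<close> from
  below, the parallelogram law makes a minimising sequence Cauchy, and the vanishing first variation
  at the limit is the representation.\<close>

lemma L2_Riesz:
  fixes \<phi> :: "('a \<Rightarrow> complex) \<Rightarrow> complex"
  assumes add: "\<And>f g. f \<in> L2 M \<Longrightarrow> g \<in> L2 M \<Longrightarrow> \<phi> (\<lambda>x. f x + g x) = \<phi> f + \<phi> g"
    and cmult: "\<And>c f. f \<in> L2 M \<Longrightarrow> \<phi> (\<lambda>x. c * f x) = c * \<phi> f"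
    and bound: "\<And>f. f \<in> L2 M \<Longrightarrow> cmod (\<phi> f) \<le> C * L2_norm M f"
  shows "\<exists>h\<in>L2 M. \<forall>f\<in>L2 M. \<phi> f = L2_inner M f h"
proof -
  define J where "J f = (L2_norm M f)\<^sup>2 - 2 * Re (\<phi> f)" for f
  have Jlow: "- C\<^sup>2 \<le> J f" if "f \<in> L2 M" for f
  proof -
    have "Re (\<phi> f) \<le> C * L2_norm M f"
      using bound[OF that] complex_Re_le_cmod[of "\<phi> f"] by linarith
    then show ?thesis
      unfolding J_def using zero_le_power2[of "L2_norm M f - C"] by (simp add: power2_eq_square algebra_simps)
  qed
  define m where "m = (INF f\<in>L2 M. J f)"
  have bdd: "bdd_below (J ` L2 M)"
    using Jlow by (intro bdd_belowI2) auto
  have zero: "(\<lambda>x. 0) \<in> L2 M"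
    by (simp add: L2_def)
  have mle: "m \<le> J f" if "f \<in> L2 M" for f
    unfolding m_def using bdd that by (rule cINF_lower)
  have "\<exists>f. f \<in> L2 M \<and> J f < m + (1/16) ^ n" for n :: nat
  proof -
    have "(INF f\<in>L2 M. J f) < m + (1/16) ^ n"
      by (simp add: m_def)
    moreover have "L2 M \<noteq> {}"
      using zero by (metis empty_iff)
    ultimately show ?thesis
      unfolding cINF_less_iff[OF \<open>L2 M \<noteq> {}\<close> bdd] by (elim bexE) (intro exI conjI)
  qed
  note ex = this
  define f where "f n = (SOME f. f \<in> L2 M \<and> J f < m + (1/16) ^ n)" for n :: nat
  have f: "f n \<in> L2 M" and Jf: "J (f n) < m + (1/16) ^ n" for n
    unfolding f_def using someI_ex[OF ex[of n]] by simp_all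
  \<comment> \<open>Parallelogram law, where the midpoint of \<open>g\<close> and \<open>h\<close>
    is estimated by the infimum \<open>m\<close>.\<close>
  have para: "(L2_norm M (\<lambda>x. g x - h x))\<^sup>2 \<le> 2 * J g + 2 * J h - 4 * m" if g: "g \<in> L2 M" and h: "h \<in> L2 M" for g h
  proof -
    have mh: "(\<lambda>x. (-1) * h x) \<in> L2 M" using h by (rule L2_cmult)
    have s: "(\<lambda>x. g x + h x) \<in> L2 M" using g h by (rule L2_add)
    have "m \<le> J (\<lambda>x. (1/2) * (g x + h x))"
      by (intro mle L2_cmult s)
    also have "\<dots> = (L2_norm M (\<lambda>x. g x + h x))\<^sup>2 / 4 - Re (\<phi> g) - Re (\<phi> h)"
      unfolding J_def L2_norm_cmult cmult[OF s] add[OF g h] by (simp add: power_divide norm_divide field_simps)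
    finally have 1: "m \<le> (L2_norm M (\<lambda>x. g x + h x))\<^sup>2 / 4 - Re (\<phi> g) - Re (\<phi> h)" .
    have 2: "(L2_norm M (\<lambda>x. g x - h x))\<^sup>2 = (L2_norm M g)\<^sup>2 + (L2_norm M h)\<^sup>2 - 2 * Re (L2_inner M g h)"
      using L2_norm_add_sq[OF g mh] unfolding L2_norm_cmult L2_inner_cmult_right by simp
    show ?thesis
      using 1 unfolding 2 L2_norm_add_sq[OF g h] J_def by (simp add: field_simps)
  qed
  \<comment> \<open>The terms with \<open>m\<close> cancel; what remains is twice the error at n
    plus twice the error at n + 1, hence the constant 4.\<close>
  have cauchy: "(L2_norm M (\<lambda>x. f (Suc n) x - f n x))\<^sup>2 \<le> 4 * (1/16) ^ n" for n
  proof -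
    have "(1/16::real) ^ Suc n \<le> (1/16) ^ n" by simp
    then show ?thesis
      using para[OF f f, of "Suc n" n] Jf[of n] Jf[of "Suc n"] by linarith
  qed
  obtain h where h: "h \<in> L2 M" and lim: "(\<lambda>n. L2_norm M (\<lambda>x. f n x - h x)) \<longlonglongrightarrow> 0"
    using f cauchy by (rule L2_complete[where f = f and M = M and c = 4])
  have Jm: "J h \<le> m + (1/16) ^ n + 2 * L2_norm M (\<lambda>x. f n x - h x) * (L2_norm M (\<lambda>x. f n x - h x) + L2_norm M h + \<bar>C\<bar>)" for n
  proof -
    let ?e = "\<lambda>x. f n x - h x"
    have e: "?e \<in> L2 M" by (intro L2_diff f h)
    have "Re (\<phi> (f n)) = Re (\<phi> h) + Re (\<phi> ?e)"
      using add[OF h e] by simp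
    moreover have "(L2_norm M (f n))\<^sup>2 = (L2_norm M h)\<^sup>2 + (L2_norm M ?e)\<^sup>2 + 2 * Re (L2_inner M h ?e)"
      using L2_norm_add_sq[OF h e] by simp
    ultimately have a: "J (f n) = J h + (L2_norm M ?e)\<^sup>2 + 2 * Re (L2_inner M h ?e) - 2 * Re (\<phi> ?e)"
      by (simp add: J_def)
    have b: "- Re (L2_inner M h ?e) \<le> L2_norm M h * L2_norm M ?e"
      using L2_Cauchy_Schwarz[OF h e] abs_Re_le_cmod[of "L2_inner M h ?e"] by linarith
    have c: "Re (\<phi> ?e) \<le> \<bar>C\<bar> * L2_norm M ?e"
      using bound[OF e] complex_Re_le_cmod[of "\<phi> ?e"]
        mult_right_mono[OF abs_ge_self[of C] L2_norm_nonneg[of M ?e]] by linarith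
    show ?thesis
    proof -
      let ?N = "L2_norm M ?e"
      have "2 * ?N * (?N + L2_norm M h + \<bar>C\<bar>) = 2 * ?N\<^sup>2 + 2 * (L2_norm M h * ?N) + 2 * (\<bar>C\<bar> * ?N)"
        by (simp add: algebra_simps power2_eq_square)
      moreover have "0 \<le> ?N\<^sup>2" by simp
      ultimately show ?thesis
        using Jf[of n] a b c by linarith
    qed
  qed
  have "(\<lambda>n. m + (1/16) ^ n + 2 * L2_norm M (\<lambda>x. f n x - h x) * (L2_norm M (\<lambda>x. f n x - h x) + L2_norm M h + \<bar>C\<bar>)) \<longlonglongrightarrow>
       m + 0 + 2 * 0 * (0 + L2_norm M h + \<bar>C\<bar>)"
    by (intro tendsto_intros lim LIMSEQ_realpow_zero) auto
  then have "J h \<le> m"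
    using Jm by (intro Lim_bounded2[of _ m]) auto
  then have min: "J h \<le> J g" if "g \<in> L2 M" for g
    using mle[OF that] by linarith
  have Re_eq: "Re (\<phi> g) = Re (L2_inner M g h)" if g: "g \<in> L2 M" for g
  proof (rule ccontr)
    assume ne: "Re (\<phi> g) \<noteq> Re (L2_inner M g h)"
    define \<delta> where "\<delta> = Re (\<phi> g) - Re (L2_inner M g h)"
    \<comment> \<open>The summand 1 keeps the denominator positive when \<open>g\<close> has norm 0;
      \<open>t\<close> is then close to the minimiser of the quadratic polynomial in t
      below.\<close>
    define N where "N = (L2_norm M g)\<^sup>2 + 1"
    have N: "N > 0" "(L2_norm M g)\<^sup>2 < N" by (auto simp: N_def add_nonneg_pos)
    define t where "t = \<delta> / N"
    have tg: "(\<lambda>x. of_real t * g x) \<in> L2 M" using g by (rule L2_cmult)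
    have "J h \<le> J (\<lambda>x. h x + of_real t * g x)"
      by (intro min L2_add h tg)
    also have "\<dots> = J h + t\<^sup>2 * (L2_norm M g)\<^sup>2 + 2 * t * Re (L2_inner M h g) - 2 * t * Re (\<phi> g)"
      unfolding J_def L2_norm_add_sq[OF h tg] add[OF h tg] cmult[OF g] L2_norm_cmult L2_inner_cmult_right
      by (simp add: power_mult_distrib)
    also have "Re (L2_inner M h g) = Re (L2_inner M g h)"
      by (subst L2_inner_commute) simp
    finally have "0 \<le> t\<^sup>2 * (L2_norm M g)\<^sup>2 - 2 * t * \<delta>"
      by (simp add: \<delta>_def algebra_simps)
    also have "t\<^sup>2 * (L2_norm M g)\<^sup>2 \<le> t\<^sup>2 * N"
      using N by (intro mult_left_mono) auto
    also have "t\<^sup>2 * N - 2 * t * \<delta> = - \<delta>\<^sup>2 / N"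
      using N by (simp add: t_def power2_eq_square field_simps)
    finally have "\<delta>\<^sup>2 \<le> 0"
      using N by (simp add: field_simps)
    then show False
      using ne by (simp add: \<delta>_def)
  qed
  have "\<phi> g = L2_inner M g h" if g: "g \<in> L2 M" for g
  proof -
    \<comment> \<open>\<open>J\<close> involves real parts only; the real part at
      \<open>\<i>\<close> times \<open>g\<close> is minus the imaginary part at \<open>g\<close>, on
      both sides.\<close>
    have "Re (\<phi> (\<lambda>x. \<i> * g x)) = Re (L2_inner M (\<lambda>x. \<i> * g x) h)"
      by (intro Re_eq L2_cmult g)
    then have "Im (\<phi> g) = Im (L2_inner M g h)"
      unfolding cmult[OF g] L2_inner_cmult_left by simp
    then show ?thesis
      using Re_eq[OF g] by (simp add: complex_eq_iff)
  qed
  then show ?thesis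
    by (intro bexI[OF _ h] ballI)
qed

text \<open>A limit point, in the product topology, of the evaluations at \<open>n\<close>.\<close>

lemma ex_generalized_limit:
  "\<exists>L :: (nat \<Rightarrow> complex) \<Rightarrow> complex.
     (\<forall>f g. Bseq f \<longrightarrow> Bseq g \<longrightarrow> L (\<lambda>n. f n + g n) = L f + L g) \<and>
     (\<forall>c f. Bseq f \<longrightarrow> L (\<lambda>n. c * f n) = c * L f) \<and>
     (\<forall>f l. f \<longlonglongrightarrow> l \<longrightarrow> L f = l) \<and>
     (\<forall>f C. (\<forall>n. cmod (f n) \<le> C) \<longrightarrow> cmod (L f) \<le> C)"
proof -
  define r :: "(nat \<Rightarrow> complex) \<Rightarrow> real" where "r f = (if Bseq f then SUP n. cmod (f n) else 0)" for f
  have r: "cmod (f n) \<le> r f" if "Bseq f" for f n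
    using that unfolding r_def by (auto intro!: cSUP_upper simp: Bseq_eq_bounded bounded_imp_bdd_above bounded_norm_comp image_image)
  \<comment> \<open>Unbounded sequences are sent to 0, so that every coordinate of
    \<open>ev n\<close> stays in a fixed disc and Tychonoff's theorem applies to the product
    \<open>K\<close>.\<close>
  define ev :: "nat \<Rightarrow> (nat \<Rightarrow> complex) \<Rightarrow> complex" where "ev n f = (if Bseq f then f n else 0)" for n f
  define K where "K = PiE UNIV (\<lambda>f. cball (0::complex) (r f))"
  have "compactin (product_topology (\<lambda>_. euclidean) UNIV) K"
    unfolding K_def by (subst compactin_PiE) (auto simp: compactin_euclidean_iff)
  then have "compact K"
    by (simp add: euclidean_product_topology compactin_euclidean_iff)
  moreover have evK: "ev n \<in> K" for n
    by (auto simp: K_def ev_def r) (simp add: r_def)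
  define F where "F = filtermap ev sequentially"
  have "F \<noteq> bot" "eventually (\<lambda>x. x \<in> K) F"
    using evK by (auto simp: F_def filtermap_bot_iff eventually_filtermap)
  ultimately obtain L where L: "inf (nhds L) F \<noteq> bot"
    unfolding compact_filter by blast
  \<comment> \<open>A filter that refines the evaluations and converges to \<open>L\<close>. Every
    relation satisfied by all \<open>ev n\<close> with large \<open>n\<close> passes to
    \<open>L\<close> along it: linearity, the bound, and the value at convergent sequences.\<close>
  define F' where "F' = inf (nhds L) F"
  have F': "F' \<noteq> bot" "F' \<le> nhds L" "F' \<le> F"
    using L by (auto simp: F'_def)
  have lim: "((\<lambda>h. h f) \<longlongrightarrow> L f) F'" for f
  proof -
    have "continuous_on UNIV (\<lambda>h::(nat \<Rightarrow> complex) \<Rightarrow> complex. h f)"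
      by (rule continuous_on_product_coordinates)
    then have "((\<lambda>h. h f) \<longlongrightarrow> L f) (at L)"
      by (simp add: continuous_on_def)
    then show ?thesis
      using F'(2) by (intro tendsto_compose[of "\<lambda>h. h f" L "\<lambda>h. h" F'])
        (auto simp: filterlim_def filtermap_ident)
  qed
  have ev: "eventually P F'" if "\<And>n. n \<ge> N \<Longrightarrow> P (ev n)" for P N
    using F'(3) that by (auto simp: F_def eventually_filtermap eventually_sequentially le_filter_def)
  show ?thesis
  proof (intro exI[of _ L] conjI allI impI)
    fix f g :: "nat \<Rightarrow> complex" assume f: "Bseq f" and g: "Bseq g"
    have fg: "Bseq (\<lambda>n. f n + g n)"
    proof -
      obtain K where "\<forall>n. cmod (f n) \<le> K" using BseqD[OF f] by blast
      moreover obtain K' where "\<forall>n. cmod (g n) \<le> K'" using BseqD[OF g] by blast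
      ultimately have "cmod (f n + g n) \<le> K + K'" for n
        by (intro norm_triangle_le add_mono) simp_all
      then show ?thesis
        by (rule BseqI')
    qed
    have "((\<lambda>h. h (\<lambda>n. f n + g n)) \<longlongrightarrow> L f + L g) F'"
      using tendsto_add[OF lim[of f] lim[of g]]
      by (rule Lim_transform_eventually) (auto intro!: ev[of 0] simp: ev_def f g fg)
    then show "L (\<lambda>n. f n + g n) = L f + L g"
      using lim F'(1) tendsto_unique by blast
  next
    fix f :: "nat \<Rightarrow> complex" and c assume f: "Bseq f"
    have cf: "Bseq (\<lambda>n. c * f n)"
    proof -
      obtain K where "\<forall>n. cmod (f n) \<le> K" using BseqD[OF f] by blast
      then have "cmod (c * f n) \<le> cmod c * K" for n
        by (simp add: norm_mult mult_left_mono)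
      then show ?thesis
        by (rule BseqI')
    qed
    have "((\<lambda>h. h (\<lambda>n. c * f n)) \<longlongrightarrow> c * L f) F'"
      using tendsto_mult[OF tendsto_const lim[of f]]
      by (rule Lim_transform_eventually) (auto intro!: ev[of 0] simp: ev_def f cf)
    then show "L (\<lambda>n. c * f n) = c * L f"
      using lim F'(1) tendsto_unique by blast
  next
    fix f :: "nat \<Rightarrow> complex" and l assume f: "f \<longlonglongrightarrow> l"
    then have Bf: "Bseq f"
      by (rule convergentI[THEN convergent_imp_Bseq])
    have "((\<lambda>h. h f) \<longlongrightarrow> l) F'"
    proof (rule tendstoI)
      fix e :: real assume "e > 0"
      then obtain N where "\<And>n. n \<ge> N \<Longrightarrow> dist (f n) l < e"
        using f by (auto simp: lim_sequentially)
      then show "eventually (\<lambda>h. dist (h f) l < e) F'"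
        by (intro ev[of N]) (auto simp: ev_def Bf)
    qed
    then show "L f = l"
      using lim F'(1) tendsto_unique by blast
  next
    fix f :: "nat \<Rightarrow> complex" and C assume f: "\<forall>n. cmod (f n) \<le> C"
    then have Bf: "Bseq f"
      by (auto intro: BseqI')
    have "((\<lambda>h. cmod (h f)) \<longlongrightarrow> cmod (L f)) F'"
      by (intro tendsto_norm lim)
    then show "cmod (L f) \<le> C"
      by (rule tendsto_upperbound[OF _ _ F'(1)]) (auto intro!: ev[of 0] simp: ev_def Bf f)
  qed
qed

section \<open>The motion group and its Haar measure\<close>

lemma space_circle_measure [simp]: "space circle_measure = sphere 0 1"
  by (simp add: circle_measure_def space_restrict_space)

lemma sets_circle_measure [measurable_cong]: "sets circle_measure = sets (restrict_space borel (sphere 0 1))"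
  by (simp add: circle_measure_def)

lemma measurable_circleD: "f \<in> M \<rightarrow>\<^sub>M circle_measure \<Longrightarrow> f \<in> borel_measurable M"
  using measurable_compose[of f M circle_measure "\<lambda>z. z" borel]
  by (simp add: measurable_restrict_space1 measurable_cong_sets[OF sets_circle_measure refl])

lemma measurable_circleI:
  assumes "f \<in> borel_measurable M" "\<And>x. x \<in> space M \<Longrightarrow> cmod (f x) = 1"
  shows "f \<in> M \<rightarrow>\<^sub>M circle_measure"
  using assms by (subst measurable_cong_sets[OF refl sets_circle_measure])
    (auto intro!: measurable_restrict_space2)

lemma measurable_id_circle_borel [measurable]: "(\<lambda>z. z) \<in> circle_measure \<rightarrow>\<^sub>M borel"
  by (rule measurable_circleD) simp

lemma measurable_cis [measurable]: "cis \<in> borel_measurable borel"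
  by (intro borel_measurable_continuous_onI continuous_intros)

lemma measurable_cis_circle: "cis \<in> borel \<rightarrow>\<^sub>M circle_measure"
  by (rule measurable_circleI) auto

interpretation circle: prob_space circle_measure
  by (rule prob_space_circle_measure)

text \<open>The endpoint is dropped because half-open intervals of length 2 pi can be cut and
  shifted without overlap, as the proof of rotation invariance does.\<close>

lemma nn_integral_circle_measure:
  assumes [measurable]: "f \<in> borel_measurable circle_measure"
  shows "(\<integral>\<^sup>+z. f z \<partial>circle_measure) = (\<integral>\<^sup>+t. f (cis t) * indicator {0..<2 * pi} t \<partial>lborel) / ennreal (2 * pi)"
proof -
  have [measurable]: "(\<lambda>t. f (cis t)) \<in> borel_measurable borel"
    using measurable_compose[OF measurable_cis_circle assms] .
  have "(\<integral>\<^sup>+z. f z \<partial>circle_measure) = (\<integral>\<^sup>+t. f (cis t) \<partial>uniform_measure lborel {0..2 * pi})"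
    unfolding circle_measure_def
  proof (rule nn_integral_distr)
    show "cis \<in> uniform_measure lborel {0..2 * pi} \<rightarrow>\<^sub>M restrict_space borel (sphere 0 1)"
      using measurable_cis_circle by (simp add: measurable_cong_sets[OF refl sets_circle_measure])
    show "f \<in> borel_measurable (distr (uniform_measure lborel {0..2 * pi}) (restrict_space borel (sphere 0 1)) cis)"
      using assms by (simp add: circle_measure_def)
  qed
  also have "\<dots> = (\<integral>\<^sup>+t. f (cis t) * indicator {0..2 * pi} t \<partial>lborel) / ennreal (2 * pi)"
    by (subst nn_integral_uniform_measure) auto
  also have "(\<integral>\<^sup>+t. f (cis t) * indicator {0..2 * pi} t \<partial>lborel) = (\<integral>\<^sup>+t. f (cis t) * indicator {0..<2 * pi} t \<partial>lborel)"
    by (rule nn_integral_cong_AE, rule AE_mp[OF AE_lborel_singleton[of "2 * pi"]])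
       (auto split: split_indicator)
  finally show ?thesis .
qed

section \<open>Invariance of Lebesgue measure and of the circle measure\<close>

lemma nn_integral_lborel_shift:
  fixes f :: "'a::euclidean_space \<Rightarrow> ennreal"
  assumes [measurable]: "f \<in> borel_measurable borel"
  shows "(\<integral>\<^sup>+x. f (c + x) \<partial>lborel) = (\<integral>\<^sup>+x. f x \<partial>lborel)"
proof -
  have "(\<integral>\<^sup>+x. f x \<partial>lborel) = (\<integral>\<^sup>+x. f x \<partial>distr lborel borel ((+) c))"
    by (simp only: lborel_distr_plus)
  also have "\<dots> = (\<integral>\<^sup>+x. f (c + x) \<partial>lborel)"
    by (rule nn_integral_distr) auto
  finally show ?thesis ..
qed

lemma nn_integral_lborel_reflect:
  fixes f :: "'a::euclidean_space \<Rightarrow> ennreal"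
  assumes [measurable]: "f \<in> borel_measurable borel"
  shows "(\<integral>\<^sup>+x. f (c - x) \<partial>lborel) = (\<integral>\<^sup>+x. f x \<partial>lborel)"
proof -
  have "lborel = distr lborel borel (\<lambda>x::'a. c - x)"
    using lborel_affine[of "-1" c] by (simp add: density_1)
  then have "(\<integral>\<^sup>+x. f x \<partial>lborel) = (\<integral>\<^sup>+x. f x \<partial>distr lborel borel (\<lambda>x. c - x))"
    by simp
  also have "\<dots> = (\<integral>\<^sup>+x. f (c - x) \<partial>lborel)"
    by (rule nn_integral_distr) auto
  finally show ?thesis ..
qed

text \<open>A rotation by the angle \<open>a\<close> shifts the period interval to
  \<open>[a, a + 2 pi)\<close>. The part beyond 2 pi is moved back by periodicity and fills the gap
  \<open>[0, a)\<close>.\<close>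

lemma distr_circle_rotate:
  assumes w: "cmod w = 1"
  shows "distr circle_measure circle_measure (\<lambda>z. w * z) = circle_measure"
proof -
  have m: "(\<lambda>z. w * z) \<in> circle_measure \<rightarrow>\<^sub>M circle_measure"
    by (rule measurable_circleI) (auto simp: norm_mult w)
  define a where "a = Arg2pi w"
  have a: "0 \<le> a" "a < 2 * pi" "w = cis a"
    using Arg2pi[of w] w by (auto simp: a_def cis_conv_exp is_Arg_def)
  show ?thesis
  proof (rule measure_eqI)
    fix A assume "A \<in> sets (distr circle_measure circle_measure (\<lambda>z. w * z))"
    then have A [measurable]: "A \<in> sets circle_measure" by simp
    define h :: "real \<Rightarrow> ennreal" where "h t = indicator A (cis t)" for t
    have [measurable]: "h \<in> borel_measurable borel"
      unfolding h_def using measurable_compose[OF measurable_cis_circle, of "indicator A :: complex \<Rightarrow> ennreal" borel] by simp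
    have per: "h (2 * pi + t) = h t" for t
      by (simp add: h_def flip: cis_mult)
    have "(\<integral>\<^sup>+t. h (a + t) * indicator {0..<2 * pi} t \<partial>lborel) =
          (\<integral>\<^sup>+t. h (a + t) * indicator {a..<a + 2 * pi} (a + t) \<partial>lborel)"
      by (intro nn_integral_cong) (auto split: split_indicator)
    also have "\<dots> = (\<integral>\<^sup>+t. h t * indicator {a..<a + 2 * pi} t \<partial>lborel)"
      by (rule nn_integral_lborel_shift) measurable
    also have "\<dots> = (\<integral>\<^sup>+t. h t * indicator {a..<2 * pi} t + h t * indicator {2 * pi..<2 * pi + a} t \<partial>lborel)"
      using a by (intro nn_integral_cong) (auto split: split_indicator)
    also have "\<dots> = (\<integral>\<^sup>+t. h t * indicator {a..<2 * pi} t \<partial>lborel) + (\<integral>\<^sup>+t. h t * indicator {2 * pi..<2 * pi + a} t \<partial>lborel)"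
      by (rule nn_integral_add) measurable
    also have "(\<integral>\<^sup>+t. h t * indicator {2 * pi..<2 * pi + a} t \<partial>lborel) =
          (\<integral>\<^sup>+t. h (2 * pi + t) * indicator {2 * pi..<2 * pi + a} (2 * pi + t) \<partial>lborel)"
      by (rule nn_integral_lborel_shift[symmetric]) measurable
    also have "\<dots> = (\<integral>\<^sup>+t. h t * indicator {0..<a} t \<partial>lborel)"
      unfolding per by (intro nn_integral_cong) (auto split: split_indicator)
    also have "(\<integral>\<^sup>+t. h t * indicator {a..<2 * pi} t \<partial>lborel) + (\<integral>\<^sup>+t. h t * indicator {0..<a} t \<partial>lborel) =
         (\<integral>\<^sup>+t. h t * indicator {a..<2 * pi} t + h t * indicator {0..<a} t \<partial>lborel)"
      by (rule nn_integral_add[symmetric]) measurable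
    also have "\<dots> = (\<integral>\<^sup>+t. h t * indicator {0..<2 * pi} t \<partial>lborel)"
      using a by (intro nn_integral_cong) (auto split: split_indicator)
    finally have shift: "(\<integral>\<^sup>+t. h (a + t) * indicator {0..<2 * pi} t \<partial>lborel) = (\<integral>\<^sup>+t. h t * indicator {0..<2 * pi} t \<partial>lborel)" .
    have "emeasure (distr circle_measure circle_measure (\<lambda>z. w * z)) A =
        (\<integral>\<^sup>+z. indicator A z \<partial>distr circle_measure circle_measure (\<lambda>z. w * z))"
      by (rule nn_integral_indicator[symmetric]) simp
    also have "\<dots> = (\<integral>\<^sup>+z. indicator A (w * z) \<partial>circle_measure)"
      using m by (rule nn_integral_distr) simp
    also have "\<dots> = (\<integral>\<^sup>+t. indicator A (w * cis t) * indicator {0..<2 * pi} t \<partial>lborel) / ennreal (2 * pi)"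
      using measurable_compose[OF m, of "indicator A :: complex \<Rightarrow> ennreal" borel] by (intro nn_integral_circle_measure) simp
    also have "(\<lambda>t. indicator A (w * cis t)) = (\<lambda>t. h (a + t))"
      by (simp add: h_def a cis_mult)
    also have "(\<integral>\<^sup>+t. h (a + t) * indicator {0..<2 * pi} t \<partial>lborel) / ennreal (2 * pi) = (\<integral>\<^sup>+z. indicator A z \<partial>circle_measure)"
      unfolding shift by (subst nn_integral_circle_measure) (auto simp: h_def)
    finally show "emeasure (distr circle_measure circle_measure (\<lambda>z. w * z)) A = emeasure circle_measure A"
      by simp
  qed simp
qed

text \<open>The uniqueness argument for invariant measures, with the indicator \<open>g\<close> of
  the unit ball as auxiliary function, which \<open>T\<close> leaves unchanged. The double integral
  of \<open>f (T x) * g (T x + y)\<close> equals \<open>m\<close> times the integral of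
  \<open>f o T\<close> when \<open>y\<close> is integrated first; after a shift of \<open>x\<close>
  it becomes \<open>m\<close> times the integral of \<open>f\<close>. As \<open>m\<close> is
  positive and finite, it cancels.\<close>

lemma distr_lborel_isometry:
  fixes T S :: "'a::euclidean_space \<Rightarrow> 'a"
  assumes T: "linear T" and n: "\<And>x. norm (T x) = norm x" and TS: "\<And>x. T (S x) = x"
  shows "distr lborel lborel T = lborel"
proof (rule measure_eqI)
  fix A assume "A \<in> sets (distr lborel lborel T)"
  then have [measurable]: "A \<in> sets borel" by simp
  have "bounded_linear T"
    using T by (simp add: linear_conv_bounded_linear)
  then have [measurable]: "T \<in> borel_measurable borel"
    by (intro borel_measurable_continuous_onI linear_continuous_on)
  define f :: "'a \<Rightarrow> ennreal" where "f = indicator A"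
  define g :: "'a \<Rightarrow> ennreal" where "g = indicator (ball 0 1)"
  have [measurable]: "f \<in> borel_measurable borel" "g \<in> borel_measurable borel"
    by (auto simp: f_def g_def intro!: borel_measurable_indicator)
  define m where "m = (\<integral>\<^sup>+x. g x \<partial>lborel)"
  have m: "m = emeasure lborel (ball (0::'a) 1)"
    unfolding m_def g_def by simp
  have m_fin: "m \<noteq> \<infinity>" and m_pos: "m \<noteq> 0"
  proof -
    show "m \<noteq> \<infinity>"
      unfolding m using emeasure_lborel_ball_finite[of "0::'a" 1] by simp
    show "m \<noteq> 0"
    proof
      assume "m = 0"
      then have "ball (0::'a) 1 \<in> null_sets lborel"
        by (auto simp: m null_sets_def)
      moreover have "open (ball (0::'a) 1)" "ball (0::'a) 1 \<noteq> {}"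
        by auto
      ultimately show False
        using open_not_negligible[of "ball (0::'a) 1"] by (simp add: negligible_iff_null_sets null_sets_completionI)
    qed
  qed
  have gT: "g (T x) = g x" for x
    by (simp add: g_def n indicator_def)
  have "m * (\<integral>\<^sup>+x. f (T x) \<partial>lborel) = (\<integral>\<^sup>+x. f (T x) * m \<partial>lborel)"
    by (subst mult.commute, rule nn_integral_multc[symmetric]) measurable
  also have "\<dots> = (\<integral>\<^sup>+x. f (T x) * (\<integral>\<^sup>+y. g (T x + y) \<partial>lborel) \<partial>lborel)"
    unfolding m_def by (subst nn_integral_lborel_shift) auto
  also have "\<dots> = (\<integral>\<^sup>+x. (\<integral>\<^sup>+y. f (T x) * g (T x + y) \<partial>lborel) \<partial>lborel)"
    by (intro nn_integral_cong nn_integral_cmult[symmetric]) measurable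
  also have "\<dots> = (\<integral>\<^sup>+y. (\<integral>\<^sup>+x. f (T x) * g (T x + y) \<partial>lborel) \<partial>lborel)"
    by (rule lborel_pair.Fubini'[symmetric]) measurable
  also have "\<dots> = (\<integral>\<^sup>+y. (\<integral>\<^sup>+x. f (T x - y) * g x \<partial>lborel) \<partial>lborel)"
  proof (rule nn_integral_cong)
    fix y :: 'a
    \<comment> \<open>Shifting \<open>x\<close> by the preimage \<open>S y\<close> moves
      \<open>y\<close> from the argument of \<open>g\<close> to that of \<open>f\<close>, and then
      \<open>g (T x) = g x\<close>.\<close>
    have "(\<integral>\<^sup>+x. f (T x) * g (T x + y) \<partial>lborel) = (\<integral>\<^sup>+x. f (T (- S y + x)) * g (T (- S y + x) + y) \<partial>lborel)"
      by (rule nn_integral_lborel_shift[symmetric]) measurable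
    also have "\<dots> = (\<integral>\<^sup>+x. f (T x - y) * g x \<partial>lborel)"
      by (simp add: linear_diff[OF T] TS gT)
    finally show "(\<integral>\<^sup>+x. f (T x) * g (T x + y) \<partial>lborel) = (\<integral>\<^sup>+x. f (T x - y) * g x \<partial>lborel)" .
  qed
  also have "\<dots> = (\<integral>\<^sup>+x. (\<integral>\<^sup>+y. f (T x - y) * g x \<partial>lborel) \<partial>lborel)"
    by (rule lborel_pair.Fubini') measurable
  also have "\<dots> = (\<integral>\<^sup>+x. (\<integral>\<^sup>+y. f (T x - y) \<partial>lborel) * g x \<partial>lborel)"
    by (intro nn_integral_cong nn_integral_multc) measurable
  also have "\<dots> = (\<integral>\<^sup>+x. (\<integral>\<^sup>+y. f y \<partial>lborel) * g x \<partial>lborel)"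
    by (subst nn_integral_lborel_reflect) auto
  also have "\<dots> = (\<integral>\<^sup>+y. f y \<partial>lborel) * m"
    unfolding m_def by (rule nn_integral_cmult) measurable
  finally have "m * (\<integral>\<^sup>+x. f (T x) \<partial>lborel) = m * (\<integral>\<^sup>+y. f y \<partial>lborel)"
    by (simp add: mult.commute)
  then have "(\<integral>\<^sup>+x. f (T x) \<partial>lborel) = (\<integral>\<^sup>+y. f y \<partial>lborel)"
    using m_fin m_pos by (simp add: ennreal_mult_cancel_left)
  moreover have "emeasure (distr lborel lborel T) A = (\<integral>\<^sup>+x. f x \<partial>distr lborel lborel T)"
    unfolding f_def by (rule nn_integral_indicator[symmetric]) simp
  moreover have "(\<integral>\<^sup>+x. f x \<partial>distr lborel lborel T) = (\<integral>\<^sup>+x. f (T x) \<partial>lborel)"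
    by (rule nn_integral_distr) auto
  ultimately show "emeasure (distr lborel lborel T) A = emeasure lborel A"
    by (simp add: f_def)
qed simp

section \<open>The Haar measure of the product group in split coordinates\<close>

lemma sigma_finite_circle: "sigma_finite_measure circle_measure"
  by unfold_locales

abbreviation circle2 :: "(complex \<times> complex) measure" where
  "circle2 \<equiv> circle_measure \<Otimes>\<^sub>M circle_measure"

lemma sigma_finite_pair: "sigma_finite_measure M \<Longrightarrow> sigma_finite_measure N \<Longrightarrow> sigma_finite_measure (M \<Otimes>\<^sub>M N)"
proof -
  assume "sigma_finite_measure M" "sigma_finite_measure N"
  then interpret pair_sigma_finite M N
    by (rule pair_sigma_finite.intro)
  show ?thesis
    by unfold_locales
qed

lemma sigma_finite_motion_haar: "sigma_finite_measure motion_haar"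
  unfolding motion_haar_def by (intro sigma_finite_pair sigma_finite_lborel sigma_finite_circle)

lemma sigma_finite_motion_haar2: "sigma_finite_measure motion_haar2"
  by (intro sigma_finite_pair sigma_finite_motion_haar)

interpretation circle2: prob_space circle2
  by (intro prob_space_pair) unfold_locales

lemma sigma_finite_circle2: "sigma_finite_measure circle2"
  by unfold_locales

text \<open>Collects the two translation and the two rotation coordinates; the translations then form the
  Euclidean space on which the Fourier transform acts.\<close>

definition regroup :: "(complex \<times> complex) \<times> (complex \<times> complex) \<Rightarrow> (complex \<times> complex) \<times> (complex \<times> complex)" where
  "regroup = (\<lambda>((x, y), (z, w)). ((x, z), (y, w)))"

lemma regroup_simp [simp]: "regroup ((x, y), (z, w)) = ((x, z), (y, w))"
  by (simp add: regroup_def)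

abbreviation haar_split :: "((complex \<times> complex) \<times> (complex \<times> complex)) measure" where
  "haar_split \<equiv> lborel \<Otimes>\<^sub>M circle2"

lemma measurable_regroup [measurable]: "regroup \<in> haar_split \<rightarrow>\<^sub>M motion_haar2"
proof -
  have *: "regroup = (\<lambda>p. ((fst (fst p), fst (snd p)), (snd (fst p), snd (snd p))))"
    by (auto simp: regroup_def)
  have [measurable]: "fst \<in> lborel \<rightarrow>\<^sub>M (lborel :: complex measure)" "snd \<in> lborel \<rightarrow>\<^sub>M (lborel :: complex measure)"
    by (simp_all add: lborel_prod[symmetric])
  show ?thesis
    unfolding * motion_haar_def by measurable
qed

lemma nn_integral_motion_haar2:
  assumes [measurable]: "f \<in> borel_measurable motion_haar2"
  shows "(\<integral>\<^sup>+p. f p \<partial>motion_haar2) = (\<integral>\<^sup>+p. f (regroup p) \<partial>haar_split)"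
proof -
  interpret lc: pair_sigma_finite "lborel :: complex measure" circle_measure
    by (intro pair_sigma_finite.intro sigma_finite_lborel sigma_finite_circle)
  interpret ll: pair_sigma_finite "lborel :: complex measure" "lborel :: complex measure"
    by (intro pair_sigma_finite.intro sigma_finite_lborel)
  interpret cc: pair_sigma_finite circle_measure circle_measure
    by (intro pair_sigma_finite.intro sigma_finite_circle)
  interpret mm: pair_sigma_finite motion_haar motion_haar
    by (intro pair_sigma_finite.intro sigma_finite_motion_haar)
  interpret vc: pair_sigma_finite "lborel :: (complex \<times> complex) measure" circle2
    by (intro pair_sigma_finite.intro sigma_finite_lborel sigma_finite_circle2)
  have f' [measurable]: "(\<lambda>p. f (regroup p)) \<in> borel_measurable haar_split"
    using measurable_compose[OF measurable_regroup assms] .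
  have f1 [measurable]: "f \<in> borel_measurable ((lborel \<Otimes>\<^sub>M circle_measure) \<Otimes>\<^sub>M (lborel \<Otimes>\<^sub>M circle_measure))"
    using assms by (simp add: motion_haar_def)
  have f2 [measurable]: "(\<lambda>p. f (regroup p)) \<in> borel_measurable ((lborel \<Otimes>\<^sub>M lborel) \<Otimes>\<^sub>M circle2)"
    using f' by (simp add: lborel_prod)
  have f3 [measurable]: "(\<lambda>p. f ((fst (fst p), fst (snd p)), (snd (fst p), snd (snd p)))) \<in> borel_measurable ((lborel \<Otimes>\<^sub>M lborel) \<Otimes>\<^sub>M circle2)"
    by measurable
  have "(\<integral>\<^sup>+p. f p \<partial>motion_haar2) = (\<integral>\<^sup>+g. \<integral>\<^sup>+h. f (g, h) \<partial>motion_haar \<partial>motion_haar)"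
    by (rule sigma_finite_measure.nn_integral_fst[OF sigma_finite_motion_haar, symmetric]) simp
  also have "\<dots> = (\<integral>\<^sup>+g. \<integral>\<^sup>+y. \<integral>\<^sup>+w. f (g, (y, w)) \<partial>circle_measure \<partial>lborel \<partial>motion_haar)"
  proof (rule nn_integral_cong)
    fix g assume g: "g \<in> space motion_haar"
    have "(\<lambda>h. f (g, h)) \<in> borel_measurable motion_haar"
      using g by measurable
    then have "(\<lambda>h. f (g, h)) \<in> borel_measurable (lborel \<Otimes>\<^sub>M circle_measure)"
      by (simp add: motion_haar_def)
    from sigma_finite_measure.nn_integral_fst[OF sigma_finite_circle this]
    show "(\<integral>\<^sup>+h. f (g, h) \<partial>motion_haar) = (\<integral>\<^sup>+y. \<integral>\<^sup>+w. f (g, (y, w)) \<partial>circle_measure \<partial>lborel)"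
      by (simp add: motion_haar_def)
  qed
  also have "\<dots> = (\<integral>\<^sup>+x. \<integral>\<^sup>+z. \<integral>\<^sup>+y. \<integral>\<^sup>+w. f ((x, z), (y, w)) \<partial>circle_measure \<partial>lborel \<partial>circle_measure \<partial>lborel)"
  proof -
    have "(\<lambda>g. \<integral>\<^sup>+y. \<integral>\<^sup>+w. f (g, (y, w)) \<partial>circle_measure \<partial>lborel) \<in> borel_measurable (lborel \<Otimes>\<^sub>M circle_measure)"
      by measurable
    from sigma_finite_measure.nn_integral_fst[OF sigma_finite_circle this]
    show ?thesis
      by (simp add: motion_haar_def)
  qed
  also have "\<dots> = (\<integral>\<^sup>+x. \<integral>\<^sup>+y. \<integral>\<^sup>+z. \<integral>\<^sup>+w. f ((x, z), (y, w)) \<partial>circle_measure \<partial>circle_measure \<partial>lborel \<partial>lborel)"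
    by (intro nn_integral_cong lc.Fubini') measurable
  also have "\<dots> = (\<integral>\<^sup>+v. \<integral>\<^sup>+z. \<integral>\<^sup>+w. f ((fst v, z), (snd v, w)) \<partial>circle_measure \<partial>circle_measure \<partial>(lborel \<Otimes>\<^sub>M lborel))"
  proof -
    have "(\<lambda>v. \<integral>\<^sup>+z. \<integral>\<^sup>+w. f ((fst v, z), (snd v, w)) \<partial>circle_measure \<partial>circle_measure) \<in> borel_measurable (lborel \<Otimes>\<^sub>M lborel)"
      by measurable
    from sigma_finite_measure.nn_integral_fst[OF sigma_finite_lborel this]
    show ?thesis
      by simp
  qed
  also have "\<dots> = (\<integral>\<^sup>+v. \<integral>\<^sup>+k. f ((fst v, fst k), (snd v, snd k)) \<partial>circle2 \<partial>(lborel \<Otimes>\<^sub>M lborel))"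
  proof (rule nn_integral_cong)
    fix v :: "complex \<times> complex" assume v: "v \<in> space (lborel \<Otimes>\<^sub>M lborel)"
    have "(\<lambda>k. f ((fst v, fst k), (snd v, snd k))) \<in> borel_measurable circle2"
      using v by measurable
    from sigma_finite_measure.nn_integral_fst[OF sigma_finite_circle this]
    show "(\<integral>\<^sup>+z. \<integral>\<^sup>+w. f ((fst v, z), (snd v, w)) \<partial>circle_measure \<partial>circle_measure) =
        (\<integral>\<^sup>+k. f ((fst v, fst k), (snd v, snd k)) \<partial>circle2)"
      by simp
  qed
  also have "\<dots> = (\<integral>\<^sup>+v. \<integral>\<^sup>+k. f (regroup (v, k)) \<partial>circle2 \<partial>lborel)"
    by (simp add: lborel_prod regroup_def case_prod_beta)
  also have "\<dots> = (\<integral>\<^sup>+p. f (regroup p) \<partial>haar_split)"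
    by (rule sigma_finite_measure.nn_integral_fst[OF sigma_finite_circle2]) simp
  finally show ?thesis .
qed

lemma distr_regroup: "distr haar_split motion_haar2 regroup = motion_haar2"
proof (rule measure_eqI)
  fix A assume "A \<in> sets (distr haar_split motion_haar2 regroup)"
  then have [measurable]: "A \<in> sets motion_haar2" by simp
  have "emeasure (distr haar_split motion_haar2 regroup) A = (\<integral>\<^sup>+p. indicator A p \<partial>distr haar_split motion_haar2 regroup)"
    by (rule nn_integral_indicator[symmetric]) simp
  also have "\<dots> = (\<integral>\<^sup>+p. indicator A (regroup p) \<partial>haar_split)"
    by (rule nn_integral_distr) auto
  also have "\<dots> = (\<integral>\<^sup>+p. indicator A p \<partial>motion_haar2)"
    by (rule nn_integral_motion_haar2[symmetric]) simp
  finally show "emeasure (distr haar_split motion_haar2 regroup) A = emeasure motion_haar2 A"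
    by simp
qed simp

lemma integral_motion_haar2:
  fixes f :: "_ \<Rightarrow> 'b::{banach, second_countable_topology}"
  assumes "f \<in> borel_measurable motion_haar2"
  shows "(LINT p|motion_haar2. f p) = (LINT p|haar_split. f (regroup p))"
  using integral_distr[OF measurable_regroup assms] by (simp add: distr_regroup)

lemma integrable_motion_haar2_iff:
  fixes f :: "_ \<Rightarrow> 'b::{banach, second_countable_topology}"
  assumes "f \<in> borel_measurable motion_haar2"
  shows "integrable motion_haar2 f \<longleftrightarrow> integrable haar_split (\<lambda>p. f (regroup p))"
  using integrable_distr_eq[OF measurable_regroup assms] by (simp add: distr_regroup)

lemma distr_lborel_affine_rotation:
  assumes z: "cmod z = 1"
  shows "distr lborel lborel (\<lambda>x::complex. a + z * x) = lborel"
proof -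
  have 1: "distr lborel lborel (\<lambda>x. z * x) = lborel"
    using z by (intro distr_lborel_isometry[where S="\<lambda>x. x / z"] bounded_linear.linear bounded_linear_mult_right)
      (auto simp: norm_mult)
  have "distr lborel lborel (\<lambda>x. a + z * x) = distr (distr lborel lborel (\<lambda>x. z * x)) lborel ((+) a)"
    by (subst distr_distr) (auto simp: comp_def)
  also have "\<dots> = distr lborel borel ((+) a)"
    unfolding 1 by (intro distr_cong) auto
  finally show ?thesis
    by (simp add: lborel_distr_plus)
qed

section \<open>Group operations in coordinates and left invariance\<close>

lemma mult_cnj_unit: "cmod z = 1 \<Longrightarrow> z * cnj z = 1"
  using cnj_mult_unit[of z] by (simp only: mult.commute)

definition mult_E :: "complex \<times> complex \<Rightarrow> complex \<times> complex \<Rightarrow> complex \<times> complex" where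
  "mult_E g h = (fst g + snd g * fst h, snd g * snd h)"

definition inv_E :: "complex \<times> complex \<Rightarrow> complex \<times> complex" where
  "inv_E g = (- cnj (snd g) * fst g, cnj (snd g))"

lemma mult_E_eq: "g \<otimes>\<^bsub>motion_group\<^esub> h = mult_E g h"
  by (cases g; cases h) (simp add: mult_E_def)

lemma inv_E_eq: "g \<in> carrier motion_group \<Longrightarrow> inv\<^bsub>motion_group\<^esub> g = inv_E g"
  by (cases g) (auto simp: inv_E_def inv_motion_group)

lemma space_motion_haar_times: "space motion_haar = UNIV \<times> sphere 0 1"
  by (simp add: space_motion_haar)

lemma measurable_motion_haarI:
  assumes "(\<lambda>x. fst (f x)) \<in> borel_measurable M" "(\<lambda>x. snd (f x)) \<in> borel_measurable M"
    "\<And>x. x \<in> space M \<Longrightarrow> cmod (snd (f x)) = 1"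
  shows "f \<in> M \<rightarrow>\<^sub>M motion_haar"
  unfolding motion_haar_def
proof (rule measurable_pair)
  show "fst \<circ> f \<in> M \<rightarrow>\<^sub>M lborel"
    using assms(1) by (simp add: comp_def)
  show "snd \<circ> f \<in> M \<rightarrow>\<^sub>M circle_measure"
    using assms(2,3) by (auto simp: comp_def intro: measurable_circleI)
qed

lemma measurable_fst_motion_haar [measurable (raw)]:
  "f \<in> M \<rightarrow>\<^sub>M motion_haar \<Longrightarrow> (\<lambda>x. fst (f x)) \<in> borel_measurable M"
  unfolding motion_haar_def using measurable_compose[OF _ measurable_fst, of f M lborel circle_measure] by simp

lemma measurable_snd_motion_haar [measurable (raw)]:
  "f \<in> M \<rightarrow>\<^sub>M motion_haar \<Longrightarrow> (\<lambda>x. snd (f x)) \<in> borel_measurable M"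
  unfolding motion_haar_def
  by (rule measurable_circleD) (rule measurable_compose[OF _ measurable_snd])

lemma measurable_mult_E [measurable (raw)]:
  assumes [measurable]: "f \<in> M \<rightarrow>\<^sub>M motion_haar" "g \<in> M \<rightarrow>\<^sub>M motion_haar"
  shows "(\<lambda>x. mult_E (f x) (g x)) \<in> M \<rightarrow>\<^sub>M motion_haar"
proof (rule measurable_motion_haarI)
  fix x assume "x \<in> space M"
  then have "f x \<in> UNIV \<times> sphere 0 1" "g x \<in> UNIV \<times> sphere 0 1"
    using assms[THEN measurable_space] by (auto simp: space_motion_haar_times)
  then show "cmod (snd (mult_E (f x) (g x))) = 1"
    by (auto simp: mult_E_def norm_mult)
qed (simp_all add: mult_E_def)

lemma measurable_inv_E [measurable (raw)]:
  assumes [measurable]: "f \<in> M \<rightarrow>\<^sub>M motion_haar"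
  shows "(\<lambda>x. inv_E (f x)) \<in> M \<rightarrow>\<^sub>M motion_haar"
proof (rule measurable_motion_haarI)
  fix x assume "x \<in> space M"
  then have "f x \<in> UNIV \<times> sphere 0 1"
    using assms[THEN measurable_space] by (auto simp: space_motion_haar_times)
  then show "cmod (snd (inv_E (f x))) = 1"
    by (auto simp: inv_E_def)
qed (simp_all add: inv_E_def)

lemma distr_motion_haar_mult:
  assumes "cmod (snd g) = 1"
  shows "distr motion_haar motion_haar (mult_E g) = motion_haar"
proof -
  have "distr lborel lborel (\<lambda>x. fst g + snd g * x) \<Otimes>\<^sub>M distr circle_measure circle_measure (\<lambda>z. snd g * z) =
      distr (lborel \<Otimes>\<^sub>M circle_measure) (lborel \<Otimes>\<^sub>M circle_measure) (\<lambda>(x, z). (fst g + snd g * x, snd g * z))"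
    using assms by (intro pair_measure_distr)
      (auto simp: distr_circle_rotate norm_mult intro!: sigma_finite_circle measurable_circleI)
  moreover have "(\<lambda>(x, z). (fst g + snd g * x, snd g * z)) = mult_E g"
    by (auto simp: mult_E_def fun_eq_iff)
  ultimately show ?thesis
    using assms by (simp add: distr_lborel_affine_rotation distr_circle_rotate motion_haar_def)
qed

definition mult_EE where
  "mult_EE g h = (mult_E (fst g) (fst h), mult_E (snd g) (snd h))"

definition inv_EE where
  "inv_EE g = (inv_E (fst g), inv_E (snd g))"

lemma mult_EE_eq: "g \<otimes>\<^bsub>motion_group2\<^esub> h = mult_EE g h"
  by (cases g; cases h) (simp add: mult_EE_def mult_E_eq)

lemma carrier_motion_group2: "carrier motion_group2 = (UNIV \<times> sphere 0 1) \<times> (UNIV \<times> sphere 0 1)"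
  by (simp add: carrier_DirProd)

lemma space_motion_haar2: "space motion_haar2 = carrier motion_group2"
  by (simp add: carrier_motion_group2 space_pair_measure space_motion_haar_times)

lemma inv_EE_eq: "g \<in> carrier motion_group2 \<Longrightarrow> inv\<^bsub>motion_group2\<^esub> g = inv_EE g"
  by (cases g) (auto simp: inv_EE_def inv_DirProd group_motion_group inv_E_eq carrier_motion_group2)

lemma left_regular_eq:
  "g \<in> carrier motion_group2 \<Longrightarrow> left_regular motion_group2 g \<xi> h = \<xi> (mult_EE (inv_EE g) h)"
  by (simp add: left_regular_def inv_EE_eq mult_EE_eq)

lemma inv_EE_carrier: "g \<in> carrier motion_group2 \<Longrightarrow> inv_EE g \<in> carrier motion_group2"
  by (auto simp: inv_EE_def inv_E_def carrier_motion_group2)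

lemma measurable_mult_EE [measurable (raw)]:
  assumes [measurable]: "f \<in> M \<rightarrow>\<^sub>M motion_haar2" "g \<in> M \<rightarrow>\<^sub>M motion_haar2"
  shows "(\<lambda>x. mult_EE (f x) (g x)) \<in> M \<rightarrow>\<^sub>M motion_haar2"
  unfolding mult_EE_def by measurable

lemma measurable_inv_EE [measurable (raw)]:
  assumes [measurable]: "f \<in> M \<rightarrow>\<^sub>M motion_haar2"
  shows "(\<lambda>x. inv_EE (f x)) \<in> M \<rightarrow>\<^sub>M motion_haar2"
  unfolding inv_EE_def by measurable

lemma distr_motion_haar2_mult:
  assumes "g \<in> carrier motion_group2"
  shows "distr motion_haar2 motion_haar2 (mult_EE g) = motion_haar2"
proof -
  have g: "cmod (snd (fst g)) = 1" "cmod (snd (snd g)) = 1"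
    using assms by (auto simp: carrier_motion_group2)
  then have gs: "fst g \<in> space motion_haar" "snd g \<in> space motion_haar"
    using assms by (auto simp: space_motion_haar_times carrier_motion_group2)
  have "distr motion_haar motion_haar (mult_E (fst g)) \<Otimes>\<^sub>M distr motion_haar motion_haar (mult_E (snd g)) =
      distr motion_haar2 motion_haar2 (\<lambda>(x, y). (mult_E (fst g) x, mult_E (snd g) y))"
    using gs g by (intro pair_measure_distr) (auto simp: distr_motion_haar_mult sigma_finite_motion_haar)
  then show ?thesis
    using g by (simp add: distr_motion_haar_mult mult_EE_def[abs_def] case_prod_beta')
qed

lemma measurable_mult_EE_left:
  assumes "g \<in> carrier motion_group2"
  shows "mult_EE g \<in> motion_haar2 \<rightarrow>\<^sub>M motion_haar2"
proof -
  have "(\<lambda>_. g) \<in> motion_haar2 \<rightarrow>\<^sub>M motion_haar2"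
    using assms by (intro measurable_const) (simp only: space_motion_haar2)
  then show ?thesis
    by (rule measurable_mult_EE[OF _ measurable_ident_sets[OF refl]])
qed

lemma mult_E_inv:
  assumes "cmod (snd g) = 1"
  shows "mult_E (inv_E g) (mult_E g h) = h" "mult_E g (mult_E (inv_E g) h) = h"
proof -
  obtain a z x w where gh: "g = (a, z)" "h = (x, w)"
    by (cases g; cases h)
  have z: "cnj z * z = 1" "z * cnj z = 1"
    using assms cnj_mult_unit mult_cnj_unit by (auto simp only: gh snd_conv)
  \<comment> \<open>Each composite is arranged so that \<open>z\<close> meets its conjugate only in
    the two products that equal 1 by \<open>z\<close>.\<close>
  have "- cnj z * a + cnj z * (a + z * x) = (cnj z * z) * x" "cnj z * (z * w) = (cnj z * z) * w"
    "a + z * (- cnj z * a + cnj z * x) = (z * cnj z) * x + (1 - z * cnj z) * a" "z * (cnj z * w) = (z * cnj z) * w"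
    by (simp_all add: algebra_simps)
  then show "mult_E (inv_E g) (mult_E g h) = h" "mult_E g (mult_E (inv_E g) h) = h"
    unfolding z by (simp_all only: gh mult_E_def inv_E_def fst_conv snd_conv mult_1 diff_self mult_zero_left add_0_right)
qed

lemma mult_EE_inv:
  assumes "g \<in> carrier motion_group2"
  shows "mult_EE (inv_EE g) (mult_EE g h) = h" "mult_EE g (mult_EE (inv_EE g) h) = h"
proof -
  have "cmod (snd (fst g)) = 1" "cmod (snd (snd g)) = 1"
    using assms by (auto simp: carrier_motion_group2)
  then show "mult_EE (inv_EE g) (mult_EE g h) = h" "mult_EE g (mult_EE (inv_EE g) h) = h"
    by (simp_all add: mult_EE_def inv_EE_def mult_E_inv)
qed

lemma left_regular_borel_measurable:
  assumes "g \<in> carrier motion_group2" "\<xi> \<in> borel_measurable motion_haar2"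
  shows "left_regular motion_group2 g \<xi> \<in> borel_measurable motion_haar2"
proof -
  have "(\<lambda>h. \<xi> (mult_EE (inv_EE g) h)) \<in> borel_measurable motion_haar2"
    using measurable_compose[OF measurable_mult_EE_left[OF inv_EE_carrier[OF assms(1)]] assms(2)] .
  moreover have "left_regular motion_group2 g \<xi> = (\<lambda>h. \<xi> (mult_EE (inv_EE g) h))"
    using assms(1) by (simp add: left_regular_eq fun_eq_iff)
  ultimately show ?thesis
    by simp
qed

lemma integral_mult_EE:
  fixes f :: "_ \<Rightarrow> 'b::{banach, second_countable_topology}"
  assumes g: "g \<in> carrier motion_group2" and f: "f \<in> borel_measurable motion_haar2"
  shows "(LINT h|motion_haar2. f (mult_EE g h)) = (LINT h|motion_haar2. f h)"
  using integral_distr[OF measurable_mult_EE_left[OF g] f] by (simp only: distr_motion_haar2_mult[OF g])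

lemma integrable_mult_EE:
  fixes f :: "_ \<Rightarrow> 'b::{banach, second_countable_topology}"
  assumes g: "g \<in> carrier motion_group2" and f: "integrable motion_haar2 f"
  shows "integrable motion_haar2 (\<lambda>h. f (mult_EE g h))"
  using integrable_distr[OF measurable_mult_EE_left[OF g], of f] f by (simp only: distr_motion_haar2_mult[OF g])

lemma left_regular_L2:
  assumes g: "g \<in> carrier motion_group2" and \<xi>: "\<xi> \<in> L2 motion_haar2"
  shows "left_regular motion_group2 g \<xi> \<in> L2 motion_haar2"
    and "L2_norm motion_haar2 (left_regular motion_group2 g \<xi>) = L2_norm motion_haar2 \<xi>"
proof -
  note g' = inv_EE_carrier[OF g]
  have m: "\<xi> \<in> borel_measurable motion_haar2" and i: "integrable motion_haar2 (\<lambda>h. (cmod (\<xi> h))\<^sup>2)"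
    using \<xi> by (auto simp: L2_def)
  have "integrable motion_haar2 (\<lambda>h. (cmod (left_regular motion_group2 g \<xi> h))\<^sup>2)"
    using integrable_mult_EE[OF g' i] by (simp only: left_regular_eq[OF g])
  then show "left_regular motion_group2 g \<xi> \<in> L2 motion_haar2"
    unfolding L2_def using left_regular_borel_measurable[OF g m] by (intro CollectI conjI)
  show "L2_norm motion_haar2 (left_regular motion_group2 g \<xi>) = L2_norm motion_haar2 \<xi>"
    unfolding L2_norm_def left_regular_eq[OF g]
    using integral_mult_EE[OF g' borel_measurable_integrable[OF i]] by simp
qed

lemma measurable_coefficient:
  assumes \<xi>: "\<xi> \<in> borel_measurable motion_haar2" and \<eta>: "\<eta> \<in> borel_measurable motion_haar2"
  shows "(\<lambda>g. L2_inner motion_haar2 (left_regular motion_group2 g \<xi>) \<eta>) \<in> borel_measurable motion_haar2"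
proof -
  interpret sigma_finite_measure motion_haar2
    by (rule sigma_finite_motion_haar2)
  note [measurable] = assms
  have m: "(\<lambda>p. mult_EE (inv_EE (fst p)) (snd p)) \<in> motion_haar2 \<Otimes>\<^sub>M motion_haar2 \<rightarrow>\<^sub>M motion_haar2"
    by (intro measurable_mult_EE measurable_inv_EE measurable_fst measurable_snd)
  have [measurable]: "(\<lambda>p. \<xi> (mult_EE (inv_EE (fst p)) (snd p))) \<in> borel_measurable (motion_haar2 \<Otimes>\<^sub>M motion_haar2)"
    by (rule measurable_compose[OF m \<xi>])
  have "(\<lambda>g. LINT h|motion_haar2. \<xi> (mult_EE (inv_EE g) h) * cnj (\<eta> h)) \<in> borel_measurable motion_haar2"
    by (rule borel_measurable_lebesgue_integral) (simp add: case_prod_beta)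
  then show ?thesis
    by (subst measurable_cong) (auto simp: L2_inner_def left_regular_eq space_motion_haar2)
qed

lemma cmod_coefficient_le:
  assumes "g \<in> carrier motion_group2" "\<xi> \<in> L2 motion_haar2" "\<eta> \<in> L2 motion_haar2"
  shows "cmod (L2_inner motion_haar2 (left_regular motion_group2 g \<xi>) \<eta>) \<le> L2_norm motion_haar2 \<xi> * L2_norm motion_haar2 \<eta>"
  using L2_Cauchy_Schwarz[OF left_regular_L2(1)[OF assms(1,2)] assms(3)] left_regular_L2(2)[OF assms(1,2)]
  by simp

section \<open>Affine substitutions and products of integrable functions\<close>

lemma lborel_integral_affine:
  fixes f :: "'a::euclidean_space \<Rightarrow> 'b::{banach, second_countable_topology}"
  assumes [measurable]: "f \<in> borel_measurable borel" and c: "c \<noteq> 0"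
  shows "(LINT x|lborel. f x) = \<bar>c\<bar> ^ DIM('a) *\<^sub>R (LINT x|lborel. f (t + c *\<^sub>R x))"
proof -
  have "(LINT x|lborel. f x) = (LINT x|density (distr lborel borel (\<lambda>x. t + c *\<^sub>R x)) (\<lambda>_. ennreal (\<bar>c\<bar> ^ DIM('a))). f x)"
    using lborel_affine[OF c, of t] by simp
  also have "\<dots> = (LINT x|distr lborel borel (\<lambda>x. t + c *\<^sub>R x). \<bar>c\<bar> ^ DIM('a) *\<^sub>R f x)"
    by (rule integral_density) auto
  also have "\<dots> = (LINT x|lborel. \<bar>c\<bar> ^ DIM('a) *\<^sub>R f (t + c *\<^sub>R x))"
    by (rule integral_distr) auto
  finally show ?thesis
    by simp
qed

lemma lborel_integrable_affine:
  fixes f :: "'a::euclidean_space \<Rightarrow> 'b::{banach, second_countable_topology}"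
  assumes f: "integrable lborel f" and c: "c \<noteq> 0"
  shows "integrable lborel (\<lambda>x. f (t + c *\<^sub>R x))"
proof -
  have [measurable]: "f \<in> borel_measurable borel"
    using borel_measurable_integrable[OF f] by simp
  have "integrable (density (distr lborel borel (\<lambda>x. t + c *\<^sub>R x)) (\<lambda>_. ennreal (\<bar>c\<bar> ^ DIM('a)))) f"
    using lborel_affine[OF c, of t] f by simp
  then have "integrable (distr lborel borel (\<lambda>x. t + c *\<^sub>R x)) (\<lambda>x. \<bar>c\<bar> ^ DIM('a) *\<^sub>R f x)"
    by (subst (asm) integrable_density) auto
  then have "integrable (distr lborel borel (\<lambda>x. t + c *\<^sub>R x)) (\<lambda>x. inverse (\<bar>c\<bar> ^ DIM('a)) *\<^sub>R (\<bar>c\<bar> ^ DIM('a) *\<^sub>R f x))"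
    by (rule integrable_scaleR_right)
  then have "integrable (distr lborel borel (\<lambda>x. t + c *\<^sub>R x)) f"
    using c by simp
  then show ?thesis
    by (subst (asm) integrable_distr_eq) auto
qed

lemma integrable_pair_mult:
  fixes f :: "'a \<Rightarrow> complex" and g :: "'b \<Rightarrow> complex"
  assumes M: "sigma_finite_measure M" and N: "sigma_finite_measure N"
    and f: "integrable M f" and g: "integrable N g"
  shows "integrable (M \<Otimes>\<^sub>M N) (\<lambda>(x, y). f x * g y)"
proof -
  interpret pair_sigma_finite M N
    using M N by (rule pair_sigma_finite.intro)
  have [measurable]: "f \<in> borel_measurable M" "g \<in> borel_measurable N"
    using f g by auto
  show ?thesis
  proof (rule Fubini_integrable)
    show "(\<lambda>(x, y). f x * g y) \<in> borel_measurable (M \<Otimes>\<^sub>M N)"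
      by measurable
    show "integrable M (\<lambda>x. LINT y|N. norm (case (x, y) of (x, y) \<Rightarrow> f x * g y))"
      using f by (simp add: norm_mult)
    show "AE x in M. integrable N (\<lambda>y. case (x, y) of (x, y) \<Rightarrow> f x * g y)"
      using g by simp
  qed
qed

section \<open>Gaussian smoothing and the Fourier transform\<close>

text \<open>The total mass of the unnormalised Gaussian in dimension d. Its square, (2 pi)^d, is the
  Plancherel constant of the transform \<open>FT\<close>.\<close>

definition gauss_const :: "'a::euclidean_space itself \<Rightarrow> real" where
  "gauss_const _ = sqrt (2 * pi) ^ DIM('a)"

definition gauss :: "'a::euclidean_space \<Rightarrow> real" where
  "gauss x = exp (- (norm x)\<^sup>2 / 2) / gauss_const TYPE('a)"

lemma gauss_const_pos: "0 < gauss_const TYPE('a::euclidean_space)"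
  by (simp add: gauss_const_def)

lemma gauss_pos: "0 < gauss x"
  by (simp add: gauss_def gauss_const_pos)

lemma measurable_gauss [measurable]: "gauss \<in> borel_measurable borel"
  unfolding gauss_def[abs_def] by measurable

lemma gauss_nonneg [simp]: "0 \<le> gauss x"
  using gauss_pos[of x] by simp

lemma norm_power2_eq_sum_Basis: "(norm x)\<^sup>2 = (\<Sum>b\<in>Basis. (x \<bullet> b)\<^sup>2)"
  unfolding power2_norm_eq_inner by (subst euclidean_inner) (simp add: power2_eq_square)

lemma gauss_eq_prod: "gauss (x::'a::euclidean_space) = (\<Prod>b\<in>Basis. std_normal_density (x \<bullet> b))"
proof -
  have "exp (- (norm x)\<^sup>2 / 2) = (\<Prod>b\<in>Basis. exp (- (x \<bullet> b)\<^sup>2 / 2))"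
    by (simp add: norm_power2_eq_sum_Basis exp_sum[symmetric] sum_negf sum_divide_distrib)
  then show ?thesis
    by (simp add: gauss_def gauss_const_def std_normal_density_def prod_dividef prod.distrib power_divide)
qed

lemma cis_inner_eq_prod: "cis (x \<bullet> y) = (\<Prod>b\<in>Basis. cis ((x \<bullet> b) * (y \<bullet> b)))"
  by (simp add: euclidean_inner[of x y] cis_conv_exp exp_sum[symmetric] sum_distrib_left)

text \<open>The Gaussian and the character both factor over the coordinates, so the integral is a
  product of characteristic functions of the standard normal distribution on the line.\<close>

lemma gauss_Fourier:
  fixes w :: "'a::euclidean_space"
  shows "integrable lborel (\<lambda>x::'a. of_real (gauss x) * cis (x \<bullet> w))" (is ?A)
    and "(LINT x|lborel. of_real (gauss x) * cis (x \<bullet> w)) = of_real (exp (- (norm w)\<^sup>2 / 2))" (is ?B)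
proof -
  interpret product_sigma_finite "\<lambda>_::'a. lborel :: real measure"
    by unfold_locales
  define F where "F b t = complex_of_real (std_normal_density t) * cis (t * (w \<bullet> b))" for b t
  have F: "integrable lborel (F b)" for b
  proof -
    have "integrable lborel (\<lambda>t. std_normal_density t *\<^sub>R cis (t * (w \<bullet> b)))"
      by (rule Bochner_Integration.integrable_bound[of _ std_normal_density])
         (auto simp: integrable_normal_density)
    then show ?thesis
      by (simp add: F_def[abs_def] scaleR_conv_of_real)
  qed
  have FI: "(LINT t|lborel. F b t) = of_real (exp (- (w \<bullet> b)\<^sup>2 / 2))" for b
  proof -
    have "complex_of_real (exp (- (w \<bullet> b)\<^sup>2 / 2)) = char std_normal_distribution (w \<bullet> b)"
      by (simp add: char_std_normal_distribution)
    also have "\<dots> = (LINT t|lborel. std_normal_density t *\<^sub>R iexp ((w \<bullet> b) * t))"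
      unfolding char_def by (rule integral_density) (auto simp: normal_density_nonneg)
    also have "\<dots> = (LINT t|lborel. F b t)"
      by (simp add: F_def scaleR_conv_of_real cis_conv_exp mult_ac)
    finally show ?thesis ..
  qed
  have eq: "of_real (gauss x) * cis (x \<bullet> w) = (\<Prod>b\<in>Basis. F b (x \<bullet> b))" for x :: 'a
    by (simp add: F_def gauss_eq_prod cis_inner_eq_prod prod.distrib)
  have m [measurable]: "(\<lambda>f. \<Sum>b\<in>Basis. f b *\<^sub>R b) \<in> (\<Pi>\<^sub>M b\<in>(Basis::'a set). lborel) \<rightarrow>\<^sub>M borel"
    by measurable
  have mF [measurable]: "(\<lambda>x::'a. of_real (gauss x) * cis (x \<bullet> w)) \<in> borel_measurable borel"
    by measurable
  have coord: "(\<Prod>b\<in>Basis. F b ((\<Sum>b\<in>Basis. f b *\<^sub>R b) \<bullet> b)) = (\<Prod>b\<in>Basis. F b (f b))" for f :: "'a \<Rightarrow> real"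
    by (intro prod.cong) auto
  show ?A
    unfolding eq
    by (subst lborel_eq, subst integrable_distr_eq)
       (use F mF in \<open>auto simp: coord eq intro!: product_integrable_prod\<close>)
  have "(LINT x|lborel. of_real (gauss x) * cis (x \<bullet> w)) = (LINT f|(\<Pi>\<^sub>M b\<in>(Basis::'a set). lborel). (\<Prod>b\<in>Basis. F b (f b)))"
    by (subst lborel_eq, subst integral_distr) (use mF in \<open>auto simp: eq coord\<close>)
  also have "\<dots> = (\<Prod>b\<in>(Basis::'a set). of_real (exp (- (w \<bullet> b)\<^sup>2 / 2)))"
    using F by (subst product_integral_prod) (auto simp: FI)
  also have "\<dots> = of_real (exp (- (norm w)\<^sup>2 / 2))"
  proof -
    show ?thesis
      by (simp add: norm_power2_eq_sum_Basis exp_sum[symmetric] sum_negf sum_divide_distrib flip: of_real_prod)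
  qed
  finally show ?B .
qed

lemma integrable_gauss: "integrable lborel (gauss :: 'a::euclidean_space \<Rightarrow> real)"
  and integral_gauss: "(LINT x|lborel. gauss (x::'a)) = 1"
proof -
  have "integrable lborel (\<lambda>x::'a. complex_of_real (gauss x))"
    using gauss_Fourier(1)[of "0::'a"] by simp
  then show "integrable lborel (gauss :: 'a \<Rightarrow> real)"
    using complex_of_real_integrable_eq by blast
  have "(LINT x|lborel. complex_of_real (gauss (x::'a))) = of_real 1"
    using gauss_Fourier(2)[of "0::'a"] by simp
  then show "(LINT x|lborel. gauss (x::'a)) = 1"
    unfolding integral_complex_of_real of_real_eq_iff .
qed

lemma gauss_scaled_Fourier:
  fixes w :: "'a::euclidean_space"
  assumes e: "e > 0"
  shows "(LINT x|lborel. of_real (gauss (e *\<^sub>R x)) * cis (x \<bullet> w)) =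
     of_real (gauss_const TYPE('a) / e ^ DIM('a) * gauss ((1/e) *\<^sub>R w))"
proof -
  have "complex_of_real (exp (- (norm ((1/e) *\<^sub>R w))\<^sup>2 / 2)) = (LINT x|lborel. of_real (gauss (x::'a)) * cis (x \<bullet> ((1/e) *\<^sub>R w)))"
    by (rule gauss_Fourier(2)[symmetric])
  also have "\<dots> = \<bar>e\<bar> ^ DIM('a) *\<^sub>R (LINT x|lborel. of_real (gauss (0 + e *\<^sub>R x)) * cis ((0 + e *\<^sub>R x) \<bullet> ((1/e) *\<^sub>R w)))"
    using e by (intro lborel_integral_affine) auto
  also have "\<dots> = of_real (e ^ DIM('a)) * (LINT x|lborel. of_real (gauss (e *\<^sub>R x)) * cis (x \<bullet> w))"
    using e by (simp add: scaleR_conv_of_real)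
  also have "exp (- (norm ((1/e) *\<^sub>R w))\<^sup>2 / 2) = gauss_const TYPE('a) * gauss ((1/e) *\<^sub>R w)"
    using gauss_const_pos[where 'a='a] by (simp add: gauss_def)
  finally show ?thesis
    using e by (simp add: field_simps)
qed

lemma integrable_gauss_scaled:
  fixes e :: real
  assumes e: "e > 0"
  shows "integrable lborel (\<lambda>x::'a::euclidean_space. gauss (e *\<^sub>R x))"
  using lborel_integrable_affine[OF integrable_gauss, of e "0::'a"] e by simp

section \<open>The Fourier transform of integrable functions\<close>

definition FT :: "('a::euclidean_space \<Rightarrow> complex) \<Rightarrow> 'a \<Rightarrow> complex" where
  "FT f k = (LINT x|lborel. f x * cis (- (k \<bullet> x)))"

lemma integrable_mult_cis:
  fixes f :: "'a \<Rightarrow> complex"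
  assumes "integrable M f" "h \<in> borel_measurable M"
  shows "integrable M (\<lambda>x. f x * cis (h x))" "integrable M (\<lambda>x. cis (h x) * f x)"
proof -
  have [measurable]: "f \<in> borel_measurable M" using assms by auto
  note [measurable] = assms(2)
  show "integrable M (\<lambda>x. f x * cis (h x))"
    by (rule Bochner_Integration.integrable_bound[OF assms(1)]) (auto simp: norm_mult)
  then show "integrable M (\<lambda>x. cis (h x) * f x)"
    by (simp add: mult.commute)
qed

lemma FT_bound:
  assumes "integrable lborel f"
  shows "cmod (FT f k) \<le> (LINT x|lborel. cmod (f x))"
proof -
  have "cmod (FT f k) \<le> (LINT x|lborel. cmod (f x * cis (- (k \<bullet> x))))"
    unfolding FT_def by (rule integral_norm_bound)
  then show ?thesis
    by (simp add: norm_mult)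
qed

lemma measurable_FT [measurable]:
  fixes f :: "'a::euclidean_space \<Rightarrow> complex"
  assumes [measurable]: "f \<in> borel_measurable borel"
  shows "FT f \<in> borel_measurable borel"
  unfolding FT_def[abs_def] by measurable

text \<open>A Parseval identity for the Gaussian mean of the correlation of \<open>f\<close> and
  \<open>g\<close> around the displacement \<open>a\<close>. Both sides are the same triple integral
  over the frequency k, the position x and the extra displacement w; the factor
  \<open>gauss (e *\<^sub>R k)\<close> makes it converge absolutely for arbitrary \<open>f\<close>,
  \<open>g\<close> in L1, so that the order of integration can be changed.\<close>

lemma Fourier_smoothing:
  fixes f g :: "'a::euclidean_space \<Rightarrow> complex"
  assumes f: "integrable lborel f" and g: "integrable lborel g" and e: "e > 0"
  shows "gauss_const TYPE('a) * (LINT b|lborel. of_real (gauss b) * (LINT x|lborel. f (x - (a + e *\<^sub>R b)) * cnj (g x))) =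
         (LINT k|lborel. of_real (gauss (e *\<^sub>R k)) * (cis (- (k \<bullet> a)) * (FT f k * cnj (FT g k))))"
proof -
  have [measurable]: "f \<in> borel_measurable borel" "g \<in> borel_measurable borel"
    using f g borel_measurable_integrable by fastforce+
  \<comment> \<open>The components of \<open>p\<close> are the position x and the displacement w
    that remains after \<open>a\<close>.\<close>
  define G where "G p = cnj (g (fst p)) * f (fst p - a - snd p)" for p :: "'a \<times> 'a"
  have shift: "integrable lborel (\<lambda>w. f (x - w))" for x
    using lborel_integrable_affine[OF f, of "-1" x] by simp
  have [measurable]: "G \<in> borel_measurable (lborel \<Otimes>\<^sub>M lborel)"
    unfolding G_def by measurable
  have int_shift: "(LINT w|lborel. h (x - w)) = (LINT w|lborel. h w)" if "h \<in> borel_measurable borel"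
    for x :: 'a and h :: "'a \<Rightarrow> 'b::{banach, second_countable_topology}"
    using lborel_integral_affine[OF that, of "-1" x] by simp
  have G: "integrable (lborel \<Otimes>\<^sub>M lborel) G"
  proof (rule lborel_pair.Fubini_integrable)
    have "(LINT w|lborel. norm (G (x, w))) = cmod (g x) * (LINT w|lborel. cmod (f w))" for x
      using int_shift[of "\<lambda>w. cmod (f w)" "x - a"] by (simp add: G_def norm_mult)
    then show "integrable lborel (\<lambda>x. LINT w|lborel. norm (G (x, w)))"
      using g by simp
    show "AE x in lborel. integrable lborel (\<lambda>w. G (x, w))"
      using shift by (simp add: G_def)
  qed measurable
  define \<gamma> where "\<gamma> k = complex_of_real (gauss (e *\<^sub>R k))" for k :: 'a
  have \<gamma>: "integrable lborel \<gamma>"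
    unfolding \<gamma>_def[abs_def] using integrable_gauss_scaled[OF e, where 'a='a] by (simp add: complex_of_real_integrable_eq)
  interpret kp: pair_sigma_finite "lborel :: 'a measure" "lborel \<Otimes>\<^sub>M lborel :: ('a \<times> 'a) measure"
    by (intro pair_sigma_finite.intro sigma_finite_pair sigma_finite_lborel)
  define H where "H k p = \<gamma> k * G p * cis (k \<bullet> snd p)" for k and p :: "'a \<times> 'a"
  have H: "integrable (lborel \<Otimes>\<^sub>M (lborel \<Otimes>\<^sub>M lborel)) (\<lambda>(k, p). H k p)"
  proof -
    have "integrable (lborel \<Otimes>\<^sub>M (lborel \<Otimes>\<^sub>M lborel)) (\<lambda>(k, p). \<gamma> k * G p)"
      by (intro integrable_pair_mult sigma_finite_pair sigma_finite_lborel \<gamma> G)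
    then show ?thesis
      unfolding H_def case_prod_beta by (rule integrable_mult_cis) measurable
  qed
  have "(LINT k|lborel. \<gamma> k * (cis (- (k \<bullet> a)) * (FT f k * cnj (FT g k)))) = (LINT k|lborel. LINT p|(lborel \<Otimes>\<^sub>M lborel). H k p)"
  proof (rule Bochner_Integration.integral_cong)
    fix k :: 'a
    have "cis (- (k \<bullet> a)) * FT f k * cis (k \<bullet> x) = (LINT w|lborel. f (x - a - w) * cis (k \<bullet> w))" for x
    proof -
      have "cis (- (k \<bullet> a)) * FT f k * cis (k \<bullet> x) = (LINT y|lborel. f y * cis (k \<bullet> (x - a - y)))"
        unfolding FT_def by (simp add: cis_mult algebra_simps inner_diff_right flip: integral_mult_right_zero integral_mult_left_zero)
      also have "\<dots> = (LINT w|lborel. f (x - a - w) * cis (k \<bullet> (x - a - (x - a - w))))"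
        by (rule int_shift[symmetric]) measurable
      finally show ?thesis by simp
    qed
    note inner = this
    have "cis (- (k \<bullet> a)) * (FT f k * cnj (FT g k)) = (cis (- (k \<bullet> a)) * FT f k) * (LINT x|lborel. cnj (g x) * cis (k \<bullet> x))"
      unfolding FT_def[of g] by (simp add: cis_cnj flip: Bochner_Integration.integral_cnj)
    also have "\<dots> = (LINT x|lborel. cnj (g x) * (cis (- (k \<bullet> a)) * FT f k * cis (k \<bullet> x)))"
      by (simp add: mult_ac flip: integral_mult_right_zero)
    also have "\<dots> = (LINT x|lborel. LINT w|lborel. G (x, w) * cis (k \<bullet> w))"
      unfolding inner by (simp add: G_def mult.assoc)
    also have "\<dots> = (LINT p|(lborel \<Otimes>\<^sub>M lborel). G p * cis (k \<bullet> snd p))"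
    proof -
      have "integrable (lborel \<Otimes>\<^sub>M lborel) (\<lambda>p. G p * cis (k \<bullet> snd p))"
        by (rule integrable_mult_cis[OF G]) measurable
      from lborel_pair.integral_fst'[OF this] show ?thesis by simp
    qed
    finally show "\<gamma> k * (cis (- (k \<bullet> a)) * (FT f k * cnj (FT g k))) = (LINT p|(lborel \<Otimes>\<^sub>M lborel). H k p)"
      by (simp add: H_def mult.assoc)
  qed simp
  \<comment> \<open>With k innermost, the phases have combined to
    \<open>cis (k \<bullet> w)\<close>, and the inner integral is the transform of a Gaussian of
    width 1 / e, that is, a Gaussian of width e in w.\<close>
  also have "\<dots> = (LINT p|(lborel \<Otimes>\<^sub>M lborel). LINT k|lborel. H k p)"
    by (rule kp.Fubini_integral[OF H, symmetric])
  also have "\<dots> = (LINT p|(lborel \<Otimes>\<^sub>M lborel). G p * of_real (gauss_const TYPE('a) / e ^ DIM('a) * gauss ((1/e) *\<^sub>R snd p)))"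
  proof (rule Bochner_Integration.integral_cong)
    fix p :: "'a \<times> 'a"
    have "(LINT k|lborel. H k p) = G p * (LINT k|lborel. \<gamma> k * cis (k \<bullet> snd p))"
      unfolding H_def by (simp add: mult_ac flip: integral_mult_right_zero)
    then show "(LINT k|lborel. H k p) = G p * of_real (gauss_const TYPE('a) / e ^ DIM('a) * gauss ((1/e) *\<^sub>R snd p))"
      unfolding \<gamma>_def gauss_scaled_Fourier[OF e] .
  qed simp
  also have "\<dots> = (LINT w|lborel. LINT x|lborel. G (x, w) * of_real (gauss_const TYPE('a) / e ^ DIM('a) * gauss ((1/e) *\<^sub>R w)))"
  proof -
    have "integrable (lborel \<Otimes>\<^sub>M lborel) (\<lambda>p. G p * of_real (gauss_const TYPE('a) / e ^ DIM('a) * gauss ((1/e) *\<^sub>R snd p)))"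
    proof (rule Bochner_Integration.integrable_bound)
      show "integrable (lborel \<Otimes>\<^sub>M lborel) (\<lambda>p. of_real (gauss_const TYPE('a) / e ^ DIM('a) * (1 / gauss_const TYPE('a))) * G p)"
        using G by (rule integrable_mult_right)
      have "gauss x \<le> 1 / gauss_const TYPE('a)" for x :: 'a
        unfolding gauss_def using gauss_const_pos[where 'a='a] by (intro divide_right_mono) auto
      then show "AE p in lborel \<Otimes>\<^sub>M lborel. norm (G p * of_real (gauss_const TYPE('a) / e ^ DIM('a) * gauss ((1/e) *\<^sub>R snd p)))
         \<le> norm (of_real (gauss_const TYPE('a) / e ^ DIM('a) * (1 / gauss_const TYPE('a))) * G p)"
        using e gauss_const_pos[where 'a='a]
        by (intro AE_I2) (simp only: norm_mult norm_of_real abs_mult mult.commute[of "cmod (G _)"],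
           intro mult_right_mono mult_left_mono, simp_all add: abs_of_nonneg)
    qed measurable
    then have "integrable (lborel \<Otimes>\<^sub>M lborel) (\<lambda>(x, w). G (x, w) * of_real (gauss_const TYPE('a) / e ^ DIM('a) * gauss ((1/e) *\<^sub>R w)))"
      by (simp only: case_prod_unfold prod.collapse)
    from lborel_pair.integral_snd[OF this, symmetric] show ?thesis
      by (simp only: case_prod_unfold prod.collapse)
  qed
  also have "\<dots> = (LINT w|lborel. of_real (gauss_const TYPE('a) / e ^ DIM('a) * gauss ((1/e) *\<^sub>R w)) * (LINT x|lborel. f (x - (a + w)) * cnj (g x)))"
  proof (rule Bochner_Integration.integral_cong)
    fix w :: 'a
    have "(LINT x|lborel. G (x, w) * c) = c * (LINT x|lborel. f (x - (a + w)) * cnj (g x))" for c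
    proof -
      have "(LINT x|lborel. G (x, w) * c) = (LINT x|lborel. G (x, w)) * c"
        by simp
      then show ?thesis
        by (simp only: G_def fst_conv snd_conv diff_diff_eq mult.commute)
    qed
    then show "(LINT x|lborel. G (x, w) * of_real (gauss_const TYPE('a) / e ^ DIM('a) * gauss ((1/e) *\<^sub>R w))) =
       of_real (gauss_const TYPE('a) / e ^ DIM('a) * gauss ((1/e) *\<^sub>R w)) * (LINT x|lborel. f (x - (a + w)) * cnj (g x))"
      .
  qed simp
  \<comment> \<open>The substitution w = e b cancels the power of \<open>e\<close> in the
    Gaussian.\<close>
  also have "\<dots> = \<bar>e\<bar> ^ DIM('a) *\<^sub>R (LINT b|lborel. of_real (gauss_const TYPE('a) / e ^ DIM('a) * gauss ((1/e) *\<^sub>R (0 + e *\<^sub>R b))) *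
        (LINT x|lborel. f (x - (a + (0 + e *\<^sub>R b))) * cnj (g x)))"
    using e by (intro lborel_integral_affine) auto
  also have "\<dots> = gauss_const TYPE('a) * (LINT b|lborel. of_real (gauss b) * (LINT x|lborel. f (x - (a + e *\<^sub>R b)) * cnj (g x)))"
    using e by (simp add: scaleR_conv_of_real mult.assoc)
  finally show ?thesis
    unfolding \<gamma>_def by (rule sym)
qed

text \<open>Only the inequality is needed; it follows from the smoothed identity by monotone convergence.\<close>

lemma Plancherel_le:
  fixes f :: "'a::euclidean_space \<Rightarrow> complex"
  assumes f: "integrable lborel f"
  shows "(\<integral>\<^sup>+k. ennreal ((cmod (FT f k))\<^sup>2) \<partial>lborel) \<le>
     ennreal ((gauss_const TYPE('a))\<^sup>2) * (\<integral>\<^sup>+x. ennreal ((cmod (f x))\<^sup>2) \<partial>lborel)"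
proof (cases "(\<integral>\<^sup>+x. ennreal ((cmod (f x))\<^sup>2) \<partial>lborel) = \<infinity>")
  case True
  then show ?thesis
    using gauss_const_pos[where 'a='a] by (simp add: ennreal_mult_top)
next
  case False
  have m [measurable]: "f \<in> borel_measurable borel"
    using borel_measurable_integrable[OF f] by simp
  define C where "C = gauss_const TYPE('a)"
  have C: "C > 0" by (simp add: C_def gauss_const_pos)
  have f2: "integrable lborel (\<lambda>x. (cmod (f x))\<^sup>2)"
    using False by (intro integrableI_bounded) (auto simp: less_top)
  define I where "I = (LINT x|lborel. (cmod (f x))\<^sup>2)"
  have I0: "I \<ge> 0" by (simp add: I_def)
  \<comment> \<open>The correlation of \<open>f\<close> with any translate of itself is dominated by
    its value at displacement 0, so the smoothed identity is bounded uniformly in the width.\<close>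
  have corr: "cmod (LINT x|lborel. f (x - c) * cnj (f x)) \<le> I" for c
  proof -
    have fc: "integrable lborel (\<lambda>x. (cmod (f (x - c)))\<^sup>2)"
      using lborel_integrable_affine[OF f2, of 1 "- c"] by simp
    have Ic: "(LINT x|lborel. (cmod (f (x - c)))\<^sup>2) = I"
      unfolding I_def using lborel_integral_affine[of "\<lambda>x. (cmod (f x))\<^sup>2" 1 "- c"] by simp
    have "cmod (LINT x|lborel. f (x - c) * cnj (f x)) \<le> (LINT x|lborel. cmod (f (x - c) * cnj (f x)))"
      by (rule integral_norm_bound)
    also have "\<dots> \<le> (LINT x|lborel. (1/2) * (cmod (f (x - c)))\<^sup>2 + (1/2) * (cmod (f x))\<^sup>2)"
    proof (rule integral_mono')
      show "integrable lborel (\<lambda>x. (1/2) * (cmod (f (x - c)))\<^sup>2 + (1/2) * (cmod (f x))\<^sup>2)"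
        using fc f2 by simp
      fix x
      show "cmod (f (x - c) * cnj (f x)) \<le> (1/2) * (cmod (f (x - c)))\<^sup>2 + (1/2) * (cmod (f x))\<^sup>2"
        using sum_squares_bound[of "cmod (f (x - c))" "cmod (f x)"] by (simp add: norm_mult)
    qed simp
    also have "\<dots> = I"
      using fc f2 Ic by (simp add: I_def)
    finally show ?thesis .
  qed
  have est: "(\<integral>\<^sup>+k. ennreal (gauss (e *\<^sub>R k) * (cmod (FT f k))\<^sup>2) \<partial>lborel) \<le> ennreal (C * I)" if e: "e > 0" for e :: real
  proof -
    define J where "J b = (LINT x|lborel. f (x - e *\<^sub>R b) * cnj (f x))" for b
    have "integrable lborel (\<lambda>k. gauss (e *\<^sub>R k) * (cmod (FT f k))\<^sup>2)"
    proof (rule Bochner_Integration.integrable_bound)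
      show "integrable lborel (\<lambda>k::'a. (LINT x|lborel. cmod (f x))\<^sup>2 * gauss (e *\<^sub>R k))"
        using integrable_gauss_scaled[OF e, where 'a='a] by (rule integrable_mult_right)
      show "AE k in lborel. norm (gauss (e *\<^sub>R k) * (cmod (FT f k))\<^sup>2) \<le> norm ((LINT x|lborel. cmod (f x))\<^sup>2 * gauss (e *\<^sub>R k))"
        using FT_bound[OF f] less_imp_le[OF gauss_pos]
        by (intro AE_I2) (simp add: abs_mult mult.commute abs_of_nonneg mult_left_mono power_mono)
    qed measurable
    then have "(\<integral>\<^sup>+k. ennreal (gauss (e *\<^sub>R k) * (cmod (FT f k))\<^sup>2) \<partial>lborel) = ennreal (LINT k|lborel. gauss (e *\<^sub>R k) * (cmod (FT f k))\<^sup>2)"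
      by (intro nn_integral_eq_integral) auto
    also have "(LINT k|lborel. gauss (e *\<^sub>R k) * (cmod (FT f k))\<^sup>2) \<le> C * I"
    proof -
      have "complex_of_real (LINT k|lborel. gauss (e *\<^sub>R k) * (cmod (FT f k))\<^sup>2) =
         (LINT k|lborel. of_real (gauss (e *\<^sub>R k)) * (cis (- (k \<bullet> 0)) * (FT f k * cnj (FT f k))))"
        by (simp add: complex_norm_square del: of_real_power flip: integral_complex_of_real)
      also have "\<dots> = C * (LINT b|lborel. of_real (gauss b) * J b)"
        unfolding C_def J_def using Fourier_smoothing[OF f f e, of 0] by simp
      finally have "cmod (of_real (LINT k|lborel. gauss (e *\<^sub>R k) * (cmod (FT f k))\<^sup>2)) = C * cmod (LINT b|lborel. of_real (gauss b) * J b)"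
        using C by (simp add: norm_mult)
      moreover have "cmod (LINT b|lborel. of_real (gauss b) * J b) \<le> (LINT b|lborel. I * gauss (b::'a))"
      proof -
        have "cmod (LINT b|lborel. of_real (gauss b) * J b) \<le> (LINT b|lborel. cmod (of_real (gauss b) * J b))"
          by (rule integral_norm_bound)
        also have "\<dots> \<le> (LINT b|lborel. I * gauss (b::'a))"
        proof (rule integral_mono')
          show "integrable lborel (\<lambda>b::'a. I * gauss b)"
            using integrable_gauss by (rule integrable_mult_right)
          fix b :: 'a
          have "cmod (J b) \<le> I"
            unfolding J_def by (rule corr)
          then show "cmod (of_real (gauss b) * J b) \<le> I * gauss b"
            by (simp add: norm_mult mult.commute[of I] mult_left_mono)
        qed (simp add: I0 less_imp_le[OF gauss_pos])
        finally show ?thesis .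
      qed
      ultimately show ?thesis
        using C by (simp add: integral_gauss)
    qed
    finally show ?thesis
      by (simp add: ennreal_leI)
  qed
  define e where "e n = 1 / real (Suc n)" for n
  have e0: "e n > 0" for n by (simp add: e_def)
  \<comment> \<open>The weight tends to \<open>gauss 0 = 1 / C\<close> as its width parameter tends
    to 0; this is one of the two factors \<open>C\<close> in the Plancherel constant, the other one
    comes from the smoothed identity.\<close>
  have lim: "(\<lambda>n. ennreal (gauss (e n *\<^sub>R k) * (cmod (FT f k))\<^sup>2)) \<longlonglongrightarrow> ennreal ((1 / C) * (cmod (FT f k))\<^sup>2)" for k
  proof -
    have "e \<longlonglongrightarrow> 0"
      unfolding e_def using LIMSEQ_inverse_real_of_nat by (simp add: inverse_eq_divide)
    then have "(\<lambda>n. exp (- (norm (e n *\<^sub>R k))\<^sup>2 / 2) / C * (cmod (FT f k))\<^sup>2) \<longlonglongrightarrow> exp (- (norm (0 *\<^sub>R k))\<^sup>2 / 2) / C * (cmod (FT f k))\<^sup>2"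
      using C by (intro tendsto_intros) auto
    then show ?thesis
      by (intro tendsto_ennrealI) (simp add: gauss_def C_def)
  qed
  have "(\<integral>\<^sup>+k. ennreal ((1 / C) * (cmod (FT f k))\<^sup>2) \<partial>lborel) = (\<integral>\<^sup>+k. liminf (\<lambda>n. ennreal (gauss (e n *\<^sub>R k) * (cmod (FT f k))\<^sup>2)) \<partial>lborel)"
    using lim by (intro nn_integral_cong) (auto intro!: lim_imp_Liminf[symmetric])
  \<comment> \<open>Fatou's lemma turns the bound for every width into one for the limit.\<close>
  also have "\<dots> \<le> liminf (\<lambda>n. \<integral>\<^sup>+k. ennreal (gauss (e n *\<^sub>R k) * (cmod (FT f k))\<^sup>2) \<partial>lborel)"
    by (rule nn_integral_liminf) measurable
  also have "\<dots> \<le> ennreal (C * I)"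
    using est[OF e0] by (intro Liminf_le) (auto intro: always_eventually)
  finally have le: "(\<integral>\<^sup>+k. ennreal ((1 / C) * (cmod (FT f k))\<^sup>2) \<partial>lborel) \<le> ennreal (C * I)" .
  have "(\<integral>\<^sup>+k. ennreal ((cmod (FT f k))\<^sup>2) \<partial>lborel) = (\<integral>\<^sup>+k. ennreal C * ennreal ((1 / C) * (cmod (FT f k))\<^sup>2) \<partial>lborel)"
    using C by (intro nn_integral_cong) (simp flip: ennreal_mult)
  also have "\<dots> = ennreal C * (\<integral>\<^sup>+k. ennreal ((1 / C) * (cmod (FT f k))\<^sup>2) \<partial>lborel)"
    by (rule nn_integral_cmult) measurable
  also have "\<dots> \<le> ennreal C * ennreal (C * I)"
    using le by (rule mult_left_mono) simp
  also have "\<dots> = ennreal (C\<^sup>2) * ennreal I"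
    using C I0 by (simp add: power2_eq_square mult.assoc flip: ennreal_mult)
  also have "ennreal I = (\<integral>\<^sup>+x. ennreal ((cmod (f x))\<^sup>2) \<partial>lborel)"
    unfolding I_def by (intro nn_integral_eq_integral[symmetric] f2) auto
  finally show ?thesis
    by (simp add: C_def)
qed

section \<open>Smooth functions and decay of Fourier transforms\<close>

lemma frechet_derivative_eqI: "(f has_derivative f') (at x) \<Longrightarrow> frechet_derivative f (at x) = f'"
  by (rule frechet_derivative_at[symmetric])

lemma has_derivative_frechet: "f differentiable (at x) \<Longrightarrow> (f has_derivative frechet_derivative f (at x)) (at x)"
  by (simp add: frechet_derivative_works)

lemma C_class_SucI:
  assumes "\<And>x. (f has_derivative f' x) (at x)" "\<And>d. C_class k (\<lambda>x. f' x d)"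
  shows "C_class (Suc k) f"
proof -
  have "frechet_derivative f (at x) = f' x" for x
    using assms(1) by (rule frechet_derivative_eqI)
  then show ?thesis
    using assms by (auto simp: differentiable_def)
qed

lemma cis_has_derivative: "(cis has_derivative (\<lambda>d. d *\<^sub>R (\<i> * cis t))) (at t)"
proof -
  have "((\<lambda>t. \<i> * complex_of_real t) has_derivative (\<lambda>d. \<i> * complex_of_real d)) (at t)"
    by (auto intro!: derivative_eq_intros)
  from has_derivative_compose[OF this DERIV_exp[unfolded has_field_derivative_def]]
  show ?thesis
    by (simp add: cis_conv_exp[abs_def] scaleR_conv_of_real mult_ac)
qed

lemma C_class_Suc_has_derivative:
  "C_class (Suc k) f \<Longrightarrow> (f has_derivative frechet_derivative f (at x)) (at x)"
  by (simp add: has_derivative_frechet)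

text \<open>\<open>C_class (Suc k)\<close> speaks of differentiability and of derivatives only, so
  the descent by one class is an induction of its own. The product rule depends on it, because each
  of its summands keeps one factor undifferentiated.\<close>

lemma C_class_SucD: "C_class (Suc k) f \<Longrightarrow> C_class k f"
proof (induction k arbitrary: f)
  case 0
  then have "\<And>x. f differentiable (at x)" by simp
  then show ?case
    by (auto intro!: continuous_at_imp_continuous_on differentiable_imp_continuous_within)
next
  case (Suc k)
  show ?case
  proof (rule C_class_SucI)
    show "(f has_derivative frechet_derivative f (at x)) (at x)" for x
      using Suc.prems by (rule C_class_Suc_has_derivative)
    show "C_class k (\<lambda>x. frechet_derivative f (at x) d)" for d
      using Suc.prems by (intro Suc.IH) simp
  qed
qed

lemma C_class_const: "C_class k (\<lambda>x. c)"
  by (induction k arbitrary: c) (auto intro!: C_class_SucI[where f'="\<lambda>_ _. 0"] simp del: C_class.simps(2))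

lemma C_class_add:
  assumes "C_class k f" "C_class k g"
  shows "C_class k (\<lambda>x. f x + g x)"
  using assms
proof (induction k arbitrary: f g)
  case 0
  then show ?case by (auto intro: continuous_intros)
next
  case (Suc k)
  show ?case
  proof (rule C_class_SucI)
    show "((\<lambda>x. f x + g x) has_derivative (\<lambda>d. frechet_derivative f (at x) d + frechet_derivative g (at x) d)) (at x)" for x
      by (intro has_derivative_add C_class_Suc_has_derivative[OF Suc.prems(1)] C_class_Suc_has_derivative[OF Suc.prems(2)])
    show "C_class k (\<lambda>x. frechet_derivative f (at x) d + frechet_derivative g (at x) d)" for d
      using Suc.prems by (intro Suc.IH) simp_all
  qed
qed

lemma C_class_mult:
  fixes f g :: "'a::euclidean_space \<Rightarrow> 'b::real_normed_algebra"
  assumes "C_class k f" "C_class k g"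
  shows "C_class k (\<lambda>x. f x * g x)"
  using assms
proof (induction k arbitrary: f g)
  case 0
  then show ?case by (auto intro: continuous_intros)
next
  case (Suc k)
  show ?case
  proof (rule C_class_SucI)
    show "((\<lambda>x. f x * g x) has_derivative (\<lambda>d. f x * frechet_derivative g (at x) d + frechet_derivative f (at x) d * g x)) (at x)" for x
      by (intro has_derivative_mult C_class_Suc_has_derivative[OF Suc.prems(1)] C_class_Suc_has_derivative[OF Suc.prems(2)])
    have "C_class k f" "C_class k g"
      using Suc.prems by (blast intro: C_class_SucD)+
    then show "C_class k (\<lambda>x. f x * frechet_derivative g (at x) d + frechet_derivative f (at x) d * g x)" for d
      using Suc.prems by (intro C_class_add Suc.IH) simp_all
  qed
qed

lemma C_class_linear_comp:
  assumes L: "bounded_linear L" and "C_class k f"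
  shows "C_class k (\<lambda>x. L (f x))"
  using assms(2)
proof (induction k arbitrary: f)
  case 0
  then show ?case by (auto intro: bounded_linear.continuous_on[OF L])
next
  case (Suc k)
  show ?case
  proof (rule C_class_SucI)
    show "((\<lambda>x. L (f x)) has_derivative (\<lambda>d. L (frechet_derivative f (at x) d))) (at x)" for x
      by (intro bounded_linear.has_derivative[OF L] C_class_Suc_has_derivative[OF Suc.prems(1)])
    show "C_class k (\<lambda>x. L (frechet_derivative f (at x) d))" for d
      using Suc.prems by (intro Suc.IH) simp_all
  qed
qed

lemma C_class_comp_linear:
  fixes L :: "'a::euclidean_space \<Rightarrow> 'c::euclidean_space"
  assumes L: "bounded_linear L" and "C_class k f"
  shows "C_class k (\<lambda>x. f (L x))"
  using assms(2)
proof (induction k arbitrary: f)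
  case 0
  have "continuous_on UNIV L"
    using L by (rule linear_continuous_on)
  then show ?case
    using 0 by (auto intro: continuous_on_compose2[of UNIV f])
next
  case (Suc k)
  show ?case
  proof (rule C_class_SucI)
    show "((\<lambda>x. f (L x)) has_derivative (\<lambda>d. frechet_derivative f (at (L x)) (L d))) (at x)" for x
      using C_class_Suc_has_derivative[OF Suc.prems(1), of "L x"]
      by (rule has_derivative_compose[OF bounded_linear_imp_has_derivative[OF L]])
    show "C_class k (\<lambda>x. frechet_derivative f (at (L x)) (L d))" for d
      using Suc.prems by (intro Suc.IH[of "\<lambda>x. frechet_derivative f (at x) (L d)"]) simp_all
  qed
qed

lemma C_class_linear:
  fixes L :: "'a::euclidean_space \<Rightarrow> 'b::real_normed_vector"
  assumes "bounded_linear L"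
  shows "C_class k L"
proof (cases k)
  case 0
  then show ?thesis using linear_continuous_on[OF assms] by simp
next
  case (Suc n)
  have "C_class (Suc n) L"
    by (rule C_class_SucI[OF bounded_linear_imp_has_derivative[OF assms]]) (rule C_class_const)
  then show ?thesis using Suc by simp
qed

text \<open>The outer function is given together with the sequence of its derivatives: the chain
  rule then leads from \<open>\<psi> n\<close> to \<open>\<psi> (Suc n)\<close> within the same
  family, and the induction on the class closes for all n at once.\<close>

lemma C_class_comp_real:
  fixes \<psi> :: "nat \<Rightarrow> real \<Rightarrow> real"
  assumes \<psi>: "\<And>n x. (\<psi> n has_real_derivative \<psi> (Suc n) x) (at x)"
    and "C_class k g"
  shows "C_class k (\<lambda>x. \<psi> n (g x))"
  using assms(2)
proof (induction k arbitrary: n)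
  case 0
  have "continuous_on UNIV (\<psi> n)"
    using \<psi> by (intro continuous_at_imp_continuous_on) (auto intro: DERIV_isCont)
  then show ?case
    using 0 by (auto intro: continuous_on_compose2[of UNIV "\<psi> n"])
next
  case (Suc k)
  show ?case
  proof (rule C_class_SucI)
    show "((\<lambda>x. \<psi> n (g x)) has_derivative (\<lambda>d. \<psi> (Suc n) (g x) * frechet_derivative g (at x) d)) (at x)" for x
      using has_derivative_compose[OF C_class_Suc_has_derivative[OF Suc.prems] \<psi>[of n "g x", unfolded has_field_derivative_def]] .
    show "C_class k (\<lambda>x. \<psi> (Suc n) (g x) * frechet_derivative g (at x) d)" for d
      using Suc.prems by (intro C_class_mult Suc.IH C_class_SucD[OF Suc.prems]) simp_all
  qed
qed

text \<open>The derivative is the same character with another constant, so the constant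
  \<open>c\<close> is carried through the induction.\<close>

lemma C_class_cis:
  fixes k :: "'a::euclidean_space"
  shows "C_class n (\<lambda>x. c * cis (- (k \<bullet> x)))"
proof (induction n arbitrary: c)
  case 0
  then show ?case by (auto intro!: continuous_intros)
next
  case (Suc n)
  show ?case
  proof (rule C_class_SucI)
    from has_derivative_compose[OF _ cis_has_derivative, where f="\<lambda>x. - (k \<bullet> x)"]
    show "((\<lambda>x. c * cis (- (k \<bullet> x))) has_derivative (\<lambda>d. (- \<i> * (k \<bullet> d) * c) * cis (- (k \<bullet> x)))) (at x)" for x
      by (auto intro!: derivative_eq_intros simp: scaleR_conv_of_real mult_ac)
  qed (rule Suc.IH)
qed

lemma smoothD: "smooth f \<Longrightarrow> C_class k f"
  by (simp add: smooth_def)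

lemma smooth_has_derivative: "smooth f \<Longrightarrow> (f has_derivative frechet_derivative f (at x)) (at x)"
  using C_class_Suc_has_derivative[of 0 f] by (simp only: smooth_def)

lemma smooth_frechet_derivative: "smooth f \<Longrightarrow> smooth (\<lambda>x. frechet_derivative f (at x) d)"
  unfolding smooth_def using C_class.simps(2) by blast

lemma smooth_continuous: "smooth f \<Longrightarrow> continuous_on UNIV f"
  using smoothD[of f 0] by simp

lemma smooth_mult:
  fixes f g :: "'a::euclidean_space \<Rightarrow> 'b::real_normed_algebra"
  shows "smooth f \<Longrightarrow> smooth g \<Longrightarrow> smooth (\<lambda>x. f x * g x)"
  by (simp add: smooth_def C_class_mult del: C_class.simps)

lemma smooth_add: "smooth f \<Longrightarrow> smooth g \<Longrightarrow> smooth (\<lambda>x. f x + g x)"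
  by (simp add: smooth_def C_class_add del: C_class.simps)

lemma smooth_const: "smooth (\<lambda>x. c)"
  by (simp add: smooth_def C_class_const del: C_class.simps)

text \<open>Differentiating p(1/s) exp(-1/s) gives (1/s)^2 (p - p')(1/s) exp(-1/s), which is the
  recursion.\<close>

fun flat_poly :: "nat \<Rightarrow> real poly" where
  "flat_poly 0 = 1"
| "flat_poly (Suc n) = [:0, 0, 1:] * (flat_poly n - pderiv (flat_poly n))"

text \<open>The successive derivatives of the function equal to \<open>exp (-1/s)\<close> for positive \<open>s\<close> and to \<open>0\<close> otherwise.\<close>

definition flat :: "nat \<Rightarrow> real \<Rightarrow> real" where
  "flat n s = (if s > 0 then poly (flat_poly n) (1 / s) * exp (- (1 / s)) else 0)"

lemma poly_times_exp_tendsto_0: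
  fixes p :: "real poly"
  shows "((\<lambda>t. poly p t * exp (- t)) \<longlongrightarrow> 0) at_top"
proof -
  have "((\<lambda>t. \<Sum>i\<le>degree p. coeff p i * (t ^ i / exp t)) \<longlongrightarrow> (\<Sum>i\<le>degree p. coeff p i * 0)) at_top"
    by (intro tendsto_intros tendsto_power_div_exp_0)
  then show ?thesis
    by (simp add: poly_altdef sum_distrib_right exp_minus divide_inverse mult.assoc)
qed

lemma flat_has_derivative: "(flat n has_real_derivative flat (Suc n) s) (at s)"
proof -
  consider "s > 0" | "s < 0" | "s = 0" by linarith
  then show ?thesis
  proof cases
    case 1
    have "((\<lambda>s. poly (flat_poly n) (1 / s) * exp (- (1 / s))) has_real_derivative flat (Suc n) s) (at s)"
      using 1 by (auto intro!: derivative_eq_intros DERIV_chain2[OF poly_DERIV] simp: flat_def field_simps power2_eq_square)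
    then show ?thesis
      by (rule has_field_derivative_transform_within_open[of _ _ _ "{0<..}"]) (use 1 in \<open>auto simp: flat_def\<close>)
  next
    case 2
    have "((\<lambda>s. 0) has_real_derivative flat (Suc n) s) (at s)"
      using 2 by (auto simp: flat_def)
    then show ?thesis
      by (rule has_field_derivative_transform_within_open[of _ _ _ "{..<0}"]) (use 2 in \<open>auto simp: flat_def\<close>)
  next
    case 3
    \<comment> \<open>With t = 1/h, the right difference quotient at 0 is t p(t) exp(-t), and the
      exponential outweighs every polynomial.\<close>
    have "((\<lambda>h. poly ([:0, 1:] * flat_poly n) (inverse h) * exp (- inverse h)) \<longlongrightarrow> 0) (at_right (0::real))"
      using filterlim_compose[OF poly_times_exp_tendsto_0 filterlim_inverse_at_top_right] .
    then have "((\<lambda>h. (flat n h - flat n 0) / h) \<longlongrightarrow> 0) (at_right 0)"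
      by (rule Lim_transform_eventually) (auto simp: eventually_at_filter flat_def field_simps)
    moreover have "((\<lambda>h. (flat n h - flat n 0) / h) \<longlongrightarrow> 0) (at_left 0)"
      by (rule Lim_transform_eventually[OF tendsto_const]) (auto simp: eventually_at_filter flat_def)
    ultimately have "((\<lambda>h. (flat n h - flat n 0) / h) \<longlongrightarrow> 0) (at 0)"
      by (simp add: filterlim_at_split)
    then show ?thesis
      using 3 by (simp add: has_field_derivative_iff flat_def[of "Suc n"])
  qed
qed

definition bump :: "'a::euclidean_space \<Rightarrow> complex" where
  "bump x = of_real (flat 0 (1 - x \<bullet> x))"

lemma smooth_bump: "smooth (bump :: 'a::euclidean_space \<Rightarrow> complex)"
  unfolding smooth_def bump_def[abs_def]
proof
  fix k
  have "C_class k (\<lambda>x::'a. x \<bullet> x)"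
  proof (cases k)
    case 0
    then show ?thesis by (auto intro: continuous_intros)
  next
    case (Suc n)
    have "C_class (Suc n) (\<lambda>x::'a. x \<bullet> x)"
    proof (rule C_class_SucI)
      show "((\<lambda>x::'a. x \<bullet> x) has_derivative (\<lambda>d. x \<bullet> d + d \<bullet> x)) (at x)" for x
        by (auto intro!: derivative_eq_intros)
      show "C_class n (\<lambda>x::'a. x \<bullet> d + d \<bullet> x)" for d
        by (intro C_class_linear bounded_linear_add bounded_linear_inner_left bounded_linear_inner_right)
    qed
    then show ?thesis using Suc by simp
  qed
  then have "C_class k (\<lambda>x::'a. 1 + (- 1) * (x \<bullet> x))"
    by (intro C_class_add C_class_mult C_class_const)
  then have "C_class k (\<lambda>x::'a. flat 0 (1 - x \<bullet> x))"
    using C_class_comp_real[where \<psi>=flat, OF flat_has_derivative, of k "\<lambda>x::'a. 1 - x \<bullet> x" 0] by simp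
  then show "C_class k (\<lambda>x::'a. complex_of_real (flat 0 (1 - x \<bullet> x)))"
    by (rule C_class_linear_comp[OF bounded_linear_of_real])
qed

lemma bump_eq_0:
  assumes "norm x \<ge> 1"
  shows "bump x = 0"
proof -
  have "1 \<le> (norm x)\<^sup>2"
    using assms by (rule one_le_power)
  then show ?thesis
    by (auto simp: bump_def flat_def dot_square_norm)
qed

lemma bump_0: "bump 0 \<noteq> 0"
  by (simp add: bump_def flat_def)

section \<open>Fourier decay from weak second derivatives\<close>

lemma frechet_derivative_eq_0_outside:
  assumes "\<And>y. norm y > 1 \<Longrightarrow> f y = 0" "norm x > 1"
  shows "frechet_derivative f (at x) = (\<lambda>_. 0)"
proof (rule frechet_derivative_eqI)
  have "open {y::'a. norm y > 1}"
    by (intro open_Collect_less continuous_intros)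
  then show "(f has_derivative (\<lambda>_. 0)) (at x)"
    using assms by (intro has_derivative_transform_within_open[OF has_derivative_const]) auto
qed

lemma bounded_of_vanishing_outside:
  fixes f :: "'a::euclidean_space \<Rightarrow> 'b::real_normed_vector"
  assumes "continuous_on UNIV f" "\<And>y. norm y > 1 \<Longrightarrow> f y = 0"
  obtains C where "\<And>y. norm (f y) \<le> C"
proof -
  have "bounded (f ` cball 0 1)"
    using assms(1) by (intro compact_imp_bounded compact_continuous_image) (auto intro: continuous_on_subset)
  then obtain C where C: "\<forall>y\<in>f ` cball 0 1. norm y \<le> C"
    unfolding bounded_iff ..
  have "norm (f y) \<le> max 0 C" for y
    using C assms(2)[of y] by (cases "norm y > 1") (auto simp: le_max_iff_disj)
  then show ?thesis ..
qed

lemma dir_deriv_eq: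
  assumes "(f has_derivative f') (at y)"
  shows "dir_deriv x f y = f' x"
proof -
  have "((\<lambda>t. f (y + t *\<^sub>R x)) has_derivative (\<lambda>t. f' (t *\<^sub>R x))) (at 0)"
    by (rule has_derivative_compose[where f="\<lambda>t. y + t *\<^sub>R x"]) (auto intro!: derivative_eq_intros assms)
  moreover have "f' (t *\<^sub>R x) = t *\<^sub>R f' x" for t
    using assms by (intro linear_scale has_derivative_linear)
  ultimately show ?thesis
    unfolding dir_deriv_def by (intro vector_derivative_at) (simp add: has_vector_derivative_def)
qed

lemma dir_deriv_scaled_mult_cis:
  fixes g :: "'a::euclidean_space \<Rightarrow> complex" and g' :: "'a \<Rightarrow> 'a \<Rightarrow> complex" and s :: real
  assumes "\<And>z. (g has_derivative g' z) (at z)"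
  shows "dir_deriv x (\<lambda>y. g (s *\<^sub>R y) * cis (- (k \<bullet> y))) y =
      (s * g' (s *\<^sub>R y) x - \<i> * (k \<bullet> x) * g (s *\<^sub>R y)) * cis (- (k \<bullet> y))"
proof -
  from has_derivative_compose[OF _ cis_has_derivative, where f="\<lambda>x. - (k \<bullet> x)"]
  have c: "((\<lambda>x. cis (- (k \<bullet> x))) has_derivative (\<lambda>d. (- (k \<bullet> d)) *\<^sub>R (\<i> * cis (- (k \<bullet> y))))) (at y)"
    by (auto intro!: derivative_eq_intros)
  have "((\<lambda>y. g (s *\<^sub>R y)) has_derivative (\<lambda>d. g' (s *\<^sub>R y) (s *\<^sub>R d))) (at y)"
    by (rule has_derivative_compose[OF _ assms]) (auto intro!: derivative_eq_intros)
  moreover have "g' z (s *\<^sub>R d) = s * g' z d" for z d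
    using assms[of z] has_derivative_linear linear_scale by (metis scaleR_conv_of_real)
  ultimately show ?thesis
    by (subst dir_deriv_eq[OF has_derivative_mult[OF _ c]]) (auto simp: scaleR_conv_of_real algebra_simps)
qed

text \<open>Tested against a character times a bump function that is stretched towards a nonzero constant.\<close>

lemma weak_second_deriv_FT_bound:
  fixes f w :: "'a::euclidean_space \<Rightarrow> complex"
  assumes f: "integrable lborel f" and w: "integrable lborel w" and weak: "has_weak_second_deriv f x w"
  shows "(k \<bullet> x)\<^sup>2 * cmod (FT f k) \<le> (LINT y|lborel. cmod (w y))"
proof -
  have [measurable]: "f \<in> borel_measurable borel" "w \<in> borel_measurable borel"
    using f w borel_measurable_integrable by fastforce+
  define \<beta> :: "'a \<Rightarrow> complex" where "\<beta> = bump"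
  define b where "b y = frechet_derivative \<beta> (at y) x" for y
  define c where "c y = frechet_derivative b (at y) x" for y
  have sm: "smooth \<beta>" "smooth b" "smooth c"
    unfolding \<beta>_def b_def[abs_def] c_def[abs_def] by (intro smooth_bump smooth_frechet_derivative)+
  have cont: "continuous_on UNIV \<beta>" "continuous_on UNIV b" "continuous_on UNIV c"
    by (intro smooth_continuous sm)+
  have [measurable]: "\<beta> \<in> borel_measurable borel" "b \<in> borel_measurable borel" "c \<in> borel_measurable borel"
    by (intro borel_measurable_continuous_onI cont)+
  have \<beta>0: "\<beta> y = 0" if "norm y > 1" for y
    using that by (simp add: \<beta>_def bump_eq_0)
  have b0: "b y = 0" if "norm y > 1" for y
    using frechet_derivative_eq_0_outside[of \<beta>, OF \<beta>0 that] by (simp add: b_def)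
  have c0: "c y = 0" if "norm y > 1" for y
    using frechet_derivative_eq_0_outside[of b, OF b0 that] by (simp add: c_def)
  obtain A where A: "cmod (\<beta> y) \<le> A" for y
    using bounded_of_vanishing_outside[OF cont(1) \<beta>0] by blast
  obtain B where B: "cmod (b y) \<le> B" for y
    using bounded_of_vanishing_outside[OF cont(2) b0] by blast
  obtain C where C: "cmod (c y) \<le> C" for y
    using bounded_of_vanishing_outside[OF cont(3) c0] by blast
  \<comment> \<open>Stretching by 1 / s makes the bump tend to the constant \<open>\<beta> 0\<close>
    on every bounded set, while each test function keeps compact support.\<close>
  define s where "s n = 1 / real (Suc n)" for n
  have s: "0 < s n" "s n \<le> 1" for n by (auto simp: s_def)
  have slim: "s \<longlonglongrightarrow> 0"
    unfolding s_def using LIMSEQ_inverse_real_of_nat by (simp add: inverse_eq_divide)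
  define \<phi> where "\<phi> n y = \<beta> (s n *\<^sub>R y) * cis (- (k \<bullet> y))" for n y
  define q where "q = complex_of_real (k \<bullet> x)"
  have test: "\<phi> n \<in> test_functions" for n
  proof -
    have "smooth (\<lambda>y. \<beta> (s n *\<^sub>R y))"
      using sm(1) by (auto simp: smooth_def simp del: C_class.simps intro: C_class_comp_linear[OF bounded_linear_scaleR_right])
    moreover have "smooth (\<lambda>y. cis (- (k \<bullet> y)))"
      using C_class_cis[of _ 1 k] by (simp add: smooth_def)
    ultimately have "smooth (\<phi> n)"
      unfolding \<phi>_def[abs_def] by (rule smooth_mult)
    moreover have "{y. \<phi> n y \<noteq> 0} \<subseteq> cball 0 (1 / s n)"
    proof
      fix y assume "y \<in> {y. \<phi> n y \<noteq> 0}"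
      then have "\<not> norm (s n *\<^sub>R y) > 1"
        using \<beta>0 by (auto simp: \<phi>_def)
      then show "y \<in> cball 0 (1 / s n)"
        using s[of n] by (simp add: field_simps)
    qed
    then have "bounded {y. \<phi> n y \<noteq> 0}"
      using bounded_subset bounded_cball by blast
    ultimately show ?thesis
      by (simp add: test_functions_def compact_closure)
  qed
  have d1: "dir_deriv x (\<phi> n) = (\<lambda>y. (s n * b (s n *\<^sub>R y) - \<i> * q * \<beta> (s n *\<^sub>R y)) * cis (- (k \<bullet> y)))" for n
    unfolding \<phi>_def[abs_def] b_def q_def
    by (rule ext) (rule dir_deriv_scaled_mult_cis[OF smooth_has_derivative[OF sm(1)]])
  have d2: "dir_deriv x (dir_deriv x (\<phi> n)) y =
     (s n * (s n * c (s n *\<^sub>R y) - \<i> * q * b (s n *\<^sub>R y)) - \<i> * q * (s n * b (s n *\<^sub>R y) - \<i> * q * \<beta> (s n *\<^sub>R y))) * cis (- (k \<bullet> y))" for n y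
  proof -
    have "((\<lambda>z. s n * b z - \<i> * q * \<beta> z) has_derivative
        (\<lambda>d. s n * frechet_derivative b (at z) d - \<i> * q * frechet_derivative \<beta> (at z) d)) (at z)" for z
      by (intro has_derivative_diff has_derivative_mult_right smooth_has_derivative sm)
    from dir_deriv_scaled_mult_cis[OF this, of x "s n" k y] show ?thesis
      unfolding d1 by (simp add: b_def c_def q_def)
  qed
  \<comment> \<open>Each derivative that falls on the stretched bump carries a factor
    \<open>s n\<close>. In the limit both derivatives fall on the character, which contributes the
    factor \<open>- q\<^sup>2\<close>.\<close>
  have "(\<lambda>n. LINT y|lborel. f y * dir_deriv x (dir_deriv x (\<phi> n)) y) \<longlonglongrightarrow> (LINT y|lborel. f y * (- q\<^sup>2 * \<beta> 0 * cis (- (k \<bullet> y))))"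
  proof (rule integral_dominated_convergence)
    show "integrable lborel (\<lambda>y. (C + 2 * cmod q * B + (cmod q)\<^sup>2 * A) * cmod (f y))"
      using f by simp
    show "AE y in lborel. (\<lambda>n. f y * dir_deriv x (dir_deriv x (\<phi> n)) y) \<longlonglongrightarrow> f y * (- q\<^sup>2 * \<beta> 0 * cis (- (k \<bullet> y)))"
    proof (rule AE_I2)
      fix y :: 'a
      have sy: "(\<lambda>n. s n *\<^sub>R y) \<longlonglongrightarrow> 0"
        using tendsto_scaleR[OF slim tendsto_const[of y]] by simp
      have L: "(\<lambda>n. h (s n *\<^sub>R y)) \<longlonglongrightarrow> h 0" if "continuous_on UNIV h" for h :: "'a \<Rightarrow> complex"
        using that sy by (rule continuous_on_tendsto_compose) auto
      have "(\<lambda>n. f y * dir_deriv x (dir_deriv x (\<phi> n)) y) \<longlonglongrightarrow>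
         f y * ((of_real 0 * (of_real 0 * c 0 - \<i> * q * b 0) - \<i> * q * (of_real 0 * b 0 - \<i> * q * \<beta> 0)) * cis (- (k \<bullet> y)))"
        unfolding d2 by (intro tendsto_intros slim L cont)
      then show "(\<lambda>n. f y * dir_deriv x (dir_deriv x (\<phi> n)) y) \<longlonglongrightarrow> f y * (- q\<^sup>2 * \<beta> 0 * cis (- (k \<bullet> y)))"
        by (simp add: power2_eq_square algebra_simps)
    qed
    show "AE y in lborel. norm (f y * dir_deriv x (dir_deriv x (\<phi> n)) y) \<le> (C + 2 * cmod q * B + (cmod q)\<^sup>2 * A) * cmod (f y)" for n
    proof (rule AE_I2)
      fix y :: 'a
      let ?b = "b (s n *\<^sub>R y)" and ?c = "c (s n *\<^sub>R y)" and ?a = "\<beta> (s n *\<^sub>R y)"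
      have "cmod (s n * (s n * ?c - \<i> * q * ?b) - \<i> * q * (s n * ?b - \<i> * q * ?a))
          \<le> cmod (s n * (s n * ?c - \<i> * q * ?b)) + cmod (\<i> * q * (s n * ?b - \<i> * q * ?a))"
        by (rule norm_triangle_ineq4)
      also have "cmod (s n * (s n * ?c - \<i> * q * ?b)) \<le> 1 * (1 * C + cmod q * B)"
      proof -
        have "cmod (s n * ?c - \<i> * q * ?b) \<le> cmod (s n * ?c) + cmod (\<i> * q * ?b)"
          by (rule norm_triangle_ineq4)
        also have "cmod (s n * ?c) \<le> 1 * C"
          unfolding norm_mult using s[of n] C by (intro mult_mono) auto
        also have "cmod (\<i> * q * ?b) \<le> cmod q * B"
          unfolding norm_mult using B by (simp add: mult_left_mono)
        finally show ?thesis
          unfolding norm_mult[of "of_real (s n)" "of_real (s n) * ?c - \<i> * q * ?b"] using s[of n] by (intro mult_mono) auto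
      qed
      also have "cmod (\<i> * q * (s n * ?b - \<i> * q * ?a)) \<le> cmod q * (1 * B + cmod q * A)"
      proof -
        have "cmod (s n * ?b - \<i> * q * ?a) \<le> cmod (s n * ?b) + cmod (\<i> * q * ?a)"
          by (rule norm_triangle_ineq4)
        also have "cmod (s n * ?b) \<le> 1 * B"
          unfolding norm_mult using s[of n] B by (intro mult_mono) auto
        also have "cmod (\<i> * q * ?a) \<le> cmod q * A"
          unfolding norm_mult using A by (simp add: mult_left_mono)
        finally show ?thesis
          unfolding norm_mult[of "\<i> * q" "of_real (s n) * ?b - \<i> * q * ?a"] by (simp add: norm_mult mult_left_mono)
      qed
      finally have "cmod (s n * (s n * ?c - \<i> * q * ?b) - \<i> * q * (s n * ?b - \<i> * q * ?a)) \<le> C + 2 * cmod q * B + (cmod q)\<^sup>2 * A"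
        by (simp add: power2_eq_square algebra_simps)
      then show "norm (f y * dir_deriv x (dir_deriv x (\<phi> n)) y) \<le> (C + 2 * cmod q * B + (cmod q)\<^sup>2 * A) * cmod (f y)"
        unfolding d2 norm_mult norm_cis mult_1_right by (subst mult.commute) (rule mult_right_mono, simp_all)
    qed
  qed (unfold d2, measurable)
  moreover have "(\<lambda>n. LINT y|lborel. w y * \<phi> n y) \<longlonglongrightarrow> (LINT y|lborel. w y * (\<beta> 0 * cis (- (k \<bullet> y))))"
  proof (rule integral_dominated_convergence)
    show "integrable lborel (\<lambda>y. A * cmod (w y))"
      using w by simp
    show "AE y in lborel. (\<lambda>n. w y * \<phi> n y) \<longlonglongrightarrow> w y * (\<beta> 0 * cis (- (k \<bullet> y)))"
    proof (rule AE_I2)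
      fix y :: 'a
      have sy: "(\<lambda>n. s n *\<^sub>R y) \<longlonglongrightarrow> 0"
        using tendsto_scaleR[OF slim tendsto_const[of y]] by simp
      have "(\<lambda>n. \<beta> (s n *\<^sub>R y)) \<longlonglongrightarrow> \<beta> 0"
        using cont(1) sy by (rule continuous_on_tendsto_compose) auto
      then show "(\<lambda>n. w y * \<phi> n y) \<longlonglongrightarrow> w y * (\<beta> 0 * cis (- (k \<bullet> y)))"
        unfolding \<phi>_def by (intro tendsto_intros)
    qed
    show "AE y in lborel. norm (w y * \<phi> n y) \<le> A * cmod (w y)" for n
      using A by (intro AE_I2) (simp add: \<phi>_def norm_mult mult.commute[of _ "cmod (w _)"] mult_left_mono)
  qed (simp_all add: \<phi>_def)
  moreover have "(LINT y|lborel. f y * dir_deriv x (dir_deriv x (\<phi> n)) y) = (LINT y|lborel. w y * \<phi> n y)" for n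
    using weak test unfolding has_weak_second_deriv_def by blast
  ultimately have "(LINT y|lborel. f y * (- q\<^sup>2 * \<beta> 0 * cis (- (k \<bullet> y)))) = (LINT y|lborel. w y * (\<beta> 0 * cis (- (k \<bullet> y))))"
    using LIMSEQ_unique by simp
  moreover have "(LINT y|lborel. f y * (- q\<^sup>2 * \<beta> 0 * cis (- (k \<bullet> y)))) = (- q\<^sup>2 * \<beta> 0) * FT f k"
    unfolding FT_def by (subst integral_mult_right_zero[symmetric]) (simp add: mult_ac)
  moreover have "(LINT y|lborel. w y * (\<beta> 0 * cis (- (k \<bullet> y)))) = \<beta> 0 * FT w k"
    unfolding FT_def by (subst integral_mult_right_zero[symmetric]) (simp add: mult_ac)
  ultimately have "\<beta> 0 * (- q\<^sup>2 * FT f k) = \<beta> 0 * FT w k"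
    by (simp add: mult_ac)
  moreover have "\<beta> 0 \<noteq> 0"
    unfolding \<beta>_def by (rule bump_0)
  ultimately have "- q\<^sup>2 * FT f k = FT w k"
    by (simp only: mult_cancel_left) simp
  then have "cmod (- q\<^sup>2 * FT f k) = cmod (FT w k)"
    by (rule arg_cong)
  then have "cmod (FT w k) = (k \<bullet> x)\<^sup>2 * cmod (FT f k)"
    by (simp add: q_def norm_mult norm_power)
  then show ?thesis
    using FT_bound[OF w, of k] by simp
qed

text \<open>Second derivatives in the directions 1 and \<open>\<i>\<close> suffice, since the
  squares of the components of k along them add up to |k|^2; the summand 1 comes from the L1 norm of
  f itself.\<close>

lemma H21_FT_decay:
  fixes f :: "complex \<Rightarrow> complex"
  assumes "f \<in> H21"
  obtains W where "W \<ge> 0" "\<And>k. (1 + (cmod k)\<^sup>2) * cmod (FT f k) \<le> W"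
proof -
  have f: "integrable lborel f"
    using assms by (simp add: H21_def)
  obtain w1 w2 where w1: "integrable lborel w1" "has_weak_second_deriv f 1 w1"
    and w2: "integrable lborel w2" "has_weak_second_deriv f \<i> w2"
    using assms unfolding H21_def by blast
  define W where "W = (LINT y|lborel. cmod (f y)) + (LINT y|lborel. cmod (w1 y)) + (LINT y|lborel. cmod (w2 y))"
  have "(1 + (cmod k)\<^sup>2) * cmod (FT f k) \<le> W" for k
    using FT_bound[OF f, of k] weak_second_deriv_FT_bound[OF f w1, of k] weak_second_deriv_FT_bound[OF f w2, of k]
    by (simp add: W_def cmod_power2 algebra_simps inner_complex_def)
  moreover have "W \<ge> 0"
    by (simp add: W_def)
  ultimately show ?thesis
    using that by blast
qed

section \<open>Test functions as coefficient functions\<close>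

lemma cis_Arg2pi: "cmod z = 1 \<Longrightarrow> cis (Arg2pi z) = z"
  using Arg2pi[of z] by (simp add: cis_conv_exp is_Arg_def)

lemma Arg2pi_cis: "0 \<le> t \<Longrightarrow> t < 2 * pi \<Longrightarrow> Arg2pi (cis t) = t"
  by (rule Arg2pi_unique[of 1]) (auto simp: cis_conv_exp)

lemma measurable_Arg2pi [measurable]: "Arg2pi \<in> borel_measurable borel"
  using closed_Arg2pi2pi_le by (auto simp: borel_measurable_iff_le)

type_synonym chart = "(complex \<times> real) \<times> (complex \<times> real)"

text \<open>A covering map from a Euclidean space, periodic in both angles. Smoothness of a function
  on the group is smoothness of its composition with this map.\<close>

definition chart :: "chart \<Rightarrow> (complex \<times> complex) \<times> (complex \<times> complex)" where
  "chart q = ((fst (fst q), cis (snd (fst q))), (fst (snd q), cis (snd (snd q))))"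

text \<open>A section of the covering over the carrier. It jumps where an angle passes 0, so it
  serves to pick coordinates of a point and to prove measurability, never to prove
  smoothness.\<close>

definition chart_inv :: "(complex \<times> complex) \<times> (complex \<times> complex) \<Rightarrow> chart" where
  "chart_inv p = ((fst (fst p), Arg2pi (snd (fst p))), (fst (snd p), Arg2pi (snd (snd p))))"

lemma chart_carrier: "chart q \<in> carrier motion_group2"
  by (simp add: chart_def carrier_motion_group2)

lemma chart_chart_inv: "p \<in> carrier motion_group2 \<Longrightarrow> chart (chart_inv p) = p"
  by (auto simp: chart_def chart_inv_def carrier_motion_group2 cis_Arg2pi)

text \<open>Smooth functions on the group whose support is bounded in the translation coordinates; on the
  group this amounts to compact support.\<close>

definition smooth_bounded_support :: "((complex \<times> complex) \<times> (complex \<times> complex) \<Rightarrow> complex) set" where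
  "smooth_bounded_support = {u. smooth (\<lambda>q. u (chart q)) \<and>
     (\<exists>R. \<forall>q. norm (fst (fst q)) > R \<or> norm (fst (snd q)) > R \<longrightarrow> u (chart q) = 0)}"

lemma smooth_bounded_supportI:
  assumes "smooth (\<lambda>q. u (chart q))"
    and "\<And>q. norm (fst (fst q)) > R \<or> norm (fst (snd q)) > R \<Longrightarrow> u (chart q) = 0"
  shows "u \<in> smooth_bounded_support"
  unfolding smooth_bounded_support_def using assms by blast

lemma D_motion2_subset: "D_motion2 \<subseteq> smooth_bounded_support"
proof
  fix u assume u: "u \<in> D_motion2"
  have "(\<lambda>((x, s :: real), (y, t :: real)). u ((x, cis s), (y, cis t))) = (\<lambda>q. u (chart q))"
    by (auto simp: chart_def fun_eq_iff)
  then have 1: "smooth (\<lambda>q. u (chart q))"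
    using u by (simp add: D_motion2_def)
  have "bounded {p \<in> carrier motion_group2. u p \<noteq> 0}"
    using u by (simp add: D_motion2_def compact_closure)
  then obtain R where R: "\<And>p. p \<in> carrier motion_group2 \<Longrightarrow> u p \<noteq> 0 \<Longrightarrow> norm p \<le> R"
    unfolding bounded_iff by blast
  have "u (chart q) = 0" if "norm (fst (fst q)) > R \<or> norm (fst (snd q)) > R" for q
  proof (rule ccontr)
    assume "u (chart q) \<noteq> 0"
    then have le: "norm (chart q) \<le> R"
      by (intro R chart_carrier)
    have "norm (fst (fst (chart q))) \<le> norm (chart q)" "norm (fst (snd (chart q))) \<le> norm (chart q)"
      using norm_fst_le[of "fst (chart q)" "snd (chart q)"] norm_snd_le[of "snd (chart q)" "fst (chart q)"]
        norm_fst_le[of "fst (fst (chart q))" "snd (fst (chart q))"] norm_fst_le[of "fst (snd (chart q))" "snd (snd (chart q))"]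
      by (auto intro: order_trans)
    then show False
      using that le by (simp add: chart_def)
  qed
  with 1 show "u \<in> smooth_bounded_support"
    by (rule smooth_bounded_supportI)
qed

lemma smooth_bounded_support_smooth: "u \<in> smooth_bounded_support \<Longrightarrow> smooth (\<lambda>q. u (chart q))"
  by (simp add: smooth_bounded_support_def)

text \<open>Every point of the carrier has coordinates with both angles between 0 and 2 pi. So the
  values are those on the compact set \<open>K\<close>, or else 0.\<close>

lemma smooth_bounded_support_bounded:
  assumes "u \<in> smooth_bounded_support"
  obtains C where "\<And>p. p \<in> carrier motion_group2 \<Longrightarrow> cmod (u p) \<le> C"
proof -
  obtain R where R: "\<And>q. norm (fst (fst q)) > R \<or> norm (fst (snd q)) > R \<Longrightarrow> u (chart q) = 0"
    using assms unfolding smooth_bounded_support_def by blast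
  define K :: "chart set" where "K = (cball 0 R \<times> {0..2 * pi}) \<times> (cball 0 R \<times> {0..2 * pi})"
  have "compact K"
    unfolding K_def by (intro compact_Times compact_cball compact_Icc)
  moreover have "continuous_on K (\<lambda>q. u (chart q))"
    using smooth_continuous[OF smooth_bounded_support_smooth[OF assms]] continuous_on_subset by blast
  ultimately have "bounded ((\<lambda>q. u (chart q)) ` K)"
    using compact_continuous_image compact_imp_bounded by blast
  then obtain C where C: "\<And>q. q \<in> K \<Longrightarrow> cmod (u (chart q)) \<le> C"
    unfolding bounded_iff by blast
  have "cmod (u p) \<le> max 0 C" if p: "p \<in> carrier motion_group2" for p
  proof (cases "chart_inv p \<in> K")
    case True
    then show ?thesis
      using C[of "chart_inv p"] by (simp add: chart_chart_inv[OF p])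
  next
    case False
    have "0 \<le> Arg2pi z" "Arg2pi z \<le> 2 * pi" for z
      using Arg2pi[of z] by auto
    then have "norm (fst (fst (chart_inv p))) > R \<or> norm (fst (snd (chart_inv p))) > R"
      using False by (auto simp: K_def chart_inv_def mem_Times_iff)
    then show ?thesis
      using R[of "chart_inv p"] by (simp add: chart_chart_inv[OF p])
  qed
  then show ?thesis ..
qed

lemma smooth_bounded_support_measurable:
  assumes "u \<in> smooth_bounded_support"
  shows "u \<in> borel_measurable motion_haar2"
proof -
  have U [measurable]: "(\<lambda>q. u (chart q)) \<in> borel_measurable borel"
    by (intro borel_measurable_continuous_onI smooth_continuous smooth_bounded_support_smooth assms)
  have "(\<lambda>p. fst (fst p)) \<in> borel_measurable motion_haar2" "(\<lambda>p. fst (snd p)) \<in> borel_measurable motion_haar2"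
     "(\<lambda>p. snd (fst p)) \<in> borel_measurable motion_haar2" "(\<lambda>p. snd (snd p)) \<in> borel_measurable motion_haar2"
    by (intro measurable_fst_motion_haar measurable_snd_motion_haar measurable_fst measurable_snd)+
  note [measurable] = this
  have "chart_inv \<in> borel_measurable motion_haar2"
    unfolding chart_inv_def[abs_def] by measurable
  from measurable_compose[OF this U]
  have "(\<lambda>p. u (chart (chart_inv p))) \<in> borel_measurable motion_haar2" .
  then show ?thesis
    by (subst measurable_cong[where g="\<lambda>p. u (chart (chart_inv p))"])
       (auto simp: space_motion_haar2 chart_chart_inv)
qed

lemma smooth_bounded_support_swap:
  assumes "u \<in> smooth_bounded_support"
  shows "(\<lambda>p. u (prod.swap p)) \<in> smooth_bounded_support"
proof -
  obtain R where R: "\<And>q. norm (fst (fst q)) > R \<or> norm (fst (snd q)) > R \<Longrightarrow> u (chart q) = 0"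
    using assms unfolding smooth_bounded_support_def by blast
  have eq: "prod.swap (chart q) = chart (prod.swap q)" for q
    by (simp add: chart_def)
  have "bounded_linear (prod.swap :: chart \<Rightarrow> chart)"
    unfolding prod.swap_def by (intro bounded_linear_Pair bounded_linear_fst bounded_linear_snd)
  then have "smooth (\<lambda>q. u (chart (prod.swap q)))"
    using smooth_bounded_support_smooth[OF assms] C_class_comp_linear unfolding smooth_def by blast
  moreover have "u (chart (prod.swap q)) = 0" if "norm (fst (fst q)) > R \<or> norm (fst (snd q)) > R" for q
    using that by (intro R) auto
  ultimately show ?thesis
    by (intro smooth_bounded_supportI) (simp_all only: eq)
qed

text \<open>The one-parameter subgroup \<open>e\<close> acts from the right, in coordinates, along straight lines in
  direction of the vector field \<open>d\<close>.\<close>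

definition flow :: "(real \<Rightarrow> (complex \<times> complex) \<times> (complex \<times> complex)) \<Rightarrow> (chart \<Rightarrow> chart) \<Rightarrow> bool" where
  "flow e d \<longleftrightarrow> smooth d \<and> (\<forall>q t. mult_EE (chart q) (e t) = chart (q + t *\<^sub>R d q)) \<and> (\<forall>q t. d (q + t *\<^sub>R d q) = d q)"

lemma flow_chart: "flow e d \<Longrightarrow> mult_EE (chart q) (e t) = chart (q + t *\<^sub>R d q)"
  unfolding flow_def by blast

lemma flow_invariant: "flow e d \<Longrightarrow> d (q + t *\<^sub>R d q) = d q"
  unfolding flow_def by blast

text \<open>The derivative along the left-invariant vector field that belongs to the one-parameter
  subgroup \<open>e\<close>.\<close>

definition right_deriv where
  "right_deriv e u p = vector_derivative (\<lambda>t::real. u (mult_EE p (e t))) (at 0)" for u :: "_ \<Rightarrow> complex"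

section \<open>Derivatives along flows\<close>

lemma smooth_along_line:
  assumes "smooth U"
  shows "((\<lambda>t. U (q + t *\<^sub>R d)) has_vector_derivative frechet_derivative U (at (q + t *\<^sub>R d)) d) (at t)"
proof -
  let ?D = "frechet_derivative U (at (q + t *\<^sub>R d))"
  have D: "(U has_derivative ?D) (at (q + t *\<^sub>R d))"
    using assms by (rule smooth_has_derivative)
  have "((\<lambda>t. U (q + t *\<^sub>R d)) has_derivative (\<lambda>h. ?D (h *\<^sub>R d))) (at t)"
    by (rule has_derivative_compose[where f="\<lambda>t. q + t *\<^sub>R d", OF _ D]) (auto intro!: derivative_eq_intros)
  then show ?thesis
    using linear_scale[OF has_derivative_linear[OF D]] by (simp add: has_vector_derivative_def)
qed

lemma right_deriv_chart:
  assumes "flow e d" "smooth (\<lambda>q. u (chart q))"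
  shows "right_deriv e u (chart q) = frechet_derivative (\<lambda>q. u (chart q)) (at q) (d q)"
proof -
  have "(\<lambda>t. u (mult_EE (chart q) (e t))) = (\<lambda>t. u (chart (q + t *\<^sub>R d q)))"
    by (simp only: flow_chart[OF assms(1)])
  then show ?thesis
    unfolding right_deriv_def using smooth_along_line[OF assms(2), of q "d q" 0]
    by (intro vector_derivative_at) simp
qed

lemma smooth_sum:
  "(\<And>b. b \<in> B \<Longrightarrow> smooth (f b)) \<Longrightarrow> smooth (\<lambda>x. \<Sum>b\<in>B. f b x)"
  by (induction B rule: infinite_finite_induct) (auto intro: smooth_const smooth_add)

lemma smooth_linear_comp: "bounded_linear L \<Longrightarrow> smooth f \<Longrightarrow> smooth (\<lambda>x. L (f x))"
  unfolding smooth_def by (blast intro: C_class_linear_comp)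

text \<open>The direction varies with the point. Expanding it in the basis leaves smooth
  coefficients times derivatives in fixed directions.\<close>

lemma smooth_derivative_vector_field:
  fixes U :: "'a::euclidean_space \<Rightarrow> complex" and d :: "'a \<Rightarrow> 'a"
  assumes U: "smooth U" and d: "smooth d"
  shows "smooth (\<lambda>q. frechet_derivative U (at q) (d q))"
proof -
  have "frechet_derivative U (at q) (d q) = (\<Sum>b\<in>Basis. of_real (d q \<bullet> b) * frechet_derivative U (at q) b)" for q
  proof -
    have lin: "linear (frechet_derivative U (at q))"
      using smooth_has_derivative[OF U] by (rule has_derivative_linear)
    have "frechet_derivative U (at q) (d q) = frechet_derivative U (at q) (\<Sum>b\<in>Basis. (d q \<bullet> b) *\<^sub>R b)"
      by (simp add: euclidean_representation)
    also have "\<dots> = (\<Sum>b\<in>Basis. (d q \<bullet> b) *\<^sub>R frechet_derivative U (at q) b)"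
      by (simp add: linear_sum[OF lin] linear_scale[OF lin])
    finally show ?thesis
      by (simp add: scaleR_conv_of_real)
  qed
  moreover have "smooth (\<lambda>q. \<Sum>b\<in>Basis. of_real (d q \<bullet> b) * frechet_derivative U (at q) b)"
    by (intro smooth_sum smooth_mult smooth_frechet_derivative U
        smooth_linear_comp[OF bounded_linear_of_real] smooth_linear_comp[OF bounded_linear_inner_left] d)
  ultimately show ?thesis
    by simp
qed

text \<open>Stability of the class under 1 - X allows the resolvents of several fields to be applied
  one after the other.\<close>

lemma smooth_bounded_support_diff_deriv:
  assumes "flow e d" "u \<in> smooth_bounded_support"
  shows "(\<lambda>p. u p - right_deriv e u p) \<in> smooth_bounded_support"
proof -
  have sm: "smooth (\<lambda>q. u (chart q))"
    using assms(2) by (rule smooth_bounded_support_smooth)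
  have d: "smooth d"
    using assms(1) by (simp add: flow_def)
  obtain R where R: "\<And>q. norm (fst (fst q)) > R \<or> norm (fst (snd q)) > R \<Longrightarrow> u (chart q) = 0"
    using assms(2) unfolding smooth_bounded_support_def by blast
  have "smooth (\<lambda>q. u (chart q) + (- 1) * frechet_derivative (\<lambda>q. u (chart q)) (at q) (d q))"
    by (intro smooth_add smooth_mult smooth_const sm smooth_derivative_vector_field d)
  then have "smooth (\<lambda>q. u (chart q) - right_deriv e u (chart q))"
    by (simp add: right_deriv_chart[OF assms(1) sm])
  moreover have "u (chart q) - right_deriv e u (chart q) = 0" if q: "norm (fst (fst q)) > R \<or> norm (fst (snd q)) > R" for q
  proof -
    \<comment> \<open>The function vanishes on the whole open set \<open>?S\<close>, hence so does
      its derivative there.\<close>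
    let ?S = "{q::chart. norm (fst (fst q)) > R} \<union> {q. norm (fst (snd q)) > R}"
    have "open ?S"
      by (intro open_Un open_Collect_less continuous_intros)
    then have "((\<lambda>q. u (chart q)) has_derivative (\<lambda>_. 0)) (at q)"
      using q R by (intro has_derivative_transform_within_open[OF has_derivative_const, of ?S q 0]) auto
    then show ?thesis
      using R[OF q] by (simp add: right_deriv_chart[OF assms(1) sm] frechet_derivative_eqI)
  qed
  ultimately show ?thesis
    unfolding smooth_bounded_support_def by blast
qed

lemma flow_has_vector_derivative:
  assumes fl: "flow e d" and u: "u \<in> smooth_bounded_support" and p: "p \<in> carrier motion_group2"
  shows "((\<lambda>t. u (mult_EE p (e t))) has_vector_derivative right_deriv e u (mult_EE p (e t))) (at t)"
proof -
  define q where "q = chart_inv p"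
  have q: "chart q = p"
    using p by (simp add: q_def chart_chart_inv)
  have sm: "smooth (\<lambda>q. u (chart q))"
    using u by (rule smooth_bounded_support_smooth)
  have e: "mult_EE p (e t) = chart (q + t *\<^sub>R d q)" for t
    by (simp only: flow_chart[OF fl] flip: q)
  show ?thesis
    unfolding e right_deriv_chart[OF fl sm] flow_invariant[OF fl] by (rule smooth_along_line[OF sm])
qed

text \<open>Along the flow, \<open>- exp (- t)\<close> times \<open>u\<close> is an antiderivative
  of \<open>exp (- t)\<close> times \<open>u - X u\<close>. This recovers \<open>u\<close> from
  \<open>u - X u\<close> up to the boundary term at \<open>T\<close>, which the translations and the
  rotations dispose of in different ways.\<close>

lemma flow_FTC:
  assumes fl: "flow e d" and u: "u \<in> smooth_bounded_support" and p: "p \<in> carrier motion_group2" and T: "T \<ge> 0"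
  defines "w \<equiv> \<lambda>p. u p - right_deriv e u p"
  shows "(LINT t|lborel. indicator {0..T} t *\<^sub>R (exp (- t) *\<^sub>R w (mult_EE p (e t)))) = u (mult_EE p (e 0)) - exp (- T) *\<^sub>R u (mult_EE p (e T))"
proof -
  define q where "q = chart_inv p"
  have q: "chart q = p"
    using p by (simp add: q_def chart_chart_inv)
  have sm: "smooth (\<lambda>q. u (chart q))"
    using u by (rule smooth_bounded_support_smooth)
  define \<phi> where "\<phi> t = u (chart (q + t *\<^sub>R d q))" for t
  define \<psi> where "\<psi> t = w (chart (q + t *\<^sub>R d q))" for t
  have e: "mult_EE p (e t) = chart (q + t *\<^sub>R d q)" for t
    by (simp only: flow_chart[OF fl] flip: q)
  have \<phi>: "(\<phi> has_vector_derivative (\<phi> t - \<psi> t)) (at t)" for t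
    using flow_has_vector_derivative[OF fl u p, of t] unfolding e \<phi>_def[abs_def] \<psi>_def w_def by simp
  have wsm: "smooth (\<lambda>q. w (chart q))"
    unfolding w_def by (intro smooth_bounded_support_smooth smooth_bounded_support_diff_deriv[OF fl u])
  have cont: "continuous_on UNIV \<psi>"
    unfolding \<psi>_def[abs_def] by (rule continuous_on_compose2[OF smooth_continuous[OF wsm]]) (auto intro!: continuous_intros)
  have "(LINT t|lborel. indicator {0..T} t *\<^sub>R (exp (- t) *\<^sub>R \<psi> t)) = - (exp (- T) *\<^sub>R \<phi> T) - - (exp (- 0) *\<^sub>R \<phi> 0)"
  proof (rule integral_FTC_Icc[OF T])
    have "((\<lambda>t. - (exp (- t) *\<^sub>R \<phi> t)) has_vector_derivative (exp (- t) *\<^sub>R \<psi> t)) (at t)" for t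
      by (auto intro!: derivative_eq_intros \<phi> simp: algebra_simps)
    then show "((\<lambda>t. - (exp (- t) *\<^sub>R \<phi> t)) has_vector_derivative (exp (- t) *\<^sub>R \<psi> t)) (at t within {0..T})" for t
      by (rule has_vector_derivative_at_within)
    show "continuous_on {0..T} (\<lambda>t. exp (- t) *\<^sub>R \<psi> t)"
      by (intro continuous_intros continuous_on_subset[OF cont]) auto
  qed
  then show ?thesis
    unfolding e by (simp add: \<phi>_def \<psi>_def)
qed

section \<open>Resolvents of translations and rotations\<close>

definition translation_flow :: "complex \<Rightarrow> real \<Rightarrow> (complex \<times> complex) \<times> (complex \<times> complex)" where
  "translation_flow c t = ((t * c, 1), (0, 1))"

definition rotation_flow :: "real \<Rightarrow> (complex \<times> complex) \<times> (complex \<times> complex)" where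
  "rotation_flow t = ((0, cis t), (0, 1))"

lemma flow_translation: "flow (translation_flow c) (\<lambda>q. ((c * cis (snd (fst q)), 0), (0, 0)))"
  unfolding flow_def
proof (intro conjI allI)
  \<comment> \<open>The angle in the first factor is read off as the inner product with a fixed
    vector, so the field is a character in the sense of \<open>C_class_cis\<close>.\<close>
  have "smooth (\<lambda>q::chart. c * cis (- ((((0, -1), (0, 0)) :: chart) \<bullet> q)))"
    unfolding smooth_def by (intro allI C_class_cis)
  then have "smooth (\<lambda>q::chart. c * cis (snd (fst q)))"
    by (simp add: inner_prod_def)
  moreover have "bounded_linear (\<lambda>x::complex. ((x, 0::real), (0::complex, 0::real)))"
    by (intro bounded_linear_Pair bounded_linear_ident bounded_linear_zero)
  ultimately show "smooth (\<lambda>q::chart. ((c * cis (snd (fst q)), 0), (0, 0)) :: chart)"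
    using smooth_linear_comp by blast
qed (auto simp: mult_EE_def mult_E_def chart_def translation_flow_def scaleR_conv_of_real)

lemma flow_rotation: "flow rotation_flow (\<lambda>q. ((0, 1), (0, 0)))"
  unfolding flow_def
  by (auto simp: mult_EE_def mult_E_def chart_def rotation_flow_def cis_mult intro: smooth_const)

lemma mult_EE_carrier:
  "p \<in> carrier motion_group2 \<Longrightarrow> h \<in> carrier motion_group2 \<Longrightarrow> mult_EE p h \<in> carrier motion_group2"
  by (auto simp: mult_EE_def mult_E_def carrier_motion_group2 norm_mult)

lemma translation_flow_carrier: "translation_flow c t \<in> carrier motion_group2"
  by (simp add: translation_flow_def carrier_motion_group2)

lemma smooth_bounded_support_vanish:
  assumes "u \<in> smooth_bounded_support"
  obtains R where "\<And>p. p \<in> carrier motion_group2 \<Longrightarrow> norm (fst (fst p)) > R \<Longrightarrow> u p = 0"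
proof -
  obtain R where R: "\<And>q. norm (fst (fst q)) > R \<or> norm (fst (snd q)) > R \<Longrightarrow> u (chart q) = 0"
    using assms unfolding smooth_bounded_support_def by blast
  have "u p = 0" if "p \<in> carrier motion_group2" "norm (fst (fst p)) > R" for p
    using R[of "chart_inv p"] that by (simp add: chart_chart_inv) (simp add: chart_inv_def)
  then show ?thesis ..
qed

definition exp_kernel :: "real \<Rightarrow> real" where
  "exp_kernel t = indicator {0..} t * exp (- t)"

text \<open>The resolvent \<open>(1 - X)\<^sup>-\<^sup>1\<close> of a left-invariant vector field \<open>X\<close> is the Laplace transform of its flow.\<close>

lemma translation_resolvent:
  assumes u: "u \<in> smooth_bounded_support" and c: "cmod c = 1" and p: "p \<in> carrier motion_group2"
  shows "u p = (LINT t|lborel. exp_kernel t *\<^sub>R (u (mult_EE p (translation_flow c t)) - right_deriv (translation_flow c) u (mult_EE p (translation_flow c t))))"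
proof -
  define w where "w p = u p - right_deriv (translation_flow c) u p" for p
  have w: "w \<in> smooth_bounded_support"
    unfolding w_def[abs_def] by (rule smooth_bounded_support_diff_deriv[OF flow_translation u])
  obtain R1 where R1: "\<And>p. p \<in> carrier motion_group2 \<Longrightarrow> norm (fst (fst p)) > R1 \<Longrightarrow> u p = 0"
    using smooth_bounded_support_vanish[OF u] by blast
  obtain R2 where R2: "\<And>p. p \<in> carrier motion_group2 \<Longrightarrow> norm (fst (fst p)) > R2 \<Longrightarrow> w p = 0"
    using smooth_bounded_support_vanish[OF w] by blast
  \<comment> \<open>From time \<open>T\<close> on, the translation has carried the point beyond the
    support bounds of both \<open>u\<close> and \<open>w\<close>. So the boundary term is 0, and the
    integral may be extended to infinity.\<close>
  define T where "T = \<bar>R1\<bar> + \<bar>R2\<bar> + cmod (fst (fst p)) + 1"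
  have T: "T \<ge> 0" by (simp add: T_def)
  have big: "norm (fst (fst (mult_EE p (translation_flow c t)))) > \<bar>R1\<bar> + \<bar>R2\<bar>" if "t \<ge> T" for t
  proof -
    have "cmod (snd (fst p)) = 1"
      using p by (auto simp: carrier_motion_group2)
    then have "t = cmod (snd (fst p) * (t * c))"
      using that T c by (simp add: norm_mult)
    also have "\<dots> \<le> cmod (fst (fst p) + snd (fst p) * (t * c)) + cmod (fst (fst p))"
      using norm_triangle_ineq4[of "fst (fst p) + snd (fst p) * (t * c)" "fst (fst p)"] by simp
    finally show ?thesis
      using that by (simp add: mult_EE_def mult_E_def translation_flow_def T_def)
  qed
  have u0: "u (mult_EE p (translation_flow c T)) = 0"
    using big[of T] by (intro R1 mult_EE_carrier p translation_flow_carrier) auto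
  have w0: "w (mult_EE p (translation_flow c t)) = 0" if "t \<ge> T" for t
    using big[OF that] by (intro R2 mult_EE_carrier p translation_flow_carrier) auto
  have e0: "mult_EE p (translation_flow c 0) = p"
    by (simp add: mult_EE_def mult_E_def translation_flow_def)
  have "u p = (LINT t|lborel. indicator {0..T} t *\<^sub>R (exp (- t) *\<^sub>R w (mult_EE p (translation_flow c t))))"
    using flow_FTC[OF flow_translation u p T, of c] unfolding u0 e0 w_def[symmetric] by simp
  also have "\<dots> = (LINT t|lborel. exp_kernel t *\<^sub>R w (mult_EE p (translation_flow c t)))"
    using w0 by (intro Bochner_Integration.integral_cong) (auto simp: exp_kernel_def split: split_indicator)
  finally show ?thesis
    unfolding w_def .
qed

text \<open>Rotations never leave the support, but they return after the time 2 pi: the boundary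
  term is a multiple of \<open>u p\<close> itself and accounts for the factor on the left. One turn
  replaces the integral over the half-line.\<close>

lemma rotation_resolvent:
  assumes u: "u \<in> smooth_bounded_support" and p: "p \<in> carrier motion_group2"
  shows "(1 - exp (- 2 * pi)) *\<^sub>R u p = (LINT t|lborel. indicator {0..2 * pi} t *\<^sub>R (exp (- t) *\<^sub>R (u (mult_EE p (rotation_flow t)) - right_deriv rotation_flow u (mult_EE p (rotation_flow t)))))"
proof -
  have "mult_EE p (rotation_flow 0) = p" "mult_EE p (rotation_flow (2 * pi)) = p"
    by (simp_all add: mult_EE_def mult_E_def rotation_flow_def)
  then show ?thesis
    using flow_FTC[OF flow_rotation u p, of "2 * pi"] by (simp add: scaleR_diff_left)
qed

section \<open>The kernel of the composed resolvents\<close>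

lemma measurable_Complex [measurable (raw)]:
  assumes [measurable]: "f \<in> borel_measurable M" "g \<in> borel_measurable M"
  shows "(\<lambda>x. Complex (f x) (g x)) \<in> borel_measurable M"
  unfolding Complex_eq by measurable

lemma lborel_complex: "lborel = distr (lborel \<Otimes>\<^sub>M lborel) borel (\<lambda>(a, b). Complex a b)"
proof (rule lborel_eqI)
  fix l u :: complex assume le: "\<And>b. b \<in> Basis \<Longrightarrow> l \<bullet> b \<le> u \<bullet> b"
  have "(\<lambda>(a, b). Complex a b) -` box l u \<inter> space (lborel \<Otimes>\<^sub>M lborel) = {Re l<..<Re u} \<times> {Im l<..<Im u}"
    by (auto simp: box_def Basis_complex_def inner_complex_def space_pair_measure)
  then have "emeasure (distr (lborel \<Otimes>\<^sub>M lborel) borel (\<lambda>(a, b). Complex a b)) (box l u) =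
      emeasure (lborel \<Otimes>\<^sub>M lborel) ({Re l<..<Re u} \<times> {Im l<..<Im u})"
    by (subst emeasure_distr) auto
  also have "\<dots> = emeasure lborel {Re l<..<Re u} * emeasure lborel {Im l<..<Im u}"
    by (rule lborel.emeasure_pair_measure_Times) auto
  also have "\<dots> = ennreal ((Re u - Re l) * (Im u - Im l))"
    using le[of 1] le[of \<i>] by (simp add: Basis_complex_def inner_complex_def ennreal_mult)
  also have "\<dots> = (\<Prod>b\<in>Basis. (u - l) \<bullet> b)"
    by (simp add: Basis_complex_def inner_complex_def)
  finally show "emeasure (distr (lborel \<Otimes>\<^sub>M lborel) borel (\<lambda>(a, b). Complex a b)) (box l u) = (\<Prod>b\<in>Basis. (u - l) \<bullet> b)" .
qed simp

lemma integral_lborel_complex: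
  fixes f :: "complex \<Rightarrow> complex"
  assumes "integrable lborel f"
  shows "(LINT x|lborel. f x) = (LINT a|lborel. LINT b|lborel. f (Complex a b))"
proof -
  have [measurable]: "f \<in> borel_measurable borel"
    using borel_measurable_integrable[OF assms] by simp
  have i: "integrable (lborel \<Otimes>\<^sub>M lborel) (\<lambda>(a, b). f (Complex a b))"
    using assms by (subst (asm) lborel_complex, subst (asm) integrable_distr_eq) (auto simp: case_prod_unfold)
  have "(LINT x|lborel. f x) = (LINT p|(lborel \<Otimes>\<^sub>M lborel). f (Complex (fst p) (snd p)))"
    by (subst lborel_complex, subst integral_distr) (auto simp: case_prod_unfold)
  also have "\<dots> = (LINT a|lborel. LINT b|lborel. f (Complex a b))"
    using lborel_pair.integral_fst'[OF i] by (simp add: case_prod_unfold)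
  finally show ?thesis .
qed

lemma integral_circle_measure:
  fixes f :: "complex \<Rightarrow> complex"
  assumes [measurable]: "f \<in> borel_measurable circle_measure"
  shows "(LINT z|circle_measure. f z) = (1 / (2 * pi)) *\<^sub>R (LINT t|lborel. indicator {0..2 * pi} t *\<^sub>R f (cis t))"
proof -
  have [measurable]: "(\<lambda>t. f (cis t)) \<in> borel_measurable borel"
    using measurable_compose[OF measurable_cis_circle assms] .
  have "(LINT z|circle_measure. f z) = (LINT t|uniform_measure lborel {0..2 * pi}. f (cis t))"
    unfolding circle_measure_def
  proof (rule integral_distr)
    show "cis \<in> uniform_measure lborel {0..2 * pi} \<rightarrow>\<^sub>M restrict_space borel (sphere 0 1)"
      using measurable_cis_circle by (simp add: measurable_cong_sets[OF refl sets_circle_measure])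
    show "f \<in> borel_measurable (restrict_space borel (sphere 0 1))"
      using assms by (simp add: circle_measure_def)
  qed
  also have "uniform_measure lborel {0..2 * pi} = density lborel (\<lambda>t. ennreal (indicator {0..2 * pi} t / (2 * pi)))"
    unfolding uniform_measure_def by (intro density_cong) (use divide_ennreal[of 1 "2 * pi"] in \<open>auto split: split_indicator\<close>)
  also have "(LINT t|density lborel (\<lambda>t. ennreal (indicator {0..2 * pi} t / (2 * pi))). f (cis t)) =
      (LINT t|lborel. (indicator {0..2 * pi} t / (2 * pi)) *\<^sub>R f (cis t))"
    by (rule integral_density) auto
  also have "\<dots> = (LINT t|lborel. (1 / (2 * pi)) *\<^sub>R (indicator {0..2 * pi} t *\<^sub>R f (cis t)))"
    by (intro Bochner_Integration.integral_cong) auto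
  finally show ?thesis
    by (simp only: integral_scaleR_right)
qed

lemma measurable_exp_kernel [measurable]: "exp_kernel \<in> borel_measurable borel"
  unfolding exp_kernel_def[abs_def] by measurable

lemma integrable_exp_kernel: "integrable lborel exp_kernel"
proof (rule integrableI_bounded)
  have "((\<lambda>t::real. - exp (- t)) \<longlongrightarrow> - 0) at_top"
    by (intro tendsto_minus filterlim_compose[OF exp_at_bot] filterlim_uminus_at_bot_at_top)
  then have "(\<integral>\<^sup>+t. ennreal (exp (- t)) * indicator {0..} t \<partial>lborel) = ennreal (0 - (- exp (- 0)))"
    by (intro nn_integral_FTC_atLeast) (auto intro!: derivative_eq_intros)
  moreover have "(\<integral>\<^sup>+t. ennreal (norm (exp_kernel t)) \<partial>lborel) = (\<integral>\<^sup>+t. ennreal (exp (- t)) * indicator {0..} t \<partial>lborel)"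
    by (intro nn_integral_cong) (auto simp: exp_kernel_def split: split_indicator)
  ultimately show "(\<integral>\<^sup>+t. ennreal (norm (exp_kernel t)) \<partial>lborel) < \<infinity>"
    by simp
qed measurable

text \<open>The density, with respect to Haar measure, of the product of the three resolvents of one
  motion group. The factor 2 pi converts normalised arc length to the angle, and the denominator is
  the factor in the resolvent of the rotations.\<close>

definition resolvent_kernel :: "complex \<times> complex \<Rightarrow> real" where
  "resolvent_kernel h = exp_kernel (Re (fst h)) * exp_kernel (Im (fst h)) * (2 * pi / (1 - exp (- 2 * pi)) * exp (- Arg2pi (snd h)))"

lemma exp_kernel_bounds: "0 \<le> exp_kernel t" "exp_kernel t \<le> 1"
  by (auto simp: exp_kernel_def split: split_indicator)

lemma resolvent_kernel_bounds: "0 \<le> resolvent_kernel h" "resolvent_kernel h \<le> 2 * pi / (1 - exp (- 2 * pi))"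
proof -
  have pos: "0 < 1 - exp (- 2 * pi)" by simp
  then show "0 \<le> resolvent_kernel h"
    unfolding resolvent_kernel_def by (intro mult_nonneg_nonneg divide_nonneg_pos) (auto simp: exp_kernel_bounds)
  have "resolvent_kernel h \<le> 1 * 1 * (2 * pi / (1 - exp (- 2 * pi)) * 1)"
    unfolding resolvent_kernel_def using pos Arg2pi[of "snd h"]
    by (intro mult_mono mult_nonneg_nonneg divide_nonneg_pos) (auto simp: exp_kernel_bounds)
  then show "resolvent_kernel h \<le> 2 * pi / (1 - exp (- 2 * pi))"
    by simp
qed

lemma measurable_resolvent_kernel [measurable]: "resolvent_kernel \<in> borel_measurable motion_haar"
proof -
  have [measurable]: "fst \<in> borel_measurable motion_haar" "snd \<in> borel_measurable motion_haar"
    using measurable_fst_motion_haar[of "\<lambda>x. x" motion_haar] measurable_snd_motion_haar[of "\<lambda>x. x" motion_haar] by auto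
  show ?thesis
    unfolding resolvent_kernel_def[abs_def] by measurable
qed

lemma integrable_resolvent_kernel: "integrable motion_haar (\<lambda>h. complex_of_real (resolvent_kernel h))"
proof -
  have e: "integrable lborel (\<lambda>t. complex_of_real (exp_kernel t))"
    using integrable_exp_kernel by (simp add: complex_of_real_integrable_eq)
  have "integrable (lborel \<Otimes>\<^sub>M lborel) (\<lambda>(a, b). complex_of_real (exp_kernel a) * complex_of_real (exp_kernel b))"
    by (intro integrable_pair_mult sigma_finite_lborel e)
  then have 1: "integrable lborel (\<lambda>x. complex_of_real (exp_kernel (Re x)) * complex_of_real (exp_kernel (Im x)))"
    by (subst lborel_complex, subst integrable_distr_eq) (auto simp: case_prod_unfold)
  have 2: "integrable circle_measure (\<lambda>z. complex_of_real (2 * pi / (1 - exp (- 2 * pi)) * exp (- Arg2pi z)))"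
  proof (rule circle.integrable_const_bound)
    have "\<bar>exp (- Arg2pi z)\<bar> \<le> 1" for z
      using Arg2pi[of z] by simp
    then show "AE z in circle_measure. norm (complex_of_real (2 * pi / (1 - exp (- 2 * pi)) * exp (- Arg2pi z))) \<le> \<bar>2 * pi / (1 - exp (- 2 * pi))\<bar>"
      unfolding norm_of_real abs_mult by (intro AE_I2 mult_left_le) auto
  qed measurable
  have "integrable (lborel \<Otimes>\<^sub>M circle_measure) (\<lambda>(x, z). (complex_of_real (exp_kernel (Re x)) * complex_of_real (exp_kernel (Im x))) *
      complex_of_real (2 * pi / (1 - exp (- 2 * pi)) * exp (- Arg2pi z)))"
    by (intro integrable_pair_mult sigma_finite_lborel sigma_finite_circle 1 2)
  then show ?thesis
    by (simp add: motion_haar_def resolvent_kernel_def[abs_def] case_prod_unfold)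
qed

text \<open>Every element of the motion group is a translation along 1, followed by one along
  \<open>\<i>\<close> and by a rotation. Hence the three nested one-dimensional integrals of the
  resolvents are a single integral over the group acting from the right on the first factor.\<close>

lemma first_factor_resolvent:
  assumes u: "u \<in> smooth_bounded_support"
  obtains w where "w \<in> smooth_bounded_support"
    "\<And>p. p \<in> carrier motion_group2 \<Longrightarrow> u p = (LINT h|motion_haar. of_real (resolvent_kernel h) * w (mult_EE p (h, (0, 1))))"
proof -
  define w1 where "w1 p = u p - right_deriv (translation_flow 1) u p" for p
  have w1: "w1 \<in> smooth_bounded_support"
    unfolding w1_def[abs_def] by (rule smooth_bounded_support_diff_deriv[OF flow_translation u])
  define w2 where "w2 p = w1 p - right_deriv (translation_flow \<i>) w1 p" for p
  have w2: "w2 \<in> smooth_bounded_support"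
    unfolding w2_def[abs_def] by (rule smooth_bounded_support_diff_deriv[OF flow_translation w1])
  define w where "w p = w2 p - right_deriv rotation_flow w2 p" for p
  have w: "w \<in> smooth_bounded_support"
    unfolding w_def[abs_def] by (rule smooth_bounded_support_diff_deriv[OF flow_rotation w2])
  obtain C where C: "\<And>p. p \<in> carrier motion_group2 \<Longrightarrow> cmod (w p) \<le> C"
    using smooth_bounded_support_bounded[OF w] by blast
  define c where "c = 1 - exp (- 2 * pi)"
  have c: "c > 0" by (simp add: c_def)
  have "u p = (LINT h|motion_haar. of_real (resolvent_kernel h) * w (mult_EE p (h, (0, 1))))" if p: "p \<in> carrier motion_group2" for p
  proof -
    define F where "F h = w (mult_EE p (h, (0, 1)))" for h
    have hm: "(\<lambda>h. (h, (0, 1))) \<in> motion_haar \<rightarrow>\<^sub>M motion_haar2"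
      by (intro measurable_Pair measurable_ident_sets[OF refl] measurable_const) (simp add: space_motion_haar_times)
    have Fm [measurable]: "F \<in> borel_measurable motion_haar"
      unfolding F_def[abs_def]
      by (rule measurable_compose[OF measurable_compose[OF hm measurable_mult_EE_left[OF p]] smooth_bounded_support_measurable[OF w]])
    have FC: "cmod (F h) \<le> C" if "h \<in> UNIV \<times> sphere 0 1" for h
      unfolding F_def using that by (intro C mult_EE_carrier p) (auto simp: carrier_motion_group2)
    have int: "integrable motion_haar (\<lambda>h. of_real (resolvent_kernel h) * F h)"
    proof (rule Bochner_Integration.integrable_bound)
      show "integrable motion_haar (\<lambda>h. of_real C * complex_of_real (resolvent_kernel h))"
        by (intro integrable_mult_right integrable_resolvent_kernel)
      show "AE h in motion_haar. norm (of_real (resolvent_kernel h) * F h) \<le> norm (of_real C * complex_of_real (resolvent_kernel h))"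
      proof (rule AE_I2)
        fix h assume "h \<in> space motion_haar"
        then have "cmod (F h) \<le> \<bar>C\<bar>"
          using FC[of h] by (auto simp: space_motion_haar_times)
        then show "norm (of_real (resolvent_kernel h) * F h) \<le> norm (of_real C * complex_of_real (resolvent_kernel h))"
          unfolding norm_mult norm_of_real by (subst mult.commute) (rule mult_right_mono, simp_all)
      qed
    qed measurable
    have int': "integrable (lborel \<Otimes>\<^sub>M circle_measure) (\<lambda>(x, z). of_real (resolvent_kernel (x, z)) * F (x, z))"
      using int by (simp add: motion_haar_def case_prod_unfold)
    interpret lc: pair_sigma_finite "lborel :: complex measure" circle_measure
      by (intro pair_sigma_finite.intro sigma_finite_lborel sigma_finite_circle)
    have inner: "exp_kernel a *\<^sub>R (exp_kernel b *\<^sub>R w2 (mult_EE (mult_EE p (translation_flow 1 a)) (translation_flow \<i> b))) =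
        (LINT z|circle_measure. of_real (resolvent_kernel (Complex a b, z)) * F (Complex a b, z))" for a b
    proof -
      let ?q = "mult_EE (mult_EE p (translation_flow 1 a)) (translation_flow \<i> b)"
      have q: "?q \<in> carrier motion_group2"
        by (intro mult_EE_carrier p translation_flow_carrier)
      \<comment> \<open>The three flow times are the real part, the imaginary part and the angle of
        one group element.\<close>
      have F_eq: "w (mult_EE ?q (rotation_flow t)) = F (Complex a b, cis t)" for t
        unfolding F_def by (simp add: mult_EE_def mult_E_def translation_flow_def rotation_flow_def Complex_eq algebra_simps)
      have mz: "(\<lambda>z. (Complex a b, z)) \<in> circle_measure \<rightarrow>\<^sub>M motion_haar"
        unfolding motion_haar_def by measurable
      have m: "(\<lambda>z. of_real (resolvent_kernel (Complex a b, z)) * F (Complex a b, z)) \<in> borel_measurable circle_measure"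
        using measurable_compose[OF mz measurable_resolvent_kernel] measurable_compose[OF mz Fm] by measurable
      have r: "c *\<^sub>R w2 ?q = (LINT t|lborel. indicator {0..2 * pi} t *\<^sub>R (exp (- t) *\<^sub>R F (Complex a b, cis t)))"
        using rotation_resolvent[OF w2 q] unfolding c_def w_def[symmetric] F_eq .
      have "(LINT z|circle_measure. of_real (resolvent_kernel (Complex a b, z)) * F (Complex a b, z)) =
         (1 / (2 * pi)) *\<^sub>R (LINT t|lborel. indicator {0..2 * pi} t *\<^sub>R (of_real (resolvent_kernel (Complex a b, cis t)) * F (Complex a b, cis t)))"
        by (rule integral_circle_measure[OF m])
      also have "(LINT t|lborel. indicator {0..2 * pi} t *\<^sub>R (of_real (resolvent_kernel (Complex a b, cis t)) * F (Complex a b, cis t))) =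
         (LINT t|lborel. (exp_kernel a * exp_kernel b * (2 * pi / c)) *\<^sub>R (indicator {0..2 * pi} t *\<^sub>R (exp (- t) *\<^sub>R F (Complex a b, cis t))))"
      proof (rule integral_cong_AE)
        \<comment> \<open>At the angle 2 pi, \<open>Arg2pi\<close> gives 0; the two sides may differ
          at this single point.\<close>
        show "AE t in lborel. indicator {0..2 * pi} t *\<^sub>R (of_real (resolvent_kernel (Complex a b, cis t)) * F (Complex a b, cis t)) =
           (exp_kernel a * exp_kernel b * (2 * pi / c)) *\<^sub>R (indicator {0..2 * pi} t *\<^sub>R (exp (- t) *\<^sub>R F (Complex a b, cis t)))"
          using AE_lborel_singleton[of "2 * pi"]
        proof eventually_elim
          case (elim t)
          show ?case
          proof (cases "t \<in> {0..2 * pi}")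
            case True
            then have "Arg2pi (cis t) = t"
              using elim by (intro Arg2pi_cis) auto
            then show ?thesis
              by (simp add: resolvent_kernel_def c_def scaleR_conv_of_real mult_ac)
          qed simp
        qed
        have mt: "(\<lambda>t. (Complex a b, cis t)) \<in> borel \<rightarrow>\<^sub>M motion_haar"
          by (rule measurable_motion_haarI) auto
        have [measurable]: "(\<lambda>t. F (Complex a b, cis t)) \<in> borel_measurable borel"
          "(\<lambda>t. resolvent_kernel (Complex a b, cis t)) \<in> borel_measurable borel"
          using measurable_compose[OF mt Fm] measurable_compose[OF mt measurable_resolvent_kernel] by auto
        show "(\<lambda>t. indicator {0..2 * pi} t *\<^sub>R (of_real (resolvent_kernel (Complex a b, cis t)) * F (Complex a b, cis t))) \<in> borel_measurable lborel"
          "(\<lambda>t. (exp_kernel a * exp_kernel b * (2 * pi / c)) *\<^sub>R (indicator {0..2 * pi} t *\<^sub>R (exp (- t) *\<^sub>R F (Complex a b, cis t)))) \<in> borel_measurable lborel"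
          by measurable
      qed
      also have "\<dots> = (exp_kernel a * exp_kernel b * (2 * pi / c)) *\<^sub>R (c *\<^sub>R w2 ?q)"
        unfolding r by (rule integral_scaleR_right)
      finally show ?thesis
        using c by simp
    qed
    have "u p = (LINT a|lborel. exp_kernel a *\<^sub>R w1 (mult_EE p (translation_flow 1 a)))"
      using translation_resolvent[OF u _ p, of 1] by (simp add: w1_def)
    also have "\<dots> = (LINT a|lborel. LINT b|lborel. exp_kernel a *\<^sub>R (exp_kernel b *\<^sub>R w2 (mult_EE (mult_EE p (translation_flow 1 a)) (translation_flow \<i> b))))"
    proof (rule Bochner_Integration.integral_cong)
      fix a
      have "w1 (mult_EE p (translation_flow 1 a)) = (LINT b|lborel. exp_kernel b *\<^sub>R w2 (mult_EE (mult_EE p (translation_flow 1 a)) (translation_flow \<i> b)))"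
        using translation_resolvent[OF w1 _ mult_EE_carrier[OF p translation_flow_carrier], of \<i> 1 a] by (simp add: w2_def)
      then show "exp_kernel a *\<^sub>R w1 (mult_EE p (translation_flow 1 a)) = (LINT b|lborel. exp_kernel a *\<^sub>R (exp_kernel b *\<^sub>R w2 (mult_EE (mult_EE p (translation_flow 1 a)) (translation_flow \<i> b))))"
        by (simp only: integral_scaleR_right)
    qed simp
    also have "\<dots> = (LINT x|lborel. LINT z|circle_measure. of_real (resolvent_kernel (x, z)) * F (x, z))"
      unfolding inner by (rule integral_lborel_complex[symmetric], rule lc.integrable_fst[OF int'])
    also have "\<dots> = (LINT h|motion_haar. of_real (resolvent_kernel h) * F h)"
      using lc.integral_fst'[OF int'] by (simp add: motion_haar_def case_prod_unfold)
    finally show ?thesis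
      by (simp add: F_def)
  qed
  then show ?thesis
    using that w by blast
qed

section \<open>Writing a test function as a matrix coefficient\<close>

lemma mult_EE_assoc: "mult_EE (mult_EE g h) k = mult_EE g (mult_EE h k)"
  by (simp add: mult_EE_def mult_E_def algebra_simps)

definition haar_box :: "real \<Rightarrow> ((complex \<times> complex) \<times> (complex \<times> complex)) set" where
  "haar_box R = (cball 0 R \<times> sphere 0 1) \<times> (cball 0 R \<times> sphere 0 1)"

lemma haar_box_half: "cball 0 R \<times> sphere 0 1 \<in> sets motion_haar" "emeasure motion_haar (cball 0 R \<times> sphere 0 1) < \<infinity>"
proof -
  have sp: "sphere (0::complex) 1 \<in> sets circle_measure"
    using sets.top[of circle_measure] by simp
  then show "cball 0 R \<times> sphere 0 1 \<in> sets motion_haar"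
    unfolding motion_haar_def by (intro pair_measureI) auto
  have "emeasure motion_haar (cball 0 R \<times> sphere 0 1) = emeasure lborel (cball (0::complex) R) * emeasure circle_measure (space circle_measure)"
    unfolding motion_haar_def by (subst circle.emeasure_pair_measure_Times) (use sp in auto)
  also have "\<dots> < \<infinity>"
    unfolding circle.emeasure_space_1 using emeasure_lborel_cball_finite[of "0::complex" R] by simp
  finally show "emeasure motion_haar (cball 0 R \<times> sphere 0 1) < \<infinity>" .
qed

lemma sets_haar_box: "haar_box R \<in> sets motion_haar2"
  unfolding haar_box_def by (intro pair_measureI haar_box_half)

lemma emeasure_haar_box_finite: "emeasure motion_haar2 (haar_box R) < \<infinity>"
proof -
  have "emeasure motion_haar2 (haar_box R) = emeasure motion_haar (cball 0 R \<times> sphere 0 1) * emeasure motion_haar (cball 0 R \<times> sphere 0 1)"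
    unfolding haar_box_def by (intro sigma_finite_measure.emeasure_pair_measure_Times sigma_finite_motion_haar haar_box_half)
  also have "\<dots> < \<infinity>"
    using haar_box_half(2) by (simp add: ennreal_mult_less_top)
  finally show ?thesis .
qed

text \<open>The resolvents in both factors give u(g) as the integral of K(h) w(g h), which by left
  invariance is the integral of K(g^-1 h) w(h), a coefficient at \<open>K\<close> and the conjugate
  of \<open>w\<close>. The kernel is bounded and integrable, hence in L2; \<open>w\<close> is
  bounded with support of finite measure. Without such a representation the value of
  \<open>VN_apply\<close> at a test function would be meaningless.\<close>

lemma coefficient_smooth_bounded_support:
  assumes u: "u \<in> smooth_bounded_support"
  obtains \<xi> \<eta> where "is_coefficient motion_group2 motion_haar2 u \<xi> \<eta>"
proof -
  let ?k = "\<lambda>h. complex_of_real (resolvent_kernel h)"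
  obtain w1 where w1: "w1 \<in> smooth_bounded_support"
    and u_eq: "\<And>p. p \<in> carrier motion_group2 \<Longrightarrow> u p = (LINT h|motion_haar. ?k h * w1 (mult_EE p (h, (0, 1))))"
    using first_factor_resolvent[OF u] by blast
  obtain w2 where w2: "w2 \<in> smooth_bounded_support"
    and w1_eq: "\<And>p. p \<in> carrier motion_group2 \<Longrightarrow> w1 (prod.swap p) = (LINT h|motion_haar. ?k h * w2 (mult_EE p (h, (0, 1))))"
    using first_factor_resolvent[OF smooth_bounded_support_swap[OF w1]] by blast
  define w where "w p = w2 (prod.swap p)" for p
  have w: "w \<in> smooth_bounded_support"
    unfolding w_def[abs_def] by (rule smooth_bounded_support_swap[OF w2])
  obtain C where C: "\<And>p. p \<in> carrier motion_group2 \<Longrightarrow> cmod (w p) \<le> C"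
    using smooth_bounded_support_bounded[OF w] by blast
  note wm [measurable] = smooth_bounded_support_measurable[OF w]
  \<comment> \<open>The resolvent in the second factor is the one in the first factor conjugated
    with the exchange of the factors.\<close>
  have swap_mult: "mult_EE (prod.swap p) (h, (0, 1)) = prod.swap (mult_EE p ((0, 1), h))" for p h
    by (simp add: mult_EE_def)
  have swap_carrier: "prod.swap p \<in> carrier motion_group2" if "p \<in> carrier motion_group2" for p
    using that by (auto simp: carrier_motion_group2)
  have w1_eq': "w1 p = (LINT h|motion_haar. ?k h * w (mult_EE p ((0, 1), h)))" if "p \<in> carrier motion_group2" for p
    using w1_eq[OF swap_carrier[OF that]] by (simp add: swap_mult w_def)
  define K where "K h = ?k (fst h) * ?k (snd h)" for h
  have Km [measurable]: "K \<in> borel_measurable motion_haar2"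
    unfolding K_def[abs_def] by measurable
  have Kint: "integrable motion_haar2 K"
    using integrable_pair_mult[OF sigma_finite_motion_haar sigma_finite_motion_haar integrable_resolvent_kernel integrable_resolvent_kernel]
    by (simp add: K_def[abs_def] case_prod_unfold)
  have KL2: "K \<in> L2 motion_haar2"
    unfolding L2_def
  proof (intro CollectI conjI Km)
    define B where "B = (2 * pi / (1 - exp (- 2 * pi)))\<^sup>2"
    have "cmod (K h) \<le> B" for h
      unfolding K_def B_def norm_mult norm_of_real power2_eq_square
      using resolvent_kernel_bounds by (intro mult_mono) auto
    then have KB: "norm ((cmod (K h))\<^sup>2) \<le> norm (of_real B * K h)" for h
      using mult_right_mono[of "cmod (K h)" "\<bar>B\<bar>" "cmod (K h)"] abs_ge_self[of B] order_trans[of "cmod (K h)" B "\<bar>B\<bar>"]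
      by (simp add: norm_mult power2_eq_square)
    show "integrable motion_haar2 (\<lambda>h. (cmod (K h))\<^sup>2)"
    proof (rule Bochner_Integration.integrable_bound)
      show "integrable motion_haar2 (\<lambda>h. of_real B * K h)"
        using Kint by (rule integrable_mult_right)
      show "AE h in motion_haar2. norm ((cmod (K h))\<^sup>2) \<le> norm (of_real B * K h)"
        by (intro AE_I2 KB)
    qed measurable
  qed
  have wL2: "(\<lambda>h. cnj (w h)) \<in> L2 motion_haar2"
  proof -
    obtain R where R: "\<And>q. norm (fst (fst q)) > R \<or> norm (fst (snd q)) > R \<Longrightarrow> w (chart q) = 0"
      using w unfolding smooth_bounded_support_def by blast
    have w0: "w p = 0" if "p \<in> carrier motion_group2" "p \<notin> haar_box R" for p
    proof -
      have "norm (fst (fst (chart_inv p))) > R \<or> norm (fst (snd (chart_inv p))) > R"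
        using that by (auto simp: haar_box_def chart_inv_def carrier_motion_group2 mem_Times_iff)
      then show ?thesis
        using R[of "chart_inv p"] by (simp add: chart_chart_inv[OF that(1)])
    qed
    note [measurable] = sets_haar_box[of R]
    have "integrable motion_haar2 (\<lambda>h. (cmod (cnj (w h)))\<^sup>2)"
    proof (rule Bochner_Integration.integrable_bound)
      show "integrable motion_haar2 (\<lambda>h. C\<^sup>2 * indicator (haar_box R) h :: real)"
        by (intro integrable_mult_right integrable_real_indicator sets_haar_box emeasure_haar_box_finite)
      show "AE h in motion_haar2. norm ((cmod (cnj (w h)))\<^sup>2) \<le> norm (C\<^sup>2 * indicator (haar_box R) h :: real)"
        using w0 C by (intro AE_I2) (auto simp: space_motion_haar2 split: split_indicator intro: power_mono)
    qed measurable
    then show ?thesis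
      by (simp add: L2_def)
  qed
  have "u g = L2_inner motion_haar2 (left_regular motion_group2 g K) (\<lambda>h. cnj (w h))" if g: "g \<in> carrier motion_group2" for g
  proof -
    define F where "F h = w (mult_EE g h)" for h
    have Fm [measurable]: "F \<in> borel_measurable motion_haar2"
      unfolding F_def[abs_def] by (rule measurable_compose[OF measurable_mult_EE_left[OF g] wm])
    have int: "integrable motion_haar2 (\<lambda>h. K h * F h)"
    proof (rule Bochner_Integration.integrable_bound)
      show "integrable motion_haar2 (\<lambda>h. of_real C * K h)"
        by (intro integrable_mult_right Kint)
      show "AE h in motion_haar2. norm (K h * F h) \<le> norm (of_real C * K h)"
      proof (rule AE_I2)
        fix h assume "h \<in> space motion_haar2"
        then have "cmod (F h) \<le> \<bar>C\<bar>"
          using C[OF mult_EE_carrier[OF g, of h]] by (simp add: F_def space_motion_haar2)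
        then show "norm (K h * F h) \<le> norm (of_real C * K h)"
          unfolding norm_mult norm_of_real by (subst mult.commute) (rule mult_right_mono, simp_all)
      qed
    qed measurable
    interpret mm: pair_sigma_finite motion_haar motion_haar
      by (intro pair_sigma_finite.intro sigma_finite_motion_haar)
    have "u g = (LINT h1|motion_haar. LINT h2|motion_haar. K (h1, h2) * F (h1, h2))"
      unfolding u_eq[OF g]
    proof (rule Bochner_Integration.integral_cong)
      fix h1 assume "h1 \<in> space motion_haar"
      then have c: "mult_EE g (h1, (0, 1)) \<in> carrier motion_group2"
        by (intro mult_EE_carrier g) (auto simp: carrier_motion_group2 space_motion_haar_times)
      have "mult_EE (mult_EE g (h1, (0, 1))) ((0, 1), h2) = mult_EE g (h1, h2)" for h2
        by (simp add: mult_EE_assoc) (simp add: mult_EE_def mult_E_def)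
      then have "w1 (mult_EE g (h1, (0, 1))) = (LINT h2|motion_haar. ?k h2 * F (h1, h2))"
        using w1_eq'[OF c] by (simp add: F_def)
      then show "?k h1 * w1 (mult_EE g (h1, (0, 1))) = (LINT h2|motion_haar. K (h1, h2) * F (h1, h2))"
        by (simp add: K_def mult.assoc)
    qed simp
    also have "\<dots> = (LINT h|motion_haar2. K h * F h)"
      using mm.integral_fst'[OF int] .
    \<comment> \<open>Writing \<open>h\<close> as g^-1 (g h) prepares the substitution of
      \<open>h\<close> for g h, which moves g from the argument of \<open>w\<close> to that of
      \<open>K\<close>.\<close>
    also have "\<dots> = (LINT h|motion_haar2. K (mult_EE (inv_EE g) (mult_EE g h)) * w (mult_EE g h))"
      by (simp add: F_def mult_EE_inv[OF g])
    also have "\<dots> = (LINT h|motion_haar2. K (mult_EE (inv_EE g) h) * w h)"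
      by (rule integral_mult_EE[OF g, where f="\<lambda>h. K (mult_EE (inv_EE g) h) * w h"])
         (intro borel_measurable_times wm measurable_compose[OF measurable_mult_EE_left[OF inv_EE_carrier[OF g]] Km])
    finally show ?thesis
      by (simp add: L2_inner_def left_regular_eq[OF g])
  qed
  then have "is_coefficient motion_group2 motion_haar2 u K (\<lambda>h. cnj (w h))"
    using KL2 wL2 by (simp add: is_coefficient_def)
  then show ?thesis ..
qed

lemma borel_measurable_fst [measurable (raw)]:
  fixes f :: "'a \<Rightarrow> 'b::topological_space \<times> 'c::topological_space"
  shows "f \<in> borel_measurable M \<Longrightarrow> (\<lambda>x. fst (f x)) \<in> borel_measurable M"
  by (rule borel_measurable_continuous_on) (intro continuous_intros)

lemma borel_measurable_snd [measurable (raw)]: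
  fixes f :: "'a \<Rightarrow> 'b::topological_space \<times> 'c::topological_space"
  shows "f \<in> borel_measurable M \<Longrightarrow> (\<lambda>x. snd (f x)) \<in> borel_measurable M"
  by (rule borel_measurable_continuous_on) (intro continuous_intros)

section \<open>The Schur test\<close>

text \<open>Jordan's inequality with a crude constant: up to pi/3 the derivative of the sine is at
  least 1/2, and beyond it the sine is at least 1/2 while a quarter of the angle stays below
  that.\<close>

lemma abs_sin_ge:
  fixes x :: real
  assumes "\<bar>x\<bar> \<le> pi / 2"
  shows "\<bar>x\<bar> / 4 \<le> \<bar>sin x\<bar>"
proof -
  have pos: "x / 4 \<le> sin x" if x: "0 \<le> x" "x \<le> pi / 2" for x :: real
  proof (cases "x \<le> pi / 3")
    case True
    have "sin 0 - 0 / 4 \<le> sin x - x / 4"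
    proof (rule DERIV_nonneg_imp_nondecreasing[OF x(1)])
      fix y assume y: "0 \<le> y" "y \<le> x"
      have "1 / 2 \<le> cos y"
        using y True cos_monotone_0_pi_le[of y "pi / 3"] by (simp add: cos_60)
      then show "\<exists>D. ((\<lambda>t. sin t - t / 4) has_real_derivative D) (at y) \<and> 0 \<le> D"
        by (intro exI[of _ "cos y - 1 / 4"]) (auto intro!: derivative_eq_intros)
    qed
    then show ?thesis by simp
  next
    case False
    have "x / 4 \<le> 1 / 2"
      using x pi_less_4 by simp
    also have "(1::real) / 2 = sin (pi / 6)"
      by (simp add: sin_30)
    also have "\<dots> \<le> sin x"
      using False x by (intro sin_monotone_2pi_le) auto
    finally show ?thesis .
  qed
  show ?thesis
  proof (cases "x \<ge> 0")
    case True
    then show ?thesis using pos[of x] assms by auto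
  next
    case False
    then show ?thesis using pos[of "- x"] assms by auto
  qed
qed

text \<open>The integrand has peaks of height r and width about 1/r at the zeros 0, pi and 2 pi of
  the sine. Each is dominated by a multiple of a Cauchy density, \<open>g a\<close>, whose integral
  is at most 4 pi whatever \<open>r\<close> is; three of them, divided by the length 2 pi of the
  circle, give 6.\<close>

lemma nn_integral_circle_angular_bound:
  assumes r: "r \<ge> 0"
  shows "(\<integral>\<^sup>+z. ennreal (r / (1 + r\<^sup>2 * (Im z)\<^sup>2)) \<partial>circle_measure) \<le> 6"
proof -
  define g where "g a t = r / (1 + (r / 4)\<^sup>2 * (t - a)\<^sup>2)" for a t :: real
  have g0: "g a t \<ge> 0" for a t
    unfolding g_def using r by (intro divide_nonneg_nonneg) auto
  have den: "1 + (r / 4)\<^sup>2 * y > 0" if "y \<ge> 0" for y :: real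
    using that by (intro add_pos_nonneg) auto
  have near: "r / (1 + r\<^sup>2 * (sin t)\<^sup>2) \<le> g a t" if "\<bar>t - a\<bar> / 4 \<le> \<bar>sin t\<bar>" for a t
  proof -
    have "(\<bar>t - a\<bar> / 4)\<^sup>2 \<le> \<bar>sin t\<bar>\<^sup>2"
      using that by (intro power_mono) auto
    then have "r\<^sup>2 * ((t - a)\<^sup>2 / 16) \<le> r\<^sup>2 * (sin t)\<^sup>2"
      by (intro mult_left_mono) (simp_all add: power_divide)
    then have "1 + (r / 4)\<^sup>2 * (t - a)\<^sup>2 \<le> 1 + r\<^sup>2 * (sin t)\<^sup>2"
      by (simp add: power_divide)
    then show ?thesis
      unfolding g_def using r den[of "(t - a)\<^sup>2"] by (intro divide_left_mono mult_pos_pos) auto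
  qed
  have le: "r / (1 + r\<^sup>2 * (sin t)\<^sup>2) \<le> g 0 t + g pi t + g (2 * pi) t" if t: "0 \<le> t" "t \<le> 2 * pi" for t
  proof -
    consider "t \<le> pi / 2" | "pi / 2 \<le> t" "t \<le> 3 * pi / 2" | "3 * pi / 2 \<le> t"
      by linarith
    then show ?thesis
    proof cases
      case 1
      then have "r / (1 + r\<^sup>2 * (sin t)\<^sup>2) \<le> g 0 t"
        using t abs_sin_ge[of t] by (intro near) simp
      then show ?thesis using g0[of pi t] g0[of "2 * pi" t] by linarith
    next
      case 2
      have "\<bar>sin (t - pi)\<bar> = \<bar>sin t\<bar>" by (simp add: sin_diff)
      moreover have "\<bar>t - pi\<bar> \<le> pi / 2"
        unfolding abs_le_iff using 2 by (intro conjI; linarith)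
      ultimately have "r / (1 + r\<^sup>2 * (sin t)\<^sup>2) \<le> g pi t"
        using abs_sin_ge[of "t - pi"] by (intro near) simp
      then show ?thesis using g0[of 0 t] g0[of "2 * pi" t] by linarith
    next
      case 3
      have "\<bar>sin (t - 2 * pi)\<bar> = \<bar>sin t\<bar>" by (simp add: sin_diff)
      moreover have "\<bar>t - 2 * pi\<bar> \<le> pi / 2"
        unfolding abs_le_iff using 3 t by (intro conjI; linarith)
      ultimately have "r / (1 + r\<^sup>2 * (sin t)\<^sup>2) \<le> g (2 * pi) t"
        using abs_sin_ge[of "t - 2 * pi"] by (intro near) simp
      then show ?thesis using g0[of 0 t] g0[of pi t] by linarith
    qed
  qed
  define G where "G a t = 4 * arctan (r / 4 * (t - a))" for a t :: real
  have dG: "(G a has_real_derivative g a t) (at t)" for a t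
  proof -
    have "((\<lambda>t. 4 * arctan (r / 4 * (t - a))) has_real_derivative 4 * (inverse (1 + (r / 4 * (t - a))\<^sup>2) * (r / 4))) (at t)"
      by (rule derivative_eq_intros refl | simp)+
    moreover have "4 * (inverse X * (r / 4)) = r / X" for X
      by (cases "X = 0") (simp_all add: field_simps)
    ultimately show ?thesis
      unfolding G_def[abs_def] g_def power_mult_distrib[symmetric] by simp
  qed
  have Gb: "G a (2 * pi) - G a 0 \<le> 4 * pi" for a
    unfolding G_def using arctan_ubound[of "r / 4 * (2 * pi - a)"] arctan_lbound[of "r / 4 * (0 - a)"] by linarith
  have "(\<integral>\<^sup>+z. ennreal (r / (1 + r\<^sup>2 * (Im z)\<^sup>2)) \<partial>circle_measure) =
     (\<integral>\<^sup>+t. ennreal (r / (1 + r\<^sup>2 * (sin t)\<^sup>2)) * indicator {0..<2 * pi} t \<partial>lborel) / ennreal (2 * pi)"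
    by (subst nn_integral_circle_measure) auto
  note circ = this
  have "(\<integral>\<^sup>+t. ennreal (r / (1 + r\<^sup>2 * (sin t)\<^sup>2)) * indicator {0..<2 * pi} t \<partial>lborel) \<le>
      (\<integral>\<^sup>+t. ennreal (g 0 t + g pi t + g (2 * pi) t) * indicator {0..2 * pi} t \<partial>lborel)"
    using le by (intro nn_integral_mono) (auto split: split_indicator intro: ennreal_leI)
  also have "\<dots> = ennreal ((G 0 (2 * pi) + G pi (2 * pi) + G (2 * pi) (2 * pi)) - (G 0 0 + G pi 0 + G (2 * pi) 0))"
  proof (rule nn_integral_FTC_Icc[where f="\<lambda>t. g 0 t + g pi t + g (2 * pi) t" and F="\<lambda>t. G 0 t + G pi t + G (2 * pi) t" and a=0 and b="2 * pi"])
    show "(\<lambda>t. g 0 t + g pi t + g (2 * pi) t) \<in> borel_measurable borel"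
    proof -
      have "continuous_on UNIV (g a)" for a
      proof -
        have "1 + (r / 4)\<^sup>2 * (t - a)\<^sup>2 \<noteq> 0" for t
          using den[of "(t - a)\<^sup>2"] by simp
        then show ?thesis
          unfolding g_def[abs_def] by (intro continuous_on_divide continuous_intros) auto
      qed
      then have "g a \<in> borel_measurable borel" for a
        by (rule borel_measurable_continuous_onI)
      then show ?thesis
        by (intro borel_measurable_add)
    qed
    show "((\<lambda>t. G 0 t + G pi t + G (2 * pi) t) has_real_derivative g 0 x + g pi x + g (2 * pi) x) (at x)" for x
      by (intro DERIV_add dG)
    show "0 \<le> g 0 x + g pi x + g (2 * pi) x" for x
      using g0[of 0 x] g0[of pi x] g0[of "2 * pi" x] by linarith
  qed auto
  also have "\<dots> \<le> ennreal (12 * pi)"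
    using Gb[of 0] Gb[of pi] Gb[of "2 * pi"] by (intro ennreal_leI) linarith
  finally have "(\<integral>\<^sup>+z. ennreal (r / (1 + r\<^sup>2 * (Im z)\<^sup>2)) \<partial>circle_measure) \<le> ennreal (12 * pi) / ennreal (2 * pi)"
    unfolding circ by (rule divide_right_mono_ennreal)
  also have "\<dots> = 6"
    by (subst divide_ennreal) auto
  finally show ?thesis .
qed

lemma nn_integral_circle_rotate:
  assumes "cmod w = 1" and f: "f \<in> borel_measurable circle_measure"
  shows "(\<integral>\<^sup>+z. f (w * z) \<partial>circle_measure) = (\<integral>\<^sup>+z. f z \<partial>circle_measure)"
proof -
  have m: "(\<lambda>z. w * z) \<in> circle_measure \<rightarrow>\<^sub>M circle_measure"
    using assms by (intro measurable_circleI) (auto simp: norm_mult)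
  have "(\<integral>\<^sup>+z. f z \<partial>circle_measure) = (\<integral>\<^sup>+z. f z \<partial>distr circle_measure circle_measure (\<lambda>z. w * z))"
    by (simp only: distr_circle_rotate[OF assms(1)])
  also have "\<dots> = (\<integral>\<^sup>+z. f (w * z) \<partial>circle_measure)"
    using m by (rule nn_integral_distr) (simp add: f)
  finally show ?thesis ..
qed

text \<open>Both orders of the arguments are needed: they are the row and the column of the Schur test. The
  distance from \<open>r\<close> times a unit vector to a point on a line through the origin is at least \<open>r\<close> times
  the sine of the enclosed angle, whatever the position of the point on the line.\<close>

lemma nn_integral_circle_kernel_bound:
  shows "(\<integral>\<^sup>+z. ennreal (cmod k / (1 + (cmod (k - z * l))\<^sup>2)) \<partial>circle_measure) \<le> 6" (is ?A)
    and "(\<integral>\<^sup>+z. ennreal (cmod k / (1 + (cmod (z * k - l))\<^sup>2)) \<partial>circle_measure) \<le> 6" (is ?B)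
proof -
  define r s \<alpha> \<beta> where "r = cmod k" and "s = cmod l" and "\<alpha> = Arg k" and "\<beta> = Arg l"
  have k: "k = r * cis \<alpha>" and l: "l = s * cis \<beta>"
    using rcis_cmod_Arg[of k] rcis_cmod_Arg[of l] by (simp_all add: r_def s_def \<alpha>_def \<beta>_def rcis_def)
  have r: "r \<ge> 0" by (simp add: r_def)
  \<comment> \<open>It suffices to bound the distance from below by \<open>r\<close> times the sine
    of an angle that differs from that of z by a constant; the constant \<open>w\<close> disappears
    by rotation invariance.\<close>
  have red: "(\<integral>\<^sup>+z. ennreal (cmod k / (1 + (D z)\<^sup>2)) \<partial>circle_measure) \<le> 6"
    if w: "cmod w = 1" and D: "\<And>z. cmod z = 1 \<Longrightarrow> r * \<bar>Im (w * z)\<bar> \<le> D z" for w :: complex and D :: "complex \<Rightarrow> real"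
  proof -
    have "(\<integral>\<^sup>+z. ennreal (cmod k / (1 + (D z)\<^sup>2)) \<partial>circle_measure) \<le> (\<integral>\<^sup>+z. ennreal (r / (1 + r\<^sup>2 * (Im (w * z))\<^sup>2)) \<partial>circle_measure)"
    proof (intro nn_integral_mono ennreal_leI)
      fix z assume "z \<in> space circle_measure"
      then have "(r * \<bar>Im (w * z)\<bar>)\<^sup>2 \<le> (D z)\<^sup>2"
        using r by (intro power_mono D) auto
      then have "1 + r\<^sup>2 * (Im (w * z))\<^sup>2 \<le> 1 + (D z)\<^sup>2"
        by (simp add: power_mult_distrib)
      moreover have "0 < 1 + r\<^sup>2 * (Im (w * z))\<^sup>2"
        by (intro add_pos_nonneg) auto
      ultimately show "cmod k / (1 + (D z)\<^sup>2) \<le> r / (1 + r\<^sup>2 * (Im (w * z))\<^sup>2)"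
        unfolding r_def[symmetric] using r by (intro divide_left_mono mult_pos_pos) auto
    qed
    also have "\<dots> = (\<integral>\<^sup>+z. ennreal (r / (1 + r\<^sup>2 * (Im z)\<^sup>2)) \<partial>circle_measure)"
      using w by (rule nn_integral_circle_rotate[where f="\<lambda>z. ennreal (r / (1 + r\<^sup>2 * (Im z)\<^sup>2))"]) measurable
    also have "\<dots> \<le> 6"
      by (rule nn_integral_circle_angular_bound[OF r])
    finally show ?thesis .
  qed
  show ?A
  proof (rule red[of "cis (\<beta> - \<alpha>)"])
    fix z :: complex assume z: "cmod z = 1"
    define \<zeta> where "\<zeta> = cis (\<beta> - \<alpha>) * z"
    have \<zeta>: "cmod \<zeta> = 1" using z by (simp add: \<zeta>_def norm_mult)
    have "k - z * l = cis \<alpha> * (r - s * \<zeta>)"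
      by (simp add: k l \<zeta>_def algebra_simps cis_mult)
    \<comment> \<open>Multiplication by the unit number \<open>cnj \<zeta>\<close> moves the
      rotation from the second term to the first one. The imaginary part then sees only
      \<open>r\<close>, and \<open>s\<close> drops out.\<close>
    then have "cmod (k - z * l) = cmod (cnj \<zeta>) * cmod (r - s * \<zeta>)"
      using \<zeta> by (simp add: norm_mult)
    also have "\<dots> = cmod (r * cnj \<zeta> - s * (cnj \<zeta> * \<zeta>))"
      unfolding norm_mult[symmetric] by (simp only: right_diff_distrib mult_ac)
    also have "\<dots> = cmod (r * cnj \<zeta> - s)"
      unfolding cnj_mult_unit[OF \<zeta>] by simp
    also have "\<dots> \<ge> \<bar>Im (r * cnj \<zeta> - s)\<bar>"
      by (rule abs_Im_le_cmod)
    finally show "r * \<bar>Im (cis (\<beta> - \<alpha>) * z)\<bar> \<le> cmod (k - z * l)"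
      unfolding \<zeta>_def[symmetric] using r by (simp add: abs_mult)
  qed simp
  show ?B
  proof (rule red[of "cis (\<alpha> - \<beta>)"])
    fix z :: complex assume z: "cmod z = 1"
    let ?\<zeta> = "cis (\<alpha> - \<beta>) * z"
    have "z * k - l = cis \<beta> * (r * ?\<zeta> - s)"
      by (simp add: k l algebra_simps cis_mult)
    then have "cmod (z * k - l) = cmod (r * ?\<zeta> - s)"
      by (simp add: norm_mult)
    also have "\<dots> \<ge> \<bar>Im (r * ?\<zeta> - s)\<bar>"
      by (rule abs_Im_le_cmod)
    finally show "r * \<bar>Im ?\<zeta>\<bar> \<le> cmod (z * k - l)"
      using r by (simp add: abs_mult)
  qed simp
qed

text \<open>The linear part of the inverse of a group element with rotations
  \<open>(z, cnj z)\<close>. The same formula describes its action on the translations and on the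
  rotations.\<close>

definition twist :: "complex \<Rightarrow> complex \<times> complex \<Rightarrow> complex \<times> complex" where
  "twist z y = (cnj z * fst y, z * snd y)"

lemma linear_twist: "linear (twist z)"
  by (rule linearI) (auto simp: twist_def algebra_simps scaleR_conv_of_real)

lemma norm_twist: "cmod z = 1 \<Longrightarrow> norm (twist z y) = norm y"
  by (cases y) (simp add: twist_def norm_Pair norm_mult)

lemma twist_twist_cnj: "cmod z = 1 \<Longrightarrow> twist z (twist (cnj z) y) = y" "cmod z = 1 \<Longrightarrow> twist (cnj z) (twist z y) = y"
  by (simp_all add: twist_def cnj_mult_unit mult_cnj_unit flip: mult.assoc)

lemma distr_lborel_twist: "cmod z = 1 \<Longrightarrow> distr lborel lborel (twist z) = lborel"
  by (rule distr_lborel_isometry[where S="twist (cnj z)"]) (auto simp: linear_twist norm_twist twist_twist_cnj)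

lemma measurable_twist [measurable]: "twist z \<in> borel_measurable borel"
  unfolding twist_def[abs_def] by measurable

lemma measurable_twist_circle2:
  assumes z: "cmod z = 1"
  shows "twist z \<in> circle2 \<rightarrow>\<^sub>M circle2"
  unfolding twist_def[abs_def]
proof (rule measurable_Pair)
  show "(\<lambda>x. cnj z * fst x) \<in> circle2 \<rightarrow>\<^sub>M circle_measure"
    using z measurable_circleD[OF measurable_fst]
    by (intro measurable_circleI borel_measurable_times) (auto simp: norm_mult space_pair_measure)
  show "(\<lambda>x. z * snd x) \<in> circle2 \<rightarrow>\<^sub>M circle_measure"
    using z measurable_circleD[OF measurable_snd]
    by (intro measurable_circleI borel_measurable_times) (auto simp: norm_mult space_pair_measure)
qed

lemma distr_circle2_twist:
  assumes z: "cmod z = 1"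
  shows "distr circle2 circle2 (twist z) = circle2"
proof -
  have m: "(\<lambda>x. w * x) \<in> circle_measure \<rightarrow>\<^sub>M circle_measure" if "cmod w = 1" for w
    using that by (intro measurable_circleI) (auto simp: norm_mult)
  have "distr circle_measure circle_measure (\<lambda>x. cnj z * x) \<Otimes>\<^sub>M distr circle_measure circle_measure (\<lambda>x. z * x) =
      distr circle2 circle2 (\<lambda>(x, y). (cnj z * x, z * y))"
    using z by (intro pair_measure_distr m) (auto simp: distr_circle_rotate sigma_finite_circle)
  moreover have "(\<lambda>(x, y). (cnj z * x, z * y)) = twist z"
    by (auto simp: twist_def fun_eq_iff)
  ultimately show ?thesis
    using z by (simp add: distr_circle_rotate)
qed

lemma nn_integral_haar_split_twist:
  assumes z: "cmod z = 1" and f: "f \<in> borel_measurable haar_split"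
  shows "(\<integral>\<^sup>+p. f (twist z (fst p), twist z (snd p)) \<partial>haar_split) = (\<integral>\<^sup>+p. f p \<partial>haar_split)"
proof -
  have "distr lborel lborel (twist z) \<Otimes>\<^sub>M distr circle2 circle2 (twist z) =
      distr haar_split haar_split (\<lambda>(x, y). (twist z x, twist z y))"
    using z measurable_twist_circle2[OF z]
    by (intro pair_measure_distr) (auto simp: distr_circle2_twist sigma_finite_circle2)
  then have d: "distr haar_split haar_split (\<lambda>p. (twist z (fst p), twist z (snd p))) = haar_split"
    using z by (simp add: distr_circle2_twist distr_lborel_twist case_prod_unfold)
  have m: "(\<lambda>p. (twist z (fst p), twist z (snd p))) \<in> haar_split \<rightarrow>\<^sub>M haar_split"
    using measurable_compose[OF measurable_snd measurable_twist_circle2[OF z]]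
      measurable_compose[OF measurable_fst, of "twist z" lborel lborel]
    by (intro measurable_Pair) auto
  have "(\<integral>\<^sup>+p. f p \<partial>haar_split) = (\<integral>\<^sup>+p. f p \<partial>distr haar_split haar_split (\<lambda>p. (twist z (fst p), twist z (snd p))))"
    by (simp only: d)
  also have "\<dots> = (\<integral>\<^sup>+p. f (twist z (fst p), twist z (snd p)) \<partial>haar_split)"
    using m by (rule nn_integral_distr) (simp add: f)
  finally show ?thesis ..
qed

lemma measurable_twist_haar_split:
  "(\<lambda>(z, p). (twist z (fst p), twist z (snd p))) \<in> circle_measure \<Otimes>\<^sub>M haar_split \<rightarrow>\<^sub>M haar_split"
proof -
  have 1: "(\<lambda>q. fst q) \<in> borel_measurable (circle_measure \<Otimes>\<^sub>M haar_split)"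
    "(\<lambda>q. fst (snd (snd q))) \<in> borel_measurable (circle_measure \<Otimes>\<^sub>M haar_split)"
    "(\<lambda>q. snd (snd (snd q))) \<in> borel_measurable (circle_measure \<Otimes>\<^sub>M haar_split)"
    by (rule measurable_circleD, measurable)+
  have 2: "(\<lambda>q. fst (snd q)) \<in> borel_measurable (circle_measure \<Otimes>\<^sub>M haar_split)"
    using measurable_compose[OF measurable_snd measurable_fst, of circle_measure lborel circle2] by simp
  note [measurable] = 1 2
  have "(\<lambda>q. twist (fst q) (fst (snd q))) \<in> borel_measurable (circle_measure \<Otimes>\<^sub>M haar_split)"
    unfolding twist_def by measurable
  moreover have "(\<lambda>q. twist (fst q) (snd (snd q))) \<in> circle_measure \<Otimes>\<^sub>M haar_split \<rightarrow>\<^sub>M circle2"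
    unfolding twist_def
    by (intro measurable_Pair measurable_circleI) (auto simp: space_pair_measure norm_mult)
  ultimately show ?thesis
    unfolding case_prod_unfold by (intro measurable_Pair) auto
qed

text \<open>The numerator is the cost of one derivative in the first translation, the fraction the
  Fourier decay of a function in \<open>H21\<close> at the frequency met in
  \<open>inner_base_point\<close>.\<close>

definition schur_kernel :: "complex \<Rightarrow> complex \<times> complex \<Rightarrow> real" where
  "schur_kernel z \<kappa> = cmod (fst \<kappa>) / (1 + (cmod (fst \<kappa> - z * snd \<kappa>))\<^sup>2)"

lemma schur_kernel_nonneg: "0 \<le> schur_kernel z \<kappa>"
  unfolding schur_kernel_def by (intro divide_nonneg_nonneg) auto

text \<open>Undoing the twist moves the rotation from the second frequency to the first, which is
  the other order of arguments in the circle bound.\<close>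

lemma schur_kernel_twist_cnj:
  assumes "cmod z = 1"
  shows "schur_kernel z (twist (cnj z) \<kappa>) = cmod (fst \<kappa>) / (1 + (cmod (z * fst \<kappa> - snd \<kappa>))\<^sup>2)"
  using assms by (simp add: schur_kernel_def twist_def norm_mult mult_cnj_unit flip: mult.assoc)

text \<open>Cauchy--Schwarz with the kernel as weight; one factor is integrated over \<open>z\<close> first as it stands,
  the other one after the measure preserving substitution of \<open>twist (cnj z)\<close>.\<close>

lemma schur_test:
  assumes \<Phi> [measurable]: "\<Phi> \<in> borel_measurable haar_split" and \<Psi> [measurable]: "\<Psi> \<in> borel_measurable haar_split"
    and \<Phi>0: "\<And>p. (0::real) \<le> \<Phi> p" and \<Psi>0: "\<And>p. (0::real) \<le> \<Psi> p"
    and \<Phi>A: "(\<integral>\<^sup>+p. ennreal ((\<Phi> p)\<^sup>2) \<partial>haar_split) \<le> ennreal (A\<^sup>2)" and \<Psi>B: "(\<integral>\<^sup>+p. ennreal ((\<Psi> p)\<^sup>2) \<partial>haar_split) \<le> ennreal (B\<^sup>2)"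
    and AB: "0 \<le> A" "0 \<le> B"
  shows "(\<integral>\<^sup>+z. (\<integral>\<^sup>+p. ennreal (schur_kernel z (fst p) * \<Phi> (twist z (fst p), twist z (snd p)) * \<Psi> p) \<partial>haar_split) \<partial>circle_measure)
     \<le> ennreal (6 * A * B)"
proof -
  interpret cs: pair_sigma_finite circle_measure haar_split
    by (intro pair_sigma_finite.intro sigma_finite_circle sigma_finite_pair sigma_finite_lborel sigma_finite_circle2)
  let ?N = "circle_measure \<Otimes>\<^sub>M haar_split"
  have [measurable]: "(\<lambda>q. fst q) \<in> borel_measurable ?N"
    by (rule measurable_circleD) measurable
  have m2: "(\<lambda>q. fst (snd q)) \<in> borel_measurable ?N"
    using measurable_compose[OF measurable_snd measurable_fst, of circle_measure lborel circle2] by simp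
  note [measurable] = m2
  have Km [measurable]: "(\<lambda>q. schur_kernel (fst q) (fst (snd q))) \<in> borel_measurable ?N"
    unfolding schur_kernel_def by measurable
  have \<Phi>m [measurable]: "(\<lambda>q. \<Phi> (twist (fst q) (fst (snd q)), twist (fst q) (snd (snd q)))) \<in> borel_measurable ?N"
    using measurable_compose[OF measurable_twist_haar_split \<Phi>] by (simp add: case_prod_unfold)
  \<comment> \<open>The kernel is split into two square roots, one for each factor of the
    Cauchy-Schwarz inequality.\<close>
  define F where "F q = sqrt (schur_kernel (fst q) (fst (snd q))) * \<Phi> (twist (fst q) (fst (snd q)), twist (fst q) (snd (snd q)))" for q
  define G where "G q = sqrt (schur_kernel (fst q) (fst (snd q))) * \<Psi> (snd q)" for q :: "complex \<times> (complex \<times> complex) \<times> (complex \<times> complex)"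
  have [measurable]: "F \<in> borel_measurable ?N" "G \<in> borel_measurable ?N"
    unfolding F_def[abs_def] G_def[abs_def] by measurable
  have F0: "0 \<le> F q" and G0: "0 \<le> G q" for q
    by (simp_all add: F_def G_def schur_kernel_nonneg \<Phi>0 \<Psi>0)
  have "(\<integral>\<^sup>+q. ennreal ((F q)\<^sup>2) \<partial>?N) = (\<integral>\<^sup>+z. \<integral>\<^sup>+p. ennreal ((F (z, p))\<^sup>2) \<partial>haar_split \<partial>circle_measure)"
    by (rule cs.M2.nn_integral_fst[symmetric]) measurable
  \<comment> \<open>For fixed z the twist is removed from the argument of \<open>\<Phi>\<close>. The
    function then no longer depends on z, and the circle integral meets the kernel alone.\<close>
  also have "\<dots> = (\<integral>\<^sup>+z. \<integral>\<^sup>+p. ennreal (cmod (fst (fst p)) / (1 + (cmod (z * fst (fst p) - snd (fst p)))\<^sup>2)) * ennreal ((\<Phi> p)\<^sup>2) \<partial>haar_split \<partial>circle_measure)"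
  proof (rule nn_integral_cong)
    fix z assume "z \<in> space circle_measure"
    then have z: "cmod z = 1" by simp
    have mz: "(\<lambda>p. ennreal (cmod (fst (fst p)) / (1 + (cmod (z * fst (fst p) - snd (fst p)))\<^sup>2)) * ennreal ((\<Phi> p)\<^sup>2)) \<in> borel_measurable haar_split"
    proof -
      have [measurable]: "fst \<in> borel_measurable haar_split"
        using measurable_fst[of lborel circle2] by simp
      show ?thesis by measurable
    qed
    have "(\<integral>\<^sup>+p. ennreal (cmod (fst (fst p)) / (1 + (cmod (z * fst (fst p) - snd (fst p)))\<^sup>2)) * ennreal ((\<Phi> p)\<^sup>2) \<partial>haar_split) =
       (\<integral>\<^sup>+p. ennreal (cmod (fst (twist z (fst p))) / (1 + (cmod (z * fst (twist z (fst p)) - snd (twist z (fst p))))\<^sup>2)) * ennreal ((\<Phi> (twist z (fst p), twist z (snd p)))\<^sup>2) \<partial>haar_split)"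
      using nn_integral_haar_split_twist[OF z mz] by simp
    also have "\<dots> = (\<integral>\<^sup>+p. ennreal ((F (z, p))\<^sup>2) \<partial>haar_split)"
    proof (rule nn_integral_cong)
      fix p :: "(complex \<times> complex) \<times> (complex \<times> complex)"
      have "cmod (fst (twist z (fst p))) / (1 + (cmod (z * fst (twist z (fst p)) - snd (twist z (fst p))))\<^sup>2) = schur_kernel z (fst p)"
        using schur_kernel_twist_cnj[OF z, of "twist z (fst p)"] by (simp add: twist_twist_cnj[OF z])
      then show "ennreal (cmod (fst (twist z (fst p))) / (1 + (cmod (z * fst (twist z (fst p)) - snd (twist z (fst p))))\<^sup>2)) * ennreal ((\<Phi> (twist z (fst p), twist z (snd p)))\<^sup>2) = ennreal ((F (z, p))\<^sup>2)"
        by (simp add: F_def power_mult_distrib schur_kernel_nonneg ennreal_mult)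
    qed
    finally show "(\<integral>\<^sup>+p. ennreal ((F (z, p))\<^sup>2) \<partial>haar_split) =
       (\<integral>\<^sup>+p. ennreal (cmod (fst (fst p)) / (1 + (cmod (z * fst (fst p) - snd (fst p)))\<^sup>2)) * ennreal ((\<Phi> p)\<^sup>2) \<partial>haar_split)" ..
  qed
  also have "\<dots> = (\<integral>\<^sup>+p. \<integral>\<^sup>+z. ennreal (cmod (fst (fst p)) / (1 + (cmod (z * fst (fst p) - snd (fst p)))\<^sup>2)) * ennreal ((\<Phi> p)\<^sup>2) \<partial>circle_measure \<partial>haar_split)"
    by (rule cs.Fubini'[symmetric]) (simp add: case_prod_unfold)
  also have "\<dots> = (\<integral>\<^sup>+p. (\<integral>\<^sup>+z. ennreal (cmod (fst (fst p)) / (1 + (cmod (z * fst (fst p) - snd (fst p)))\<^sup>2)) \<partial>circle_measure) * ennreal ((\<Phi> p)\<^sup>2) \<partial>haar_split)"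
    by (intro nn_integral_cong nn_integral_multc) measurable
  also have "\<dots> \<le> (\<integral>\<^sup>+p. 6 * ennreal ((\<Phi> p)\<^sup>2) \<partial>haar_split)"
    by (intro nn_integral_mono mult_right_mono nn_integral_circle_kernel_bound) auto
  also have "\<dots> = 6 * (\<integral>\<^sup>+p. ennreal ((\<Phi> p)\<^sup>2) \<partial>haar_split)"
    by (rule nn_integral_cmult) measurable
  also have "\<dots> \<le> 6 * ennreal (A\<^sup>2)"
    using \<Phi>A by (rule mult_left_mono) simp
  finally have FF: "(\<integral>\<^sup>+q. ennreal ((F q)\<^sup>2) \<partial>?N) \<le> 6 * ennreal (A\<^sup>2)" .
  have "(\<integral>\<^sup>+q. ennreal ((G q)\<^sup>2) \<partial>?N) = (\<integral>\<^sup>+z. \<integral>\<^sup>+p. ennreal (cmod (fst (fst p)) / (1 + (cmod (fst (fst p) - z * snd (fst p)))\<^sup>2)) * ennreal ((\<Psi> p)\<^sup>2) \<partial>haar_split \<partial>circle_measure)"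
  proof -
    have eq: "ennreal ((G (z, p))\<^sup>2) = ennreal (cmod (fst (fst p)) / (1 + (cmod (fst (fst p) - z * snd (fst p)))\<^sup>2)) * ennreal ((\<Psi> p)\<^sup>2)" for z p
      using schur_kernel_nonneg[of z "fst p"] by (simp add: G_def power_mult_distrib ennreal_mult flip: schur_kernel_def)
    have "(\<lambda>q. ennreal ((G q)\<^sup>2)) \<in> borel_measurable ?N" by measurable
    from cs.M2.nn_integral_fst[OF this, symmetric] show ?thesis
      unfolding eq .
  qed
  also have "\<dots> = (\<integral>\<^sup>+p. \<integral>\<^sup>+z. ennreal (cmod (fst (fst p)) / (1 + (cmod (fst (fst p) - z * snd (fst p)))\<^sup>2)) * ennreal ((\<Psi> p)\<^sup>2) \<partial>circle_measure \<partial>haar_split)"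
    by (rule cs.Fubini'[symmetric]) (simp add: case_prod_unfold)
  also have "\<dots> = (\<integral>\<^sup>+p. (\<integral>\<^sup>+z. ennreal (cmod (fst (fst p)) / (1 + (cmod (fst (fst p) - z * snd (fst p)))\<^sup>2)) \<partial>circle_measure) * ennreal ((\<Psi> p)\<^sup>2) \<partial>haar_split)"
    by (intro nn_integral_cong nn_integral_multc) measurable
  also have "\<dots> \<le> (\<integral>\<^sup>+p. 6 * ennreal ((\<Psi> p)\<^sup>2) \<partial>haar_split)"
    by (intro nn_integral_mono mult_right_mono nn_integral_circle_kernel_bound) auto
  also have "\<dots> = 6 * (\<integral>\<^sup>+p. ennreal ((\<Psi> p)\<^sup>2) \<partial>haar_split)"
    by (rule nn_integral_cmult) measurable
  also have "\<dots> \<le> 6 * ennreal (B\<^sup>2)"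
    using \<Psi>B by (rule mult_left_mono) simp
  finally have GG: "(\<integral>\<^sup>+q. ennreal ((G q)\<^sup>2) \<partial>?N) \<le> 6 * ennreal (B\<^sup>2)" .
  have "(\<integral>\<^sup>+q. ennreal (F q) * ennreal (G q) \<partial>?N)\<^sup>2 \<le> (\<integral>\<^sup>+q. (ennreal (F q))\<^sup>2 \<partial>?N) * (\<integral>\<^sup>+q. (ennreal (G q))\<^sup>2 \<partial>?N)"
    by (rule Cauchy_Schwarz_nn_integral) measurable
  also have "\<dots> \<le> (6 * ennreal (A\<^sup>2)) * (6 * ennreal (B\<^sup>2))"
    using FF GG by (intro mult_mono) (simp_all add: ennreal_power F0 G0)
  also have "\<dots> = ennreal ((6 * A * B)\<^sup>2)"
  proof -
    have "(6 * ennreal (A\<^sup>2)) * (6 * ennreal (B\<^sup>2)) = ennreal (6 * A\<^sup>2) * ennreal (6 * B\<^sup>2)"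
      by (simp add: ennreal_mult)
    also have "\<dots> = ennreal ((6 * A\<^sup>2) * (6 * B\<^sup>2))"
      by (rule ennreal_mult[symmetric]) auto
    also have "(6 * A\<^sup>2) * (6 * B\<^sup>2) = (6 * A * B)\<^sup>2"
      by (simp add: power_mult_distrib)
    finally show ?thesis .
  qed
  finally have "(\<integral>\<^sup>+q. ennreal (F q) * ennreal (G q) \<partial>?N) \<le> ennreal (6 * A * B)"
    by (rule ennreal_power2_le_D) (simp add: AB)
  moreover have "(\<integral>\<^sup>+q. ennreal (F q) * ennreal (G q) \<partial>?N) =
     (\<integral>\<^sup>+z. (\<integral>\<^sup>+p. ennreal (schur_kernel z (fst p) * \<Phi> (twist z (fst p), twist z (snd p)) * \<Psi> p) \<partial>haar_split) \<partial>circle_measure)"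
  proof -
    have eq: "ennreal (F (z, p)) * ennreal (G (z, p)) = ennreal (schur_kernel z (fst p) * \<Phi> (twist z (fst p), twist z (snd p)) * \<Psi> p)" for z p
    proof -
      have "F (z, p) * G (z, p) = (sqrt (schur_kernel z (fst p)) * sqrt (schur_kernel z (fst p))) * \<Phi> (twist z (fst p), twist z (snd p)) * \<Psi> p"
        by (simp add: F_def G_def mult_ac)
      then show ?thesis
        by (simp add: schur_kernel_nonneg F0 G0 flip: ennreal_mult)
    qed
    have "(\<lambda>q. ennreal (F q) * ennreal (G q)) \<in> borel_measurable ?N" by measurable
    from cs.M2.nn_integral_fst[OF this] show ?thesis
      by (simp add: eq)
  qed
  ultimately show ?thesis by simp
qed

lemma cmod_cis_minus_1_le: "cmod (cis t - 1) \<le> \<bar>t\<bar>"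
proof -
  have "\<bar>sin (t / 2)\<bar> \<le> \<bar>t / 2\<bar>"
    using sin_x_le_x[of "t / 2"] sin_x_ge_neg_x[of "t / 2"] sin_x_le_x[of "- (t / 2)"] sin_x_ge_neg_x[of "- (t / 2)"]
    by (cases "t \<ge> 0") auto
  then show ?thesis
    using dist_exp_i_1[of t] by (simp add: cis_conv_exp)
qed

section \<open>Approximating functionals\<close>

text \<open>The translation coordinates of the pair formed by \<open>(x, z) exp (a, 0)\<close> and the inverse of \<open>(x, z)\<close>.\<close>

definition base_point :: "complex \<Rightarrow> complex \<Rightarrow> complex \<Rightarrow> complex \<times> complex" where
  "base_point z a x = (x + z * a, - cnj z * x)"

lemma measurable_base_point [measurable]: "base_point z a \<in> borel_measurable borel"
  unfolding base_point_def[abs_def] by measurable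

text \<open>The factor \<open>- cnj z\<close> in the second coordinate passes to the second
  frequency as \<open>- z\<close>, its real adjoint. The step \<open>a\<close> enters only through
  the first frequency.\<close>

lemma inner_base_point: "\<kappa> \<bullet> base_point z a x = (fst \<kappa> - z * snd \<kappa>) \<bullet> x + fst \<kappa> \<bullet> (z * a)"
  by (simp add: base_point_def inner_prod_def inner_complex_def algebra_simps)

section \<open>Smoothed correlations on the Fourier side\<close>

lemma measurable_integral_param:
  fixes f :: "'a \<times> 'b \<Rightarrow> complex"
  assumes "sigma_finite_measure N" "f \<in> borel_measurable (M \<Otimes>\<^sub>M N)"
  shows "(\<lambda>x. LINT y|N. f (x, y)) \<in> borel_measurable M"
  using sigma_finite_measure.borel_measurable_lebesgue_integral[OF assms(1), of "\<lambda>x y. f (x, y)" M] assms(2)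
  by simp

lemma integrable_gauss_FT:
  fixes f g :: "'a::euclidean_space \<Rightarrow> complex"
  assumes f: "integrable lborel f" and g: "integrable lborel g" and e: "e > 0"
  shows "integrable lborel (\<lambda>k. of_real (gauss (e *\<^sub>R k)) * (FT f k * cnj (FT g k)))"
proof (rule Bochner_Integration.integrable_bound)
  have [measurable]: "f \<in> borel_measurable borel" "g \<in> borel_measurable borel"
    using f g borel_measurable_integrable by fastforce+
  let ?A = "LINT x|lborel. cmod (f x)" and ?B = "LINT x|lborel. cmod (g x)"
  show "integrable lborel (\<lambda>k::'a. (?A * ?B) * gauss (e *\<^sub>R k))"
    using integrable_gauss_scaled[OF e, where 'a='a] by (rule integrable_mult_right)
  show "AE k in lborel. norm (of_real (gauss (e *\<^sub>R k)) * (FT f k * cnj (FT g k))) \<le> norm ((?A * ?B) * gauss (e *\<^sub>R k))"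
  proof (rule AE_I2)
    fix k
    have "cmod (FT f k) * cmod (FT g k) \<le> ?A * ?B"
      by (intro mult_mono FT_bound f g) auto
    then have "gauss (e *\<^sub>R k) * (cmod (FT f k) * cmod (FT g k)) \<le> gauss (e *\<^sub>R k) * (?A * ?B)"
      by (intro mult_left_mono gauss_nonneg)
    then show "norm (of_real (gauss (e *\<^sub>R k)) * (FT f k * cnj (FT g k))) \<le> norm ((?A * ?B) * gauss (e *\<^sub>R k))"
      by (simp add: norm_mult abs_mult mult_ac)
  qed
  show "(\<lambda>k. of_real (gauss (e *\<^sub>R k)) * (FT f k * cnj (FT g k))) \<in> borel_measurable lborel"
    by measurable
qed

text \<open>Integrating the smoothed Parseval identity over the base points \<open>s x\<close> with
  the weight \<open>v\<close> affects only the phase and turns it into an oscillatory integral of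
  \<open>v\<close>; for the base points in use this is a value of its Fourier transform.\<close>

lemma smoothing_Fubini:
  fixes f g :: "'a::euclidean_space \<Rightarrow> complex" and v :: "'b::euclidean_space \<Rightarrow> complex"
  assumes f: "integrable lborel f" and g: "integrable lborel g" and v: "integrable lborel v" and e: "e > 0"
    and s [measurable]: "s \<in> borel_measurable borel"
  shows "(LINT x|lborel. v x * (LINT b|lborel. of_real (gauss b) * (LINT y|lborel. f (y - (s x + e *\<^sub>R b)) * cnj (g y)))) =
    (1 / gauss_const TYPE('a)) * (LINT k|lborel. of_real (gauss (e *\<^sub>R k)) * (FT f k * cnj (FT g k)) * (LINT x|lborel. v x * cis (- (k \<bullet> s x))))"
proof -
  have [measurable]: "v \<in> borel_measurable borel"
    using v borel_measurable_integrable by fastforce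
  define Z where "Z k = of_real (gauss (e *\<^sub>R k)) * (FT f k * cnj (FT g k))" for k
  have Z: "integrable lborel Z"
    unfolding Z_def[abs_def] by (rule integrable_gauss_FT[OF f g e])
  have int: "integrable (lborel \<Otimes>\<^sub>M lborel) (\<lambda>(x, k). v x * Z k * cis (- (k \<bullet> s x)))"
    using integrable_mult_cis(1)[OF integrable_pair_mult[OF sigma_finite_lborel sigma_finite_lborel v Z], of "\<lambda>(x, k). - (k \<bullet> s x)"]
    by (simp add: case_prod_unfold)
  have st: "(LINT b|lborel. of_real (gauss b) * (LINT y|lborel. f (y - (s x + e *\<^sub>R b)) * cnj (g y))) =
     (1 / gauss_const TYPE('a)) * (LINT k|lborel. Z k * cis (- (k \<bullet> s x)))" for x
    using Fourier_smoothing[OF f g e, of "s x"] gauss_const_pos[where 'a='a]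
    by (simp add: Z_def field_simps)
  have "v x * (LINT b|lborel. of_real (gauss b) * (LINT y|lborel. f (y - (s x + e *\<^sub>R b)) * cnj (g y))) =
     (1 / gauss_const TYPE('a)) * (LINT k|lborel. v x * Z k * cis (- (k \<bullet> s x)))" for x
    unfolding st mult.assoc integral_mult_right_zero by (rule mult.left_commute)
  then have "(LINT x|lborel. v x * (LINT b|lborel. of_real (gauss b) * (LINT y|lborel. f (y - (s x + e *\<^sub>R b)) * cnj (g y)))) =
     (LINT x|lborel. (1 / gauss_const TYPE('a)) * (LINT k|lborel. v x * Z k * cis (- (k \<bullet> s x))))"
    by (simp only:)
  also have "\<dots> = (1 / gauss_const TYPE('a)) * (LINT x|lborel. LINT k|lborel. v x * Z k * cis (- (k \<bullet> s x)))"
    by (rule integral_mult_right_zero)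
  also have "(LINT x|lborel. LINT k|lborel. v x * Z k * cis (- (k \<bullet> s x))) = (LINT k|lborel. LINT x|lborel. v x * Z k * cis (- (k \<bullet> s x)))"
    by (rule lborel_pair.Fubini_integral[OF int, symmetric])
  also have "\<dots> = (LINT k|lborel. Z k * (LINT x|lborel. v x * cis (- (k \<bullet> s x))))"
  proof (rule Bochner_Integration.integral_cong)
    fix k
    have "v x * Z k * cis (- (k \<bullet> s x)) = Z k * (v x * cis (- (k \<bullet> s x)))" for x
      by (simp only: mult_ac)
    then show "(LINT x|lborel. v x * Z k * cis (- (k \<bullet> s x))) = Z k * (LINT x|lborel. v x * cis (- (k \<bullet> s x)))"
      by (simp only: integral_mult_right_zero)
  qed simp
  finally show ?thesis
    by (simp add: Z_def)
qed

definition smoothed_correlation ::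
  "(complex \<Rightarrow> complex) \<Rightarrow> real \<Rightarrow> complex \<Rightarrow> complex \<Rightarrow> (complex \<times> complex \<Rightarrow> complex) \<Rightarrow> (complex \<times> complex \<Rightarrow> complex) \<Rightarrow> complex" where
  "smoothed_correlation v e z a f g =
     (LINT x|lborel. v x * (LINT b|lborel. of_real (gauss b) * (LINT y|lborel. f (y - (base_point z a x + e *\<^sub>R b)) * cnj (g y))))"

text \<open>The step by \<open>h * c\<close> appears on the Fourier side as a phase, which differs
  from 1 by at most h |c| times the first frequency. This cancels the division by \<open>h\<close>,
  and the rest is the kernel of the Schur test. The Gaussian enters through its maximum only, so the
  bound is uniform in \<open>e\<close> and \<open>h\<close>.\<close>

lemma smoothed_correlation_difference:
  fixes v :: "complex \<Rightarrow> complex" and e h :: real and c :: complex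
  assumes f: "integrable lborel f" and g: "integrable lborel g" and v: "integrable lborel v" and e: "e > 0" and h: "h > 0"
    and z: "cmod z = 1" and W: "\<And>k. (1 + (cmod k)\<^sup>2) * cmod (FT v k) \<le> W"
  shows "ennreal (cmod ((smoothed_correlation v e z (h * c) f g - smoothed_correlation v e z 0 f g) / h)) \<le>
     (\<integral>\<^sup>+\<kappa>. ennreal ((cmod c * W / (gauss_const TYPE(complex \<times> complex))\<^sup>2) * (schur_kernel z \<kappa> * cmod (FT f \<kappa>) * cmod (FT g \<kappa>))) \<partial>lborel)"
proof -
  define N where "N = gauss_const TYPE(complex \<times> complex)"
  have N: "N > 0" unfolding N_def by (rule gauss_const_pos)
  define Z where "Z \<kappa> = of_real (gauss (e *\<^sub>R \<kappa>)) * (FT f \<kappa> * cnj (FT g \<kappa>)) * FT v (fst \<kappa> - z * snd \<kappa>)" for \<kappa>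
  define E where "E a \<kappa> = cis (- (fst \<kappa> \<bullet> (z * a)))" for a and \<kappa> :: "complex \<times> complex"
  have vm: "v \<in> borel_measurable borel"
    using v borel_measurable_integrable by fastforce
  have FTv: "(LINT x|lborel. v x * cis (- (\<kappa> \<bullet> base_point z a x))) = FT v (fst \<kappa> - z * snd \<kappa>) * E a \<kappa>" for a \<kappa>
  proof -
    have "v x * cis (- (\<kappa> \<bullet> base_point z a x)) = (v x * cis (- ((fst \<kappa> - z * snd \<kappa>) \<bullet> x))) * E a \<kappa>" for x
      unfolding inner_base_point E_def by (simp add: cis_mult)
    then show ?thesis
      unfolding FT_def by (simp only: integral_mult_left_zero)
  qed
  have Em [measurable]: "E a \<in> borel_measurable borel" for a
    unfolding E_def[abs_def] by measurable
  have Zint: "integrable lborel Z"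
  proof (rule Bochner_Integration.integrable_bound)
    show "integrable lborel (\<lambda>\<kappa>. of_real (LINT x|lborel. cmod (v x)) * (of_real (gauss (e *\<^sub>R \<kappa>)) * (FT f \<kappa> * cnj (FT g \<kappa>))))"
      by (intro integrable_mult_right integrable_gauss_FT f g e)
    have [measurable]: "f \<in> borel_measurable borel" "g \<in> borel_measurable borel"
      using f g borel_measurable_integrable by fastforce+
    have "(\<lambda>\<kappa>::complex \<times> complex. FT v (fst \<kappa> - z * snd \<kappa>)) \<in> borel_measurable borel"
      by (rule measurable_compose[OF _ measurable_FT[OF vm]]) measurable
    note [measurable] = this
    show "Z \<in> borel_measurable lborel"
      unfolding Z_def[abs_def] by measurable
    show "AE \<kappa> in lborel. norm (Z \<kappa>) \<le> norm (of_real (LINT x|lborel. cmod (v x)) * (of_real (gauss (e *\<^sub>R \<kappa>)) * (FT f \<kappa> * cnj (FT g \<kappa>))))"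
    proof (rule AE_I2)
      fix \<kappa>
      show "norm (Z \<kappa>) \<le> norm (of_real (LINT x|lborel. cmod (v x)) * (of_real (gauss (e *\<^sub>R \<kappa>)) * (FT f \<kappa> * cnj (FT g \<kappa>))))"
        using mult_right_mono[OF FT_bound[OF v, of "fst \<kappa> - z * snd \<kappa>"], of "gauss (e *\<^sub>R \<kappa>) * (cmod (FT f \<kappa>) * cmod (FT g \<kappa>))"]
        by (simp add: Z_def norm_mult mult_ac)
    qed
  qed
  have ZE: "integrable lborel (\<lambda>\<kappa>. Z \<kappa> * E a \<kappa>)" for a
    using integrable_mult_cis(1)[OF Zint, of "\<lambda>\<kappa>. - (fst \<kappa> \<bullet> (z * a))"] by (simp add: E_def)
  have T: "smoothed_correlation v e z a f g = (1 / N) * (LINT \<kappa>|lborel. Z \<kappa> * E a \<kappa>)" for a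
    unfolding smoothed_correlation_def smoothing_Fubini[OF f g v e measurable_base_point] FTv N_def Z_def
    by (simp only: mult.assoc)
  have "(smoothed_correlation v e z (h * c) f g - smoothed_correlation v e z 0 f g) / h =
     (LINT \<kappa>|lborel. (1 / (N * h)) * (Z \<kappa> * E (h * c) \<kappa> - Z \<kappa> * E 0 \<kappa>))"
    unfolding T using ZE h N by (simp add: Bochner_Integration.integral_diff field_simps)
  then have "ennreal (cmod ((smoothed_correlation v e z (h * c) f g - smoothed_correlation v e z 0 f g) / h)) \<le>
     (\<integral>\<^sup>+\<kappa>. ennreal (cmod ((1 / (N * h)) * (Z \<kappa> * E (h * c) \<kappa> - Z \<kappa> * E 0 \<kappa>))) \<partial>lborel)"
    using integral_norm_bound_ennreal[of lborel "\<lambda>\<kappa>. (1 / (N * h)) * (Z \<kappa> * E (h * c) \<kappa> - Z \<kappa> * E 0 \<kappa>)"] ZE by simp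
  also have "\<dots> \<le> (\<integral>\<^sup>+\<kappa>. ennreal ((cmod c * W / N\<^sup>2) * (schur_kernel z \<kappa> * cmod (FT f \<kappa>) * cmod (FT g \<kappa>))) \<partial>lborel)"
  proof (intro nn_integral_mono ennreal_leI)
    fix \<kappa> :: "complex \<times> complex"
    let ?m = "fst \<kappa> - z * snd \<kappa>"
    have E1: "cmod (E (h * c) \<kappa> - E 0 \<kappa>) \<le> h * (cmod (fst \<kappa>) * cmod c)"
    proof -
      have "cmod (E (h * c) \<kappa> - E 0 \<kappa>) \<le> \<bar>fst \<kappa> \<bullet> (z * (h * c))\<bar>"
        using cmod_cis_minus_1_le[of "- (fst \<kappa> \<bullet> (z * (h * c)))"] by (simp add: E_def)
      also have "\<dots> \<le> cmod (fst \<kappa>) * cmod (z * (h * c))"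
        by (rule Cauchy_Schwarz_ineq2)
      also have "\<dots> = h * (cmod (fst \<kappa>) * cmod c)"
        using z h by (simp add: norm_mult)
      finally show ?thesis .
    qed
    have den: "1 + (cmod ?m)\<^sup>2 > 0" by (intro add_pos_nonneg) auto
    have Fv: "cmod (FT v ?m) \<le> W / (1 + (cmod ?m)\<^sup>2)"
      using W[of ?m] den by (simp add: field_simps)
    have W0: "0 \<le> W / (1 + (cmod ?m)\<^sup>2)"
      by (rule order_trans[OF norm_ge_zero Fv])
    \<comment> \<open>One factor 1 / N comes from the smoothed identity, the second one from this
      maximum.\<close>
    have g1: "gauss (e *\<^sub>R \<kappa>) \<le> 1 / N"
      unfolding gauss_def N_def using gauss_const_pos[where 'a="complex \<times> complex"] by (intro divide_right_mono) auto
    have "cmod ((1 / (N * h)) * (Z \<kappa> * E (h * c) \<kappa> - Z \<kappa> * E 0 \<kappa>)) =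
        (1 / (N * h)) * (gauss (e *\<^sub>R \<kappa>) * (cmod (FT f \<kappa>) * cmod (FT g \<kappa>)) * cmod (FT v ?m) * cmod (E (h * c) \<kappa> - E 0 \<kappa>))"
      using N h by (simp add: Z_def norm_mult norm_divide flip: right_diff_distrib)
    also have "\<dots> \<le> (1 / (N * h)) * ((1 / N) * (cmod (FT f \<kappa>) * cmod (FT g \<kappa>)) * (W / (1 + (cmod ?m)\<^sup>2)) * (h * (cmod (fst \<kappa>) * cmod c)))"
      using N h g1 Fv E1 W0 by (intro mult_left_mono mult_mono mult_nonneg_nonneg) auto
    also have "\<dots> = (cmod c * W / N\<^sup>2) * (schur_kernel z \<kappa> * cmod (FT f \<kappa>) * cmod (FT g \<kappa>))"
      using N h den by (simp add: schur_kernel_def power2_eq_square field_simps)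
    finally show "cmod ((1 / (N * h)) * (Z \<kappa> * E (h * c) \<kappa> - Z \<kappa> * E 0 \<kappa>)) \<le> (cmod c * W / N\<^sup>2) * (schur_kernel z \<kappa> * cmod (FT f \<kappa>) * cmod (FT g \<kappa>))" .
  qed
  finally show ?thesis
    by (simp add: N_def)
qed

text \<open>For \<open>e = 0\<close> this is the pair of (x, z) exp(a, 0) and the inverse of (x, z).
  The displacement by \<open>e\<close> affects the translations alone; the rotations remain exactly
  \<open>(z, cnj z)\<close>, so the average over z is untouched.\<close>

definition sample :: "real \<Rightarrow> complex \<Rightarrow> complex \<times> (complex \<times> (complex \<times> complex)) \<Rightarrow> (complex \<times> complex) \<times> (complex \<times> complex)" where
  "sample e a q = regroup (base_point (fst q) a (fst (snd q)) + e *\<^sub>R snd (snd q), (fst q, cnj (fst q)))"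

abbreviation sample_measure :: "(complex \<times> (complex \<times> (complex \<times> complex))) measure" where
  "sample_measure \<equiv> circle_measure \<Otimes>\<^sub>M (lborel \<Otimes>\<^sub>M lborel)"

definition weight :: "(complex \<Rightarrow> complex) \<Rightarrow> complex \<times> (complex \<times> (complex \<times> complex)) \<Rightarrow> complex" where
  "weight v q = v (fst (snd q)) * of_real (gauss (snd (snd q)))"

definition approx_functional ::
  "(complex \<Rightarrow> complex) \<Rightarrow> complex \<Rightarrow> real \<Rightarrow> real \<Rightarrow> ((complex \<times> complex) \<times> (complex \<times> complex) \<Rightarrow> complex) \<Rightarrow> complex" where
  "approx_functional v c e h u = (LINT q|sample_measure. weight v q * ((u (sample e (h * c) q) - u (sample e 0 q)) / h))"

section \<open>Integrability and linearity of the approximating functionals\<close>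

lemma space_sample_measure: "space sample_measure = sphere 0 1 \<times> UNIV"
  by (simp add: space_pair_measure)

lemma sample_carrier: "q \<in> space sample_measure \<Longrightarrow> sample e a q \<in> carrier motion_group2"
  by (auto simp: space_sample_measure sample_def regroup_def carrier_motion_group2 case_prod_unfold)

lemma measurable_sample_parts:
  "(\<lambda>q. fst q) \<in> borel_measurable sample_measure"
  "(\<lambda>q. fst (snd q)) \<in> borel_measurable sample_measure"
  "(\<lambda>q. snd (snd q)) \<in> borel_measurable sample_measure"
proof -
  show "(\<lambda>q. fst q) \<in> borel_measurable sample_measure"
    by (rule measurable_circleD) measurable
  show "(\<lambda>q. fst (snd q)) \<in> borel_measurable sample_measure"
    using measurable_compose[OF measurable_snd measurable_fst, of circle_measure lborel lborel] by simp
  show "(\<lambda>q. snd (snd q)) \<in> borel_measurable sample_measure"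
    using measurable_compose[OF measurable_snd measurable_snd, of circle_measure lborel lborel] by simp
qed

lemma measurable_sample: "sample e a \<in> sample_measure \<rightarrow>\<^sub>M motion_haar2"
proof -
  note [measurable] = measurable_sample_parts
  have eq: "sample e a q = ((fst (base_point (fst q) a (fst (snd q)) + e *\<^sub>R snd (snd q)), fst q), (snd (base_point (fst q) a (fst (snd q)) + e *\<^sub>R snd (snd q)), cnj (fst q)))" for q
    by (simp add: sample_def regroup_def case_prod_unfold)
  have [measurable]: "(\<lambda>q. base_point (fst q) a (fst (snd q))) \<in> borel_measurable sample_measure"
    unfolding base_point_def by measurable
  show ?thesis
    unfolding eq[abs_def]
    by (intro measurable_Pair measurable_motion_haarI) (auto simp: space_sample_measure)
qed

lemma integrable_weight:
  assumes v: "integrable lborel v"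
  shows "integrable sample_measure (weight v)"
proof -
  have g: "integrable lborel (\<lambda>b. complex_of_real (gauss b))"
    using integrable_gauss by (simp add: complex_of_real_integrable_eq)
  have "integrable (lborel \<Otimes>\<^sub>M lborel) (\<lambda>(x, b). v x * complex_of_real (gauss b))"
    by (intro integrable_pair_mult sigma_finite_lborel v g)
  moreover have "integrable circle_measure (\<lambda>z. 1 :: complex)"
    by simp
  ultimately have "integrable sample_measure (\<lambda>(z, p). 1 * (case p of (x, b) \<Rightarrow> v x * complex_of_real (gauss b)))"
    by (intro integrable_pair_mult[OF sigma_finite_circle sigma_finite_pair[OF sigma_finite_lborel sigma_finite_lborel]])
  then show ?thesis
    by (simp add: weight_def[abs_def] case_prod_unfold)
qed

lemma integrable_weight_mult:
  assumes v: "integrable lborel v" and u: "u \<in> borel_measurable motion_haar2"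
    and B: "\<And>g. g \<in> carrier motion_group2 \<Longrightarrow> cmod (u g) \<le> B"
  shows "integrable sample_measure (\<lambda>q. weight v q * u (sample e a q))"
proof (rule Bochner_Integration.integrable_bound)
  show "integrable sample_measure (\<lambda>q. of_real B * weight v q)"
    by (intro integrable_mult_right integrable_weight v)
  have [measurable]: "(\<lambda>q. u (sample e a q)) \<in> borel_measurable sample_measure"
    by (rule measurable_compose[OF measurable_sample u])
  have [measurable]: "weight v \<in> borel_measurable sample_measure"
    using integrable_weight[OF v] by auto
  show "(\<lambda>q. weight v q * u (sample e a q)) \<in> borel_measurable sample_measure"
    by measurable
  show "AE q in sample_measure. norm (weight v q * u (sample e a q)) \<le> norm (of_real B * weight v q)"
  proof (rule AE_I2)
    fix q assume "q \<in> space sample_measure"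
    then have "cmod (u (sample e a q)) \<le> \<bar>B\<bar>"
      using B[OF sample_carrier[of q e a]] by simp
    then show "norm (weight v q * u (sample e a q)) \<le> norm (of_real B * weight v q)"
      unfolding norm_mult norm_of_real by (subst mult.commute) (rule mult_right_mono, simp_all)
  qed
qed

lemma approx_functional_eq_diff:
  assumes v: "integrable lborel v" and u: "u \<in> borel_measurable motion_haar2"
    and B: "\<And>g. g \<in> carrier motion_group2 \<Longrightarrow> cmod (u g) \<le> B"
  shows "approx_functional v c e h u =
    ((LINT q|sample_measure. weight v q * u (sample e (h * c) q)) - (LINT q|sample_measure. weight v q * u (sample e 0 q))) / h"
proof -
  have i: "integrable sample_measure (\<lambda>q. weight v q * u (sample e a q))" for a
    by (rule integrable_weight_mult[OF v u]) (rule B)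
  have "weight v q * ((u (sample e (h * c) q) - u (sample e 0 q)) / h) = (weight v q * u (sample e (h * c) q) - weight v q * u (sample e 0 q)) / h" for q
    by (simp add: right_diff_distrib)
  then show ?thesis
    unfolding approx_functional_def
    by (simp only: integral_divide_zero Bochner_Integration.integral_diff[OF i i])
qed

text \<open>This bound blows up as h -> 0. Its use is continuity at a fixed \<open>h\<close>, by
  which the uniform estimate passes from truncated functions to all of L2.\<close>

lemma approx_functional_bound:
  assumes v: "integrable lborel v" and u: "u \<in> borel_measurable motion_haar2"
    and B: "\<And>g. g \<in> carrier motion_group2 \<Longrightarrow> cmod (u g) \<le> B" and h: "h > 0"
  shows "cmod (approx_functional v c e h u) \<le> 2 * (LINT q|sample_measure. cmod (weight v q)) / h * B"
proof -
  have B0: "B \<ge> 0"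
    using order_trans[OF norm_ge_zero B[of "((0, 1), (0, 1))"]] by (simp add: carrier_motion_group2)
  have le: "cmod (LINT q|sample_measure. weight v q * u (sample e a q)) \<le> (LINT q|sample_measure. cmod (weight v q)) * B" for a
  proof -
    have "cmod (LINT q|sample_measure. weight v q * u (sample e a q)) \<le> (LINT q|sample_measure. cmod (weight v q * u (sample e a q)))"
      by (rule integral_norm_bound)
    also have "\<dots> \<le> (LINT q|sample_measure. cmod (weight v q) * B)"
    proof (rule integral_mono)
      show "integrable sample_measure (\<lambda>q. cmod (weight v q * u (sample e a q)))"
        by (intro integrable_norm integrable_weight_mult[OF v u, where B=B]) (rule B)
      show "integrable sample_measure (\<lambda>q. cmod (weight v q) * B)"
        by (intro integrable_mult_left integrable_norm integrable_weight v)
      fix q assume "q \<in> space sample_measure"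
      then show "cmod (weight v q * u (sample e a q)) \<le> cmod (weight v q) * B"
        unfolding norm_mult by (intro mult_left_mono B sample_carrier) auto
    qed
    finally show ?thesis by simp
  qed
  have "cmod (approx_functional v c e h u) =
     cmod ((LINT q|sample_measure. weight v q * u (sample e (h * c) q)) - (LINT q|sample_measure. weight v q * u (sample e 0 q))) / h"
  proof -
    have "approx_functional v c e h u =
      ((LINT q|sample_measure. weight v q * u (sample e (h * c) q)) - (LINT q|sample_measure. weight v q * u (sample e 0 q))) / h"
      by (rule approx_functional_eq_diff[OF v u]) (rule B)
    then show ?thesis
      using h by (simp add: norm_divide)
  qed
  also have "\<dots> \<le> ((LINT q|sample_measure. cmod (weight v q)) * B + (LINT q|sample_measure. cmod (weight v q)) * B) / h"
    using h by (intro divide_right_mono order_trans[OF norm_triangle_ineq4] add_mono le) auto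
  finally show ?thesis
    by (simp add: mult_ac)
qed

lemma approx_functional_add:
  assumes v: "integrable lborel v" and u: "u \<in> borel_measurable motion_haar2" "u' \<in> borel_measurable motion_haar2"
    and B: "\<And>g. g \<in> carrier motion_group2 \<Longrightarrow> cmod (u g) \<le> B" and B': "\<And>g. g \<in> carrier motion_group2 \<Longrightarrow> cmod (u' g) \<le> B'"
  shows "approx_functional v c e h (\<lambda>g. u g + u' g) = approx_functional v c e h u + approx_functional v c e h u'"
proof -
  have "cmod (u g + u' g) \<le> B + B'" if "g \<in> carrier motion_group2" for g
    using norm_triangle_mono[OF B[OF that] B'[OF that]] .
  then have s: "approx_functional v c e h (\<lambda>g. u g + u' g) =
     ((LINT q|sample_measure. weight v q * (u (sample e (h * c) q) + u' (sample e (h * c) q))) -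
      (LINT q|sample_measure. weight v q * (u (sample e 0 q) + u' (sample e 0 q)))) / h"
    by (rule approx_functional_eq_diff[OF v borel_measurable_add[OF u]])
  have i: "integrable sample_measure (\<lambda>q. weight v q * u (sample e a q))" for a
    by (rule integrable_weight_mult[OF v u(1)]) (rule B)
  have i': "integrable sample_measure (\<lambda>q. weight v q * u' (sample e a q))" for a
    by (rule integrable_weight_mult[OF v u(2)]) (rule B')
  have "(LINT q|sample_measure. weight v q * (u (sample e a q) + u' (sample e a q))) =
     (LINT q|sample_measure. weight v q * u (sample e a q)) + (LINT q|sample_measure. weight v q * u' (sample e a q))" for a
    unfolding distrib_left by (rule Bochner_Integration.integral_add[OF i i'])
  moreover have "approx_functional v c e h u =
    ((LINT q|sample_measure. weight v q * u (sample e (h * c) q)) - (LINT q|sample_measure. weight v q * u (sample e 0 q))) / h"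
    by (rule approx_functional_eq_diff[OF v u(1)]) (rule B)
  moreover have "approx_functional v c e h u' =
    ((LINT q|sample_measure. weight v q * u' (sample e (h * c) q)) - (LINT q|sample_measure. weight v q * u' (sample e 0 q))) / h"
    by (rule approx_functional_eq_diff[OF v u(2)]) (rule B')
  ultimately show ?thesis
    unfolding s by (simp add: diff_divide_distrib add_divide_distrib)
qed

lemma approx_functional_cmult: "approx_functional v c e h (\<lambda>g. k * u g) = k * approx_functional v c e h u"
proof -
  have "weight v q * ((k * u (sample e (h * c) q) - k * u (sample e 0 q)) / h) = k * (weight v q * ((u (sample e (h * c) q) - u (sample e 0 q)) / h))" for q
    by (simp add: algebra_simps diff_divide_distrib)
  then show ?thesis
    unfolding approx_functional_def by (simp only: integral_mult_right_zero)
qed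

lemma approx_functional_cong:
  assumes "\<And>g. g \<in> carrier motion_group2 \<Longrightarrow> u g = u' g"
  shows "approx_functional v c e h u = approx_functional v c e h u'"
  unfolding approx_functional_def
proof (rule Bochner_Integration.integral_cong)
  fix q assume q: "q \<in> space sample_measure"
  show "weight v q * ((u (sample e (h * c) q) - u (sample e 0 q)) / h) = weight v q * ((u' (sample e (h * c) q) - u' (sample e 0 q)) / h)"
    by (simp only: assms[OF sample_carrier[OF q]])
qed simp

section \<open>Fibres over the rotation coordinates and their Fourier transforms\<close>

definition fiber :: "((complex \<times> complex) \<times> (complex \<times> complex) \<Rightarrow> complex) \<Rightarrow> complex \<times> complex \<Rightarrow> complex \<times> complex \<Rightarrow> complex" where
  "fiber \<xi> k y = \<xi> (regroup (y, k))"

lemma inner_twist: "cmod z = 1 \<Longrightarrow> twist z x \<bullet> twist z y = x \<bullet> y"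
  using norm_twist[of z "x + y"] norm_twist[of z x] norm_twist[of z y]
  by (simp add: linear_add[OF linear_twist] norm_eq_sqrt_inner inner_add_left inner_add_right inner_commute)

lemma FT_twist:
  assumes z: "cmod z = 1" and [measurable]: "f \<in> borel_measurable borel"
  shows "FT (\<lambda>y. f (twist z y)) \<kappa> = FT f (twist z \<kappa>)"
proof -
  have "FT (\<lambda>y. f (twist z y)) \<kappa> = (LINT y|lborel. f (twist z y) * cis (- (twist z \<kappa> \<bullet> twist z y)))"
    by (simp only: FT_def inner_twist[OF z])
  also have "\<dots> = (LINT y|distr lborel lborel (twist z). f y * cis (- (twist z \<kappa> \<bullet> y)))"
    by (rule integral_distr[symmetric]) auto
  finally show ?thesis
    by (simp only: distr_lborel_twist[OF z] FT_def)
qed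

text \<open>On a fibre, the left translation is a shift by \<open>\<alpha>\<close> followed by an
  orthogonal map, and it sends the fibre over \<open>k\<close> to the one over
  \<open>twist z k\<close>. So a coefficient decomposes into Euclidean correlations of pairs of
  fibres.\<close>

lemma left_regular_regroup:
  assumes z: "cmod z = 1"
  shows "left_regular motion_group2 (regroup (\<alpha>, (z, cnj z))) \<xi> (regroup (y, k)) = \<xi> (regroup (twist z (y - \<alpha>), twist z k))"
proof -
  have "regroup (\<alpha>, (z, cnj z)) \<in> carrier motion_group2"
    using z by (simp add: regroup_def carrier_motion_group2 case_prod_unfold)
  then show ?thesis
    by (subst left_regular_eq)
       (simp_all add: regroup_def twist_def mult_EE_def inv_EE_def mult_E_def inv_E_def case_prod_unfold algebra_simps)
qed

lemma measurable_fiber_joint: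
  assumes "\<xi> \<in> borel_measurable motion_haar2"
  shows "(\<lambda>p. fiber \<xi> (snd p) (fst p)) \<in> borel_measurable haar_split"
  unfolding fiber_def using measurable_compose[OF measurable_regroup assms] by simp

lemma measurable_fiber:
  assumes "\<xi> \<in> borel_measurable motion_haar2" "k \<in> space circle2"
  shows "fiber \<xi> k \<in> borel_measurable borel"
proof -
  have "(\<lambda>y. (y, k)) \<in> lborel \<rightarrow>\<^sub>M haar_split"
    using assms(2) by measurable
  from measurable_compose[OF this measurable_fiber_joint[OF assms(1)]] show ?thesis
    by simp
qed

lemma measurable_FT_fiber:
  assumes \<xi>: "\<xi> \<in> borel_measurable motion_haar2"
  shows "(\<lambda>p. FT (fiber \<xi> (snd p)) (fst p)) \<in> borel_measurable haar_split"
proof -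
  have 1: "(\<lambda>q. (snd q, snd (fst q))) \<in> haar_split \<Otimes>\<^sub>M (lborel :: (complex \<times> complex) measure) \<rightarrow>\<^sub>M haar_split"
    by measurable
  have [measurable]: "(\<lambda>q. fiber \<xi> (snd (fst q)) (snd q)) \<in> borel_measurable (haar_split \<Otimes>\<^sub>M (lborel :: (complex \<times> complex) measure))"
    using measurable_compose[OF 1 measurable_fiber_joint[OF \<xi>]] by simp
  have [measurable]: "(\<lambda>q. fst (fst q)) \<in> borel_measurable (haar_split \<Otimes>\<^sub>M (lborel :: (complex \<times> complex) measure))"
    using measurable_compose[OF measurable_fst measurable_fst, of lborel circle2 lborel] by simp
  have [measurable]: "(\<lambda>q. snd q) \<in> borel_measurable (haar_split \<Otimes>\<^sub>M (lborel :: (complex \<times> complex) measure))"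
    using measurable_snd[of haar_split lborel] by simp
  have "(\<lambda>q. fiber \<xi> (snd (fst q)) (snd q) * cis (- (fst (fst q) \<bullet> snd q))) \<in> borel_measurable (haar_split \<Otimes>\<^sub>M (lborel :: (complex \<times> complex) measure))"
    by measurable
  from measurable_integral_param[OF sigma_finite_lborel this] show ?thesis
    by (simp add: FT_def)
qed

lemma pair_sigma_finite_haar_split: "pair_sigma_finite (lborel :: (complex \<times> complex) measure) circle2"
  by (intro pair_sigma_finite.intro sigma_finite_lborel sigma_finite_circle2)

text \<open>By Fubini almost every fibre is integrable, so Plancherel's inequality applies to it;
  integrating over the fibres restores the L2 norm on the group.\<close>

lemma Plancherel_fiber:
  assumes \<xi>: "\<xi> \<in> L2 motion_haar2" and i: "integrable motion_haar2 \<xi>"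
  shows "(\<integral>\<^sup>+p. ennreal ((cmod (FT (fiber \<xi> (snd p)) (fst p)))\<^sup>2) \<partial>haar_split) \<le>
     ennreal ((gauss_const TYPE(complex \<times> complex) * L2_norm motion_haar2 \<xi>)\<^sup>2)"
proof -
  interpret hs: pair_sigma_finite "lborel :: (complex \<times> complex) measure" circle2
    by (rule pair_sigma_finite_haar_split)
  have m [measurable]: "\<xi> \<in> borel_measurable motion_haar2"
    using \<xi> by (rule L2_measurable)
  have "integrable haar_split (\<lambda>p. fiber \<xi> (snd p) (fst p))"
    using i integrable_motion_haar2_iff[OF m] by (simp add: fiber_def)
  then have "integrable haar_split (\<lambda>(y, k). fiber \<xi> k y)"
    by (simp add: case_prod_unfold)
  then have AE: "AE k in circle2. integrable lborel (\<lambda>y. fiber \<xi> k y)"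
    by (rule hs.AE_integrable_snd)
  note [measurable] = measurable_FT_fiber[OF m] measurable_fiber_joint[OF m]
  let ?N = "gauss_const TYPE(complex \<times> complex)"
  have "(\<integral>\<^sup>+p. ennreal ((cmod (FT (fiber \<xi> (snd p)) (fst p)))\<^sup>2) \<partial>haar_split) =
     (\<integral>\<^sup>+k. \<integral>\<^sup>+y. ennreal ((cmod (FT (fiber \<xi> k) y))\<^sup>2) \<partial>lborel \<partial>circle2)"
    using hs.nn_integral_snd[of "\<lambda>p. ennreal ((cmod (FT (fiber \<xi> (snd p)) (fst p)))\<^sup>2)"] by simp
  also have "\<dots> \<le> (\<integral>\<^sup>+k. ennreal (?N\<^sup>2) * (\<integral>\<^sup>+y. ennreal ((cmod (fiber \<xi> k y))\<^sup>2) \<partial>lborel) \<partial>circle2)"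
  proof (rule nn_integral_mono_AE)
    show "AE k in circle2. (\<integral>\<^sup>+y. ennreal ((cmod (FT (fiber \<xi> k) y))\<^sup>2) \<partial>lborel) \<le> ennreal (?N\<^sup>2) * (\<integral>\<^sup>+y. ennreal ((cmod (fiber \<xi> k y))\<^sup>2) \<partial>lborel)"
      using AE by eventually_elim (rule Plancherel_le)
  qed
  also have "\<dots> = ennreal (?N\<^sup>2) * (\<integral>\<^sup>+k. (\<integral>\<^sup>+y. ennreal ((cmod (fiber \<xi> k y))\<^sup>2) \<partial>lborel) \<partial>circle2)"
  proof (rule nn_integral_cmult)
    have "(\<lambda>(k, y). ennreal ((cmod (fiber \<xi> k y))\<^sup>2)) \<in> borel_measurable (circle2 \<Otimes>\<^sub>M lborel)"
      using measurable_compose[OF measurable_pair_swap' measurable_fiber_joint[OF m]] by (simp add: case_prod_unfold)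
    then show "(\<lambda>k. \<integral>\<^sup>+y. ennreal ((cmod (fiber \<xi> k y))\<^sup>2) \<partial>lborel) \<in> borel_measurable circle2"
      by (rule lborel.borel_measurable_nn_integral)
  qed
  also have "(\<integral>\<^sup>+k. (\<integral>\<^sup>+y. ennreal ((cmod (fiber \<xi> k y))\<^sup>2) \<partial>lborel) \<partial>circle2) = (\<integral>\<^sup>+p. ennreal ((cmod (\<xi> (regroup p)))\<^sup>2) \<partial>haar_split)"
    using hs.nn_integral_snd[of "\<lambda>p. ennreal ((cmod (fiber \<xi> (snd p) (fst p)))\<^sup>2)"] by (simp add: fiber_def)
  also have "\<dots> = (\<integral>\<^sup>+p. ennreal ((cmod (\<xi> p))\<^sup>2) \<partial>motion_haar2)"
    by (rule nn_integral_motion_haar2[symmetric]) measurable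
  also have "\<dots> = ennreal ((L2_norm motion_haar2 \<xi>)\<^sup>2)"
    by (rule nn_integral_L2_norm[OF \<xi>])
  finally show ?thesis
    by (simp add: power_mult_distrib ennreal_mult)
qed

text \<open>The contribution of the fibre over \<open>k\<close> to a coefficient function at the
  group element with translations \<open>\<alpha>\<close> and rotations
  \<open>(z, cnj z)\<close>.\<close>

definition correlation where
  "correlation \<xi> \<eta> z k \<alpha> = (LINT y|lborel. fiber \<xi> (twist z k) (twist z (y - \<alpha>)) * cnj (fiber \<eta> k y))"

lemma measurable_correlation:
  assumes z: "cmod z = 1" and \<xi>: "\<xi> \<in> borel_measurable motion_haar2" and \<eta>: "\<eta> \<in> borel_measurable motion_haar2"
  shows "(\<lambda>q. correlation \<xi> \<eta> z (snd q) (fst q)) \<in> borel_measurable haar_split"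
proof -
  let ?L = "lborel :: (complex \<times> complex) measure"
  have b1 [measurable]: "(\<lambda>q. fst (fst q)) \<in> haar_split \<Otimes>\<^sub>M ?L \<rightarrow>\<^sub>M ?L"
    using measurable_compose[OF measurable_fst measurable_fst, of lborel circle2 ?L] .
  have b2 [measurable]: "(\<lambda>q. snd q) \<in> haar_split \<Otimes>\<^sub>M ?L \<rightarrow>\<^sub>M ?L"
    by (rule measurable_snd)
  have k: "(\<lambda>q. snd (fst q)) \<in> haar_split \<Otimes>\<^sub>M ?L \<rightarrow>\<^sub>M circle2"
    using measurable_compose[OF measurable_fst measurable_snd, of lborel circle2 ?L] .
  have "(\<lambda>q. twist z (snd q - fst (fst q))) \<in> borel_measurable (haar_split \<Otimes>\<^sub>M ?L)"
    using b1 b2 by measurable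
  then have "(\<lambda>q. (twist z (snd q - fst (fst q)), twist z (snd (fst q)))) \<in> haar_split \<Otimes>\<^sub>M ?L \<rightarrow>\<^sub>M haar_split"
    using measurable_compose[OF k measurable_twist_circle2[OF z]] by (intro measurable_Pair) auto
  from measurable_compose[OF this measurable_fiber_joint[OF \<xi>]]
  have [measurable]: "(\<lambda>q. fiber \<xi> (twist z (snd (fst q))) (twist z (snd q - fst (fst q)))) \<in> borel_measurable (haar_split \<Otimes>\<^sub>M ?L)"
    by simp
  have "(\<lambda>q. (snd q, snd (fst q))) \<in> haar_split \<Otimes>\<^sub>M ?L \<rightarrow>\<^sub>M haar_split"
    using b2 k by (intro measurable_Pair)
  from measurable_compose[OF this measurable_fiber_joint[OF \<eta>]]
  have [measurable]: "(\<lambda>q. fiber \<eta> (snd (fst q)) (snd q)) \<in> borel_measurable (haar_split \<Otimes>\<^sub>M ?L)"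
    by simp
  have "(\<lambda>q. fiber \<xi> (twist z (snd (fst q))) (twist z (snd q - fst (fst q))) * cnj (fiber \<eta> (snd (fst q)) (snd q))) \<in> borel_measurable (haar_split \<Otimes>\<^sub>M ?L)"
    by measurable
  from measurable_integral_param[OF sigma_finite_lborel this] show ?thesis
    by (simp add: correlation_def)
qed

text \<open>Fubini in split coordinates. The third claim is uniform in \<open>\<alpha>\<close> and
  serves as the majorant when the coefficient is averaged over base points and Gaussian
  displacements.\<close>

lemma coefficient_eq_correlation:
  assumes z: "cmod z = 1" and \<xi>: "\<xi> \<in> L2 motion_haar2" and \<eta>: "\<eta> \<in> L2 motion_haar2"
  shows "integrable circle2 (\<lambda>k. correlation \<xi> \<eta> z k \<alpha>)"
    and "L2_inner motion_haar2 (left_regular motion_group2 (regroup (\<alpha>, (z, cnj z))) \<xi>) \<eta> = (LINT k|circle2. correlation \<xi> \<eta> z k \<alpha>)"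
    and "(LINT k|circle2. cmod (correlation \<xi> \<eta> z k \<alpha>)) \<le> L2_norm motion_haar2 \<xi> * L2_norm motion_haar2 \<eta>"
proof -
  interpret hs: pair_sigma_finite "lborel :: (complex \<times> complex) measure" circle2
    by (rule pair_sigma_finite_haar_split)
  let ?g = "regroup (\<alpha>, (z, cnj z))"
  let ?l = "left_regular motion_group2 ?g \<xi>"
  have g: "?g \<in> carrier motion_group2"
    using z by (simp add: regroup_def carrier_motion_group2 case_prod_unfold)
  note l = left_regular_L2[OF g \<xi>]
  have [measurable]: "?l \<in> borel_measurable motion_haar2" "\<eta> \<in> borel_measurable motion_haar2"
    using l(1) \<eta> by (auto simp: L2_measurable)
  have m: "(\<lambda>p. ?l p * cnj (\<eta> p)) \<in> borel_measurable motion_haar2"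
    by measurable
  define H where "H y k = fiber \<xi> (twist z k) (twist z (y - \<alpha>)) * cnj (fiber \<eta> k y)" for y k
  have H: "?l (regroup p) * cnj (\<eta> (regroup p)) = H (fst p) (snd p)" for p
    using left_regular_regroup[OF z, of \<alpha> \<xi> "fst p" "snd p"] by (simp add: H_def fiber_def)
  have "integrable haar_split (\<lambda>p. H (fst p) (snd p))"
    using integrable_L2_mult[OF l(1) \<eta>] integrable_motion_haar2_iff[OF m] unfolding H by simp
  then have Hint: "integrable haar_split (\<lambda>(y, k). H y k)"
    by (simp add: case_prod_unfold)
  have c: "correlation \<xi> \<eta> z k \<alpha> = (LINT y|lborel. H y k)" for k
    by (simp add: correlation_def H_def)
  show ci: "integrable circle2 (\<lambda>k. correlation \<xi> \<eta> z k \<alpha>)"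
    unfolding c using Hint by (rule hs.integrable_snd)
  show "L2_inner motion_haar2 ?l \<eta> = (LINT k|circle2. correlation \<xi> \<eta> z k \<alpha>)"
    unfolding L2_inner_def integral_motion_haar2[OF m] H c hs.integral_snd[OF Hint] by (simp only: case_prod_unfold)
  have "ennreal (LINT k|circle2. cmod (correlation \<xi> \<eta> z k \<alpha>)) = (\<integral>\<^sup>+k. ennreal (cmod (correlation \<xi> \<eta> z k \<alpha>)) \<partial>circle2)"
    using ci by (intro nn_integral_eq_integral[symmetric]) auto
  also have "\<dots> \<le> (\<integral>\<^sup>+k. \<integral>\<^sup>+y. ennreal (cmod (H y k)) \<partial>lborel \<partial>circle2)"
  proof (rule nn_integral_mono_AE)
    show "AE k in circle2. ennreal (cmod (correlation \<xi> \<eta> z k \<alpha>)) \<le> (\<integral>\<^sup>+y. ennreal (cmod (H y k)) \<partial>lborel)"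
      using hs.AE_integrable_snd[OF Hint] unfolding c by eventually_elim (rule integral_norm_bound_ennreal)
  qed
  also have "\<dots> = (\<integral>\<^sup>+p. ennreal (cmod (H (fst p) (snd p))) \<partial>haar_split)"
  proof -
    have "(\<lambda>p. ennreal (cmod (H (fst p) (snd p)))) \<in> borel_measurable haar_split"
      using borel_measurable_integrable[OF Hint] by (simp add: case_prod_unfold)
    from hs.nn_integral_snd[OF this] show ?thesis by simp
  qed
  also have "\<dots> = (\<integral>\<^sup>+p. ennreal (cmod (?l p * cnj (\<eta> p))) \<partial>motion_haar2)"
    unfolding H[symmetric] by (rule nn_integral_motion_haar2[symmetric]) measurable
  also have "\<dots> \<le> ennreal (L2_norm motion_haar2 ?l * L2_norm motion_haar2 \<eta>)"
    using nn_integral_cmod_mult_le[OF l(1) \<eta>] by (simp add: norm_mult)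
  finally show "(LINT k|circle2. cmod (correlation \<xi> \<eta> z k \<alpha>)) \<le> L2_norm motion_haar2 \<xi> * L2_norm motion_haar2 \<eta>"
    unfolding l(2) by (simp add: L2_norm_nonneg)
qed

abbreviation coefficient where
  "coefficient \<xi> \<eta> \<equiv> (\<lambda>g. L2_inner motion_haar2 (left_regular motion_group2 g \<xi>) \<eta>)"

text \<open>Exchanging the fibre integral with the averages shows that the average of a coefficient
  is the integral over \<open>k\<close> of smoothed correlations of fibres. Fubini identifies the
  integrand with \<open>Q a\<close> for almost every \<open>k\<close> only, so the conclusion offers
  an integrable version \<open>q\<close> in its place.\<close>

lemma coefficient_smoothing:
  fixes v :: "complex \<Rightarrow> complex" and e :: real
  assumes z: "cmod z = 1" and \<xi>: "\<xi> \<in> L2 motion_haar2" and \<eta>: "\<eta> \<in> L2 motion_haar2" and v: "integrable lborel v"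
  defines "F \<equiv> \<lambda>a p. weight v (z, p) * coefficient \<xi> \<eta> (sample e a (z, p))"
    and "Q \<equiv> \<lambda>a k. smoothed_correlation v e z a (\<lambda>y. fiber \<xi> (twist z k) (twist z y)) (fiber \<eta> k)"
  shows "integrable (lborel \<Otimes>\<^sub>M lborel) (F a)"
    and "\<exists>q. integrable circle2 q \<and> (AE k in circle2. q k = Q a k) \<and> (LINT p|(lborel \<Otimes>\<^sub>M lborel). F a p) = (LINT k|circle2. q k)"
proof -
  let ?L = "lborel \<Otimes>\<^sub>M lborel :: (complex \<times> (complex \<times> complex)) measure"
  interpret pk: pair_sigma_finite ?L circle2
    by (intro pair_sigma_finite.intro sigma_finite_pair sigma_finite_lborel sigma_finite_circle2)
  define \<alpha> where "\<alpha> p = base_point z a (fst p) + e *\<^sub>R snd p" for p :: "complex \<times> (complex \<times> complex)"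
  define w where "w p = v (fst p) * complex_of_real (gauss (snd p))" for p :: "complex \<times> (complex \<times> complex)"
  define B where "B = L2_norm motion_haar2 \<xi> * L2_norm motion_haar2 \<eta>"
  have B0: "B \<ge> 0" by (simp add: B_def L2_norm_nonneg)
  note \<xi>m = L2_measurable[OF \<xi>] and \<eta>m = L2_measurable[OF \<eta>]
  note coeff = coefficient_eq_correlation[OF z \<xi> \<eta>]
  have F: "F a p = w p * (LINT k|circle2. correlation \<xi> \<eta> z k (\<alpha> p))" for p
    unfolding F_def weight_def w_def sample_def \<alpha>_def by (simp only: fst_conv snd_conv coeff(2))
  have g: "integrable lborel (\<lambda>b. complex_of_real (gauss b))"
    using integrable_gauss by (simp add: complex_of_real_integrable_eq)
  have w: "integrable ?L w"
    using integrable_pair_mult[OF sigma_finite_lborel sigma_finite_lborel v g] by (simp add: w_def[abs_def] case_prod_unfold)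
  define H where "H p k = w p * correlation \<xi> \<eta> z k (\<alpha> p)" for p k
  have f1: "(\<lambda>p. fst p) \<in> borel_measurable ?L" and f2: "(\<lambda>p. snd p) \<in> borel_measurable ?L"
    using measurable_fst[of lborel lborel] measurable_snd[of lborel lborel] by simp_all
  have \<alpha>m: "\<alpha> \<in> borel_measurable ?L"
    unfolding \<alpha>_def[abs_def] using measurable_compose[OF f1 measurable_base_point] f2 by measurable
  have "(\<lambda>q. (\<alpha> (fst q), snd q)) \<in> ?L \<Otimes>\<^sub>M circle2 \<rightarrow>\<^sub>M haar_split"
    using measurable_compose[OF measurable_fst \<alpha>m] by (intro measurable_Pair) auto
  from measurable_compose[OF this measurable_correlation[OF z \<xi>m \<eta>m]]
  have cm [measurable]: "(\<lambda>q. correlation \<xi> \<eta> z (snd q) (\<alpha> (fst q))) \<in> borel_measurable (?L \<Otimes>\<^sub>M circle2)"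
    by simp
  have wm [measurable]: "w \<in> borel_measurable ?L"
    using w by auto
  have Hm: "(\<lambda>(p, k). H p k) \<in> borel_measurable (?L \<Otimes>\<^sub>M circle2)"
    unfolding H_def case_prod_unfold by measurable
  have Hint: "integrable (?L \<Otimes>\<^sub>M circle2) (\<lambda>(p, k). H p k)"
  proof (rule pk.Fubini_integrable[OF Hm])
    have eq: "(LINT k|circle2. norm (case (p, k) of (p, k) \<Rightarrow> H p k)) = cmod (w p) * (LINT k|circle2. cmod (correlation \<xi> \<eta> z k (\<alpha> p)))" for p
      by (simp add: H_def norm_mult)
    show "integrable ?L (\<lambda>p. LINT k|circle2. norm (case (p, k) of (p, k) \<Rightarrow> H p k))"
    proof (rule Bochner_Integration.integrable_bound)
      show "integrable ?L (\<lambda>p. B * cmod (w p))"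
        using w by simp
      \<comment> \<open>\<open>measurable_integral_param\<close> is about complex functions; the
        real integral is recovered as a real part.\<close>
      have "(\<lambda>q. complex_of_real (norm (case q of (p, k) \<Rightarrow> H p k))) \<in> borel_measurable (?L \<Otimes>\<^sub>M circle2)"
        using Hm by measurable
      from measurable_integral_param[OF sigma_finite_circle2 this]
      have "(\<lambda>p. LINT k|circle2. complex_of_real (norm (case (p, k) of (p, k) \<Rightarrow> H p k))) \<in> borel_measurable ?L" .
      then have "(\<lambda>p. Re (LINT k|circle2. complex_of_real (norm (case (p, k) of (p, k) \<Rightarrow> H p k)))) \<in> borel_measurable ?L"
        by measurable
      then show "(\<lambda>p. LINT k|circle2. norm (case (p, k) of (p, k) \<Rightarrow> H p k)) \<in> borel_measurable ?L"
        by (simp only: integral_complex_of_real Re_complex_of_real)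
      show "AE p in ?L. norm (LINT k|circle2. norm (case (p, k) of (p, k) \<Rightarrow> H p k)) \<le> norm (B * cmod (w p))"
      proof (rule AE_I2)
        fix p
        have "cmod (w p) * (LINT k|circle2. cmod (correlation \<xi> \<eta> z k (\<alpha> p))) \<le> cmod (w p) * B"
          unfolding B_def by (intro mult_left_mono coeff(3)) auto
        then show "norm (LINT k|circle2. norm (case (p, k) of (p, k) \<Rightarrow> H p k)) \<le> norm (B * cmod (w p))"
          unfolding eq using B0 by (simp add: abs_mult mult.commute)
      qed
    qed
    show "AE p in ?L. integrable circle2 (\<lambda>k. case (p, k) of (p, k) \<Rightarrow> H p k)"
      using coeff(1) by (simp add: H_def)
  qed
  have F': "F a p = (LINT k|circle2. H p k)" for p
    unfolding F H_def by (rule integral_mult_right_zero[symmetric])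
  show "integrable ?L (F a)"
    using pk.integrable_fst[OF Hint] by (simp add: F'[abs_def])
  show "\<exists>q. integrable circle2 q \<and> (AE k in circle2. q k = Q a k) \<and> (LINT p|?L. F a p) = (LINT k|circle2. q k)"
  proof (intro exI conjI)
    show "integrable circle2 (\<lambda>k. LINT p|?L. H p k)"
      using Hint by (rule pk.integrable_snd)
    show "(LINT p|?L. F a p) = (LINT k|circle2. LINT p|?L. H p k)"
      unfolding F' by (rule pk.Fubini_integral[OF Hint, symmetric])
    show "AE k in circle2. (LINT p|?L. H p k) = Q a k"
      using pk.AE_integrable_snd[OF Hint]
    proof eventually_elim
      case (elim k)
      have "(LINT p|?L. H p k) = (LINT x|lborel. LINT b|lborel. H (x, b) k)"
        by (rule lborel_pair.integral_fst'[OF elim, symmetric])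
      also have "\<dots> = Q a k"
        unfolding Q_def smoothed_correlation_def
      proof (rule Bochner_Integration.integral_cong)
        fix x :: complex
        have "H (x, b) k = v x * (of_real (gauss b) * (LINT y|lborel. fiber \<xi> (twist z k) (twist z (y - (base_point z a x + e *\<^sub>R b))) * cnj (fiber \<eta> k y)))" for b
          by (simp add: H_def w_def \<alpha>_def correlation_def mult.assoc)
        then show "(LINT b|lborel. H (x, b) k) = v x * (LINT b|lborel. of_real (gauss b) * (LINT y|lborel. fiber \<xi> (twist z k) (twist z (y - (base_point z a x + e *\<^sub>R b))) * cnj (fiber \<eta> k y)))"
          by (simp only: integral_mult_right_zero)
      qed simp
      finally show ?case .
    qed
  qed
qed

lemma integrable_fibers:
  assumes z: "cmod z = 1" and i: "integrable motion_haar2 \<xi>"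
  shows "AE k in circle2. integrable lborel (\<lambda>y. fiber \<xi> (twist z k) (twist z y))"
proof -
  interpret hs: pair_sigma_finite "lborel :: (complex \<times> complex) measure" circle2
    by (rule pair_sigma_finite_haar_split)
  have m: "\<xi> \<in> borel_measurable motion_haar2"
    using i by auto
  let ?f = "\<lambda>p. fiber \<xi> (snd p) (fst p)"
  have f: "integrable haar_split ?f"
    using i integrable_motion_haar2_iff[OF m] by (simp add: fiber_def)
  have fm: "?f \<in> borel_measurable haar_split"
    using f by auto
  have tm: "(\<lambda>p. (twist z (fst p), twist z (snd p))) \<in> haar_split \<rightarrow>\<^sub>M haar_split"
    using measurable_compose[OF measurable_snd measurable_twist_circle2[OF z]]
      measurable_compose[OF measurable_fst, of "twist z" lborel lborel]
    by (intro measurable_Pair) auto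
  have "integrable haar_split (\<lambda>p. fiber \<xi> (twist z (snd p)) (twist z (fst p)))"
  proof (rule integrableI_bounded)
    show "(\<lambda>p. fiber \<xi> (twist z (snd p)) (twist z (fst p))) \<in> borel_measurable haar_split"
      using measurable_compose[OF tm fm] by simp
    have "(\<lambda>p. ennreal (cmod (?f p))) \<in> borel_measurable haar_split"
      using fm by measurable
    from nn_integral_haar_split_twist[OF z this]
    have "(\<integral>\<^sup>+p. ennreal (cmod (fiber \<xi> (twist z (snd p)) (twist z (fst p)))) \<partial>haar_split) = (\<integral>\<^sup>+p. ennreal (cmod (?f p)) \<partial>haar_split)"
      by simp
    also have "\<dots> < \<infinity>"
      using f by (simp add: integrable_iff_bounded)
    finally show "(\<integral>\<^sup>+p. ennreal (cmod (fiber \<xi> (twist z (snd p)) (twist z (fst p)))) \<partial>haar_split) < \<infinity>" .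
  qed
  then have "integrable haar_split (\<lambda>(y, k). fiber \<xi> (twist z k) (twist z y))"
    by (simp add: case_prod_unfold)
  then show ?thesis
    by (rule hs.AE_integrable_snd)
qed

text \<open>Integrability of \<open>\<xi>\<close> and \<open>\<eta>\<close> makes almost all fibres
  integrable, so that their Fourier transforms make sense. For each z, the fibrewise estimate of the
  difference quotient yields the integrand of the Schur test, with the transforms of the fibres of
  \<open>\<xi>\<close> and \<open>\<eta>\<close> in the two slots.\<close>

lemma approx_coefficient_bound_integrable:
  fixes v :: "complex \<Rightarrow> complex" and e h :: real
  assumes \<xi>: "\<xi> \<in> L2 motion_haar2" and \<eta>: "\<eta> \<in> L2 motion_haar2"
    and \<xi>i: "integrable motion_haar2 \<xi>" and \<eta>i: "integrable motion_haar2 \<eta>"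
    and v: "integrable lborel v" and W0: "W \<ge> 0" and W: "\<And>k. (1 + (cmod k)\<^sup>2) * cmod (FT v k) \<le> W"
    and e: "e > 0" and h: "h > 0"
  shows "cmod (approx_functional v c e h (coefficient \<xi> \<eta>)) \<le> 6 * (cmod c * W) * (L2_norm motion_haar2 \<xi> * L2_norm motion_haar2 \<eta>)"
proof -
  let ?L = "lborel \<Otimes>\<^sub>M lborel :: (complex \<times> (complex \<times> complex)) measure"
  interpret cl: pair_sigma_finite circle_measure ?L
    by (intro pair_sigma_finite.intro sigma_finite_circle sigma_finite_pair sigma_finite_lborel)
  interpret hs: pair_sigma_finite "lborel :: (complex \<times> complex) measure" circle2
    by (rule pair_sigma_finite_haar_split)
  note \<xi>m = L2_measurable[OF \<xi>] and \<eta>m = L2_measurable[OF \<eta>]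
  let ?u = "coefficient \<xi> \<eta>"
  define N where "N = gauss_const TYPE(complex \<times> complex)"
  have N: "N > 0" unfolding N_def by (rule gauss_const_pos)
  \<comment> \<open>The two factors 1 / N are compensated in the end by the two applications of
    Plancherel's inequality, each of which costs a factor N.\<close>
  define C where "C = cmod c * W / N\<^sup>2"
  have C0: "C \<ge> 0" using W0 N by (simp add: C_def)
  define \<Phi> where "\<Phi> p = C * cmod (FT (fiber \<xi> (snd p)) (fst p))" for p
  define \<Psi> where "\<Psi> p = cmod (FT (fiber \<eta> (snd p)) (fst p))" for p
  have \<Phi>m: "\<Phi> \<in> borel_measurable haar_split" and \<Psi>m: "\<Psi> \<in> borel_measurable haar_split"
    unfolding \<Phi>_def[abs_def] \<Psi>_def[abs_def] using measurable_FT_fiber[OF \<xi>m] measurable_FT_fiber[OF \<eta>m] by measurable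
  have int: "integrable sample_measure (\<lambda>q. weight v q * ?u (sample e a q))" for a
    by (rule integrable_weight_mult[OF v measurable_coefficient[OF \<xi>m \<eta>m]]) (rule cmod_coefficient_le[OF _ \<xi> \<eta>])
  define D where "D q = weight v q * ((?u (sample e (h * c) q) - ?u (sample e 0 q)) / h)" for q
  have D_eq: "D q = (weight v q * ?u (sample e (h * c) q) - weight v q * ?u (sample e 0 q)) / h" for q
    by (simp add: D_def right_diff_distrib)
  have Dint: "integrable sample_measure D"
    unfolding D_eq[abs_def] by (intro integrable_divide_zero Bochner_Integration.integrable_diff int)
  have "approx_functional v c e h ?u = (LINT z|circle_measure. LINT p|?L. D (z, p))"
  proof -
    have "approx_functional v c e h ?u = (LINT q|sample_measure. D q)"
      unfolding approx_functional_def D_def ..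
    also have "\<dots> = (LINT z|circle_measure. LINT p|?L. D (z, p))"
      by (rule cl.integral_fst'[OF Dint, symmetric])
    finally show ?thesis .
  qed
  then have "ennreal (cmod (approx_functional v c e h ?u)) \<le> (\<integral>\<^sup>+z. ennreal (cmod (LINT p|?L. D (z, p))) \<partial>circle_measure)"
    using integral_norm_bound_ennreal[OF cl.integrable_fst'[OF Dint]] by simp
  also have "\<dots> \<le> (\<integral>\<^sup>+z. (\<integral>\<^sup>+p. ennreal (schur_kernel z (fst p) * \<Phi> (twist z (fst p), twist z (snd p)) * \<Psi> p) \<partial>haar_split) \<partial>circle_measure)"
  proof (rule nn_integral_mono)
    fix z assume "z \<in> space circle_measure"
    then have z: "cmod z = 1" by simp
    let ?f = "\<lambda>k y. fiber \<xi> (twist z k) (twist z y)"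
    let ?F = "\<lambda>a p. weight v (z, p) * ?u (sample e a (z, p))"
    note sm = coefficient_smoothing[OF z \<xi> \<eta> v, of e]
    from sm(2)[of "h * c"] obtain q1 where q1: "integrable circle2 q1"
      "AE k in circle2. q1 k = smoothed_correlation v e z (h * c) (?f k) (fiber \<eta> k)"
      "(LINT p|?L. ?F (h * c) p) = (LINT k|circle2. q1 k)" by blast
    from sm(2)[of 0] obtain q0 where q0: "integrable circle2 q0"
      "AE k in circle2. q0 k = smoothed_correlation v e z 0 (?f k) (fiber \<eta> k)"
      "(LINT p|?L. ?F 0 p) = (LINT k|circle2. q0 k)" by blast
    have "(LINT p|?L. D (z, p)) = ((LINT p|?L. ?F (h * c) p) - (LINT p|?L. ?F 0 p)) / h"
      unfolding D_eq using sm(1)[of "h * c"] sm(1)[of 0] by (simp add: Bochner_Integration.integral_diff)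
    also have "\<dots> = (LINT k|circle2. (q1 k - q0 k) / h)"
      unfolding q1(3) q0(3) using q1(1) q0(1) by (simp add: Bochner_Integration.integral_diff)
    finally have "ennreal (cmod (LINT p|?L. D (z, p))) \<le> (\<integral>\<^sup>+k. ennreal (cmod ((q1 k - q0 k) / h)) \<partial>circle2)"
      using integral_norm_bound_ennreal[of circle2 "\<lambda>k. (q1 k - q0 k) / h"] q1(1) q0(1) by simp
    also have "\<dots> \<le> (\<integral>\<^sup>+k. \<integral>\<^sup>+\<kappa>. ennreal (schur_kernel z \<kappa> * \<Phi> (twist z \<kappa>, twist z k) * \<Psi> (\<kappa>, k)) \<partial>lborel \<partial>circle2)"
    proof (rule nn_integral_mono_AE)
      have one: "cmod (1::complex) = 1" by simp
      have "AE k in circle2. integrable lborel (fiber \<eta> k)"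
        using integrable_fibers[OF one \<eta>i] by (simp add: twist_def)
      with integrable_fibers[OF z \<xi>i] q1(2) q0(2) AE_space
      show "AE k in circle2. ennreal (cmod ((q1 k - q0 k) / h)) \<le> (\<integral>\<^sup>+\<kappa>. ennreal (schur_kernel z \<kappa> * \<Phi> (twist z \<kappa>, twist z k) * \<Psi> (\<kappa>, k)) \<partial>lborel)"
      proof eventually_elim
        case (elim k)
        have tk: "twist z k \<in> space circle2"
          using elim(4) measurable_space[OF measurable_twist_circle2[OF z]] by blast
        \<comment> \<open>The twist is orthogonal, hence commutes with the Fourier transform; it
          becomes the twist in the argument of \<open>\<Phi>\<close>.\<close>
        have FTt: "FT (?f k) \<kappa> = FT (fiber \<xi> (twist z k)) (twist z \<kappa>)" for \<kappa>
          by (rule FT_twist[OF z measurable_fiber[OF \<xi>m tk]])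
        have "ennreal (cmod ((q1 k - q0 k) / h)) \<le>
          (\<integral>\<^sup>+\<kappa>. ennreal (C * (schur_kernel z \<kappa> * cmod (FT (?f k) \<kappa>) * cmod (FT (fiber \<eta> k) \<kappa>))) \<partial>lborel)"
          using smoothed_correlation_difference[OF elim(1) elim(5) v e h z W, where c=c] unfolding elim(2,3) C_def N_def .
        then show ?case
          unfolding FTt \<Phi>_def \<Psi>_def by (simp add: mult_ac)
      qed
    qed
    also have "\<dots> = (\<integral>\<^sup>+p. ennreal (schur_kernel z (fst p) * \<Phi> (twist z (fst p), twist z (snd p)) * \<Psi> p) \<partial>haar_split)"
    proof -
      have "(\<lambda>p. (twist z (fst p), twist z (snd p))) \<in> haar_split \<rightarrow>\<^sub>M haar_split"
        using measurable_compose[OF measurable_snd measurable_twist_circle2[OF z]]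
          measurable_compose[OF measurable_fst, of "twist z" lborel lborel]
        by (intro measurable_Pair) auto
      from measurable_compose[OF this \<Phi>m] have [measurable]: "(\<lambda>p. \<Phi> (twist z (fst p), twist z (snd p))) \<in> borel_measurable haar_split" .
      have [measurable]: "(\<lambda>p. fst p) \<in> borel_measurable haar_split"
        using measurable_fst[of lborel circle2] by simp
      have [measurable]: "(\<lambda>p. schur_kernel z (fst p)) \<in> borel_measurable haar_split"
        unfolding schur_kernel_def by measurable
      note [measurable] = \<Psi>m
      have "(\<lambda>p. ennreal (schur_kernel z (fst p) * \<Phi> (twist z (fst p), twist z (snd p)) * \<Psi> p)) \<in> borel_measurable haar_split"
        by measurable
      from hs.nn_integral_snd[OF this] show ?thesis by simp
    qed
    finally show "ennreal (cmod (LINT p|?L. D (z, p))) \<le> (\<integral>\<^sup>+p. ennreal (schur_kernel z (fst p) * \<Phi> (twist z (fst p), twist z (snd p)) * \<Psi> p) \<partial>haar_split)" .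
  qed
  also have "\<dots> \<le> ennreal (6 * (C * (N * L2_norm motion_haar2 \<xi>)) * (N * L2_norm motion_haar2 \<eta>))"
  proof (rule schur_test[OF \<Phi>m \<Psi>m])
    show "0 \<le> \<Phi> p" "0 \<le> \<Psi> p" for p
      using C0 by (simp_all add: \<Phi>_def \<Psi>_def)
    show "0 \<le> C * (N * L2_norm motion_haar2 \<xi>)" "0 \<le> N * L2_norm motion_haar2 \<eta>"
      using C0 N by (simp_all add: L2_norm_nonneg)
    show "(\<integral>\<^sup>+p. ennreal ((\<Psi> p)\<^sup>2) \<partial>haar_split) \<le> ennreal ((N * L2_norm motion_haar2 \<eta>)\<^sup>2)"
      unfolding \<Psi>_def N_def by (rule Plancherel_fiber[OF \<eta> \<eta>i])
    have "(\<integral>\<^sup>+p. ennreal ((\<Phi> p)\<^sup>2) \<partial>haar_split) = (\<integral>\<^sup>+p. ennreal (C\<^sup>2) * ennreal ((cmod (FT (fiber \<xi> (snd p)) (fst p)))\<^sup>2) \<partial>haar_split)"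
      by (simp add: \<Phi>_def power_mult_distrib ennreal_mult)
    also have "\<dots> = ennreal (C\<^sup>2) * (\<integral>\<^sup>+p. ennreal ((cmod (FT (fiber \<xi> (snd p)) (fst p)))\<^sup>2) \<partial>haar_split)"
    proof (rule nn_integral_cmult)
      note [measurable] = measurable_FT_fiber[OF \<xi>m]
      show "(\<lambda>p. ennreal ((cmod (FT (fiber \<xi> (snd p)) (fst p)))\<^sup>2)) \<in> borel_measurable haar_split"
        by measurable
    qed
    also have "\<dots> \<le> ennreal (C\<^sup>2) * ennreal ((N * L2_norm motion_haar2 \<xi>)\<^sup>2)"
      unfolding N_def by (intro mult_left_mono Plancherel_fiber[OF \<xi> \<xi>i]) simp
    also have "\<dots> = ennreal ((C * (N * L2_norm motion_haar2 \<xi>))\<^sup>2)"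
      by (simp add: power_mult_distrib ennreal_mult)
    finally show "(\<integral>\<^sup>+p. ennreal ((\<Phi> p)\<^sup>2) \<partial>haar_split) \<le> ennreal ((C * (N * L2_norm motion_haar2 \<xi>))\<^sup>2)" .
  qed
  also have "6 * (C * (N * L2_norm motion_haar2 \<xi>)) * (N * L2_norm motion_haar2 \<eta>) = 6 * (cmod c * W) * (L2_norm motion_haar2 \<xi> * L2_norm motion_haar2 \<eta>)"
    using N by (simp add: C_def power2_eq_square field_simps)
  finally show ?thesis
    using W0 by (simp add: L2_norm_nonneg)
qed

section \<open>Truncation, and the uniform bound on all of L2\<close>

definition truncate where
  "truncate n \<xi> = (\<lambda>p. of_real (indicator (haar_box (real n)) p) * \<xi> p)" for n :: nat and \<xi> :: "_ \<Rightarrow> complex"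

lemma truncate_L2:
  assumes \<xi>: "\<xi> \<in> L2 motion_haar2"
  shows "truncate n \<xi> \<in> L2 motion_haar2" "integrable motion_haar2 (truncate n \<xi>)"
    "L2_norm motion_haar2 (truncate n \<xi>) \<le> L2_norm motion_haar2 \<xi>"
proof -
  have [measurable]: "\<xi> \<in> borel_measurable motion_haar2" "haar_box (real n) \<in> sets motion_haar2"
    using \<xi> by (auto simp: L2_measurable sets_haar_box)
  have m [measurable]: "truncate n \<xi> \<in> borel_measurable motion_haar2"
    unfolding truncate_def by measurable
  have le: "(cmod (truncate n \<xi> p))\<^sup>2 \<le> (cmod (\<xi> p))\<^sup>2" for p
    by (simp add: truncate_def norm_mult split: split_indicator)
  have i2: "integrable motion_haar2 (\<lambda>p. (cmod (truncate n \<xi> p))\<^sup>2)"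
    by (rule Bochner_Integration.integrable_bound[OF L2_integrable[OF \<xi>]]) (use le in auto)
  then show "truncate n \<xi> \<in> L2 motion_haar2"
    by (simp add: L2_def)
  show "L2_norm motion_haar2 (truncate n \<xi>) \<le> L2_norm motion_haar2 \<xi>"
    unfolding L2_norm_def using le by (intro real_sqrt_le_mono integral_mono i2 L2_integrable[OF \<xi>])
  show "integrable motion_haar2 (truncate n \<xi>)"
  proof (rule Bochner_Integration.integrable_bound)
    show "integrable motion_haar2 (\<lambda>p. indicator (haar_box (real n)) p + (cmod (\<xi> p))\<^sup>2)"
      by (intro Bochner_Integration.integrable_add L2_integrable[OF \<xi>] integrable_real_indicator sets_haar_box emeasure_haar_box_finite)
    show "AE p in motion_haar2. norm (truncate n \<xi> p) \<le> norm (indicator (haar_box (real n)) p + (cmod (\<xi> p))\<^sup>2)"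
    proof (rule AE_I2)
      fix p
      \<comment> \<open>On a set of finite measure, L2 is contained in L1 because |x| is at most 1 +
        |x|^2.\<close>
      have "0 \<le> (cmod (\<xi> p) - 1/2)\<^sup>2"
        by (rule zero_le_power2)
      then have "cmod (\<xi> p) \<le> 1 + (cmod (\<xi> p))\<^sup>2"
        by (simp add: power2_eq_square algebra_simps)
      then show "norm (truncate n \<xi> p) \<le> norm (indicator (haar_box (real n)) p + (cmod (\<xi> p))\<^sup>2)"
        by (simp add: truncate_def norm_mult split: split_indicator)
    qed
  qed measurable
qed

lemma truncate_tendsto:
  assumes \<xi>: "\<xi> \<in> L2 motion_haar2"
  shows "(\<lambda>n. L2_norm motion_haar2 (\<lambda>p. \<xi> p - truncate n \<xi> p)) \<longlonglongrightarrow> 0"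
proof -
  have m [measurable]: "\<xi> \<in> borel_measurable motion_haar2"
    using \<xi> by (rule L2_measurable)
  have [measurable]: "truncate n \<xi> \<in> borel_measurable motion_haar2" for n
    using truncate_L2(1)[OF \<xi>] by (rule L2_measurable)
  have "(\<lambda>n. LINT p|motion_haar2. (cmod (\<xi> p - truncate n \<xi> p))\<^sup>2) \<longlonglongrightarrow> (LINT p|motion_haar2. 0)"
  proof (rule integral_dominated_convergence)
    show "integrable motion_haar2 (\<lambda>p. (cmod (\<xi> p))\<^sup>2)"
      by (rule L2_integrable[OF \<xi>])
    show "AE p in motion_haar2. (\<lambda>n. (cmod (\<xi> p - truncate n \<xi> p))\<^sup>2) \<longlonglongrightarrow> 0"
    proof (rule AE_I2)
      fix p assume "p \<in> space motion_haar2"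
      then have p: "cmod (snd (fst p)) = 1" "cmod (snd (snd p)) = 1"
        by (auto simp: space_motion_haar2 carrier_motion_group2)
      obtain n0 :: nat where n0: "max (cmod (fst (fst p))) (cmod (fst (snd p))) \<le> n0"
        using real_arch_simple by blast
      have "(cmod (\<xi> p - truncate n \<xi> p))\<^sup>2 = 0" if "n \<ge> n0" for n
      proof -
        have "p \<in> haar_box (real n)"
          using n0 that p by (auto simp: haar_box_def mem_Times_iff)
        then show ?thesis by (simp add: truncate_def)
      qed
      then show "(\<lambda>n. (cmod (\<xi> p - truncate n \<xi> p))\<^sup>2) \<longlonglongrightarrow> 0"
        by (intro tendsto_eventually eventually_sequentiallyI[of n0])
    qed
    show "AE p in motion_haar2. norm ((cmod (\<xi> p - truncate n \<xi> p))\<^sup>2) \<le> (cmod (\<xi> p))\<^sup>2" for n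
      by (intro AE_I2) (simp add: truncate_def split: split_indicator)
  qed measurable
  then have "(\<lambda>n. sqrt (LINT p|motion_haar2. (cmod (\<xi> p - truncate n \<xi> p))\<^sup>2)) \<longlonglongrightarrow> sqrt 0"
    by (intro tendsto_intros) simp
  then show ?thesis
    by (simp add: L2_norm_def)
qed

lemma coefficient_add_left:
  assumes "g \<in> carrier motion_group2" "\<xi> \<in> L2 motion_haar2" "\<xi>' \<in> L2 motion_haar2" "\<eta> \<in> L2 motion_haar2"
  shows "coefficient (\<lambda>p. \<xi> p + \<xi>' p) \<eta> g = coefficient \<xi> \<eta> g + coefficient \<xi>' \<eta> g"
  using L2_inner_add_left[OF left_regular_L2(1)[OF assms(1,2)] left_regular_L2(1)[OF assms(1,3)] assms(4)]
  by (simp add: left_regular_def)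

lemma coefficient_add_right:
  assumes "g \<in> carrier motion_group2" "\<xi> \<in> L2 motion_haar2" "\<eta> \<in> L2 motion_haar2" "\<eta>' \<in> L2 motion_haar2"
  shows "coefficient \<xi> (\<lambda>p. \<eta> p + \<eta>' p) g = coefficient \<xi> \<eta> g + coefficient \<xi> \<eta>' g"
  using L2_inner_add_right[OF assms(3,4) left_regular_L2(1)[OF assms(1,2)]] .

lemma coefficient_cmult_left: "coefficient (\<lambda>p. c * \<xi> p) \<eta> g = c * coefficient \<xi> \<eta> g"
  using L2_inner_cmult_left[of motion_haar2 c "left_regular motion_group2 g \<xi>" \<eta>] by (simp add: left_regular_def)

lemma approx_coefficient_add:
  assumes v: "integrable lborel v"
    and "\<xi>1 \<in> L2 motion_haar2" "\<eta>1 \<in> L2 motion_haar2" "\<xi>2 \<in> L2 motion_haar2" "\<eta>2 \<in> L2 motion_haar2"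
    and eq: "\<And>g. g \<in> carrier motion_group2 \<Longrightarrow> coefficient \<xi> \<eta> g = coefficient \<xi>1 \<eta>1 g + coefficient \<xi>2 \<eta>2 g"
  shows "approx_functional v c e h (coefficient \<xi> \<eta>) = approx_functional v c e h (coefficient \<xi>1 \<eta>1) + approx_functional v c e h (coefficient \<xi>2 \<eta>2)"
proof -
  have "approx_functional v c e h (coefficient \<xi> \<eta>) = approx_functional v c e h (\<lambda>g. coefficient \<xi>1 \<eta>1 g + coefficient \<xi>2 \<eta>2 g)"
    by (rule approx_functional_cong) (rule eq)
  also have "\<dots> = approx_functional v c e h (coefficient \<xi>1 \<eta>1) + approx_functional v c e h (coefficient \<xi>2 \<eta>2)"
    using assms(2-5)
    by (intro approx_functional_add[OF v, where B="L2_norm motion_haar2 \<xi>1 * L2_norm motion_haar2 \<eta>1" and B'="L2_norm motion_haar2 \<xi>2 * L2_norm motion_haar2 \<eta>2"]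
        measurable_coefficient L2_measurable cmod_coefficient_le)
  finally show ?thesis .
qed

text \<open>Truncate both functions. For fixed \<open>e\<close> and \<open>h\<close> the crude bound
  makes the two error terms vanish as the truncation is lifted, although its constant
  \<open>K\<close> depends on \<open>h\<close>; the main term keeps the uniform constant
  \<open>C\<close>.\<close>

lemma approx_coefficient_bound:
  fixes v :: "complex \<Rightarrow> complex" and e h :: real
  assumes \<xi>: "\<xi> \<in> L2 motion_haar2" and \<eta>: "\<eta> \<in> L2 motion_haar2"
    and v: "integrable lborel v" and W0: "W \<ge> 0" and W: "\<And>k. (1 + (cmod k)\<^sup>2) * cmod (FT v k) \<le> W"
    and e: "e > 0" and h: "h > 0"
  shows "cmod (approx_functional v c e h (coefficient \<xi> \<eta>)) \<le> 6 * (cmod c * W) * (L2_norm motion_haar2 \<xi> * L2_norm motion_haar2 \<eta>)"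
proof -
  let ?n = "L2_norm motion_haar2"
  let ?A = "\<lambda>\<xi> \<eta>. approx_functional v c e h (coefficient \<xi> \<eta>)"
  define K where "K = 2 * (LINT q|sample_measure. cmod (weight v q)) / h"
  have K0: "K \<ge> 0" using h by (simp add: K_def)
  define C where "C = 6 * (cmod c * W)"
  have C0: "C \<ge> 0" using W0 by (simp add: C_def)
  have crude: "cmod (?A f g) \<le> K * (?n f * ?n g)" if "f \<in> L2 motion_haar2" "g \<in> L2 motion_haar2" for f g
    unfolding K_def
    by (rule approx_functional_bound[OF v measurable_coefficient[OF L2_measurable[OF that(1)] L2_measurable[OF that(2)]] _ h])
       (rule cmod_coefficient_le[OF _ that])
  have le: "cmod (?A \<xi> \<eta>) \<le> K * (?n (\<lambda>p. \<xi> p - truncate n \<xi> p) * ?n \<eta>) + K * (?n \<xi> * ?n (\<lambda>p. \<eta> p - truncate n \<eta> p)) + C * (?n \<xi> * ?n \<eta>)" for n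
  proof -
    note t\<xi> = truncate_L2[OF \<xi>, of n] and t\<eta> = truncate_L2[OF \<eta>, of n]
    let ?d\<xi> = "\<lambda>p. \<xi> p - truncate n \<xi> p" and ?d\<eta> = "\<lambda>p. \<eta> p - truncate n \<eta> p"
    have d: "?d\<xi> \<in> L2 motion_haar2" "?d\<eta> \<in> L2 motion_haar2"
      by (intro L2_diff \<xi> \<eta> t\<xi>(1) t\<eta>(1))+
    have 1: "?A \<xi> \<eta> = ?A ?d\<xi> \<eta> + ?A (truncate n \<xi>) \<eta>"
      using coefficient_add_left[OF _ d(1) t\<xi>(1) \<eta>] by (intro approx_coefficient_add[OF v d(1) \<eta> t\<xi>(1) \<eta>]) simp
    have 2: "?A (truncate n \<xi>) \<eta> = ?A (truncate n \<xi>) ?d\<eta> + ?A (truncate n \<xi>) (truncate n \<eta>)"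
      using coefficient_add_right[OF _ t\<xi>(1) d(2) t\<eta>(1)] by (intro approx_coefficient_add[OF v t\<xi>(1) d(2) t\<xi>(1) t\<eta>(1)]) simp
    have 3: "cmod (?A (truncate n \<xi>) ?d\<eta>) \<le> K * (?n \<xi> * ?n ?d\<eta>)"
      by (rule order_trans[OF crude[OF t\<xi>(1) d(2)]]) (intro mult_left_mono mult_right_mono t\<xi>(3) L2_norm_nonneg K0)
    have "cmod (?A (truncate n \<xi>) (truncate n \<eta>)) \<le> C * (?n (truncate n \<xi>) * ?n (truncate n \<eta>))"
      unfolding C_def by (rule approx_coefficient_bound_integrable[OF t\<xi>(1) t\<eta>(1) t\<xi>(2) t\<eta>(2) v W0 W e h])
    also have "\<dots> \<le> C * (?n \<xi> * ?n \<eta>)"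
      by (intro mult_left_mono mult_mono t\<xi>(3) t\<eta>(3) L2_norm_nonneg C0)
    finally have 4: "cmod (?A (truncate n \<xi>) (truncate n \<eta>)) \<le> C * (?n \<xi> * ?n \<eta>)" .
    have "cmod (?A \<xi> \<eta>) \<le> cmod (?A ?d\<xi> \<eta>) + (cmod (?A (truncate n \<xi>) ?d\<eta>) + cmod (?A (truncate n \<xi>) (truncate n \<eta>)))"
      unfolding 1 2 by (intro order_trans[OF norm_triangle_ineq] add_left_mono norm_triangle_ineq)
    then show ?thesis
      using crude[OF d(1) \<eta>] 3 4 by linarith
  qed
  have "(\<lambda>n. K * (?n (\<lambda>p. \<xi> p - truncate n \<xi> p) * ?n \<eta>) + K * (?n \<xi> * ?n (\<lambda>p. \<eta> p - truncate n \<eta> p)) + C * (?n \<xi> * ?n \<eta>)) \<longlonglongrightarrow>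
      K * (0 * ?n \<eta>) + K * (?n \<xi> * 0) + C * (?n \<xi> * ?n \<eta>)"
    by (intro tendsto_intros truncate_tendsto \<xi> \<eta>)
  then have "cmod (?A \<xi> \<eta>) \<le> K * (0 * ?n \<eta>) + K * (?n \<xi> * 0) + C * (?n \<xi> * ?n \<eta>)"
    by (rule LIMSEQ_le_const) (intro exI allI impI le)
  then show ?thesis
    by (simp add: C_def)
qed

section \<open>Convergence on test functions and the operator\<close>

lemma deriv_first_eq_right_deriv: "deriv_first (c, 0) u p = right_deriv (translation_flow c) u p"
proof -
  have "fst p \<otimes>\<^bsub>motion_group\<^esub> motion_exp (t *\<^sub>R (c, 0)) = fst (mult_EE p (translation_flow c t))" for t
    by (simp add: motion_exp_translation mult_E_eq mult_EE_def translation_flow_def scaleR_conv_of_real)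
  moreover have "snd p = snd (mult_EE p (translation_flow c t))" for t
    by (simp add: mult_EE_def mult_E_def translation_flow_def)
  ultimately have "(\<lambda>t. u (fst p \<otimes>\<^bsub>motion_group\<^esub> motion_exp (t *\<^sub>R (c, 0)), snd p)) = (\<lambda>t. u (mult_EE p (translation_flow c t)))"
    by (metis prod.collapse)
  then show ?thesis
    by (simp add: deriv_first_def right_deriv_def case_prod_unfold)
qed

lemma sample_translate: "sample e (of_real h * c) q = mult_EE (sample e 0 q) (translation_flow c h)"
  by (simp add: sample_def regroup_def base_point_def mult_EE_def mult_E_def translation_flow_def case_prod_unfold algebra_simps)

lemma right_deriv_bounded:
  assumes "flow e d" and u: "u \<in> smooth_bounded_support"
  obtains C where "\<And>p. p \<in> carrier motion_group2 \<Longrightarrow> cmod (right_deriv e u p) \<le> C"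
proof -
  obtain A where A: "\<And>p. p \<in> carrier motion_group2 \<Longrightarrow> cmod (u p) \<le> A"
    using smooth_bounded_support_bounded[OF u] by blast
  obtain B where B: "\<And>p. p \<in> carrier motion_group2 \<Longrightarrow> cmod (u p - right_deriv e u p) \<le> B"
    using smooth_bounded_support_bounded[OF smooth_bounded_support_diff_deriv[OF assms]] by blast
  have "cmod (right_deriv e u p) \<le> A + B" if "p \<in> carrier motion_group2" for p
    using norm_triangle_ineq4[of "u p" "u p - right_deriv e u p"] A[OF that] B[OF that] by simp
  then show ?thesis ..
qed

lemma right_deriv_measurable:
  assumes "flow e d" and u: "u \<in> smooth_bounded_support"
  shows "right_deriv e u \<in> borel_measurable motion_haar2"
proof -
  have "(\<lambda>p. u p - (u p - right_deriv e u p)) \<in> borel_measurable motion_haar2"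
    by (intro borel_measurable_diff smooth_bounded_support_measurable u smooth_bounded_support_diff_deriv[OF assms])
  then show ?thesis by simp
qed

text \<open>The mean value inequality for the deviation from the tangent: the error of the quotient
  is at most the oscillation of the derivative along the flow.\<close>

lemma difference_quotient_bound:
  assumes fl: "flow e d" and u: "u \<in> smooth_bounded_support" and p: "p \<in> carrier motion_group2" and h: "h > 0"
    and B: "\<And>t. t \<in> {0..h} \<Longrightarrow> cmod (right_deriv e u (mult_EE p (e t)) - right_deriv e u (mult_EE p (e 0))) \<le> B"
  shows "cmod ((u (mult_EE p (e h)) - u (mult_EE p (e 0))) / h - right_deriv e u (mult_EE p (e 0))) \<le> B"
proof -
  let ?D = "right_deriv e u (mult_EE p (e 0))"
  have "cmod (u (mult_EE p (e h)) - u (mult_EE p (e 0)) - (h - 0) *\<^sub>R ?D) \<le> norm (h - 0) * B"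
  proof (rule vector_differentiable_bound_linearization[where S="{0..h}" and f="\<lambda>t. u (mult_EE p (e t))" and f'="\<lambda>t. right_deriv e u (mult_EE p (e t))"])
    show "((\<lambda>t. u (mult_EE p (e t))) has_vector_derivative right_deriv e u (mult_EE p (e t))) (at t within {0..h})" for t
      by (rule has_vector_derivative_at_within[OF flow_has_vector_derivative[OF fl u p]])
    show "closed_segment 0 h \<subseteq> {0..h}"
      using h by (simp add: closed_segment_eq_real_ivl)
  qed (use h B in auto)
  moreover have "(u (mult_EE p (e h)) - u (mult_EE p (e 0))) / h - ?D = (u (mult_EE p (e h)) - u (mult_EE p (e 0)) - (h - 0) *\<^sub>R ?D) / h"
    using h by (simp add: diff_divide_distrib scaleR_conv_of_real)
  ultimately show ?thesis
    using h by (simp add: norm_divide field_simps)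
qed

text \<open>Dominated convergence: the quotients are bounded because the derivative is, and they
  converge pointwise because the derivative is continuous in the chart and the points at which it is
  compared approach the unsmoothed pair as width and step shrink together.\<close>

lemma approx_functional_tendsto:
  assumes u: "u \<in> smooth_bounded_support" and v: "integrable lborel v"
  defines "s \<equiv> \<lambda>n. 1 / real (Suc n)"
  shows "(\<lambda>n. approx_functional v c (s n) (s n) u) \<longlonglongrightarrow> (LINT g|motion_haar. right_deriv (translation_flow c) u (g, inv_E g) * v (fst g))"
proof -
  note fl = flow_translation[of c]
  let ?w = "right_deriv (translation_flow c) u"
  have s: "s n > 0" "s n \<le> 1" for n by (auto simp: s_def)
  have slim: "s \<longlonglongrightarrow> 0"
    unfolding s_def using LIMSEQ_inverse_real_of_nat by (simp add: inverse_eq_divide)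
  have um: "u \<in> borel_measurable motion_haar2"
    by (rule smooth_bounded_support_measurable[OF u])
  have wm: "?w \<in> borel_measurable motion_haar2"
    by (rule right_deriv_measurable[OF fl u])
  obtain C where C: "\<And>p. p \<in> carrier motion_group2 \<Longrightarrow> cmod (?w p) \<le> C"
    using right_deriv_bounded[OF fl u] by blast
  have C0: "C \<ge> 0"
    using order_trans[OF norm_ge_zero C[of "((0, 1), (0, 1))"]] by (simp add: carrier_motion_group2)
  have e0: "mult_EE p (translation_flow c 0) = p" for p
    by (simp add: mult_EE_def mult_E_def translation_flow_def)
  define \<Delta> where "\<Delta> n q = (u (sample (s n) (s n * c) q) - u (sample (s n) 0 q)) / s n" for n q
  have \<Delta>: "\<Delta> n q = (u (mult_EE (sample (s n) 0 q) (translation_flow c (s n))) - u (mult_EE (sample (s n) 0 q) (translation_flow c 0))) / s n" for n q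
    unfolding \<Delta>_def sample_translate e0 ..
  \<comment> \<open>The oscillation of the derivative is at most 2 C, and its own size at most
    C.\<close>
  have \<Delta>_bound: "cmod (\<Delta> n q) \<le> 3 * C" if q: "q \<in> space sample_measure" for n q
  proof -
    have p: "sample (s n) 0 q \<in> carrier motion_group2"
      using q by (rule sample_carrier)
    have "cmod (?w (mult_EE (sample (s n) 0 q) (translation_flow c t)) - ?w (mult_EE (sample (s n) 0 q) (translation_flow c 0))) \<le> 2 * C" for t
      using norm_triangle_ineq4[of "?w (mult_EE (sample (s n) 0 q) (translation_flow c t))" "?w (mult_EE (sample (s n) 0 q) (translation_flow c 0))"]
        C[OF mult_EE_carrier[OF p translation_flow_carrier], of c t] C[OF mult_EE_carrier[OF p translation_flow_carrier], of c 0] by linarith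
    then have "cmod (\<Delta> n q - ?w (mult_EE (sample (s n) 0 q) (translation_flow c 0))) \<le> 2 * C"
      unfolding \<Delta> by (intro difference_quotient_bound[OF fl u p s(1)])
    then show ?thesis
      using C[OF mult_EE_carrier[OF p translation_flow_carrier], of c 0]
        norm_triangle_sub[of "\<Delta> n q" "?w (mult_EE (sample (s n) 0 q) (translation_flow c 0))"] by linarith
  qed
  have \<Delta>_lim: "(\<lambda>n. \<Delta> n q) \<longlonglongrightarrow> ?w (sample 0 0 q)" if q: "q \<in> space sample_measure" for q
  proof -
    obtain z x b where qe: "q = (z, (x, b))" by (cases q) auto
    have z: "cmod z = 1" using q by (simp add: qe space_sample_measure)
    define \<theta> where "\<theta> = Arg2pi z"
    have \<theta>: "cis \<theta> = z" "cis (- \<theta>) = cnj z"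
      using cis_Arg2pi[OF z] by (simp_all add: \<theta>_def cis_cnj[symmetric])
    \<comment> \<open>Coordinates of the displaced point with both angles fixed: they are affine in
      the width \<open>e\<close> and the time \<open>t\<close>, which makes the distance estimate
      below immediate.\<close>
    define Q where "Q e t = ((x + e *\<^sub>R fst b + t *\<^sub>R (c * z), \<theta>), (- cnj z * x + e *\<^sub>R snd b, - \<theta>))" for e t :: real
    have Q: "mult_EE (sample e 0 q) (translation_flow c t) = chart (Q e t)" for e t
      by (simp add: qe sample_def regroup_def base_point_def mult_EE_def mult_E_def translation_flow_def case_prod_unfold chart_def Q_def \<theta> scaleR_conv_of_real algebra_simps)
    have Q0: "sample 0 0 q = chart (Q 0 0)"
      using Q[of 0 0] by (simp only: e0)
    have sm: "smooth (\<lambda>p. u (chart p))"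
      by (rule smooth_bounded_support_smooth[OF u])
    have "smooth (\<lambda>p. ?w (chart p))"
      unfolding right_deriv_chart[OF fl sm]
      using fl by (intro smooth_derivative_vector_field sm) (simp add: flow_def)
    then have wc: "isCont (\<lambda>p. ?w (chart p)) (Q 0 0)"
      using smooth_continuous continuous_on_eq_continuous_at[OF open_UNIV] by blast
    show ?thesis
    proof (rule tendstoI)
      fix \<epsilon> :: real assume \<epsilon>: "\<epsilon> > 0"
      from wc[unfolded continuous_at_eps_delta, rule_format, of "\<epsilon> / 4"] \<epsilon>
      obtain \<delta> where \<delta>: "\<delta> > 0" "\<And>p. dist p (Q 0 0) < \<delta> \<Longrightarrow> dist (?w (chart p)) (?w (chart (Q 0 0))) < \<epsilon> / 4"
        by auto
      have Qdist: "dist (Q e t) (Q 0 0) \<le> e * cmod (fst b) + t * cmod c + e * cmod (snd b)" if "0 \<le> e" "0 \<le> t" for e t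
      proof -
        have "dist (Q e t) (Q 0 0) = norm ((e *\<^sub>R fst b + t *\<^sub>R (c * z), 0::real), (e *\<^sub>R snd b, 0::real))"
          by (simp add: Q_def dist_norm)
        also have "\<dots> \<le> norm (e *\<^sub>R fst b + t *\<^sub>R (c * z), 0::real) + norm (e *\<^sub>R snd b, 0::real)"
          by (rule norm_Pair_le)
        also have "\<dots> \<le> (e * cmod (fst b) + t * cmod c) + e * cmod (snd b)"
          using that z norm_triangle_ineq[of "e *\<^sub>R fst b" "t *\<^sub>R (c * z)"] by (simp add: norm_Pair norm_mult)
        finally show ?thesis .
      qed
      have "(\<lambda>n. s n * cmod (fst b) + s n * cmod c + s n * cmod (snd b)) \<longlonglongrightarrow> 0 * cmod (fst b) + 0 * cmod c + 0 * cmod (snd b)"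
        by (intro tendsto_intros slim)
      then have "eventually (\<lambda>n. s n * cmod (fst b) + s n * cmod c + s n * cmod (snd b) < \<delta>) sequentially"
        by (rule order_tendstoD(2)) (use \<delta>(1) in simp)
      then show "eventually (\<lambda>n. dist (\<Delta> n q) (?w (sample 0 0 q)) < \<epsilon>) sequentially"
      proof eventually_elim
        case (elim n)
        have near: "dist (?w (chart (Q (s n) t))) (?w (chart (Q 0 0))) < \<epsilon> / 4" if t: "t \<in> {0..s n}" for t
        proof (rule \<delta>(2))
          have "t * cmod c \<le> s n * cmod c"
            using t by (intro mult_right_mono) auto
          then show "dist (Q (s n) t) (Q 0 0) < \<delta>"
            using Qdist[of "s n" t] s(1)[of n] t elim by auto
        qed
        have n0: "dist (?w (chart (Q (s n) 0))) (?w (chart (Q 0 0))) < \<epsilon> / 4"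
          using s(1)[of n] by (intro near) auto
        have "cmod (\<Delta> n q - ?w (mult_EE (sample (s n) 0 q) (translation_flow c 0))) \<le> \<epsilon> / 2"
          unfolding \<Delta>
        proof (rule difference_quotient_bound[OF fl u sample_carrier[OF q] s(1)])
          fix t assume t: "t \<in> {0..s n}"
          have "dist (?w (chart (Q (s n) t))) (?w (chart (Q (s n) 0))) < \<epsilon> / 2"
            by (rule dist_triangle_half_l[where y="?w (chart (Q 0 0))"]) (use near[OF t] n0 in \<open>auto simp: dist_commute\<close>)
          then show "cmod (?w (mult_EE (sample (s n) 0 q) (translation_flow c t)) - ?w (mult_EE (sample (s n) 0 q) (translation_flow c 0))) \<le> \<epsilon> / 2"
            unfolding Q dist_norm by simp
        qed
        then have "dist (\<Delta> n q) (?w (chart (Q (s n) 0))) \<le> \<epsilon> / 2"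
          unfolding Q dist_norm .
        then show ?case
          unfolding Q0 using n0 dist_triangle[of "\<Delta> n q" "?w (chart (Q 0 0))" "?w (chart (Q (s n) 0))"] \<epsilon> by linarith
      qed
    qed
  qed
  have weightm: "weight v \<in> borel_measurable sample_measure"
    using integrable_weight[OF v] by auto
  have samp: "(\<lambda>q. f (sample e a q)) \<in> borel_measurable sample_measure" if "f \<in> borel_measurable motion_haar2" for f :: "_ \<Rightarrow> complex" and e a
    by (rule measurable_compose[OF measurable_sample that])
  have "(\<lambda>n. LINT q|sample_measure. weight v q * \<Delta> n q) \<longlonglongrightarrow> (LINT q|sample_measure. weight v q * ?w (sample 0 0 q))"
  proof (rule integral_dominated_convergence)
    show "(\<lambda>q. weight v q * ?w (sample 0 0 q)) \<in> borel_measurable sample_measure"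
      by (intro borel_measurable_times weightm samp wm)
    show "(\<lambda>q. weight v q * \<Delta> n q) \<in> borel_measurable sample_measure" for n
      unfolding \<Delta>_def by (intro borel_measurable_times borel_measurable_divide borel_measurable_diff weightm samp um borel_measurable_const)
    show "integrable sample_measure (\<lambda>q. cmod (weight v q) * (3 * C))"
      by (intro integrable_mult_left integrable_norm integrable_weight v)
    show "AE q in sample_measure. (\<lambda>n. weight v q * \<Delta> n q) \<longlonglongrightarrow> weight v q * ?w (sample 0 0 q)"
      by (intro AE_I2 tendsto_mult tendsto_const \<Delta>_lim)
    show "AE q in sample_measure. norm (weight v q * \<Delta> n q) \<le> cmod (weight v q) * (3 * C)" for n
      unfolding norm_mult by (intro AE_I2 mult_left_mono \<Delta>_bound norm_ge_zero)
  qed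
  then have lim: "(\<lambda>n. approx_functional v c (s n) (s n) u) \<longlonglongrightarrow> (LINT q|sample_measure. weight v q * ?w (sample 0 0 q))"
    by (simp add: approx_functional_def \<Delta>_def)
  let ?L = "lborel \<Otimes>\<^sub>M lborel :: (complex \<times> (complex \<times> complex)) measure"
  interpret cl: pair_sigma_finite circle_measure ?L
    by (intro pair_sigma_finite.intro sigma_finite_circle sigma_finite_pair sigma_finite_lborel)
  interpret lc: pair_sigma_finite "lborel :: complex measure" circle_measure
    by (intro pair_sigma_finite.intro sigma_finite_lborel sigma_finite_circle)
  have w_pt: "?w (sample 0 0 (z, (x, b))) = ?w ((x, z), inv_E (x, z))" for z x b
    by (simp add: sample_def regroup_def base_point_def inv_E_def case_prod_unfold)
  define G where "G x z = v x * ?w ((x, z), inv_E (x, z))" for x z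
  have int: "integrable sample_measure (\<lambda>q. weight v q * ?w (sample 0 0 q))"
    by (rule integrable_weight_mult[OF v wm]) (rule C)
  have "(LINT q|sample_measure. weight v q * ?w (sample 0 0 q)) = (LINT z|circle_measure. LINT p|?L. weight v (z, p) * ?w (sample 0 0 (z, p)))"
    by (rule cl.integral_fst'[OF int, symmetric])
  also have "\<dots> = (LINT z|circle_measure. LINT x|lborel. G x z)"
  proof (rule integral_cong_AE)
    show "(\<lambda>z. LINT p|?L. weight v (z, p) * ?w (sample 0 0 (z, p))) \<in> borel_measurable circle_measure"
      using cl.integrable_fst'[OF int] by auto
    have pr: "(\<lambda>q. ((snd q, fst q), inv_E (snd q, fst q))) \<in> circle_measure \<Otimes>\<^sub>M lborel \<rightarrow>\<^sub>M motion_haar2"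
    proof -
      have "(\<lambda>q. (snd q, fst q)) \<in> circle_measure \<Otimes>\<^sub>M lborel \<rightarrow>\<^sub>M motion_haar"
        unfolding motion_haar_def by measurable
      then show ?thesis
        by (intro measurable_Pair measurable_inv_E)
    qed
    have "(\<lambda>q. v (snd q)) \<in> borel_measurable (circle_measure \<Otimes>\<^sub>M lborel)"
      using measurable_compose[OF measurable_snd borel_measurable_integrable[OF v]] .
    then have "(\<lambda>q. G (snd q) (fst q)) \<in> borel_measurable (circle_measure \<Otimes>\<^sub>M lborel)"
      unfolding G_def using measurable_compose[OF pr wm] by (intro borel_measurable_times)
    from measurable_integral_param[OF sigma_finite_lborel this]
    show "(\<lambda>z. LINT x|lborel. G x z) \<in> borel_measurable circle_measure"
      by simp
    show "AE z in circle_measure. (LINT p|?L. weight v (z, p) * ?w (sample 0 0 (z, p))) = (LINT x|lborel. G x z)"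
      using cl.AE_integrable_fst'[OF int]
    proof eventually_elim
      case (elim z)
      have "(LINT p|?L. weight v (z, p) * ?w (sample 0 0 (z, p))) = (LINT x|lborel. LINT b|lborel. weight v (z, (x, b)) * ?w (sample 0 0 (z, (x, b))))"
        by (rule lborel_pair.integral_fst'[OF elim, symmetric])
      also have "\<dots> = (LINT x|lborel. G x z)"
      proof (rule Bochner_Integration.integral_cong)
        fix x :: complex
        \<comment> \<open>In the limit the point no longer depends on the Gaussian variable
          \<open>b\<close>, which integrates to 1.\<close>
        have "weight v (z, (x, b)) * ?w (sample 0 0 (z, (x, b))) = G x z * of_real (gauss b)" for b
          unfolding w_pt G_def weight_def by simp
        then have "(LINT b|lborel. weight v (z, (x, b)) * ?w (sample 0 0 (z, (x, b)))) = G x z * (LINT b|lborel. complex_of_real (gauss (b :: complex \<times> complex)))"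
          by (simp only: integral_mult_right_zero)
        then show "(LINT b|lborel. weight v (z, (x, b)) * ?w (sample 0 0 (z, (x, b)))) = G x z"
          by (simp add: integral_gauss)
      qed simp
      finally show ?case .
    qed
  qed
  also have "\<dots> = (LINT g|motion_haar. G (fst g) (snd g))"
  proof -
    have "integrable (lborel \<Otimes>\<^sub>M circle_measure) (\<lambda>(x, z). v x * (1::complex))"
      by (intro integrable_pair_mult sigma_finite_lborel sigma_finite_circle v) simp
    then have vi: "integrable motion_haar (\<lambda>g. of_real C * v (fst g))"
      by (simp add: motion_haar_def case_prod_unfold)
    have Gi: "integrable motion_haar (\<lambda>g. G (fst g) (snd g))"
    proof (rule Bochner_Integration.integrable_bound[OF vi])
      have "(\<lambda>g. (g, inv_E g)) \<in> motion_haar \<rightarrow>\<^sub>M motion_haar2"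
        by (intro measurable_Pair measurable_inv_E measurable_ident_sets[OF refl])
      from measurable_compose[OF this wm] have "(\<lambda>g. ?w (g, inv_E g)) \<in> borel_measurable motion_haar" .
      moreover have "(\<lambda>g. v (fst g)) \<in> borel_measurable motion_haar"
        unfolding motion_haar_def using measurable_compose[OF measurable_fst borel_measurable_integrable[OF v]] .
      ultimately show "(\<lambda>g. G (fst g) (snd g)) \<in> borel_measurable motion_haar"
        unfolding G_def by simp
      show "AE g in motion_haar. norm (G (fst g) (snd g)) \<le> norm (of_real C * v (fst g))"
      proof (rule AE_I2)
        fix g assume "g \<in> space motion_haar"
        then have "(g, inv_E g) \<in> carrier motion_group2"
          by (auto simp: space_motion_haar_times carrier_motion_group2 inv_E_def)
        from C[OF this] show "norm (G (fst g) (snd g)) \<le> norm (of_real C * v (fst g))"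
          using C0 by (simp add: G_def norm_mult mult.commute[of C] mult_left_mono)
      qed
    qed
    then have "integrable (lborel \<Otimes>\<^sub>M circle_measure) (\<lambda>(x, z). G x z)"
      by (simp add: motion_haar_def case_prod_unfold)
    from lc.integral_snd[OF this] show ?thesis
      by (simp add: motion_haar_def case_prod_unfold)
  qed
  also have "\<dots> = (LINT g|motion_haar. ?w (g, inv_E g) * v (fst g))"
    by (simp add: G_def mult.commute)
  finally show ?thesis
    using lim by simp
qed

section \<open>From a bounded functional on coefficients to an operator\<close>

lemma L2_bounded_opsD:
  assumes "T \<in> L2_bounded_ops M"
  shows "\<And>f. f \<in> L2 M \<Longrightarrow> T f \<in> L2 M"
    and "\<And>f g. f \<in> L2 M \<Longrightarrow> g \<in> L2 M \<Longrightarrow> AE x in M. f x = g x \<Longrightarrow> AE x in M. T f x = T g x"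
    and "\<And>f g. f \<in> L2 M \<Longrightarrow> g \<in> L2 M \<Longrightarrow> AE x in M. T (\<lambda>y. f y + g y) x = T f x + T g x"
    and "\<And>c f. f \<in> L2 M \<Longrightarrow> AE x in M. T (\<lambda>y. c * f y) x = c * T f x"
    and "\<exists>C. \<forall>f\<in>L2 M. L2_norm M (T f) \<le> C * L2_norm M f"
  using assms unfolding L2_bounded_ops_def by blast+

lemma L2_adjoint:
  assumes T: "T \<in> L2_bounded_ops M" and \<eta>: "\<eta> \<in> L2 M"
  obtains \<eta>' where "\<eta>' \<in> L2 M" "\<And>f. f \<in> L2 M \<Longrightarrow> L2_inner M (T f) \<eta> = L2_inner M f \<eta>'"
proof -
  note T' = L2_bounded_opsD[OF T]
  obtain C where C: "\<forall>f\<in>L2 M. L2_norm M (T f) \<le> C * L2_norm M f"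
    using T'(5) by blast
  have "\<exists>h\<in>L2 M. \<forall>f\<in>L2 M. L2_inner M (T f) \<eta> = L2_inner M f h"
  proof (rule L2_Riesz[where C="C * L2_norm M \<eta>"])
    fix f g assume f: "f \<in> L2 M" and g: "g \<in> L2 M"
    have "L2_inner M (T (\<lambda>x. f x + g x)) \<eta> = L2_inner M (\<lambda>x. T f x + T g x) \<eta>"
      by (rule L2_inner_cong_AE[OF T'(1)[OF L2_add[OF f g]] L2_add[OF T'(1)[OF f] T'(1)[OF g]] \<eta> \<eta> T'(3)[OF f g]]) simp
    then show "L2_inner M (T (\<lambda>x. f x + g x)) \<eta> = L2_inner M (T f) \<eta> + L2_inner M (T g) \<eta>"
      by (simp only: L2_inner_add_left[OF T'(1)[OF f] T'(1)[OF g] \<eta>])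
  next
    fix c f assume f: "f \<in> L2 M"
    have "L2_inner M (T (\<lambda>x. c * f x)) \<eta> = L2_inner M (\<lambda>x. c * T f x) \<eta>"
      by (rule L2_inner_cong_AE[OF T'(1)[OF L2_cmult[OF f]] L2_cmult[OF T'(1)[OF f]] \<eta> \<eta> T'(4)[OF f]]) simp
    then show "L2_inner M (T (\<lambda>x. c * f x)) \<eta> = c * L2_inner M (T f) \<eta>"
      by (simp only: L2_inner_cmult_left)
  next
    fix f assume f: "f \<in> L2 M"
    have "cmod (L2_inner M (T f) \<eta>) \<le> L2_norm M (T f) * L2_norm M \<eta>"
      by (rule L2_Cauchy_Schwarz[OF T'(1)[OF f] \<eta>])
    also have "\<dots> \<le> (C * L2_norm M f) * L2_norm M \<eta>"
      using C f by (intro mult_right_mono L2_norm_nonneg) auto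
    finally show "cmod (L2_inner M (T f) \<eta>) \<le> C * L2_norm M \<eta> * L2_norm M f"
      by (simp only: mult_ac)
  qed
  then obtain \<eta>' where "\<eta>' \<in> L2 M" and "\<forall>f\<in>L2 M. L2_inner M (T f) \<eta> = L2_inner M f \<eta>'" ..
  then show ?thesis
    by (intro that) simp_all
qed

lemma L2_inner_commuting:
  assumes T: "T \<in> commutant M A" and S: "S \<in> A" "S f \<in> L2 M" "S (T f) \<in> L2 M" and f: "f \<in> L2 M" and \<eta>: "\<eta> \<in> L2 M"
  shows "L2_inner M (S (T f)) \<eta> = L2_inner M (T (S f)) \<eta>"
proof -
  have T': "T \<in> L2_bounded_ops M" and c: "AE x in M. T (S f) x = S (T f) x"
    using T S(1) f by (auto simp: commutant_def)
  show ?thesis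
    by (rule L2_inner_cong_AE[OF S(3) L2_bounded_opsD(1)[OF T' S(2)] \<eta> \<eta>]) (use c in auto)
qed

text \<open>The form \<Lambda>(coefficient of \<xi>, \<eta>) is sesquilinear and bounded, hence
  given by an operator \<open>S\<close>. If \<open>T\<close> commutes with the left translations,
  the coefficient at \<open>T f\<close> and \<open>h\<close> is the same function as the one at
  \<open>f\<close> and the adjoint of \<open>T\<close> applied to \<open>h\<close>. As
  \<open>\<Lambda>\<close> sees only the function, \<open>S\<close> commutes with \<open>T\<close>,
  which is membership in the bicommutant.\<close>

lemma VN_operator_of_functional:
  fixes \<Lambda> :: "((complex \<times> complex) \<times> (complex \<times> complex) \<Rightarrow> complex) \<Rightarrow> complex"
  defines "M \<equiv> motion_haar2"
  assumes cong: "\<And>u u'. (\<And>g. g \<in> carrier motion_group2 \<Longrightarrow> u g = u' g) \<Longrightarrow> \<Lambda> u = \<Lambda> u'"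
    and add: "\<And>\<xi> \<eta> \<xi>' \<eta>'. \<lbrakk>\<xi> \<in> L2 M; \<eta> \<in> L2 M; \<xi>' \<in> L2 M; \<eta>' \<in> L2 M\<rbrakk> \<Longrightarrow>
       \<Lambda> (\<lambda>g. coefficient \<xi> \<eta> g + coefficient \<xi>' \<eta>' g) = \<Lambda> (coefficient \<xi> \<eta>) + \<Lambda> (coefficient \<xi>' \<eta>')"
    and cmult: "\<And>k \<xi> \<eta>. \<lbrakk>\<xi> \<in> L2 M; \<eta> \<in> L2 M\<rbrakk> \<Longrightarrow> \<Lambda> (\<lambda>g. k * coefficient \<xi> \<eta> g) = k * \<Lambda> (coefficient \<xi> \<eta>)"
    and bound: "\<And>\<xi> \<eta>. \<lbrakk>\<xi> \<in> L2 M; \<eta> \<in> L2 M\<rbrakk> \<Longrightarrow> cmod (\<Lambda> (coefficient \<xi> \<eta>)) \<le> C * (L2_norm M \<xi> * L2_norm M \<eta>)"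
  obtains S where "S \<in> VN motion_group2 M"
    "\<And>\<xi> \<eta>. \<lbrakk>\<xi> \<in> L2 M; \<eta> \<in> L2 M\<rbrakk> \<Longrightarrow> L2_inner M (S \<xi>) \<eta> = \<Lambda> (coefficient \<xi> \<eta>)"
proof -
  define B where "B \<xi> \<eta> = \<Lambda> (coefficient \<xi> \<eta>)" for \<xi> \<eta>
  have B_add_left: "B (\<lambda>p. \<xi> p + \<xi>' p) \<eta> = B \<xi> \<eta> + B \<xi>' \<eta>" if "\<xi> \<in> L2 M" "\<xi>' \<in> L2 M" "\<eta> \<in> L2 M" for \<xi> \<xi>' \<eta>
  proof -
    have "B (\<lambda>p. \<xi> p + \<xi>' p) \<eta> = \<Lambda> (\<lambda>g. coefficient \<xi> \<eta> g + coefficient \<xi>' \<eta> g)"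
      unfolding B_def by (rule cong) (rule coefficient_add_left[OF _ that[unfolded M_def]])
    then show ?thesis
      by (simp only: add[OF that(1,3,2,3)] B_def)
  qed
  have B_add_right: "B \<xi> (\<lambda>p. \<eta> p + \<eta>' p) = B \<xi> \<eta> + B \<xi> \<eta>'" if "\<xi> \<in> L2 M" "\<eta> \<in> L2 M" "\<eta>' \<in> L2 M" for \<xi> \<eta> \<eta>'
  proof -
    have "B \<xi> (\<lambda>p. \<eta> p + \<eta>' p) = \<Lambda> (\<lambda>g. coefficient \<xi> \<eta> g + coefficient \<xi> \<eta>' g)"
      unfolding B_def by (rule cong) (rule coefficient_add_right[OF _ that[unfolded M_def]])
    then show ?thesis
      by (simp only: add[OF that(1,2,1,3)] B_def)
  qed
  have B_cmult_left: "B (\<lambda>p. k * \<xi> p) \<eta> = k * B \<xi> \<eta>" if "\<xi> \<in> L2 M" "\<eta> \<in> L2 M" for k \<xi> \<eta>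
    unfolding B_def coefficient_cmult_left by (rule cmult[OF that])
  have B_cmult_right: "B \<xi> (\<lambda>p. k * \<eta> p) = cnj k * B \<xi> \<eta>" if "\<xi> \<in> L2 M" "\<eta> \<in> L2 M" for k \<xi> \<eta>
    unfolding B_def L2_inner_cmult_right by (rule cmult[OF that])
  have ex: "\<exists>\<zeta>. \<zeta> \<in> L2 M \<and> (\<forall>\<eta>\<in>L2 M. B \<xi> \<eta> = L2_inner M \<zeta> \<eta>)" if \<xi>: "\<xi> \<in> L2 M" for \<xi>
  proof -
    have "\<exists>\<zeta>\<in>L2 M. \<forall>\<eta>\<in>L2 M. cnj (B \<xi> \<eta>) = L2_inner M \<eta> \<zeta>"
    proof (rule L2_Riesz[where C="C * L2_norm M \<xi>"])
      show "cnj (B \<xi> (\<lambda>x. f x + g x)) = cnj (B \<xi> f) + cnj (B \<xi> g)" if "f \<in> L2 M" "g \<in> L2 M" for f g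
        by (simp add: B_add_right[OF \<xi> that])
      show "cnj (B \<xi> (\<lambda>x. c * f x)) = c * cnj (B \<xi> f)" if "f \<in> L2 M" for c f
        by (simp add: B_cmult_right[OF \<xi> that])
      show "cmod (cnj (B \<xi> f)) \<le> C * L2_norm M \<xi> * L2_norm M f" if "f \<in> L2 M" for f
        using bound[OF \<xi> that] by (simp add: B_def mult.assoc)
    qed
    then obtain \<zeta> where \<zeta>: "\<zeta> \<in> L2 M" "\<forall>\<eta>\<in>L2 M. cnj (B \<xi> \<eta>) = L2_inner M \<eta> \<zeta>" ..
    have "B \<xi> \<eta> = L2_inner M \<zeta> \<eta>" if "\<eta> \<in> L2 M" for \<eta>
      using \<zeta>(2) that L2_inner_commute[of M \<zeta> \<eta>] by (metis complex_cnj_cnj)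
    then show ?thesis
      using \<zeta>(1) by (intro exI[of _ \<zeta>]) simp
  qed
  \<comment> \<open>The vector is chosen separately for every representative. Linearity and
    independence of the representative therefore hold almost everywhere and are tested against all
    of L2.\<close>
  define S where "S \<xi> = (SOME \<zeta>. \<zeta> \<in> L2 M \<and> (\<forall>\<eta>\<in>L2 M. B \<xi> \<eta> = L2_inner M \<zeta> \<eta>))" for \<xi>
  have S_spec: "S \<xi> \<in> L2 M \<and> (\<forall>\<eta>\<in>L2 M. B \<xi> \<eta> = L2_inner M (S \<xi>) \<eta>)" if "\<xi> \<in> L2 M" for \<xi>
    unfolding S_def by (rule someI_ex[OF ex[OF that]])
  note SL2 = S_spec[THEN conjunct1]
  note SB = S_spec[THEN conjunct2, rule_format, symmetric]
  have S_ops: "S \<in> L2_bounded_ops M"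
    unfolding L2_bounded_ops_def
  proof (intro CollectI conjI ballI allI impI)
    show "S f \<in> L2 M" if "f \<in> L2 M" for f
      by (rule SL2[OF that])
    show "AE x in M. S f x = S g x" if fg: "f \<in> L2 M" "g \<in> L2 M" "AE x in M. f x = g x" for f g
    proof (rule L2_eqI_inner[OF SL2[OF fg(1)] SL2[OF fg(2)]])
      fix h assume h: "h \<in> L2 M"
      \<comment> \<open>The difference has norm 0, so the bound forces the form to vanish on it; it
        is written as a sum with a multiple, on which additivity and homogeneity operate.\<close>
      have "B (\<lambda>p. f p + (-1) * g p) h = 0"
      proof -
        have mg: "(\<lambda>p. (-1) * g p) \<in> L2 M" by (rule L2_cmult[OF fg(2)])
        have d: "(\<lambda>p. f p + (-1) * g p) \<in> L2 M" by (rule L2_add[OF fg(1) mg])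
        have "L2_norm M (\<lambda>p. f p + (-1) * g p) = L2_norm M (\<lambda>p. 0)"
        proof -
          have "(LINT p|M. (cmod (f p + (-1) * g p))\<^sup>2) = (LINT p|M. (cmod 0)\<^sup>2)"
            using fg(3) borel_measurable_integrable[OF L2_integrable[OF d]] by (intro integral_cong_AE) auto
          then show ?thesis by (simp only: L2_norm_def)
        qed
        then have "L2_norm M (\<lambda>p. f p + (-1) * g p) = 0"
          by (simp add: L2_norm_def)
        then show ?thesis
          using bound[OF d h] by (simp add: B_def)
      qed
      then have "B f h + (-1) * B g h = 0"
        using B_add_left[OF fg(1) L2_cmult[OF fg(2)] h] B_cmult_left[OF fg(2) h] by metis
      then show "L2_inner M (S f) h = L2_inner M (S g) h"
        unfolding SB[OF fg(1) h] SB[OF fg(2) h] by simp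
    qed
    show "AE x in M. S (\<lambda>y. f y + g y) x = S f x + S g x" if f: "f \<in> L2 M" and g: "g \<in> L2 M" for f g
      by (rule L2_eqI_inner[OF SL2[OF L2_add[OF f g]] L2_add[OF SL2[OF f] SL2[OF g]]])
         (simp only: L2_inner_add_left[OF SL2[OF f] SL2[OF g]] SB L2_add f g B_add_left)
    show "AE x in M. S (\<lambda>y. c * f y) x = c * S f x" if f: "f \<in> L2 M" for c f
      by (rule L2_eqI_inner[OF SL2[OF L2_cmult[OF f]] L2_cmult[OF SL2[OF f]]])
         (simp only: L2_inner_cmult_left SB L2_cmult f B_cmult_left)
    show "\<exists>C. \<forall>f\<in>L2 M. L2_norm M (S f) \<le> C * L2_norm M f"
    proof (intro exI[of _ C] ballI)
      fix f assume f: "f \<in> L2 M"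
      have "cmod (of_real ((L2_norm M (S f))\<^sup>2)) = cmod (B f (S f))"
        using SB[OF f SL2[OF f]] L2_inner_self[of M "S f"] by metis
      then have "(L2_norm M (S f))\<^sup>2 = cmod (B f (S f))"
        by (simp only: norm_of_real abs_power2)
      also have "\<dots> \<le> C * (L2_norm M f * L2_norm M (S f))"
        unfolding B_def by (rule bound[OF f SL2[OF f]])
      finally have le: "L2_norm M (S f) * L2_norm M (S f) \<le> (C * L2_norm M f) * L2_norm M (S f)"
        by (simp add: power2_eq_square mult.assoc)
      show "L2_norm M (S f) \<le> C * L2_norm M f"
      proof (cases "L2_norm M (S f) = 0")
        case True
        \<comment> \<open>The sign of \<open>C\<close> is not assumed; the bound itself, taken at
          \<open>f\<close> and \<open>f\<close>, supplies it unless \<open>f\<close> has norm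
          0.\<close>
        have "0 \<le> C * L2_norm M f"
        proof -
          have "0 \<le> C * (L2_norm M f * L2_norm M f)"
            using order_trans[OF norm_ge_zero bound[OF f f]] .
          then show ?thesis
            using L2_norm_nonneg[of M f] by (fastforce simp: zero_le_mult_iff mult_le_0_iff)
        qed
        then show ?thesis using True by simp
      next
        case False
        then have "L2_norm M (S f) > 0" using L2_norm_nonneg[of M "S f"] by linarith
        then show ?thesis using le by simp
      qed
    qed
  qed
  have "S \<in> VN motion_group2 M"
    unfolding VN_def commutant_def[of M "commutant M (left_regular motion_group2 ` carrier motion_group2)"]
  proof (intro CollectI conjI ballI S_ops)
    fix T f assume T: "T \<in> commutant M (left_regular motion_group2 ` carrier motion_group2)" and f: "f \<in> L2 M"
    have T': "T \<in> L2_bounded_ops M"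
      using T by (simp add: commutant_def)
    note TL2 = L2_bounded_opsD(1)[OF T']
    show "AE x in M. S (T f) x = T (S f) x"
    proof (rule L2_eqI_inner[OF SL2[OF TL2[OF f]] TL2[OF SL2[OF f]]])
      fix h assume h: "h \<in> L2 M"
      obtain h' where h': "h' \<in> L2 M" "\<And>f. f \<in> L2 M \<Longrightarrow> L2_inner M (T f) h = L2_inner M f h'"
        using L2_adjoint[OF T' h] by blast
      \<comment> \<open>The left translation passes through \<open>T\<close>, and \<open>T\<close>
        then passes to the right argument as its adjoint.\<close>
      have "B (T f) h = B f h'"
        unfolding B_def
      proof (rule cong)
        fix g assume g: "g \<in> carrier motion_group2"
        note lL2 = left_regular_L2(1)[OF g, folded M_def]
        show "coefficient (T f) h g = coefficient f h' g"
          using L2_inner_commuting[OF T imageI[OF g] lL2[OF f] lL2[OF TL2[OF f]] f h] h'(2)[OF lL2[OF f]]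
          by (simp only: M_def)
      qed
      then show "L2_inner M (S (T f)) h = L2_inner M (T (S f)) h"
        by (simp only: SB[OF TL2[OF f] h] SB[OF f h'(1)] h'(2)[OF SL2[OF f]])
    qed
  qed
  then show ?thesis
    using SB that by (simp only: B_def)
qed

theorem theorem2p5:
  fixes v' :: "complex \<Rightarrow> complex"
    and v :: "complex \<times> complex \<Rightarrow> complex"
    and X :: "complex \<times> complex"
  assumes "v' \<in> H21"
    and "\<And>x z. (x, z) \<in> carrier motion_group \<Longrightarrow> v (x, z) = v' x"
    and "X \<in> span {X\<^sub>1, X\<^sub>2}"
  shows "\<exists>S\<in>VN motion_group2 motion_haar2. \<forall>u\<in>D_motion2.
           VN_apply motion_group2 motion_haar2 S u =
             (LINT g|motion_haar. deriv_first X u (g, inv\<^bsub>motion_group\<^esub> g) * v g)"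
proof -
  obtain c where X: "X = (c, 0)"
  proof -
    \<comment> \<open>The span is a real one, and both generators lie in the real subspace of pure
      translations.\<close>
    have "X \<in> range (\<lambda>c::complex. (c, 0::complex))"
    proof (rule span_induct_alt[OF assms(3)])
      show "(0 :: complex \<times> complex) \<in> range (\<lambda>c. (c, 0))"
        by (auto simp: zero_prod_def)
    qed (auto simp: X\<^sub>1_def X\<^sub>2_def)
    then show ?thesis using that by blast
  qed
  have v': "integrable lborel v'"
    using assms(1) by (simp add: H21_def)
  obtain W where W: "W \<ge> 0" "\<And>k. (1 + (cmod k)\<^sup>2) * cmod (FT v' k) \<le> W"
    using H21_FT_decay[OF assms(1)] by blast
  obtain L :: "(nat \<Rightarrow> complex) \<Rightarrow> complex" where
    L_add: "\<And>f g. Bseq f \<Longrightarrow> Bseq g \<Longrightarrow> L (\<lambda>n. f n + g n) = L f + L g" and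
    L_cmult: "\<And>c f. Bseq f \<Longrightarrow> L (\<lambda>n. c * f n) = c * L f" and
    L_lim: "\<And>f l. f \<longlonglongrightarrow> l \<Longrightarrow> L f = l" and
    L_bound: "\<And>f C. (\<And>n. cmod (f n) \<le> C) \<Longrightarrow> cmod (L f) \<le> C"
    using ex_generalized_limit by blast
  define s where "s n = 1 / real (Suc n)" for n
  have s: "s n > 0" for n by (simp add: s_def)
  \<comment> \<open>Width and step are the same null sequence; the bound with the constant
    \<open>C\<close> holds for all positive values of either.\<close>
  define A where "A n u = approx_functional v' c (s n) (s n) u" for n u
  define C where "C = 6 * (cmod c * W)"
  have A_bound: "cmod (A n (coefficient \<xi> \<eta>)) \<le> C * (L2_norm motion_haar2 \<xi> * L2_norm motion_haar2 \<eta>)"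
    if "\<xi> \<in> L2 motion_haar2" "\<eta> \<in> L2 motion_haar2" for n \<xi> \<eta>
    unfolding A_def C_def by (rule approx_coefficient_bound[OF that v' W s s])
  then have A_Bseq: "Bseq (\<lambda>n. A n (coefficient \<xi> \<eta>))" if "\<xi> \<in> L2 motion_haar2" "\<eta> \<in> L2 motion_haar2" for \<xi> \<eta>
    using that by (intro BseqI')
  define \<Lambda> where "\<Lambda> u = L (\<lambda>n. A n u)" for u
  have \<Lambda>_cong: "\<Lambda> u = \<Lambda> u'" if "\<And>g. g \<in> carrier motion_group2 \<Longrightarrow> u g = u' g" for u u'
    unfolding \<Lambda>_def A_def using approx_functional_cong[OF that] by simp
  obtain S where S: "S \<in> VN motion_group2 motion_haar2"
    and S\<Lambda>: "\<And>\<xi> \<eta>. \<lbrakk>\<xi> \<in> L2 motion_haar2; \<eta> \<in> L2 motion_haar2\<rbrakk> \<Longrightarrow> L2_inner motion_haar2 (S \<xi>) \<eta> = \<Lambda> (coefficient \<xi> \<eta>)"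
  proof (rule VN_operator_of_functional[of \<Lambda> C])
    fix \<xi> \<eta> \<xi>' \<eta>' assume m: "\<xi> \<in> L2 motion_haar2" "\<eta> \<in> L2 motion_haar2" "\<xi>' \<in> L2 motion_haar2" "\<eta>' \<in> L2 motion_haar2"
    have "A n (\<lambda>g. coefficient \<xi> \<eta> g + coefficient \<xi>' \<eta>' g) = A n (coefficient \<xi> \<eta>) + A n (coefficient \<xi>' \<eta>')" for n
      unfolding A_def using m
      by (intro approx_functional_add[OF v', where B="L2_norm motion_haar2 \<xi> * L2_norm motion_haar2 \<eta>" and B'="L2_norm motion_haar2 \<xi>' * L2_norm motion_haar2 \<eta>'"]
        measurable_coefficient L2_measurable cmod_coefficient_le)
    then show "\<Lambda> (\<lambda>g. coefficient \<xi> \<eta> g + coefficient \<xi>' \<eta>' g) = \<Lambda> (coefficient \<xi> \<eta>) + \<Lambda> (coefficient \<xi>' \<eta>')"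
      unfolding \<Lambda>_def using L_add[OF A_Bseq[OF m(1,2)] A_Bseq[OF m(3,4)]] by simp
  next
    fix k \<xi> \<eta> assume m: "\<xi> \<in> L2 motion_haar2" "\<eta> \<in> L2 motion_haar2"
    show "\<Lambda> (\<lambda>g. k * coefficient \<xi> \<eta> g) = k * \<Lambda> (coefficient \<xi> \<eta>)"
      unfolding \<Lambda>_def A_def approx_functional_cmult using L_cmult[OF A_Bseq[OF m], of k] unfolding A_def .
  next
    fix \<xi> \<eta> assume m: "\<xi> \<in> L2 motion_haar2" "\<eta> \<in> L2 motion_haar2"
    show "cmod (\<Lambda> (coefficient \<xi> \<eta>)) \<le> C * (L2_norm motion_haar2 \<xi> * L2_norm motion_haar2 \<eta>)"
      unfolding \<Lambda>_def by (rule L_bound) (rule A_bound[OF m])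
  qed (rule \<Lambda>_cong, assumption, rule that)
  have "VN_apply motion_group2 motion_haar2 S u = (LINT g|motion_haar. deriv_first X u (g, inv\<^bsub>motion_group\<^esub> g) * v g)" if u: "u \<in> D_motion2" for u
  proof -
    have us: "u \<in> smooth_bounded_support"
      using u D_motion2_subset by blast
    let ?I = "LINT g|motion_haar. right_deriv (translation_flow c) u (g, inv_E g) * v' (fst g)"
    have \<Lambda>u: "\<Lambda> u = ?I"
      unfolding \<Lambda>_def A_def s_def by (rule L_lim[OF approx_functional_tendsto[OF us v']])
    \<comment> \<open>All representations of \<open>u\<close> as a coefficient give the same number,
      because \<open>\<Lambda>\<close> depends on the function alone. This is the uniqueness behind
      the definite description in \<open>VN_apply\<close>.\<close>
    have val: "L2_inner motion_haar2 (S \<xi>) \<eta> = ?I" if co: "is_coefficient motion_group2 motion_haar2 u \<xi> \<eta>" for \<xi> \<eta>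
    proof -
      have "\<Lambda> (coefficient \<xi> \<eta>) = \<Lambda> u"
        using co by (intro \<Lambda>_cong) (simp only: is_coefficient_def)
      then show ?thesis
        using co S\<Lambda>[of \<xi> \<eta>] \<Lambda>u by (simp add: is_coefficient_def)
    qed
    obtain \<xi> \<eta> where co: "is_coefficient motion_group2 motion_haar2 u \<xi> \<eta>"
      using coefficient_smooth_bounded_support[OF us] by blast
    then have "VN_apply motion_group2 motion_haar2 S u = ?I"
      unfolding VN_apply_def
    proof (intro the_equality exI conjI)
      show "?I = L2_inner motion_haar2 (S \<xi>) \<eta>"
        by (rule val[OF co, symmetric])
      fix a assume "\<exists>\<xi> \<eta>. is_coefficient motion_group2 motion_haar2 u \<xi> \<eta> \<and> a = L2_inner motion_haar2 (S \<xi>) \<eta>"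
      then show "a = ?I"
        using val by (elim exE conjE) simp
    qed (rule co)
    also have "\<dots> = (LINT g|motion_haar. deriv_first X u (g, inv\<^bsub>motion_group\<^esub> g) * v g)"
    proof (rule Bochner_Integration.integral_cong)
      fix g assume "g \<in> space motion_haar"
      then have g: "g \<in> carrier motion_group"
        by (simp only: space_motion_haar)
      then have "v g = v' (fst g)"
        using assms(2)[of "fst g" "snd g"] by simp
      then show "right_deriv (translation_flow c) u (g, inv_E g) * v' (fst g) = deriv_first X u (g, inv\<^bsub>motion_group\<^esub> g) * v g"
        by (simp only: X deriv_first_eq_right_deriv inv_E_eq[OF g])
    qed simp
    finally show ?thesis .
  qed
  then show ?thesis
    using S by blast
qed

end
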